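(* Let $\Gamma_1,\Gamma_2$ be two locally perturbed sound-soft surfaces (Dirichlet boundary condition) and fix the wave number $k>0$. If $u^{sc}_{1,\infty}(\hat x;d)=u^{sc}_{2,\infty}(\hat x;d)$ for all $\hat x\in\mathbb S^2_+$ and all $d\in\mathbb S^2_-$, then $\Gamma_1=\Gamma_2$.
   Context: Fix a wave number $k>0$. Write $x=(\tilde x,x_3)\in\mathbb R^3$ with $\tilde x=(x_1,x_2)$, and $\mathbb S^2_\pm=\{x\in\mathbb R^3:|x|=1,\ \pm x_3>0\}$. A locally perturbed surface is $\Gamma=\{(\tilde x,f(\tilde x)):\tilde x\in\mathbb R^2\}$, where $f:\mathbb R^2\to\mathbb R$ is Lipschitz continuous and $f(\tilde x)=0$ for $|\tilde x|>R$ for some $R>\max|f|$; $\Omega=\{x:x_3>f(\tilde x)\}$ is the region above $\Gamma$ and $\nu$ is the unit normal on $\Gamma$ pointing into $\Omega$. For $d=(\alpha,\beta,-\gamma)\in\mathbb S^2_-$ the incident plane wave is $u^{in}(x;d)=e^{ikx\cdot d}$ and its reflected wave from the flat plane $\{x_3=0\}$ is $u^{re}(x;d)=-e^{ik(\alpha x_1+\beta x_2+\gamma x_3)}$ in the Dirichlet case and $u^{re}(x;d)=+e^{ik(\alpha x_1+\beta x_2+\gamma x_3)}$ in the Neumann case. The total field is $u=u^{in}+u^{re}+u^{sc}$, where $u$ satisfies $\Delta u+k^2u=0$ in $\Omega$, the boundary condition $u=0$ on $\Gamma$ (sound-soft/Dirichlet) or $\partial_\nu u=0$ on $\Gamma$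 (sound-hard/Neumann), and the scattered field $u^{sc}$ satisfies the Sommerfeld radiation condition $\lim_{r\to\infty}r(\partial_ru^{sc}-iku^{sc})=0$, $r=|x|$, $x\in\Omega$; this problem is uniquely solvable. Then $u^{sc}(x;d)=\frac{e^{ik|x|}}{|x|}\{u^{sc}_\infty(\hat x;d)+O(1/|x|)\}$ as $|x|\to\infty$ in $\Omega$, $\hat x=x/|x|\in\mathbb S^2_+$, and $u^{sc}_\infty(\cdot;d)$ is the far-field pattern. Quantities associated with a surface $\Gamma_j=\{x_3=f_j(\tilde x)\}$ carry the index $j$. *)

theory Defs
  imports "HOL-Analysis.Analysis"
begin

definition tild :: "real^3 \<Rightarrow> real^2" where
  "tild x = vector [x$1, x$2]"

definition Omega :: "(real^2 \<Rightarrow> real) \<Rightarrow> (real^3) set" where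
  "Omega f = {x. x$3 > f (tild x)}"

definition Gamma :: "(real^2 \<Rightarrow> real) \<Rightarrow> (real^3) set" where
  "Gamma f = {x. x$3 = f (tild x)}"

definition locally_perturbed :: "(real^2 \<Rightarrow> real) \<Rightarrow> bool" where
  "locally_perturbed f \<longleftrightarrow>
     (\<exists>L. L-lipschitz_on UNIV f) \<and>
     (\<exists>R. (\<forall>y. norm y > R \<longrightarrow> f y = 0) \<and> (\<forall>y. \<bar>f y\<bar> < R))"

definition S2plus :: "(real^3) set" where
  "S2plus = {x. norm x = 1 \<and> x$3 > 0}"

definition S2minus :: "(real^3) set" where
  "S2minus = {x. norm x = 1 \<and> x$3 < 0}"

definition pdiff :: "3 \<Rightarrow> (real^3 \<Rightarrow> complex) \<Rightarrow> real^3 \<Rightarrow> complex" where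
  "pdiff i u x = vector_derivative (\<lambda>t. u (x + t *\<^sub>R axis i 1)) (at 0)"

definition helmholtz_on :: "(real^3) set \<Rightarrow> real \<Rightarrow> (real^3 \<Rightarrow> complex) \<Rightarrow> bool" where
  "helmholtz_on S k u \<longleftrightarrow>
     (\<forall>x\<in>S. u differentiable (at x) \<and> (\<forall>i. pdiff i u differentiable (at x)) \<and>
        (\<Sum>i\<in>UNIV. pdiff i (pdiff i u) x) + complex_of_real (k^2) * u x = 0)"

text \<open>Incident plane wave and its reflection (Dirichlet case) from the plane x_3 = 0,
  for d = (alpha, beta, -gamma).\<close>
definition u_in :: "real \<Rightarrow> real^3 \<Rightarrow> real^3 \<Rightarrow> complex" where
  "u_in k d x = exp (\<i> * complex_of_real (k * (x \<bullet> d)))"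

definition u_re_D :: "real \<Rightarrow> real^3 \<Rightarrow> real^3 \<Rightarrow> complex" where
  "u_re_D k d x = - exp (\<i> * complex_of_real (k * (d$1 * x$1 + d$2 * x$2 - d$3 * x$3)))"

definition radiating :: "real \<Rightarrow> (real^3) set \<Rightarrow> (real^3 \<Rightarrow> complex) \<Rightarrow> bool" where
  "radiating k S v \<longleftrightarrow>
     (\<forall>x\<in>S. v differentiable (at x)) \<and>
     (\<forall>e>0. \<exists>R0. \<forall>x\<in>S. norm x \<ge> R0 \<longrightarrow>
        norm x * cmod (frechet_derivative v (at x) (x /\<^sub>R norm x) - \<i> * complex_of_real k * v x) \<le> e)"

definition dirichlet_total_field ::
  "real \<Rightarrow> (real^2 \<Rightarrow> real) \<Rightarrow> real^3 \<Rightarrow> (real^3 \<Rightarrow> complex) \<Rightarrow> bool" where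
  "dirichlet_total_field k f d u \<longleftrightarrow>
     continuous_on (closure (Omega f)) u \<and>
     helmholtz_on (Omega f) k u \<and>
     (\<forall>x\<in>Gamma f. u x = 0) \<and>
     radiating k (Omega f) (\<lambda>x. u x - u_in k d x - u_re_D k d x)"

definition far_field :: "real \<Rightarrow> (real^3) set \<Rightarrow> (real^3 \<Rightarrow> complex) \<Rightarrow> (real^3 \<Rightarrow> complex) \<Rightarrow> bool" where
  "far_field k S v F \<longleftrightarrow>
     (\<exists>C R0. \<forall>x\<in>S. norm x \<ge> R0 \<longrightarrow>
        cmod (v x - exp (\<i> * complex_of_real (k * norm x)) / complex_of_real (norm x) * F (x /\<^sub>R norm x))
          \<le> C / (norm x)^2)"

end

theory Submission
  imports Defs "HOL-Complex_Analysis.Complex_Analysis"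
begin

text \<open>
  If the two far fields agree, the difference of the total fields decays like \<open>1 / |x|\<^sup>2\<close> and, by odd
  reflection in the plane, satisfies the Helmholtz equation outside a ball. It is then zero there
  (Rellich), and the two fields agree wherever both are defined, by analyticity on vertical lines.
  Suppose now that \<open>f1 < f2\<close> somewhere. On the bounded set \<open>D\<close> between the surfaces each total field
  of the first surface solves the Helmholtz equation and vanishes on the boundary. Such functions form
  a finite-dimensional space: for \<open>w\<close> in it, the extension by zero of \<open>|w|\<^sup>2\<close> is a weak subsolution, so
  the sup norm is bounded by the \<open>L\<^sup>2\<close> norm, and integrating the sum of squares of an orthonormal
  system bounds its size. But the fields of infinitely many directions of incidence are linearly
  independent: a vanishing combination persists on a vertical ray, where the scattered fields decay
  and the incident and reflected fields add up to multiples of \<open>sin (k \<gamma> x\<^sub>3)\<close> with different \<open>\<gamma>\<close>.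

  Neither Green's formula nor special functions are needed. A weak solution equals its convolution
  with an explicit \<open>C\<^sup>2\<close> kernel of compact support up to a constant factor, which gives analyticity
  on lines. Outside a ball it is likewise a sum of an outgoing and an incoming field, and comparing
  the growth of their holomorphic continuations along rays leaves no room for decay like
  \<open>1 / |x|\<^sup>2\<close>.
\<close>

no_notation fps_nth (infixl \<open>$\<close> 75)

section \<open>Second differences and partial derivatives\<close>

lemma has_vector_derivative_reflect:
  fixes f :: "real \<Rightarrow> 'a::real_normed_vector"
  assumes "(f has_vector_derivative D) (at (- t))"
  shows "((\<lambda>t. f (- t)) has_vector_derivative - D) (at t)"
proof -
  have "(uminus has_vector_derivative (- 1::real)) (at t)" by (auto intro!: derivative_eq_intros)
  from vector_diff_chain_at[OF this assms] show ?thesis by (simp add: o_def)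
qed

lemma second_difference_remainder:
  fixes f :: "real \<Rightarrow> 'a::real_normed_vector"
  assumes deriv: "\<And>t. \<bar>t\<bar> \<le> \<bar>h\<bar> \<Longrightarrow> (f has_vector_derivative f' t) (at t)"
    and bound: "\<And>t. \<bar>t\<bar> \<le> \<bar>h\<bar> \<Longrightarrow> norm (f' t - f' (- t) - (2 * t) *\<^sub>R D) \<le> B"
  shows "norm (f h + f (- h) - 2 *\<^sub>R f 0 - h\<^sup>2 *\<^sub>R D) \<le> B * \<bar>h\<bar>"
proof -
  define r where "r t = f t + f (- t) - t\<^sup>2 *\<^sub>R D" for t
  have r_deriv: "(r has_vector_derivative f' t - f' (- t) - (2 * t) *\<^sub>R D) (at t)" if "\<bar>t\<bar> \<le> \<bar>h\<bar>" for t
    unfolding r_def using deriv[of t] has_vector_derivative_reflect[OF deriv[of "- t"]] that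
    by (auto intro!: derivative_eq_intros simp: algebra_simps)
  have "norm (r h - r 0) \<le> B * norm (h - 0)"
  proof (rule differentiable_bound[of "closed_segment 0 h"])
    fix t assume "t \<in> closed_segment 0 h"
    then have t: "\<bar>t\<bar> \<le> \<bar>h\<bar>" by (auto simp: closed_segment_eq_real_ivl split: if_splits)
    show "(r has_derivative (\<lambda>s. s *\<^sub>R (f' t - f' (- t) - (2 * t) *\<^sub>R D))) (at t within closed_segment 0 h)"
      using r_deriv[OF t] by (simp add: has_vector_derivative_def has_derivative_at_withinI)
    show "onorm (\<lambda>s. s *\<^sub>R (f' t - f' (- t) - (2 * t) *\<^sub>R D)) \<le> B"
      using bound[OF t] by (simp add: onorm_scaleR_left onorm_id)
  qed auto
  then show ?thesis by (simp add: r_def scaleR_2 algebra_simps)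
qed

lemma second_difference_tendsto:
  fixes f :: "real \<Rightarrow> 'a::real_normed_vector"
  assumes "d > 0" and deriv: "\<And>t. \<bar>t\<bar> < d \<Longrightarrow> (f has_vector_derivative f' t) (at t)"
    and deriv2: "(f' has_vector_derivative D) (at 0)"
  shows "((\<lambda>h. (f h + f (- h) - 2 *\<^sub>R f 0) /\<^sub>R h\<^sup>2) \<longlongrightarrow> D) (at 0)"
proof (rule LIM_I)
  fix e :: real assume "e > 0"
  have "(\<lambda>t. norm (f' t - f' 0 - t *\<^sub>R D) / norm t) \<midarrow>0\<rightarrow> 0"
    using deriv2 unfolding has_vector_derivative_def has_derivative_at by simp
  from LIM_D[OF this, of "e/4"] \<open>e > 0\<close> obtain s where "s > 0"
    and quotient: "\<And>t. t \<noteq> 0 \<Longrightarrow> \<bar>t\<bar> < s \<Longrightarrow> norm (f' t - f' 0 - t *\<^sub>R D) / \<bar>t\<bar> < e/4" by auto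
  have linearization: "norm (f' t - f' 0 - t *\<^sub>R D) \<le> e/4 * \<bar>t\<bar>" if "\<bar>t\<bar> < s" for t
    using quotient[of t] that by (cases "t = 0") (auto simp: field_simps)
  have "norm ((f h + f (- h) - 2 *\<^sub>R f 0) /\<^sub>R h\<^sup>2 - D) < e" if h: "h \<noteq> 0" "\<bar>h\<bar> < min s d" for h
  proof -
    let ?r = "f h + f (- h) - 2 *\<^sub>R f 0 - h\<^sup>2 *\<^sub>R D"
    have remainder: "norm (f h + f (- h) - 2 *\<^sub>R f 0 - h\<^sup>2 *\<^sub>R D) \<le> (e/2 * \<bar>h\<bar>) * \<bar>h\<bar>"
    proof (rule second_difference_remainder)
      fix t assume "\<bar>t\<bar> \<le> \<bar>h\<bar>"
      then have t: "\<bar>t\<bar> < s" "\<bar>- t\<bar> < s" "\<bar>t\<bar> < d" using h by auto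
      show "(f has_vector_derivative f' t) (at t)" by (rule deriv[OF t(3)])
      have "f' t - f' (- t) - (2 * t) *\<^sub>R D = (f' t - f' 0 - t *\<^sub>R D) - (f' (- t) - f' 0 - (- t) *\<^sub>R D)"
        using scaleR_left_distrib[of t t D] by simp
      also have "norm \<dots> \<le> e/4 * \<bar>t\<bar> + e/4 * \<bar>- t\<bar>"
        by (rule order_trans[OF norm_triangle_ineq4 add_mono[OF linearization[OF t(1)] linearization[OF t(2)]]])
      also have "\<dots> \<le> e/2 * \<bar>h\<bar>" using \<open>\<bar>t\<bar> \<le> \<bar>h\<bar>\<close> \<open>e > 0\<close> by (simp add: field_simps)
      finally show "norm (f' t - f' (- t) - (2 * t) *\<^sub>R D) \<le> e/2 * \<bar>h\<bar>" .
    qed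
    have "(f h + f (- h) - 2 *\<^sub>R f 0) /\<^sub>R h\<^sup>2 - D = ?r /\<^sub>R h\<^sup>2"
      using h by (simp add: scaleR_diff_right)
    also have "norm \<dots> = norm ?r / h\<^sup>2" by (simp add: divide_inverse_commute)
    also have "\<dots> \<le> ((e/2 * \<bar>h\<bar>) * \<bar>h\<bar>) / h\<^sup>2" by (rule divide_right_mono[OF remainder]) simp
    also have "\<dots> = e/2" using h by (simp add: power2_eq_square mult.assoc flip: abs_mult)
    also have "\<dots> < e" using \<open>e > 0\<close> by simp
    finally show ?thesis .
  qed
  then show "\<exists>s>0. \<forall>h. h \<noteq> 0 \<and> norm (h - 0) < s \<longrightarrow> norm ((f h + f (- h) - 2 *\<^sub>R f 0) /\<^sub>R h\<^sup>2 - D) < e"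
    using \<open>s > 0\<close> \<open>d > 0\<close> by (intro exI[of _ "min s d"]) auto
qed

lemma second_difference_bound:
  fixes f :: "real \<Rightarrow> 'a::real_normed_vector"
  assumes deriv: "\<And>t. (f has_vector_derivative f' t) (at t)"
    and deriv2: "\<And>t. (f' has_vector_derivative f'' t) (at t)"
    and bound: "\<And>t. norm (f'' t) \<le> M"
  shows "norm (f h + f (- h) - 2 *\<^sub>R f 0) \<le> 2 * M * h\<^sup>2"
proof -
  have "M \<ge> 0" using bound[of 0] norm_ge_zero order_trans by blast
  have "norm (f h + f (- h) - 2 *\<^sub>R f 0 - h\<^sup>2 *\<^sub>R 0) \<le> (2 * M * \<bar>h\<bar>) * \<bar>h\<bar>"
  proof (rule second_difference_remainder[OF deriv])
    fix t assume t: "\<bar>t\<bar> \<le> \<bar>h\<bar>"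
    have "norm (f' t - f' (- t)) \<le> M * norm (t - - t)"
      by (rule differentiable_bound[where S=UNIV and f'="\<lambda>x t. t *\<^sub>R f'' x"])
         (use deriv2 bound in \<open>auto simp: has_vector_derivative_def onorm_scaleR_left onorm_id\<close>)
    also have "\<dots> = 2 * M * \<bar>t\<bar>" by (simp add: abs_mult)
    also have "\<dots> \<le> 2 * M * \<bar>h\<bar>" using \<open>M \<ge> 0\<close> t by (intro mult_left_mono) auto
    finally show "norm (f' t - f' (- t) - (2 * t) *\<^sub>R 0) \<le> 2 * M * \<bar>h\<bar>" by simp
  qed
  then show ?thesis by (simp add: power2_eq_square mult.assoc)
qed

lemma second_derivative_nonpos_at_max:
  fixes f :: "real \<Rightarrow> real"
  assumes "d > 0" and "\<And>t. \<bar>t\<bar> < d \<Longrightarrow> (f has_vector_derivative f' t) (at t)"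
    and "(f' has_vector_derivative D) (at 0)" and max: "\<And>t. \<bar>t\<bar> < d \<Longrightarrow> f t \<le> f 0"
  shows "D \<le> 0"
proof (rule tendsto_upperbound[OF second_difference_tendsto[OF assms(1-3)]])
  show "\<forall>\<^sub>F h in at 0. (f h + f (- h) - 2 *\<^sub>R f 0) /\<^sub>R h\<^sup>2 \<le> 0"
    unfolding eventually_at
  proof (intro exI[of _ d] conjI ballI impI)
    fix h :: real assume "h \<noteq> 0 \<and> dist h 0 < d"
    then have "f h \<le> f 0" "f (- h) \<le> f 0" using max[of h] max[of "- h"] by (auto simp: dist_real_def)
    then show "(f h + f (- h) - 2 *\<^sub>R f 0) /\<^sub>R h\<^sup>2 \<le> 0"
      by (auto simp: divide_inverse mult_le_0_iff)
  qed (use \<open>d > 0\<close> in auto)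
qed auto

definition has_second_partials ::
  "(real^'n) set \<Rightarrow> (real^'n \<Rightarrow> 'a::real_normed_vector) \<Rightarrow> ('n \<Rightarrow> real^'n \<Rightarrow> 'a) \<Rightarrow> ('n \<Rightarrow> real^'n \<Rightarrow> 'a) \<Rightarrow> bool"
  where "has_second_partials S u G H \<longleftrightarrow> (\<forall>x\<in>S. \<forall>i.
     ((\<lambda>t. u (x + t *\<^sub>R axis i 1)) has_vector_derivative G i x) (at 0) \<and>
     ((\<lambda>t. G i (x + t *\<^sub>R axis i 1)) has_vector_derivative H i x) (at 0))"

lemma has_vector_derivative_line_shift:
  fixes u :: "'a::real_normed_vector \<Rightarrow> 'b::real_normed_vector"
  assumes "((\<lambda>s. u ((x + t *\<^sub>R e) + s *\<^sub>R e)) has_vector_derivative D) (at 0)"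
  shows "((\<lambda>s. u (x + s *\<^sub>R e)) has_vector_derivative D) (at t)"
proof -
  have "((\<lambda>s. u ((x + t *\<^sub>R e) + s *\<^sub>R e)) has_vector_derivative D) (at (t - t))" using assms by simp
  moreover have "((\<lambda>s. s - t) has_vector_derivative 1) (at t)"
    by (auto intro!: derivative_eq_intros)
  ultimately show ?thesis
    using vector_diff_chain_at[of "\<lambda>s. s - t" 1 t "\<lambda>s. u ((x + t *\<^sub>R e) + s *\<^sub>R e)" D]
    by (simp add: o_def scaleR_left_diff_distrib)
qed

lemma has_second_partials_first:
  assumes "has_second_partials S u G H" "x + t *\<^sub>R axis i 1 \<in> S"
  shows "((\<lambda>s. u (x + s *\<^sub>R axis i 1)) has_vector_derivative G i (x + t *\<^sub>R axis i 1)) (at t)"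
  by (rule has_vector_derivative_line_shift) (use assms in \<open>simp add: has_second_partials_def\<close>)

lemma has_second_partials_second:
  assumes "has_second_partials S u G H" "x + t *\<^sub>R axis i 1 \<in> S"
  shows "((\<lambda>s. G i (x + s *\<^sub>R axis i 1)) has_vector_derivative H i (x + t *\<^sub>R axis i 1)) (at t)"
  by (rule has_vector_derivative_line_shift) (use assms in \<open>simp add: has_second_partials_def\<close>)

lemma has_second_partials_subset:
  "has_second_partials S u G H \<Longrightarrow> T \<subseteq> S \<Longrightarrow> has_second_partials T u G H"
  by (auto simp: has_second_partials_def)

lemma has_second_partials_linear:
  assumes "bounded_linear L" "has_second_partials S u G H"
  shows "has_second_partials S (\<lambda>x. L (u x)) (\<lambda>i x. L (G i x)) (\<lambda>i x. L (H i x))"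
  using assms unfolding has_second_partials_def
  by (auto intro: bounded_linear.has_vector_derivative[OF assms(1)])

lemma has_second_partials_add:
  assumes "has_second_partials S u G H" "has_second_partials S v G' H'"
  shows "has_second_partials S (\<lambda>x. u x + v x) (\<lambda>i x. G i x + G' i x) (\<lambda>i x. H i x + H' i x)"
  unfolding has_second_partials_def
  by (intro ballI allI conjI has_vector_derivative_add) (use assms in \<open>simp_all add: has_second_partials_def\<close>)

lemma has_second_partials_diff:
  assumes "has_second_partials S u G H" "has_second_partials S v G' H'"
  shows "has_second_partials S (\<lambda>x. u x - v x) (\<lambda>i x. G i x - G' i x) (\<lambda>i x. H i x - H' i x)"
  unfolding has_second_partials_def
  by (intro ballI allI conjI has_vector_derivative_diff) (use assms in \<open>simp_all add: has_second_partials_def\<close>)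

lemma has_second_partials_translate:
  assumes "has_second_partials S u G H" "\<And>x. x \<in> T \<Longrightarrow> x + a \<in> S"
  shows "has_second_partials T (\<lambda>x. u (x + a)) (\<lambda>i x. G i (x + a)) (\<lambda>i x. H i (x + a))"
proof -
  have "x + t *\<^sub>R axis i 1 + a = (x + a) + t *\<^sub>R axis i 1" for x t i by simp
  then show ?thesis using assms unfolding has_second_partials_def by (simp only:) blast
qed

lemma segment_axis_subset_open:
  fixes x :: "real^'n"
  assumes "open S" "x \<in> S"
  obtains e where "e > 0" "\<And>t i. \<bar>t\<bar> < e \<Longrightarrow> x + t *\<^sub>R axis i 1 \<in> S"
proof -
  obtain e where "e > 0" "ball x e \<subseteq> S" using assms by (auto simp: open_contains_ball)
  then show ?thesis by (intro that[of e]) (auto simp: subset_iff dist_norm norm_axis_1)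
qed

lemma has_vector_derivative_axis_transform:
  fixes x :: "real^'n"
  assumes "open S" "x \<in> S" "\<And>y. y \<in> S \<Longrightarrow> u y = v y"
    and "((\<lambda>t. u (x + t *\<^sub>R axis i 1)) has_vector_derivative D) (at 0)"
  shows "((\<lambda>t. v (x + t *\<^sub>R axis i 1)) has_vector_derivative D) (at 0)"
proof -
  obtain e where "e > 0" and e: "\<And>t i. \<bar>t\<bar> < e \<Longrightarrow> x + t *\<^sub>R axis i 1 \<in> S"
    using segment_axis_subset_open[OF assms(1,2)] by blast
  show ?thesis
    by (rule has_vector_derivative_transform_within_open[OF assms(4), where S="{-e<..<e}"])
       (use \<open>e > 0\<close> e assms(3) in auto)
qed

lemma has_second_partials_cong:
  assumes "open S" "has_second_partials S u G H" "\<And>x. x \<in> S \<Longrightarrow> u x = v x"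
    and "\<And>i x. x \<in> S \<Longrightarrow> G i x = G' i x" "\<And>i x. x \<in> S \<Longrightarrow> H i x = H' i x"
  shows "has_second_partials S v G' H'"
  unfolding has_second_partials_def
proof (intro ballI allI conjI)
  fix x i assume x: "x \<in> S"
  show "((\<lambda>t. v (x + t *\<^sub>R axis i 1)) has_vector_derivative G' i x) (at 0)"
    by (rule has_vector_derivative_axis_transform[where u=u, OF assms(1) x assms(3)])
       (use assms(2,4) x in \<open>auto simp: has_second_partials_def\<close>)
  show "((\<lambda>t. G' i (x + t *\<^sub>R axis i 1)) has_vector_derivative H' i x) (at 0)"
    by (rule has_vector_derivative_axis_transform[where u="G i", OF assms(1) x assms(4)])
       (use assms(2,5) x in \<open>auto simp: has_second_partials_def\<close>)
qed

definition mirror :: "'n \<Rightarrow> real^'n \<Rightarrow> real^'n \<Rightarrow> real^'n" where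
  "mirror j y x = x - (2 * (x$j - y$j)) *\<^sub>R axis j 1"

lemma mirror_component: "mirror j y x $ i = (if i = j then 2 * y$j - x$j else x$i)"
  by (simp add: mirror_def axis_def)

lemma mirror_add_axis:
  "mirror j y (x + t *\<^sub>R axis i 1) = mirror j y x + ((if i = j then -1 else 1) * t) *\<^sub>R axis i 1"
  by (simp add: vec_eq_iff mirror_component axis_def)

lemma mirror_mirror: "mirror j y (mirror j y x) = x"
  by (simp add: vec_eq_iff mirror_component)

lemma continuous_on_mirror: "continuous_on A (mirror j y)"
  unfolding mirror_def by (intro continuous_intros)

lemma has_second_partials_mirror:
  assumes "has_second_partials S u G H" "\<And>x. x \<in> T \<Longrightarrow> mirror j y x \<in> S"
  shows "has_second_partials T (\<lambda>x. u (mirror j y x))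
    (\<lambda>i x. (if i = j then -1 else 1) *\<^sub>R G i (mirror j y x)) (\<lambda>i x. H i (mirror j y x))"
  unfolding has_second_partials_def
proof (intro ballI allI conjI)
  fix x i assume "x \<in> T"
  let ?z = "mirror j y x" and ?s = "if i = j then -1 else 1 :: real"
  have "?z \<in> S" using assms \<open>x \<in> T\<close> by auto
  have scale: "((\<lambda>t. ?s * t) has_vector_derivative ?s) (at 0)" by (auto intro!: derivative_eq_intros)
  have first: "((\<lambda>t. u (?z + t *\<^sub>R axis i 1)) has_vector_derivative G i ?z) (at (?s * 0))"
    and second: "((\<lambda>t. G i (?z + t *\<^sub>R axis i 1)) has_vector_derivative H i ?z) (at (?s * 0))"
    using assms(1) \<open>?z \<in> S\<close> by (auto simp: has_second_partials_def)
  show "((\<lambda>t. u (mirror j y (x + t *\<^sub>R axis i 1))) has_vector_derivative ?s *\<^sub>R G i ?z) (at 0)"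
    unfolding mirror_add_axis using vector_diff_chain_at[OF scale first] by (simp add: o_def)
  have "((\<lambda>t. G i (?z + (?s * t) *\<^sub>R axis i 1)) has_vector_derivative ?s *\<^sub>R H i ?z) (at 0)"
    using vector_diff_chain_at[OF scale second] by (simp add: o_def)
  from bounded_linear.has_vector_derivative[OF bounded_linear_scaleR_right this, of ?s]
  show "((\<lambda>t. ?s *\<^sub>R G i (mirror j y (x + t *\<^sub>R axis i 1))) has_vector_derivative H i ?z) (at 0)"
    unfolding mirror_add_axis by (cases "i = j") simp_all
qed

lemma has_second_partials_dist_sq:
  fixes y :: "real^'n"
  shows "has_second_partials UNIV (\<lambda>x. (x - y) \<bullet> (x - y)) (\<lambda>i x. 2 * (x$i - y$i)) (\<lambda>i x. 2)"
  unfolding has_second_partials_def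
proof (intro ballI allI conjI)
  fix x :: "real^'n" and i
  have expand: "(x + s *\<^sub>R axis i 1 - y) \<bullet> (x + s *\<^sub>R axis i 1 - y)
      = (x - y) \<bullet> (x - y) + 2 * s * (x$i - y$i) + s\<^sup>2" for s
  proof -
    have "x + s *\<^sub>R axis i 1 - y = (x - y) + s *\<^sub>R axis i 1" by simp
    moreover have "axis i (1::real) \<bullet> axis i 1 = (1::real)" by (simp add: inner_axis_axis)
    ultimately show ?thesis
      by (simp add: inner_add_left inner_add_right inner_axis inner_axis' power2_eq_square algebra_simps)
  qed
  have "((\<lambda>s. (x - y) \<bullet> (x - y) + 2 * s * (x$i - y$i) + s\<^sup>2) has_real_derivative 2 * (x$i - y$i)) (at 0)"
    by (rule derivative_eq_intros refl | simp)+
  then show "((\<lambda>s. (x + s *\<^sub>R axis i 1 - y) \<bullet> (x + s *\<^sub>R axis i 1 - y))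
      has_vector_derivative 2 * (x$i - y$i)) (at 0)"
    unfolding expand has_real_derivative_iff_has_vector_derivative .
  have "((\<lambda>s. 2 * (x$i + s - y$i)) has_real_derivative 2) (at 0)"
    by (rule derivative_eq_intros refl | simp)+
  then show "((\<lambda>s. 2 * ((x + s *\<^sub>R axis i 1) $ i - y$i)) has_vector_derivative 2) (at 0)"
    by (simp add: has_real_derivative_iff_has_vector_derivative)
qed

lemma has_second_partials_component:
  "has_second_partials UNIV (\<lambda>x::real^'n. x$j) (\<lambda>i x. if i = j then 1 else 0) (\<lambda>i x. 0)"
  unfolding has_second_partials_def
proof (intro ballI allI conjI)
  fix x :: "real^'n" and i
  have "((\<lambda>s. x$j + s * (if i = j then 1 else 0)) has_real_derivative (if i = j then 1 else 0)) (at 0)"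
    by (rule derivative_eq_intros refl | simp)+
  moreover have "(x + s *\<^sub>R axis i 1) $ j = x$j + s * (if i = j then 1 else 0)" for s
    by (simp add: axis_def)
  ultimately show "((\<lambda>s. (x + s *\<^sub>R axis i 1) $ j) has_vector_derivative (if i = j then 1 else 0)) (at 0)"
    by (simp only: has_real_derivative_iff_has_vector_derivative)
qed (rule has_vector_derivative_const)

lemma has_second_partials_mult:
  fixes f g :: "real^'n \<Rightarrow> 'a::real_normed_field"
  assumes "has_second_partials S f G H" "has_second_partials S g G' H'"
  shows "has_second_partials S (\<lambda>x. f x * g x) (\<lambda>i x. f x * G' i x + G i x * g x)
     (\<lambda>i x. f x * H' i x + 2 * (G i x * G' i x) + H i x * g x)"
  unfolding has_second_partials_def
proof (intro ballI allI conjI)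
  fix x and i :: 'n assume "x \<in> S"
  let ?l = "\<lambda>t::real. x + t *\<^sub>R axis i 1"
  have f: "((\<lambda>t. f (?l t)) has_vector_derivative G i x) (at 0)"
      "((\<lambda>t. G i (?l t)) has_vector_derivative H i x) (at 0)"
    and g: "((\<lambda>t. g (?l t)) has_vector_derivative G' i x) (at 0)"
      "((\<lambda>t. G' i (?l t)) has_vector_derivative H' i x) (at 0)"
    using assms \<open>x \<in> S\<close> by (auto simp: has_second_partials_def)
  show "((\<lambda>t. f (?l t) * g (?l t)) has_vector_derivative f x * G' i x + G i x * g x) (at 0)"
    using has_vector_derivative_mult[OF f(1) g(1)] by simp
  show "((\<lambda>t. f (?l t) * G' i (?l t) + G i (?l t) * g (?l t)) has_vector_derivative
     f x * H' i x + 2 * (G i x * G' i x) + H i x * g x) (at 0)"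
    using has_vector_derivative_add[OF has_vector_derivative_mult[OF f(1) g(2)] has_vector_derivative_mult[OF f(2) g(1)]]
    by (simp add: algebra_simps)
qed

lemma has_second_partials_compose:
  fixes Q :: "real^'n \<Rightarrow> real" and f :: "real \<Rightarrow> 'a::real_normed_vector"
  assumes Q: "has_second_partials S Q G H"
    and f: "\<And>x. x \<in> S \<Longrightarrow> (f has_vector_derivative f' (Q x)) (at (Q x))"
    and f': "\<And>x. x \<in> S \<Longrightarrow> (f' has_vector_derivative f'' (Q x)) (at (Q x))"
  shows "has_second_partials S (\<lambda>x. f (Q x)) (\<lambda>i x. G i x *\<^sub>R f' (Q x))
    (\<lambda>i x. (G i x)\<^sup>2 *\<^sub>R f'' (Q x) + H i x *\<^sub>R f' (Q x))"
  unfolding has_second_partials_def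
proof (intro ballI allI conjI)
  fix x i assume x: "x \<in> S"
  let ?l = "\<lambda>t::real. x + t *\<^sub>R axis i 1"
  have inner: "((\<lambda>t. Q (?l t)) has_vector_derivative G i x) (at 0)"
    and inner2: "((\<lambda>t. G i (?l t)) has_vector_derivative H i x) (at 0)"
    using Q x by (auto simp: has_second_partials_def)
  have outer: "(f has_vector_derivative f' (Q x)) (at (Q (?l 0)))"
    "(f' has_vector_derivative f'' (Q x)) (at (Q (?l 0)))"
    using f[OF x] f'[OF x] by auto
  show "((\<lambda>t. f (Q (?l t))) has_vector_derivative G i x *\<^sub>R f' (Q x)) (at 0)"
    using vector_diff_chain_at[OF inner outer(1)] by (simp add: o_def)
  have f'_deriv: "((\<lambda>t. f' (Q (?l t))) has_vector_derivative G i x *\<^sub>R f'' (Q x)) (at 0)"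
    using vector_diff_chain_at[OF inner outer(2)] by (simp add: o_def)
  have "((\<lambda>t. G i (?l t)) has_field_derivative H i x) (at 0)"
    using inner2 by (simp add: has_real_derivative_iff_has_vector_derivative)
  from has_vector_derivative_scaleR[OF this f'_deriv]
  show "((\<lambda>t. G i (?l t) *\<^sub>R f' (Q (?l t))) has_vector_derivative
    (G i x)\<^sup>2 *\<^sub>R f'' (Q x) + H i x *\<^sub>R f' (Q x)) (at 0)"
    by (simp add: power2_eq_square)
qed

section \<open>Interior estimates\<close>

lemma maximum_principle_strict:
  fixes w :: "real^'n \<Rightarrow> real"
  assumes "open Q" "bounded Q" "continuous_on (closure Q) w" and partials: "has_second_partials Q w G H"
    and pos: "\<And>x. x \<in> Q \<Longrightarrow> (\<Sum>i\<in>UNIV. H i x) > 0"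
    and boundary: "\<And>x. x \<in> closure Q \<Longrightarrow> x \<notin> Q \<Longrightarrow> w x \<le> m" and "x \<in> Q"
  shows "w x \<le> m"
proof (rule ccontr)
  assume "\<not> w x \<le> m"
  have "compact (closure Q)" "closure Q \<noteq> {}" using \<open>bounded Q\<close> \<open>x \<in> Q\<close> by auto
  from continuous_attains_sup[OF this assms(3)] obtain z where z: "z \<in> closure Q"
    "\<And>y. y \<in> closure Q \<Longrightarrow> w y \<le> w z" by auto
  then have "w x \<le> w z" using \<open>x \<in> Q\<close> closure_subset by auto
  then have "z \<in> Q" using boundary[OF z(1)] \<open>\<not> w x \<le> m\<close> by linarith
  then obtain d where "d > 0" and line: "\<And>t i. \<bar>t\<bar> < d \<Longrightarrow> z + t *\<^sub>R axis i 1 \<in> Q"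
    using segment_axis_subset_open[OF \<open>open Q\<close>] by metis
  have "H i z \<le> 0" for i
  proof (rule second_derivative_nonpos_at_max[OF \<open>d > 0\<close>])
    fix t assume t: "\<bar>t\<bar> < d"
    show "((\<lambda>s. w (z + s *\<^sub>R axis i 1)) has_vector_derivative G i (z + t *\<^sub>R axis i 1)) (at t)"
      by (rule has_second_partials_first[OF partials line[OF t]])
    show "w (z + t *\<^sub>R axis i 1) \<le> w (z + 0 *\<^sub>R axis i 1)"
      using z(2)[of "z + t *\<^sub>R axis i 1"] line[OF t] closure_subset[of Q] by auto
  next
    show "((\<lambda>s. G i (z + s *\<^sub>R axis i 1)) has_vector_derivative H i z) (at 0)"
      using partials \<open>z \<in> Q\<close> by (auto simp: has_second_partials_def)
  qed
  then have "(\<Sum>i\<in>UNIV. H i z) \<le> 0" by (simp add: sum_nonpos)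
  then show False using pos[OF \<open>z \<in> Q\<close>] by simp
qed

abbreviation cube :: "real^'n \<Rightarrow> real \<Rightarrow> (real^'n) set" where
  "cube y d \<equiv> cbox (\<chi> i. y$i - d) (\<chi> i. y$i + d)"

lemma mem_cube: "x \<in> cube y d \<longleftrightarrow> (\<forall>i. \<bar>x$i - y$i\<bar> \<le> d)"
  by (auto simp: mem_box_cart abs_le_iff algebra_simps)

lemma cube_subset_cball:
  fixes y :: "real^'n"
  shows "cube y d \<subseteq> cball y (real CARD('n) * d)"
proof
  fix x assume "x \<in> cube y d"
  then have component: "\<bar>(x - y)$i\<bar> \<le> d" for i by (simp add: mem_cube)
  have "norm (x - y) \<le> (\<Sum>i\<in>UNIV. \<bar>(x - y)$i\<bar>)" by (rule norm_le_l1_cart)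
  also have "\<dots> \<le> (\<Sum>i\<in>(UNIV::'n set). d)" by (rule sum_mono) (rule component)
  also have "\<dots> = real CARD('n) * d" by simp
  finally show "x \<in> cball y (real CARD('n) * d)" by (simp add: dist_norm norm_minus_commute)
qed

lemma cube_subset_cube:
  assumes "x \<in> cube y e"
  shows "cube x d \<subseteq> cube y (e + d)"
proof
  fix z assume "z \<in> cube x d"
  have "\<bar>z$i - y$i\<bar> \<le> e + d" for i
    using assms[unfolded mem_cube, rule_format, of i] \<open>z \<in> cube x d\<close>[unfolded mem_cube, rule_format, of i]
    by linarith
  then show "z \<in> cube y (e + d)" by (simp add: mem_cube)
qed

lemma add_axis_in_cube:
  assumes "\<bar>t\<bar> \<le> d" "x \<in> cube y e"
  shows "x + t *\<^sub>R axis i 1 \<in> cube y (e + d)"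
proof (rule subsetD[OF cube_subset_cube[OF assms(2)]])
  show "x + t *\<^sub>R axis i 1 \<in> cube x d" using assms(1) by (auto simp: mem_cube axis_def)
qed

lemma mirror_in_cube: "x \<in> cube y d \<Longrightarrow> mirror j y x \<in> cube y d"
  unfolding mem_cube mirror_component by (auto simp: abs_le_iff algebra_simps)

definition barrier :: "'n \<Rightarrow> real^'n \<Rightarrow> real \<Rightarrow> real \<Rightarrow> real \<Rightarrow> real^'n \<Rightarrow> real" where
  "barrier j y d a b x = a * ((x - y) \<bullet> (x - y)) + b * (d * (x$j - y$j) - (x$j - y$j)\<^sup>2)"

lemma has_second_partials_barrier:
  fixes y :: "real^'n"
  obtains G H where "has_second_partials UNIV (barrier j y d a b) G H"
    "\<And>x. (\<Sum>i\<in>UNIV. H i x) = 2 * real CARD('n) * a - 2 * b"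
proof -
  let ?c = "\<lambda>i. if i = j then 1 else 0 :: real"
  let ?f = "\<lambda>\<tau>. d * (\<tau> - y$j) - (\<tau> - y$j)\<^sup>2" and ?f' = "\<lambda>\<tau>. d - 2 * (\<tau> - y$j)"
  have "(?f has_vector_derivative ?f' \<tau>) (at \<tau>)" "(?f' has_vector_derivative - 2) (at \<tau>)" for \<tau>
    unfolding has_real_derivative_iff_has_vector_derivative[symmetric]
    by (auto intro!: derivative_eq_intros)
  from has_second_partials_compose[OF has_second_partials_component this]
  have "has_second_partials UNIV (\<lambda>x. ?f (x$j)) (\<lambda>i x. ?c i *\<^sub>R ?f' (x$j)) (\<lambda>i x. (?c i)\<^sup>2 *\<^sub>R (- 2) + 0 *\<^sub>R ?f' (x$j))" .
  from has_second_partials_add[OF has_second_partials_linear[OF bounded_linear_mult_right has_second_partials_dist_sq]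
      has_second_partials_linear[OF bounded_linear_mult_right this]]
  have "has_second_partials UNIV (barrier j y d a b)
     (\<lambda>i x. a * (2 * (x$i - y$i)) + b * (?c i *\<^sub>R ?f' (x$j)))
     (\<lambda>i x. a * 2 + b * ((?c i)\<^sup>2 *\<^sub>R (- 2) + 0 *\<^sub>R ?f' (x$j)))"
    unfolding barrier_def[abs_def] .
  moreover have "(\<Sum>i\<in>UNIV. a * 2 + b * ((?c i)\<^sup>2 *\<^sub>R (- 2) + 0 *\<^sub>R ?f' (x$j))) = 2 * real CARD('n) * a - 2 * b"
    for x :: "real^'n"
  proof -
    have "(\<Sum>i\<in>UNIV. a * 2 + b * ((?c i)\<^sup>2 *\<^sub>R (- 2) + 0 *\<^sub>R ?f' (x$j)))
        = (\<Sum>i\<in>(UNIV::'n set). 2 * a) - 2 * b * (\<Sum>i\<in>UNIV. ?c i)"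
      unfolding sum_distrib_left sum_subtractf[symmetric] by (rule sum.cong) auto
    then show ?thesis by simp
  qed
  ultimately show ?thesis by (rule that)
qed

definition half_cube :: "'n \<Rightarrow> real^'n \<Rightarrow> real \<Rightarrow> (real^'n) set" where
  "half_cube j y d = {x. y$j < x$j \<and> (\<forall>i. \<bar>x$i - y$i\<bar> < d)}"

lemma open_half_cube: "open (half_cube j y d)"
proof -
  have "half_cube j y d = {x. y$j < x$j} \<inter> (\<Inter>i. {x. \<bar>x$i - y$i\<bar> < d})" by (auto simp: half_cube_def)
  also have "open \<dots>" by (intro open_Int open_INT open_Collect_less continuous_intros ballI) auto
  finally show ?thesis .
qed

lemma half_cube_subset_cube: "half_cube j y d \<subseteq> cube y d"
  by (simp add: half_cube_def mem_cube subset_iff less_imp_le)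

lemma closure_half_cube: "closure (half_cube j y d) \<subseteq> cube y d \<inter> {x. y$j \<le> x$j}"
proof (rule closure_minimal[OF Int_greatest[OF half_cube_subset_cube]])
  show "half_cube j y d \<subseteq> {x. y$j \<le> x$j}" by (auto simp: half_cube_def)
qed (intro closed_Int closed_cbox closed_Collect_le continuous_intros)

lemma barrier_ge_on_half_cube_boundary:
  assumes "x \<in> cube y d" "y$j \<le> x$j" "x \<notin> half_cube j y d" "0 \<le> a" "0 \<le> b"
  shows "0 \<le> barrier j y d a b x" and "x$j \<noteq> y$j \<Longrightarrow> a * d\<^sup>2 \<le> barrier j y d a b x"
proof -
  have "\<bar>x$j - y$j\<bar> \<le> d" using assms(1) by (simp add: mem_cube)
  then have "(x$j - y$j)\<^sup>2 \<le> d * (x$j - y$j)"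
    using assms(2) by (simp add: power2_eq_square mult_right_mono)
  then have ge_dist: "a * ((x - y) \<bullet> (x - y)) \<le> barrier j y d a b x"
    using \<open>0 \<le> b\<close> by (simp add: barrier_def)
  then show "0 \<le> barrier j y d a b x"
    using mult_nonneg_nonneg[OF \<open>0 \<le> a\<close> inner_ge_zero[of "x - y"]] by linarith
  assume "x$j \<noteq> y$j"
  then obtain i where "\<not> \<bar>x$i - y$i\<bar> < d" using assms(2,3) by (force simp: half_cube_def)
  then have "\<bar>x$i - y$i\<bar> = d" using assms(1) by (auto simp: mem_cube intro: antisym)
  then have "d\<^sup>2 = (x$i - y$i)\<^sup>2" by auto
  also have "\<dots> \<le> (\<Sum>i\<in>UNIV. (x$i - y$i)\<^sup>2)" by (rule member_le_sum) auto
  also have "\<dots> = (x - y) \<bullet> (x - y)" by (simp add: inner_vec_def power2_eq_square)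
  finally have "a * d\<^sup>2 \<le> a * ((x - y) \<bullet> (x - y))" using \<open>0 \<le> a\<close> by (rule mult_left_mono)
  then show "a * d\<^sup>2 \<le> barrier j y d a b x" using ge_dist by linarith
qed

lemma odd_part_le_barrier_on_boundary:
  fixes w :: "real^'n \<Rightarrow> real"
  assumes "d > 0" "0 \<le> b" and bound: "\<And>x. x \<in> cube y d \<Longrightarrow> \<bar>w x\<bar> \<le> M"
    and x: "x \<in> cube y d" "y$j \<le> x$j" "x \<notin> half_cube j y d"
  shows "(1/2) * (w x - w (mirror j y x)) \<le> barrier j y d (M / d\<^sup>2) b x"
proof (cases "x$j = y$j")
  case True
  have "0 \<le> M / d\<^sup>2" using bound[OF x(1)] by simp
  moreover have "mirror j y x = x" using True by (simp add: mirror_def)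
  ultimately show ?thesis using barrier_ge_on_half_cube_boundary(1)[OF x _ \<open>0 \<le> b\<close>] by simp
next
  case False
  have "0 \<le> M / d\<^sup>2" using bound[OF x(1)] by simp
  then have "M / d\<^sup>2 * d\<^sup>2 \<le> barrier j y d (M / d\<^sup>2) b x"
    by (rule barrier_ge_on_half_cube_boundary(2)[OF x _ \<open>0 \<le> b\<close> False])
  moreover have "w x - w (mirror j y x) \<le> 2 * M"
    using abs_le_D1[OF bound[OF x(1)]] abs_le_D2[OF bound[OF mirror_in_cube[OF x(1)], of j]] by simp
  ultimately show ?thesis using \<open>d > 0\<close> by simp
qed

text \<open>The comparison of Gilbarg and Trudinger's interior gradient estimate: the odd part of \<open>w\<close> under
  reflection in the midplane vanishes there, and its Laplacian minus that of the barrier is positive.\<close>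

lemma odd_part_le_barrier:
  fixes w :: "real^'n \<Rightarrow> real"
  assumes "d > 0" and partials: "has_second_partials (cube y d) w G H" and cont: "continuous_on (cube y d) w"
    and laplacian: "\<And>x. x \<in> cube y d \<Longrightarrow> \<bar>\<Sum>i\<in>UNIV. H i x\<bar> \<le> N" and "N < N'"
    and bound: "\<And>x. x \<in> cube y d \<Longrightarrow> \<bar>w x\<bar> \<le> M" and x: "x \<in> cube y d" "y$j \<le> x$j"
  shows "(1/2) * (w x - w (mirror j y x)) \<le> barrier j y d (M / d\<^sup>2) (real CARD('n) * (M / d\<^sup>2) + N' / 2) x"
proof -
  define \<beta> where "\<beta> = barrier j y d (M / d\<^sup>2) (real CARD('n) * (M / d\<^sup>2) + N' / 2)"
  have "N \<ge> 0" "M \<ge> 0" using laplacian[OF x(1)] bound[OF x(1)] by linarith+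
  obtain G\<beta> H\<beta> where \<beta>_partials: "has_second_partials UNIV \<beta> G\<beta> H\<beta>"
    and \<beta>_sum: "\<And>x. (\<Sum>i\<in>UNIV. H\<beta> i x) = 2 * real CARD('n) * (M / d\<^sup>2) - 2 * (real CARD('n) * (M / d\<^sup>2) + N' / 2)"
    unfolding \<beta>_def
    by (rule has_second_partials_barrier[of j y d "M / d\<^sup>2" "real CARD('n) * (M / d\<^sup>2) + N' / 2"]) (rule that[unfolded \<beta>_def])
  have \<beta>_laplacian: "(\<Sum>i\<in>UNIV. H\<beta> i x) = - N'" for x unfolding \<beta>_sum by simp
  define \<phi> where "\<phi> x = (1/2) * (w x - w (mirror j y x)) - \<beta> x" for x
  let ?H = "\<lambda>i x. (1/2) * (H i x - H i (mirror j y x)) - H\<beta> i x"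
  have \<phi>_partials: "has_second_partials (cube y d) \<phi>
     (\<lambda>i x. (1/2) * (G i x - (if i = j then -1 else 1) *\<^sub>R G i (mirror j y x)) - G\<beta> i x) ?H"
    unfolding \<phi>_def
    by (intro has_second_partials_diff has_second_partials_linear[OF bounded_linear_mult_right] partials
        has_second_partials_mirror[OF partials mirror_in_cube] has_second_partials_subset[OF \<beta>_partials]) auto
  have "0 \<le> real CARD('n) * (M / d\<^sup>2) + N' / 2" using \<open>M \<ge> 0\<close> \<open>N \<ge> 0\<close> \<open>N < N'\<close> by simp
  from odd_part_le_barrier_on_boundary[OF \<open>d > 0\<close> this bound]
  have \<phi>_boundary: "\<phi> z \<le> 0" if "z \<in> cube y d" "y$j \<le> z$j" "z \<notin> half_cube j y d" for z
    using that by (simp add: \<phi>_def \<beta>_def)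
  have "\<phi> x \<le> 0"
  proof (cases "x \<in> half_cube j y d")
    case True
    show ?thesis
    proof (rule maximum_principle_strict[OF open_half_cube _ _ has_second_partials_subset[OF \<phi>_partials half_cube_subset_cube] _ _ True])
      show "bounded (half_cube j y d)" by (rule bounded_subset[OF bounded_cbox half_cube_subset_cube])
      have "continuous_on (cube y d) (\<lambda>x. w (mirror j y x))"
        by (intro continuous_on_compose2[OF cont continuous_on_mirror]) (auto intro: mirror_in_cube)
      then have "continuous_on (cube y d) \<phi>" unfolding \<phi>_def \<beta>_def barrier_def by (intro continuous_intros cont)
      then show "continuous_on (closure (half_cube j y d)) \<phi>" by (rule continuous_on_subset) (use closure_half_cube in blast)
    next
      fix z assume "z \<in> half_cube j y d"
      then have z: "z \<in> cube y d" "mirror j y z \<in> cube y d" using half_cube_subset_cube mirror_in_cube by blast+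
      have "(\<Sum>i\<in>UNIV. ?H i z) = ((\<Sum>i\<in>UNIV. H i z) - (\<Sum>i\<in>UNIV. H i (mirror j y z))) / 2 + N'"
        unfolding sum_subtractf sum_distrib_left[symmetric] \<beta>_laplacian by simp
      moreover have "- N \<le> (\<Sum>i\<in>UNIV. H i z)" "(\<Sum>i\<in>UNIV. H i (mirror j y z)) \<le> N"
        using laplacian[OF z(1)] laplacian[OF z(2)] by (simp_all add: abs_le_iff)
      ultimately show "0 < (\<Sum>i\<in>UNIV. ?H i z)" using \<open>N < N'\<close> by (simp add: field_simps)
    qed (use \<phi>_boundary closure_half_cube in blast)
  qed (use \<phi>_boundary x in blast)
  then show ?thesis by (simp add: \<phi>_def \<beta>_def)
qed

lemma central_difference_bound:
  fixes w :: "real^'n \<Rightarrow> real"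
  assumes "d > 0" "has_second_partials (cube y d) w G H" "continuous_on (cube y d) w"
    and "\<And>x. x \<in> cube y d \<Longrightarrow> \<bar>\<Sum>i\<in>UNIV. H i x\<bar> \<le> N" and "N < N'"
    and "\<And>x. x \<in> cube y d \<Longrightarrow> \<bar>w x\<bar> \<le> M" and t: "0 \<le> t" "t \<le> d"
  shows "w (y + t *\<^sub>R axis j 1) - w (y - t *\<^sub>R axis j 1) \<le> t * (2 * real CARD('n) * M / d + N' * d)"
proof -
  define a where "a = M / d\<^sup>2"
  have "y \<in> cube y d" using \<open>d > 0\<close> by (simp add: mem_cube)
  then have "N \<ge> 0" "M \<ge> 0" using assms(4)[of y] assms(6)[of y] by linarith+
  then have "a \<ge> 0" by (simp add: a_def)
  have "a * 1 \<le> a * real CARD('n)" using \<open>a \<ge> 0\<close> by (intro mult_left_mono) auto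
  then have a_le: "a \<le> real CARD('n) * a + N' / 2" using \<open>N \<ge> 0\<close> \<open>N < N'\<close> by (simp add: mult.commute)
  have "y + t *\<^sub>R axis j 1 \<in> cube y d" using t by (auto simp: mem_cube axis_def)
  from odd_part_le_barrier[OF assms(1-6) this, of j]
  have "w (y + t *\<^sub>R axis j 1) - w (mirror j y (y + t *\<^sub>R axis j 1))
      \<le> 2 * barrier j y d a (real CARD('n) * a + N' / 2) (y + t *\<^sub>R axis j 1)" using t by (simp add: a_def)
  also have "\<dots> = 2 * (a * t\<^sup>2 + (real CARD('n) * a + N' / 2) * (d * t - t\<^sup>2))"
    by (simp add: barrier_def inner_axis_axis power2_eq_square)
  also have "\<dots> \<le> 2 * ((real CARD('n) * a + N' / 2) * t\<^sup>2 + (real CARD('n) * a + N' / 2) * (d * t - t\<^sup>2))"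
    by (intro mult_left_mono add_right_mono mult_right_mono a_le) auto
  also have "\<dots> = t * (2 * real CARD('n) * M / d + N' * d)"
    using \<open>d > 0\<close> by (simp add: a_def field_simps power2_eq_square)
  also have "mirror j y (y + t *\<^sub>R axis j 1) = y - t *\<^sub>R axis j 1"
    by (simp add: vec_eq_iff mirror_component axis_def)
  finally show ?thesis .
qed

section \<open>Classical solutions of the Helmholtz equation\<close>

definition classical_helmholtz :: "real \<Rightarrow> (real^'n) set \<Rightarrow> (real^'n \<Rightarrow> complex) \<Rightarrow> bool" where
  "classical_helmholtz k S u \<longleftrightarrow> continuous_on S u \<and>
     (\<exists>G H. has_second_partials S u G H \<and> (\<forall>x\<in>S. (\<Sum>i\<in>UNIV. H i x) + complex_of_real (k\<^sup>2) * u x = 0))"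

lemma classical_helmholtzI:
  assumes "continuous_on S u" "has_second_partials S u G H"
    and "\<And>x. x \<in> S \<Longrightarrow> (\<Sum>i\<in>UNIV. H i x) + complex_of_real (k\<^sup>2) * u x = 0"
  shows "classical_helmholtz k S u"
  using assms unfolding classical_helmholtz_def by blast

lemma classical_helmholtzE:
  assumes "classical_helmholtz k S u"
  obtains G H where "continuous_on S u" "has_second_partials S u G H"
    "\<And>x. x \<in> S \<Longrightarrow> (\<Sum>i\<in>UNIV. H i x) = - (complex_of_real (k\<^sup>2) * u x)"
  using assms unfolding classical_helmholtz_def eq_neg_iff_add_eq_0 by blast

lemma classical_helmholtz_subset: "classical_helmholtz k S u \<Longrightarrow> T \<subseteq> S \<Longrightarrow> classical_helmholtz k T u"
  unfolding classical_helmholtz_def by (meson has_second_partials_subset continuous_on_subset subsetD)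

lemma classical_helmholtz_zero: "classical_helmholtz k S (\<lambda>x. 0)"
  by (rule classical_helmholtzI[of _ _ "\<lambda>i x. 0" "\<lambda>i x. 0"]) (auto simp: has_second_partials_def)

lemma classical_helmholtz_add:
  assumes "classical_helmholtz k S u" "classical_helmholtz k S v"
  shows "classical_helmholtz k S (\<lambda>x. u x + v x)"
proof -
  obtain G H where u: "continuous_on S u" "has_second_partials S u G H"
    "\<And>x. x \<in> S \<Longrightarrow> (\<Sum>i\<in>UNIV. H i x) = - (complex_of_real (k\<^sup>2) * u x)"
    by (rule classical_helmholtzE[OF assms(1)]) (rule that)
  obtain G' H' where v: "continuous_on S v" "has_second_partials S v G' H'"
    "\<And>x. x \<in> S \<Longrightarrow> (\<Sum>i\<in>UNIV. H' i x) = - (complex_of_real (k\<^sup>2) * v x)"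
    by (rule classical_helmholtzE[OF assms(2)]) (rule that)
  show ?thesis
    by (rule classical_helmholtzI[OF continuous_on_add[OF u(1) v(1)] has_second_partials_add[OF u(2) v(2)]])
       (simp add: sum.distrib u(3) v(3) algebra_simps)
qed

lemma classical_helmholtz_cmult:
  assumes "classical_helmholtz k S u"
  shows "classical_helmholtz k S (\<lambda>x. c * u x)"
proof -
  obtain G H where u: "continuous_on S u" "has_second_partials S u G H"
    "\<And>x. x \<in> S \<Longrightarrow> (\<Sum>i\<in>UNIV. H i x) = - (complex_of_real (k\<^sup>2) * u x)"
    by (rule classical_helmholtzE[OF assms]) (rule that)
  show ?thesis
    by (rule classical_helmholtzI[OF _ has_second_partials_linear[OF bounded_linear_mult_right u(2)]])
       (auto intro!: continuous_intros u(1) simp: u(3) simp flip: sum_distrib_left)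
qed

lemma classical_helmholtz_diff:
  "classical_helmholtz k S u \<Longrightarrow> classical_helmholtz k S v \<Longrightarrow> classical_helmholtz k S (\<lambda>x. u x - v x)"
  using classical_helmholtz_add[OF _ classical_helmholtz_cmult[of k S v "-1"]] by simp

lemma classical_helmholtz_sum:
  "(\<And>i. i \<in> I \<Longrightarrow> classical_helmholtz k S (u i)) \<Longrightarrow> classical_helmholtz k S (\<lambda>x. \<Sum>i\<in>I. c i * u i x)"
  by (induction I rule: infinite_finite_induct)
     (simp_all add: classical_helmholtz_zero classical_helmholtz_add classical_helmholtz_cmult)

lemma classical_helmholtz_translate:
  assumes "classical_helmholtz k S u" "\<And>x. x \<in> T \<Longrightarrow> x + a \<in> S"
  shows "classical_helmholtz k T (\<lambda>x. u (x + a))"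
proof -
  obtain G H where u: "continuous_on S u" "has_second_partials S u G H"
    "\<And>x. x \<in> S \<Longrightarrow> (\<Sum>i\<in>UNIV. H i x) = - (complex_of_real (k\<^sup>2) * u x)"
    by (rule classical_helmholtzE[OF assms(1)]) (rule that)
  have "continuous_on T (\<lambda>x. u (x + a))"
    by (rule continuous_on_compose2[OF u(1)]) (use assms(2) in \<open>auto intro!: continuous_intros\<close>)
  then show ?thesis
    by (rule classical_helmholtzI[OF _ has_second_partials_translate[OF u(2) assms(2)]])
       (simp_all add: u(3) assms(2))
qed

lemma classical_helmholtz_mirror:
  assumes "classical_helmholtz k S u" "\<And>x. x \<in> T \<Longrightarrow> mirror j y x \<in> S"
  shows "classical_helmholtz k T (\<lambda>x. u (mirror j y x))"
proof -
  obtain G H where u: "continuous_on S u" "has_second_partials S u G H"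
    "\<And>x. x \<in> S \<Longrightarrow> (\<Sum>i\<in>UNIV. H i x) = - (complex_of_real (k\<^sup>2) * u x)"
    by (rule classical_helmholtzE[OF assms(1)]) (rule that)
  have "continuous_on T (\<lambda>x. u (mirror j y x))"
    by (rule continuous_on_compose2[OF u(1) continuous_on_mirror]) (use assms(2) in auto)
  then show ?thesis
    by (rule classical_helmholtzI[OF _ has_second_partials_mirror[OF u(2) assms(2)]])
       (simp_all add: u(3) assms(2))
qed

lemma classical_helmholtz_cong:
  assumes "open S" "classical_helmholtz k S u" "\<And>x. x \<in> S \<Longrightarrow> u x = v x"
  shows "classical_helmholtz k S v"
proof -
  obtain G H where u: "continuous_on S u" "has_second_partials S u G H"
    "\<And>x. x \<in> S \<Longrightarrow> (\<Sum>i\<in>UNIV. H i x) = - (complex_of_real (k\<^sup>2) * u x)"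
    by (rule classical_helmholtzE[OF assms(2)]) (rule that)
  have "continuous_on S v" using u(1) assms(3) continuous_on_cong[of S S u v] by simp
  moreover have "has_second_partials S v G H"
    by (rule has_second_partials_cong[OF assms(1) u(2)]) (use assms(3) in auto)
  ultimately show ?thesis
    by (rule classical_helmholtzI) (simp add: u(3) flip: assms(3))
qed

lemma has_second_partials_unique:
  assumes "open S" "has_second_partials S u G H" "has_second_partials S u G' H'" "x \<in> S"
  shows "G i x = G' i x" "H i x = H' i x"
proof -
  have G_eq: "G i y = G' i y" if "y \<in> S" for i y
    using assms(2,3) that unfolding has_second_partials_def by (blast intro: vector_derivative_unique_at)
  then show "G i x = G' i x" using assms(4) .
  have "((\<lambda>t. G' i (x + t *\<^sub>R axis i 1)) has_vector_derivative H i x) (at 0)"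
    by (rule has_vector_derivative_axis_transform[where u="G i", OF assms(1,4) G_eq])
       (use assms(2,4) in \<open>auto simp: has_second_partials_def\<close>)
  then show "H i x = H' i x"
    using assms(3,4) unfolding has_second_partials_def by (blast intro: vector_derivative_unique_at)
qed

lemma classical_helmholtz_Un:
  assumes "open S" "open T" "classical_helmholtz k S u" "classical_helmholtz k T u"
  shows "classical_helmholtz k (S \<union> T) u"
proof -
  obtain G H where S: "continuous_on S u" "has_second_partials S u G H"
    "\<And>x. x \<in> S \<Longrightarrow> (\<Sum>i\<in>UNIV. H i x) = - (complex_of_real (k\<^sup>2) * u x)"
    by (rule classical_helmholtzE[OF assms(3)]) (rule that)
  obtain G' H' where T: "continuous_on T u" "has_second_partials T u G' H'"
    "\<And>x. x \<in> T \<Longrightarrow> (\<Sum>i\<in>UNIV. H' i x) = - (complex_of_real (k\<^sup>2) * u x)"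
    by (rule classical_helmholtzE[OF assms(4)]) (rule that)
  have overlap: "G i x = G' i x" "H i x = H' i x" if "x \<in> S" "x \<in> T" for i x
    using has_second_partials_unique[OF open_Int[OF assms(1,2)], of u G H G' H' x] S(2) T(2) that
    by (auto intro: has_second_partials_subset)
  let ?G = "\<lambda>i x. if x \<in> S then G i x else G' i x" and ?H = "\<lambda>i x. if x \<in> S then H i x else H' i x"
  have "has_second_partials S u ?G ?H" by (rule has_second_partials_cong[OF assms(1) S(2)]) auto
  moreover have "has_second_partials T u ?G ?H"
    by (rule has_second_partials_cong[OF assms(2) T(2)]) (auto simp: overlap)
  ultimately have "has_second_partials (S \<union> T) u ?G ?H" by (auto simp: has_second_partials_def)
  moreover have "(\<Sum>i\<in>UNIV. ?H i x) + complex_of_real (k\<^sup>2) * u x = 0" if "x \<in> S \<union> T" for x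
    using that S(3)[of x] T(3)[of x] by (cases "x \<in> S") auto
  ultimately show ?thesis
    using continuous_on_open_Un[OF assms(1,2) S(1) T(1)] by (blast intro: classical_helmholtzI)
qed

lemma cnj_sgn_mult_self: "cnj (sgn z) * z = complex_of_real (norm z)"
proof (cases "z = 0")
  case False
  have "cnj z * z = of_real (norm z) * of_real (norm z)"
    by (metis complex_norm_square mult.commute of_real_mult power2_eq_square)
  then show ?thesis using False by (simp add: sgn_eq)
qed simp

lemma abs_Re_cnj_sgn_mult_le: "\<bar>Re (cnj (sgn z) * w)\<bar> \<le> norm w"
proof -
  have "\<bar>Re (cnj (sgn z) * w)\<bar> \<le> norm (cnj (sgn z)) * norm w" by (metis abs_Re_le_cmod norm_mult)
  also have "\<dots> \<le> 1 * norm w" by (rule mult_right_mono) (auto simp: norm_sgn)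
  finally show ?thesis by simp
qed

lemma helmholtz_central_difference_bound:
  fixes u :: "real^'n \<Rightarrow> complex"
  assumes "d > 0" "classical_helmholtz k (cube y d) u" "M > 0"
    and bound: "\<And>x. x \<in> cube y d \<Longrightarrow> norm (u x) \<le> M" and t: "0 \<le> t" "t \<le> d"
  shows "norm (u (y + t *\<^sub>R axis j 1) - u (y - t *\<^sub>R axis j 1)) \<le> t * ((2 * real CARD('n) / d + (k\<^sup>2 + 1) * d) * M)"
proof -
  obtain G H where u: "continuous_on (cube y d) u" "has_second_partials (cube y d) u G H"
    "\<And>x. x \<in> cube y d \<Longrightarrow> (\<Sum>i\<in>UNIV. H i x) = - (complex_of_real (k\<^sup>2) * u x)"
    by (rule classical_helmholtzE[OF assms(2)]) (rule that)
  define D where "D = u (y + t *\<^sub>R axis j 1) - u (y - t *\<^sub>R axis j 1)"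
  define a where "a = cnj (sgn D)"
  note Re_le = abs_Re_cnj_sgn_mult_le[of D, folded a_def]
  have linear: "bounded_linear (\<lambda>z. Re (a * z))"
    by (rule bounded_linear_compose[OF bounded_linear_Re bounded_linear_mult_right])
  have "Re (a * u (y + t *\<^sub>R axis j 1)) - Re (a * u (y - t *\<^sub>R axis j 1))
      \<le> t * (2 * real CARD('n) * M / d + ((k\<^sup>2 + 1) * M) * d)"
  proof (rule central_difference_bound[OF \<open>d > 0\<close> has_second_partials_linear[OF linear u(2)]])
    show "continuous_on (cube y d) (\<lambda>x. Re (a * u x))" by (intro continuous_intros u(1))
    show "k\<^sup>2 * M < (k\<^sup>2 + 1) * M" using \<open>M > 0\<close> by (simp add: algebra_simps)
  next
    fix x assume x: "x \<in> cube y d"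
    have "(\<Sum>i\<in>UNIV. Re (a * H i x)) = Re (a * (\<Sum>i\<in>UNIV. H i x))"
      by (simp add: sum_distrib_left Re_sum[symmetric])
    then have "\<bar>\<Sum>i\<in>UNIV. Re (a * H i x)\<bar> \<le> norm (\<Sum>i\<in>UNIV. H i x)" using Re_le by metis
    also have "\<dots> = k\<^sup>2 * norm (u x)" using u(3)[OF x] by (simp add: norm_mult del: of_real_power)
    also have "\<dots> \<le> k\<^sup>2 * M" using bound[OF x] by (intro mult_left_mono) auto
    finally show "\<bar>\<Sum>i\<in>UNIV. Re (a * H i x)\<bar> \<le> k\<^sup>2 * M" .
    show "\<bar>Re (a * u x)\<bar> \<le> M" using Re_le bound[OF x] order_trans by blast
  qed (use t in auto)
  moreover have "Re (a * u (y + t *\<^sub>R axis j 1)) - Re (a * u (y - t *\<^sub>R axis j 1)) = Re (a * D)"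
    unfolding D_def right_diff_distrib minus_complex.sel ..
  moreover have "Re (a * D) = norm D" unfolding a_def cnj_sgn_mult_self by simp
  ultimately show ?thesis using \<open>d > 0\<close> by (simp add: D_def algebra_simps)
qed

lemma helmholtz_second_difference_bound:
  fixes u :: "real^'n \<Rightarrow> complex"
  assumes "d > 0" "classical_helmholtz k (cube y (2 * d)) u" "M > 0"
    and bound: "\<And>x. x \<in> cube y (2 * d) \<Longrightarrow> norm (u x) \<le> M" and h: "0 < h" "h \<le> d"
  shows "norm (u (y + h *\<^sub>R axis j 1) + u (y - h *\<^sub>R axis j 1) - 2 *\<^sub>R u y)
    \<le> (2 * real CARD('n) / d + (k\<^sup>2 + 1) * d)\<^sup>2 * M * h\<^sup>2"
proof -
  define C where "C = 2 * real CARD('n) / d + (k\<^sup>2 + 1) * d"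
  have "C > 0" unfolding C_def using \<open>d > 0\<close> by (intro add_pos_nonneg) auto
  define v where "v x = u (x + (h/2) *\<^sub>R axis j 1) - u (x + (-h/2) *\<^sub>R axis j 1)" for x
  have cube_mono: "cube x d \<subseteq> cube y (2 * d)" if "x \<in> cube y d" for x
    by (rule cube_subset_cube[OF that, of d, folded mult_2])
  have "classical_helmholtz k (cube y d) v" unfolding v_def
  proof (intro classical_helmholtz_diff classical_helmholtz_translate[OF assms(2)])
    fix x assume "x \<in> cube y d"
    then show "x + (h/2) *\<^sub>R axis j 1 \<in> cube y (2 * d)" "x + (-h/2) *\<^sub>R axis j 1 \<in> cube y (2 * d)"
      using add_axis_in_cube[of "h/2" d x y d j, folded mult_2]
        add_axis_in_cube[of "-h/2" d x y d j, folded mult_2] h by linarith+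
  qed
  moreover have "norm (v x) \<le> (h/2) * (C * M)" if x: "x \<in> cube y d" for x
    using helmholtz_central_difference_bound[OF \<open>d > 0\<close> classical_helmholtz_subset[OF assms(2) cube_mono[OF x]]
        \<open>M > 0\<close> bound[OF subsetD[OF cube_mono[OF x]]], of "h/2" j] h
    by (simp add: v_def C_def)
  ultimately have "norm (v (y + (h/2) *\<^sub>R axis j 1) - v (y - (h/2) *\<^sub>R axis j 1)) \<le> (h/2) * (C * ((h/2) * (C * M)))"
    unfolding C_def using h \<open>M > 0\<close> \<open>C > 0\<close>[unfolded C_def]
    by (intro helmholtz_central_difference_bound \<open>d > 0\<close>) auto
  moreover have "(h/2) *\<^sub>R axis j (1::real) + (h/2) *\<^sub>R axis j 1 = h *\<^sub>R (axis j 1 :: real^'n)"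
    by (simp flip: scaleR_left_distrib)
  then have "v (y + (h/2) *\<^sub>R axis j 1) - v (y - (h/2) *\<^sub>R axis j 1)
      = u (y + h *\<^sub>R axis j 1) + u (y - h *\<^sub>R axis j 1) - 2 *\<^sub>R u y"
    unfolding v_def by (simp add: scaleR_2 add.assoc diff_diff_eq)
  moreover have "0 \<le> C\<^sup>2 * M * h\<^sup>2" using \<open>M > 0\<close> by simp
  then have "(h/2) * (C * ((h/2) * (C * M))) \<le> C\<^sup>2 * M * h\<^sup>2" by (simp add: power2_eq_square algebra_simps)
  ultimately show ?thesis unfolding C_def by simp
qed

section \<open>Bounded functions with bounded support\<close>

definition bounded_supported :: "('a::euclidean_space \<Rightarrow> 'b::real_normed_vector) \<Rightarrow> bool" where
  "bounded_supported f \<longleftrightarrow> f \<in> borel_measurable borel \<and> bounded (range f) \<and> bounded {x. f x \<noteq> 0}"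

lemma bounded_supported_measurable: "bounded_supported f \<Longrightarrow> f \<in> borel_measurable borel"
  by (simp add: bounded_supported_def)

lemma bounded_supported_bound:
  assumes "bounded_supported f"
  obtains M where "M \<ge> 0" "\<And>x. norm (f x) \<le> M"
proof -
  obtain M where M: "\<And>x. norm (f x) \<le> M" using assms by (auto simp: bounded_supported_def bounded_iff)
  then show ?thesis using that[of M] norm_ge_zero order_trans by blast
qed

lemma bounded_supported_support:
  assumes "bounded_supported f"
  obtains R where "R > 0" "\<And>x. x \<notin> cball 0 R \<Longrightarrow> f x = 0"
proof -
  obtain R where "R > 0" "\<And>x. f x \<noteq> 0 \<Longrightarrow> norm x \<le> R"
    using assms by (auto simp: bounded_supported_def bounded_pos)
  then show ?thesis using that[of R] by auto
qed

lemma bounded_supported_integrable: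
  fixes f :: "'a::euclidean_space \<Rightarrow> 'b::{banach, second_countable_topology}"
  assumes "bounded_supported f"
  shows "integrable lborel f"
proof -
  obtain M where M: "\<And>x. norm (f x) \<le> M" by (rule bounded_supported_bound[OF assms]) (rule that)
  obtain R where R: "\<And>x. x \<notin> cball 0 R \<Longrightarrow> f x = 0" by (rule bounded_supported_support[OF assms]) (rule that)
  show ?thesis
    by (rule integrableI_bounded_set[where A="cball 0 R" and B=M])
       (use M R bounded_supported_measurable[OF assms] emeasure_compact_finite[OF compact_cball, of 0 R] in auto)
qed

lemma bounded_supported_continuous:
  fixes f :: "'a::euclidean_space \<Rightarrow> 'b::real_normed_vector"
  assumes "continuous_on UNIV f" "compact K" "\<And>x. x \<notin> K \<Longrightarrow> f x = 0"
  shows "bounded_supported f"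
proof -
  have "bounded (f ` K)" using assms
    by (intro compact_imp_bounded compact_continuous_image) (auto intro: continuous_on_subset)
  then have "bounded (insert 0 (f ` K))" by simp
  then have "bounded (range f)" by (rule bounded_subset) (use assms(3) in auto)
  moreover have "bounded {x. f x \<noteq> 0}"
    by (rule bounded_subset[OF compact_imp_bounded[OF assms(2)]]) (use assms(3) in auto)
  ultimately show ?thesis
    unfolding bounded_supported_def using borel_measurable_continuous_onI[OF assms(1)] by blast
qed

lemma bounded_supported_indicator:
  fixes f :: "'a::euclidean_space \<Rightarrow> 'b::real_normed_vector"
  assumes "continuous_on K f" "compact K"
  shows "bounded_supported (\<lambda>x. indicator K x *\<^sub>R f x)"
proof -
  have "bounded (insert 0 (f ` K))" using assms by (simp add: compact_imp_bounded compact_continuous_image)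
  then have "bounded (range (\<lambda>x. indicator K x *\<^sub>R f x))"
    by (rule bounded_subset) (auto simp: indicator_def)
  moreover have "bounded {x. indicator K x *\<^sub>R f x \<noteq> 0}"
    by (rule bounded_subset[OF compact_imp_bounded[OF assms(2)]]) (auto simp: indicator_def)
  moreover have "(\<lambda>x. indicator K x *\<^sub>R f x) \<in> borel_measurable borel"
    by (rule borel_measurable_continuous_on_indicator[OF borel_closed[OF compact_imp_closed[OF assms(2)]] assms(1)])
  ultimately show ?thesis unfolding bounded_supported_def by blast
qed

lemma bounded_supported_translate:
  fixes f :: "'a::euclidean_space \<Rightarrow> 'b::real_normed_vector"
  assumes "bounded_supported f"
  shows "bounded_supported (\<lambda>x. f (x + a))"
proof -
  have "bounded (range (\<lambda>x. f (x + a)))"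
    using assms unfolding bounded_supported_def by (blast intro: bounded_subset)
  moreover have "{x. f (x + a) \<noteq> 0} = (\<lambda>x. - a + x) ` {x. f x \<noteq> 0}" by (auto simp: image_iff algebra_simps)
  then have "bounded {x. f (x + a) \<noteq> 0}"
    using assms bounded_translation[of "{x. f x \<noteq> 0}" "- a"] by (simp add: bounded_supported_def)
  moreover have "(\<lambda>x. f (x + a)) \<in> borel_measurable borel"
    using bounded_supported_measurable[OF assms] by measurable
  ultimately show ?thesis unfolding bounded_supported_def by blast
qed

lemma bounded_supported_mult_bounded:
  fixes f g :: "'a::euclidean_space \<Rightarrow> 'b::{real_normed_algebra, second_countable_topology}"
  assumes "bounded_supported f" "g \<in> borel_measurable borel" "bounded (range g)"
  shows "bounded_supported (\<lambda>x. f x * g x)"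
proof -
  obtain M where M: "M \<ge> 0" "\<And>x. norm (f x) \<le> M" by (rule bounded_supported_bound[OF assms(1)]) (rule that)
  obtain N where N: "\<And>x. norm (g x) \<le> N" using assms(3) by (auto simp: bounded_iff)
  have "norm (f x * g x) \<le> M * N" for x
    using M N by (intro order_trans[OF norm_mult_ineq] mult_mono) auto
  then have "bounded (range (\<lambda>x. f x * g x))" by (auto simp: bounded_iff)
  moreover have "bounded {x. f x * g x \<noteq> 0}"
    by (rule bounded_subset[of "{x. f x \<noteq> 0}"]) (use assms(1) in \<open>auto simp: bounded_supported_def\<close>)
  moreover have "(\<lambda>x. f x * g x) \<in> borel_measurable borel"
    using bounded_supported_measurable[OF assms(1)] assms(2) by measurable
  ultimately show ?thesis unfolding bounded_supported_def by blast
qed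

lemma bounded_supported_mult:
  fixes f g :: "'a::euclidean_space \<Rightarrow> 'b::{real_normed_algebra, second_countable_topology}"
  assumes "bounded_supported f" "bounded_supported g"
  shows "bounded_supported (\<lambda>x. f x * g x)"
  using bounded_supported_mult_bounded[OF assms(1)] assms(2) by (auto simp: bounded_supported_def)

lemma bounded_supported_add:
  fixes f g :: "'a::euclidean_space \<Rightarrow> 'b::{real_normed_vector, second_countable_topology}"
  assumes "bounded_supported f" "bounded_supported g"
  shows "bounded_supported (\<lambda>x. f x + g x)"
proof -
  have "bounded (range (\<lambda>x. f x + g x))"
    using bounded_plus_comp[of f UNIV g] assms by (simp add: bounded_supported_def)
  moreover have "bounded {x. f x + g x \<noteq> 0}"
    by (rule bounded_subset[of "{x. f x \<noteq> 0} \<union> {x. g x \<noteq> 0}"]) (use assms in \<open>auto simp: bounded_supported_def\<close>)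
  moreover have "(\<lambda>x. f x + g x) \<in> borel_measurable borel"
    using assms[THEN bounded_supported_measurable] by measurable
  ultimately show ?thesis unfolding bounded_supported_def by blast
qed

lemma bounded_supported_linear:
  assumes "bounded_linear L" "bounded_supported f"
  shows "bounded_supported (\<lambda>x. L (f x))"
proof -
  have "(\<lambda>x. L (f x)) \<in> borel_measurable borel"
    using measurable_compose[OF bounded_supported_measurable[OF assms(2)]]
      borel_measurable_continuous_onI[OF linear_continuous_on[OF assms(1)]] by blast
  moreover have "bounded (range (\<lambda>x. L (f x)))"
    using bounded_linear_image[OF _ assms(1), of "range f"] assms(2) by (simp add: bounded_supported_def image_image)
  moreover have "bounded {x. L (f x) \<noteq> 0}"
    by (rule bounded_subset[of "{x. f x \<noteq> 0}"])
       (use assms(2) linear_0[OF bounded_linear.linear[OF assms(1)]] in \<open>auto simp: bounded_supported_def\<close>)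
  ultimately show ?thesis unfolding bounded_supported_def by blast
qed

lemma integral_lborel_translate:
  fixes f :: "'a::euclidean_space \<Rightarrow> 'b::{banach, second_countable_topology}"
  assumes "f \<in> borel_measurable borel"
  shows "(LINT x|lborel. f (x + a)) = (LINT x|lborel. f x)"
proof -
  have "(LINT x|lborel. f x) = (LINT x|distr lborel borel ((+) a). f x)"
    by (simp add: lborel_distr_plus)
  also have "\<dots> = (LINT x|lborel. f (a + x))" using assms by (subst integral_distr) auto
  finally show ?thesis by (simp add: add.commute)
qed

lemma bounded_convergence_compact_support:
  fixes f :: "'a::euclidean_space \<Rightarrow> 'b::{banach, second_countable_topology}"
  assumes "\<And>n. s n \<in> borel_measurable borel" "\<And>n x. norm (s n x) \<le> M"
    and "compact K" "\<And>n x. x \<notin> K \<Longrightarrow> s n x = 0" and lim: "\<And>x. (\<lambda>n. s n x) \<longlonglongrightarrow> f x"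
  shows "(\<lambda>n. LINT x|lborel. s n x) \<longlonglongrightarrow> (LINT x|lborel. f x)"
proof (rule integral_dominated_convergence[where w="\<lambda>x. indicator K x *\<^sub>R M"])
  show "f \<in> borel_measurable lborel"
    using borel_measurable_LIMSEQ_metric[of s borel f] assms(1) lim by simp
  show "integrable lborel (\<lambda>x. indicator K x *\<^sub>R M)"
    by (rule borel_integrable_compact) (use assms in auto)
  show "AE x in lborel. norm (s n x) \<le> indicator K x *\<^sub>R M" for n
    using assms(2,4) by (auto simp: indicator_def)
qed (use assms in auto)

section \<open>The difference Laplacian\<close>

definition difference_laplacian ::
    "real \<Rightarrow> (real^'n \<Rightarrow> 'a::real_normed_vector) \<Rightarrow> real^'n \<Rightarrow> 'a" where
  "difference_laplacian h f x
     = (\<Sum>i\<in>UNIV. f (x + h *\<^sub>R axis i 1) + f (x - h *\<^sub>R axis i 1) - 2 *\<^sub>R f x) /\<^sub>R h\<^sup>2"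

lemma measurable_difference_laplacian:
  fixes f :: "real^'n \<Rightarrow> 'a::{real_normed_vector, second_countable_topology}"
  assumes [measurable]: "f \<in> borel_measurable borel"
  shows "difference_laplacian h f \<in> borel_measurable borel"
  unfolding difference_laplacian_def by measurable

lemma norm_difference_laplacian_le:
  fixes f :: "real^'n \<Rightarrow> 'a::real_normed_vector"
  assumes "\<And>i. norm (f (x + h *\<^sub>R axis i 1) + f (x - h *\<^sub>R axis i 1) - 2 *\<^sub>R f x) \<le> B i * h\<^sup>2" "h \<noteq> 0"
  shows "norm (difference_laplacian h f x) \<le> (\<Sum>i\<in>UNIV. B i)"
proof -
  have "norm (\<Sum>i\<in>UNIV. f (x + h *\<^sub>R axis i 1) + f (x - h *\<^sub>R axis i 1) - 2 *\<^sub>R f x) \<le> (\<Sum>i\<in>UNIV. B i * h\<^sup>2)"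
    by (rule order_trans[OF norm_sum sum_mono[OF assms(1)]])
  then have "norm (difference_laplacian h f x) \<le> (\<Sum>i\<in>UNIV. B i * h\<^sup>2) / h\<^sup>2"
    by (simp add: difference_laplacian_def divide_inverse_commute mult_left_mono)
  then show ?thesis using \<open>h \<noteq> 0\<close> by (simp flip: sum_distrib_right)
qed

lemma bounded_supported_difference_laplacian:
  fixes f :: "real^'n \<Rightarrow> 'a::{real_normed_vector, second_countable_topology}"
  assumes "bounded_supported f"
  shows "bounded_supported (difference_laplacian h f)"
proof -
  have shift: "bounded_supported (\<lambda>x. f (x + h *\<^sub>R axis i 1) + f (x - h *\<^sub>R axis i 1) - 2 *\<^sub>R f x)" for i
  proof -
    have "bounded_supported (\<lambda>x. (f (x + h *\<^sub>R axis i 1) + f (x + - (h *\<^sub>R axis i 1))) + (- 2) *\<^sub>R f x)"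
      by (intro bounded_supported_add bounded_supported_translate bounded_supported_linear[OF bounded_linear_scaleR_right] assms)
    then show ?thesis by simp
  qed
  have "bounded_supported (\<lambda>x. \<Sum>i\<in>I. f (x + h *\<^sub>R axis i 1) + f (x - h *\<^sub>R axis i 1) - 2 *\<^sub>R f x)"
    if "finite I" for I
    using that
    by induction (use bounded_supported_add[OF shift] in \<open>auto simp: bounded_supported_def\<close>)
  from bounded_supported_linear[OF bounded_linear_scaleR_right this[of UNIV]]
  show ?thesis by (simp add: difference_laplacian_def[abs_def])
qed

lemma integral_difference_laplacian_by_parts:
  fixes f v :: "real^'n \<Rightarrow> 'a::{real_normed_field, banach, second_countable_topology}"
  assumes "bounded_supported v" "bounded_supported f"
  shows "(LINT x|lborel. v x * difference_laplacian h f x) = (LINT x|lborel. difference_laplacian h v x * f x)"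
proof -
  have translate: "(LINT x|lborel. v x * f (x + a)) = (LINT x|lborel. v (x - a) * f x)" for a
  proof -
    have "bounded_supported (\<lambda>x. v (x + (- a)) * f x)"
      by (intro bounded_supported_mult bounded_supported_translate assms)
    then have "(\<lambda>x. v (x - a) * f x) \<in> borel_measurable borel" by (simp add: bounded_supported_def)
    from integral_lborel_translate[OF this, of a] show ?thesis by simp
  qed
  have "integrable lborel (\<lambda>x. v (x + a) * f (x + b))" for a b
    by (intro bounded_supported_integrable bounded_supported_mult bounded_supported_translate assms)
  from this[of 0] this[of _ 0] this[of 0 "- _"] this[of "- _" 0] this[of 0 0]
  have integrables: "integrable lborel (\<lambda>x. v x * f (x + a))" "integrable lborel (\<lambda>x. v (x + a) * f x)"
    "integrable lborel (\<lambda>x. v x * f (x - a))" "integrable lborel (\<lambda>x. v (x - a) * f x)"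
    "integrable lborel (\<lambda>x. v x * f x)" for a by simp_all
  have "(LINT x|lborel. v x * difference_laplacian h f x) = (LINT x|lborel. (\<Sum>i\<in>UNIV.
     v x * f (x + h *\<^sub>R axis i 1) + v x * f (x - h *\<^sub>R axis i 1) - 2 * (v x * f x)) * of_real (inverse (h\<^sup>2)))"
    by (rule Bochner_Integration.integral_cong)
       (auto simp: difference_laplacian_def scaleR_conv_of_real sum_distrib_left sum_distrib_right algebra_simps intro!: sum.cong)
  also have "\<dots> = (\<Sum>i\<in>UNIV. (LINT x|lborel. v x * f (x + h *\<^sub>R axis i 1)) +
     (LINT x|lborel. v x * f (x - h *\<^sub>R axis i 1)) - 2 * (LINT x|lborel. v x * f x)) * of_real (inverse (h\<^sup>2))"
    by (simp add: integrables)
  also have "\<dots> = (\<Sum>i\<in>UNIV. (LINT x|lborel. v (x + h *\<^sub>R axis i 1) * f x) +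
     (LINT x|lborel. v (x - h *\<^sub>R axis i 1) * f x) - 2 * (LINT x|lborel. v x * f x)) * of_real (inverse (h\<^sup>2))"
    using translate[of "h *\<^sub>R axis _ 1"] translate[of "- (h *\<^sub>R axis _ 1)"] by (simp add: add.commute)
  also have "\<dots> = (LINT x|lborel. (\<Sum>i\<in>UNIV.
     v (x + h *\<^sub>R axis i 1) * f x + v (x - h *\<^sub>R axis i 1) * f x - 2 * (v x * f x)) * of_real (inverse (h\<^sup>2)))"
    by (simp add: integrables)
  also have "\<dots> = (LINT x|lborel. difference_laplacian h v x * f x)"
    by (rule Bochner_Integration.integral_cong)
       (auto simp: difference_laplacian_def scaleR_conv_of_real sum_distrib_left sum_distrib_right algebra_simps intro!: sum.cong)
  finally show ?thesis .
qed

lemma difference_laplacian_tendsto: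
  fixes u :: "real^'n \<Rightarrow> 'a::real_normed_vector"
  assumes partials: "has_second_partials S u G H" and "open S" "x \<in> S" "h \<longlonglongrightarrow> 0" "\<And>n. h n > (0::real)"
  shows "(\<lambda>n. difference_laplacian (h n) u x) \<longlonglongrightarrow> (\<Sum>i\<in>UNIV. H i x)"
proof -
  obtain e where "e > 0" and line: "\<And>t i. \<bar>t\<bar> < e \<Longrightarrow> x + t *\<^sub>R axis i 1 \<in> S"
    using segment_axis_subset_open[OF assms(2,3)] by metis
  have "(\<lambda>n. (u (x + h n *\<^sub>R axis i 1) + u (x - h n *\<^sub>R axis i 1) - 2 *\<^sub>R u x) /\<^sub>R (h n)\<^sup>2) \<longlonglongrightarrow> H i x" for i
  proof -
    have "((\<lambda>t. (u (x + t *\<^sub>R axis i 1) + u (x + (-t) *\<^sub>R axis i 1) - 2 *\<^sub>R u (x + 0 *\<^sub>R axis i 1)) /\<^sub>R t\<^sup>2) \<longlongrightarrow> H i x) (at 0)"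
    proof (rule second_difference_tendsto[OF \<open>e > 0\<close>])
      show "((\<lambda>t. u (x + t *\<^sub>R axis i 1)) has_vector_derivative G i (x + t *\<^sub>R axis i 1)) (at t)"
        if "\<bar>t\<bar> < e" for t using has_second_partials_first[OF partials line[OF that]] .
      show "((\<lambda>t. G i (x + t *\<^sub>R axis i 1)) has_vector_derivative H i x) (at 0)"
        using partials assms(3) by (auto simp: has_second_partials_def)
    qed
    from this[unfolded tendsto_at_iff_sequentially, rule_format, of h] assms(4,5)
    show ?thesis by (simp add: o_def less_imp_neq[symmetric])
  qed
  then show ?thesis unfolding difference_laplacian_def scaleR_sum_right by (intro tendsto_sum)
qed

lemma compact_neighbourhood_in_open:
  fixes K :: "'a::euclidean_space set"
  assumes "compact K" "open S" "K \<subseteq> S"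
  obtains e K' where "e > 0" "compact K'" "K' \<subseteq> S" "\<And>x. x \<in> K \<Longrightarrow> cball x e \<subseteq> K'"
proof -
  obtain e where e: "e > 0" "(\<Union>x\<in>K. cball x e) \<subseteq> S"
    using compact_subset_open_imp_cball_epsilon_subset[OF assms] by blast
  define K' where "K' = {x + y |x y. x \<in> K \<and> y \<in> cball 0 e}"
  show ?thesis
  proof (rule that[OF \<open>e > 0\<close>])
    show "compact K'" unfolding K'_def by (rule compact_sums[OF assms(1) compact_cball])
    show "K' \<subseteq> S" using e(2) by (force simp: K'_def dist_norm)
    show "cball x e \<subseteq> K'" if "x \<in> K" for x
    proof
      fix z assume "z \<in> cball x e"
      then show "z \<in> K'" unfolding K'_def using that
        by (intro CollectI exI[of _ x] exI[of _ "z - x"]) (auto simp: dist_norm norm_minus_commute)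
    qed
  qed
qed

lemma helmholtz_difference_laplacian_bound:
  fixes u :: "real^'n \<Rightarrow> complex"
  assumes u: "classical_helmholtz k S u" and "open S" "compact K" "K \<subseteq> S"
  obtains d C K' where "d > 0" "compact K'" "K \<subseteq> K'" "K' \<subseteq> S"
    "\<And>x h i. x \<in> K \<Longrightarrow> \<bar>h\<bar> \<le> d \<Longrightarrow> x + h *\<^sub>R axis i 1 \<in> K'"
    "\<And>x h. x \<in> K \<Longrightarrow> 0 < h \<Longrightarrow> h \<le> d \<Longrightarrow> norm (difference_laplacian h u x) \<le> C"
proof -
  obtain e K' where "e > 0" "compact K'" "K' \<subseteq> S" and K': "\<And>x. x \<in> K \<Longrightarrow> cball x e \<subseteq> K'"
    by (rule compact_neighbourhood_in_open[OF assms(3,2,4)]) (rule that)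
  define n where "n = real CARD('n)"
  have "n \<ge> 1" by (simp add: n_def Suc_le_eq)
  define d where "d = e / (2 * n)"
  have "d > 0" "d \<le> e" using \<open>e > 0\<close> \<open>n \<ge> 1\<close> by (auto simp: d_def field_simps)
  have "bounded (u ` K')" using u \<open>compact K'\<close> \<open>K' \<subseteq> S\<close>
    by (intro compact_imp_bounded compact_continuous_image) (auto simp: classical_helmholtz_def intro: continuous_on_subset)
  then obtain M where M: "M > 0" "\<And>x. x \<in> K' \<Longrightarrow> norm (u x) \<le> M" by (force simp: bounded_pos)
  define B where "B = (2 * n / d + (k\<^sup>2 + 1) * d)\<^sup>2 * M"
  have cube_K': "cube x (2 * d) \<subseteq> K'" if "x \<in> K" for x
  proof -
    have "cube x (2 * d) \<subseteq> cball x (n * (2 * d))" unfolding n_def by (rule cube_subset_cball)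
    also have "\<dots> = cball x e" using \<open>n \<ge> 1\<close> by (simp add: d_def)
    finally show ?thesis using K'[OF that] by simp
  qed
  show ?thesis
  proof (rule that[OF \<open>d > 0\<close> \<open>compact K'\<close> _ \<open>K' \<subseteq> S\<close>, of "\<Sum>i\<in>(UNIV::'n set). B"])
    show "K \<subseteq> K'" using K' \<open>e > 0\<close> by force
    show "x + h *\<^sub>R axis i 1 \<in> K'" if "x \<in> K" "\<bar>h\<bar> \<le> d" for x h i
      using that \<open>d \<le> e\<close> by (intro subsetD[OF K']) (auto simp: dist_norm norm_axis_1)
    show "norm (difference_laplacian h u x) \<le> (\<Sum>i\<in>(UNIV::'n set). B)" if "x \<in> K" "0 < h" "h \<le> d" for x h
    proof (rule norm_difference_laplacian_le[where B="\<lambda>_. B"])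
      show "norm (u (x + h *\<^sub>R axis i 1) + u (x - h *\<^sub>R axis i 1) - 2 *\<^sub>R u x) \<le> B * h\<^sup>2" for i
        unfolding B_def n_def
        by (rule helmholtz_second_difference_bound[OF \<open>d > 0\<close> classical_helmholtz_subset[OF u] M(1)])
           (use cube_K'[OF \<open>x \<in> K\<close>] \<open>K' \<subseteq> S\<close> M(2) that in auto)
    qed (use that in auto)
  qed
qed

section \<open>Weak solutions\<close>

definition has_C2_partials ::
    "(real^'n \<Rightarrow> 'a::real_normed_vector) \<Rightarrow> ('n \<Rightarrow> real^'n \<Rightarrow> 'a) \<Rightarrow> ('n \<Rightarrow> real^'n \<Rightarrow> 'a) \<Rightarrow> bool" where
  "has_C2_partials \<phi> G H \<longleftrightarrow> has_second_partials UNIV \<phi> G H \<and> continuous_on UNIV \<phi> \<and>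
     (\<forall>i. continuous_on UNIV (G i)) \<and> (\<forall>i. continuous_on UNIV (H i))"

lemma has_C2_partials_continuous:
  assumes "has_C2_partials \<phi> G H"
  shows "continuous_on A \<phi>" "continuous_on A (G i)" "continuous_on A (H i)"
  using assms unfolding has_C2_partials_def by (auto intro: continuous_on_subset)

lemma has_second_partials_zero_outside:
  assumes "has_second_partials UNIV \<phi> G H" "closed K" "\<And>x. x \<notin> K \<Longrightarrow> \<phi> x = 0" "x \<notin> K"
  shows "G i x = 0" "H i x = 0"
proof -
  have "has_second_partials (- K) (\<lambda>x. 0) (\<lambda>i x. 0) (\<lambda>i x. 0)" by (auto simp: has_second_partials_def)
  then have "has_second_partials (- K) \<phi> (\<lambda>i x. 0) (\<lambda>i x. 0)"
    by (rule has_second_partials_cong[rotated]) (use assms(2,3) in auto)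
  from has_second_partials_unique[OF _ has_second_partials_subset[OF assms(1)] this, of x i] assms(2,4)
  show "G i x = 0" "H i x = 0" by auto
qed

lemma has_C2_partials_bounded_supported:
  assumes "has_C2_partials \<phi> G H" "compact K" "\<And>x. x \<notin> K \<Longrightarrow> \<phi> x = 0"
  shows "bounded_supported \<phi>" "bounded_supported (G i)" "bounded_supported (H i)"
    "bounded_supported (\<lambda>x. \<Sum>i\<in>UNIV. H i x)"
proof -
  have zero: "G i x = 0" "H i x = 0" if "x \<notin> K" for i x
    using has_second_partials_zero_outside[of \<phi> G H K x i] assms that by (auto simp: has_C2_partials_def compact_imp_closed)
  note continuous = has_C2_partials_continuous[OF assms(1)]
  show "bounded_supported \<phi>" "bounded_supported (G i)" "bounded_supported (H i)"
    "bounded_supported (\<lambda>x. \<Sum>i\<in>UNIV. H i x)"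
    by (rule bounded_supported_continuous[OF _ assms(2)];
        use zero assms(3) in \<open>auto intro!: continuous_intros continuous\<close>)+
qed

definition weak_helmholtz :: "real \<Rightarrow> (real^'n) set \<Rightarrow> (real^'n \<Rightarrow> complex) \<Rightarrow> bool" where
  "weak_helmholtz k S u \<longleftrightarrow> continuous_on S u \<and>
     (\<forall>K \<phi> G H. compact K \<longrightarrow> K \<subseteq> S \<longrightarrow> has_C2_partials \<phi> G H \<longrightarrow> (\<forall>x. x \<notin> K \<longrightarrow> \<phi> x = 0) \<longrightarrow>
        (LINT x:K|lborel. u x * ((\<Sum>i\<in>UNIV. H i x) + complex_of_real (k\<^sup>2) * \<phi> x)) = 0)"

lemma integral_difference_laplacian_test_tendsto:
  fixes \<phi> v :: "real^'n \<Rightarrow> 'a::{real_normed_field, banach, second_countable_topology}"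
  assumes \<phi>: "has_C2_partials \<phi> G H" "compact K" "\<And>x. x \<notin> K \<Longrightarrow> \<phi> x = 0" and v: "bounded_supported v"
    and h: "h \<longlonglongrightarrow> 0" "\<And>n. h n > (0::real)"
  shows "(\<lambda>n. LINT x|lborel. v x * difference_laplacian (h n) \<phi> x) \<longlonglongrightarrow> (LINT x|lborel. v x * (\<Sum>i\<in>UNIV. H i x))"
proof -
  have partials: "has_second_partials UNIV \<phi> G H" using \<phi>(1) by (simp add: has_C2_partials_def)
  have "\<forall>i. \<exists>B. \<forall>x. norm (H i x) \<le> B"
    using has_C2_partials_bounded_supported(3)[OF \<phi>] by (auto simp: bounded_supported_def bounded_iff)
  then obtain B where B: "\<And>i x. norm (H i x) \<le> B i" by metis
  have bound: "norm (difference_laplacian t \<phi> x) \<le> (\<Sum>i\<in>UNIV. 2 * B i)" if "t > 0" for t x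
  proof (rule norm_difference_laplacian_le[where B="\<lambda>i. 2 * B i"])
    show "norm (\<phi> (x + t *\<^sub>R axis i 1) + \<phi> (x - t *\<^sub>R axis i 1) - 2 *\<^sub>R \<phi> x) \<le> 2 * B i * t\<^sup>2" for i
      using second_difference_bound[where f="\<lambda>t. \<phi> (x + t *\<^sub>R axis i 1)" and h=t,
          OF has_second_partials_first[OF partials UNIV_I] has_second_partials_second[OF partials UNIV_I] B] by simp
  qed (use that in simp)
  obtain M where M: "M \<ge> 0" "\<And>x. norm (v x) \<le> M" by (rule bounded_supported_bound[OF v]) (rule that)
  obtain R where R: "\<And>x. x \<notin> cball 0 R \<Longrightarrow> v x = 0" by (rule bounded_supported_support[OF v]) (rule that)
  show ?thesis
  proof (rule bounded_convergence_compact_support[where K="cball 0 R" and M="M * (\<Sum>i\<in>UNIV. 2 * B i)"])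
    show "(\<lambda>x. v x * difference_laplacian (h n) \<phi> x) \<in> borel_measurable borel" for n
      using bounded_supported_measurable[OF v]
        measurable_difference_laplacian[OF borel_measurable_continuous_onI[OF has_C2_partials_continuous(1)[OF \<phi>(1)]], of "h n"]
      by measurable
    show "norm (v x * difference_laplacian (h n) \<phi> x) \<le> M * (\<Sum>i\<in>UNIV. 2 * B i)" for n x
      unfolding norm_mult by (intro mult_mono M bound h(2)) auto
    show "(\<lambda>n. v x * difference_laplacian (h n) \<phi> x) \<longlonglongrightarrow> v x * (\<Sum>i\<in>UNIV. H i x)" for x
      by (intro tendsto_mult tendsto_const difference_laplacian_tendsto[OF partials] h) auto
  qed (use R in auto)
qed

lemma integral_difference_laplacian_helmholtz_tendsto:
  fixes u \<phi> :: "real^'n \<Rightarrow> complex"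
  assumes u: "classical_helmholtz k S u" and "open S" "compact K" "K \<subseteq> S"
    and \<phi>: "bounded_supported \<phi>" "\<And>x. x \<notin> K \<Longrightarrow> \<phi> x = 0"
    and h: "h \<longlonglongrightarrow> 0" "\<And>n. h n > 0"
    and v: "v \<in> borel_measurable borel" "\<And>x. x \<in> K \<Longrightarrow> v x = u x"
      "\<And>x n. x \<in> K \<Longrightarrow> difference_laplacian (h n) v x = difference_laplacian (h n) u x"
    and C: "\<And>x n. x \<in> K \<Longrightarrow> norm (difference_laplacian (h n) u x) \<le> C"
  shows "(\<lambda>n. LINT x|lborel. difference_laplacian (h n) v x * \<phi> x)
    \<longlonglongrightarrow> (LINT x|lborel. - (complex_of_real (k\<^sup>2) * v x) * \<phi> x)"
proof -
  obtain G H where partials: "has_second_partials S u G H"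
    and laplacian_eq: "\<And>x. x \<in> S \<Longrightarrow> (\<Sum>i\<in>UNIV. H i x) = - (complex_of_real (k\<^sup>2) * u x)"
    by (rule classical_helmholtzE[OF u]) (rule that)
  obtain M where M: "M \<ge> 0" "\<And>x. norm (\<phi> x) \<le> M" by (rule bounded_supported_bound[OF \<phi>(1)]) (rule that)
  show ?thesis
  proof (rule bounded_convergence_compact_support[where K=K and M="\<bar>C\<bar> * M"])
    show "(\<lambda>x. difference_laplacian (h n) v x * \<phi> x) \<in> borel_measurable borel" for n
      using measurable_difference_laplacian[OF v(1), of "h n"] bounded_supported_measurable[OF \<phi>(1)] by measurable
    show "norm (difference_laplacian (h n) v x * \<phi> x) \<le> \<bar>C\<bar> * M" for n x
    proof (cases "x \<in> K")
      case True
      then have "norm (difference_laplacian (h n) v x) \<le> \<bar>C\<bar>" using v(3) C by (metis abs_ge_self order_trans)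
      then show ?thesis unfolding norm_mult using M by (intro mult_mono) auto
    qed (use \<phi>(2) M(1) in simp)
    show "(\<lambda>n. difference_laplacian (h n) v x * \<phi> x) \<longlonglongrightarrow> - (complex_of_real (k\<^sup>2) * v x) * \<phi> x" for x
    proof (cases "x \<in> K")
      case True
      then have "x \<in> S" using \<open>K \<subseteq> S\<close> by blast
      from difference_laplacian_tendsto[OF partials \<open>open S\<close> this h]
      have "(\<lambda>n. difference_laplacian (h n) v x) \<longlonglongrightarrow> - (complex_of_real (k\<^sup>2) * v x)"
        unfolding laplacian_eq[OF \<open>x \<in> S\<close>] v(2,3)[OF True] .
      then show ?thesis by (intro tendsto_mult tendsto_const)
    qed (use \<phi>(2) in auto)
  qed (use \<phi>(2) \<open>compact K\<close> in auto)
qed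

lemma weak_form_eq:
  fixes u \<phi> :: "real^'n \<Rightarrow> complex"
  assumes \<phi>: "has_C2_partials \<phi> G H" "compact K" "\<And>x. x \<notin> K \<Longrightarrow> \<phi> x = 0" and v: "bounded_supported v" "\<And>x. x \<in> K \<Longrightarrow> v x = u x"
  shows "(LINT x:K|lborel. u x * ((\<Sum>i\<in>UNIV. H i x) + c * \<phi> x))
    = (LINT x|lborel. v x * (\<Sum>i\<in>UNIV. H i x)) + c * (LINT x|lborel. v x * \<phi> x)"
proof -
  have supported: "bounded_supported \<phi>" "bounded_supported (\<lambda>x. \<Sum>i\<in>UNIV. H i x)"
    using has_C2_partials_bounded_supported[OF \<phi>(1,2)] \<phi>(3) by auto
  have "(LINT x:K|lborel. u x * ((\<Sum>i\<in>UNIV. H i x) + c * \<phi> x)) = (LINT x|lborel. v x * (\<Sum>i\<in>UNIV. H i x) + c * (v x * \<phi> x))"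
    unfolding set_lebesgue_integral_def
  proof (rule Bochner_Integration.integral_cong)
    have "has_second_partials UNIV \<phi> G H" using \<phi>(1) by (simp add: has_C2_partials_def)
    from has_second_partials_zero_outside(2)[OF this compact_imp_closed[OF \<phi>(2)] \<phi>(3)]
    show "indicator K x *\<^sub>R (u x * ((\<Sum>i\<in>UNIV. H i x) + c * \<phi> x)) = v x * (\<Sum>i\<in>UNIV. H i x) + c * (v x * \<phi> x)" for x
      using \<phi>(3) v(2) by (cases "x \<in> K") (auto simp: algebra_simps)
  qed simp
  also have "\<dots> = (LINT x|lborel. v x * (\<Sum>i\<in>UNIV. H i x)) + (LINT x|lborel. c * (v x * \<phi> x))"
    by (intro Bochner_Integration.integral_add integrable_mult_right bounded_supported_integrable bounded_supported_mult v supported)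
  finally show ?thesis by simp
qed

theorem classical_helmholtz_imp_weak:
  fixes u :: "real^'n \<Rightarrow> complex"
  assumes u: "classical_helmholtz k S u" and "open S"
  shows "weak_helmholtz k S u"
  unfolding weak_helmholtz_def
proof (intro conjI allI impI)
  show cont: "continuous_on S u" using u by (simp add: classical_helmholtz_def)
  fix K and \<phi> :: "real^'n \<Rightarrow> complex" and G H
  assume K: "compact K" "K \<subseteq> S" and \<phi>: "has_C2_partials \<phi> G H" and "\<forall>x. x \<notin> K \<longrightarrow> \<phi> x = 0"
  then have zero: "\<phi> x = 0" if "x \<notin> K" for x using that by blast
  have supported: "bounded_supported \<phi>" by (rule has_C2_partials_bounded_supported(1)[OF \<phi> K(1)]) (rule zero)
  obtain d C K' where "d > 0" and K': "compact K'" "K \<subseteq> K'" "K' \<subseteq> S"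
    "\<And>x h i. x \<in> K \<Longrightarrow> \<bar>h\<bar> \<le> d \<Longrightarrow> x + h *\<^sub>R axis i 1 \<in> K'"
    and C: "\<And>x h. x \<in> K \<Longrightarrow> 0 < h \<Longrightarrow> h \<le> d \<Longrightarrow> norm (difference_laplacian h u x) \<le> C"
    using helmholtz_difference_laplacian_bound[OF u \<open>open S\<close> K] by metis
  define v where "v x = indicator K' x *\<^sub>R u x" for x
  have v: "bounded_supported v"
    unfolding v_def using K' cont by (intro bounded_supported_indicator) (auto intro: continuous_on_subset)
  define h where "h n = d / real (Suc n)" for n
  have h: "h \<longlonglongrightarrow> 0" unfolding h_def divide_inverse
    by (rule tendsto_eq_rhs[OF tendsto_mult[OF tendsto_const LIMSEQ_inverse_real_of_nat]]) simp
  have h_pos: "h n > 0" "h n \<le> d" for n using \<open>d > 0\<close> by (auto simp: h_def field_simps)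
  have "difference_laplacian (h n) v x = difference_laplacian (h n) u x" if "x \<in> K" for x n
    using K'(4)[OF that, of "h n"] K'(4)[OF that, of "- h n"] K'(2) that h_pos[of n]
    by (auto simp: difference_laplacian_def v_def indicator_def)
  then have "(\<lambda>n. LINT x|lborel. difference_laplacian (h n) v x * \<phi> x)
      \<longlonglongrightarrow> (LINT x|lborel. - (complex_of_real (k\<^sup>2) * v x) * \<phi> x)"
    by (intro integral_difference_laplacian_helmholtz_tendsto[where C=C, OF u \<open>open S\<close> K supported zero h h_pos(1)
          bounded_supported_measurable[OF v]])
       (use K'(2) C h_pos in \<open>auto simp: v_def indicator_def\<close>)
  moreover have "(\<lambda>n. LINT x|lborel. difference_laplacian (h n) v x * \<phi> x) \<longlonglongrightarrow> (LINT x|lborel. v x * (\<Sum>i\<in>UNIV. H i x))"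
    unfolding integral_difference_laplacian_by_parts[OF v supported, symmetric]
    by (rule integral_difference_laplacian_test_tendsto[OF \<phi> K(1) _ v h h_pos(1)]) (rule zero)
  ultimately have "(LINT x|lborel. v x * (\<Sum>i\<in>UNIV. H i x)) = (LINT x|lborel. - (complex_of_real (k\<^sup>2) * v x) * \<phi> x)"
    by (rule LIMSEQ_unique[rotated])
  also have "\<dots> = - (complex_of_real (k\<^sup>2) * (LINT x|lborel. v x * \<phi> x))"
    by (simp add: mult.assoc)
  finally have "(LINT x|lborel. v x * (\<Sum>i\<in>UNIV. H i x)) + complex_of_real (k\<^sup>2) * (LINT x|lborel. v x * \<phi> x) = 0" by simp
  moreover have "v x = u x" if "x \<in> K" for x using K'(2) that by (auto simp: v_def)
  ultimately show "(LINT x:K|lborel. u x * ((\<Sum>i\<in>UNIV. H i x) + complex_of_real (k\<^sup>2) * \<phi> x)) = 0"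
    using weak_form_eq[OF \<phi> K(1) zero v] by simp
qed

lemma has_C2_partials_diff:
  assumes "has_C2_partials f G H" "has_C2_partials g G' H'"
  shows "has_C2_partials (\<lambda>x. f x - g x) (\<lambda>i x. G i x - G' i x) (\<lambda>i x. H i x - H' i x)"
  using assms unfolding has_C2_partials_def by (auto intro!: continuous_intros has_second_partials_diff)

lemma has_C2_partials_mult:
  fixes f g :: "real^'n \<Rightarrow> 'a::real_normed_field"
  assumes "has_C2_partials f G H" "has_C2_partials g G' H'"
  shows "has_C2_partials (\<lambda>x. f x * g x) (\<lambda>i x. f x * G' i x + G i x * g x)
     (\<lambda>i x. f x * H' i x + 2 * (G i x * G' i x) + H i x * g x)"
  using assms unfolding has_C2_partials_def by (auto intro!: continuous_intros has_second_partials_mult)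

lemma has_C2_partials_mirror:
  fixes f :: "real^'n \<Rightarrow> 'a::real_normed_vector"
  assumes "has_C2_partials f G H"
  shows "has_C2_partials (\<lambda>x. f (mirror j y x)) (\<lambda>i x. (if i = j then -1 else 1) *\<^sub>R G i (mirror j y x))
           (\<lambda>i x. H i (mirror j y x))"
proof -
  have compose: "continuous_on UNIV (\<lambda>x. h (mirror j y x))" if "continuous_on UNIV h" for h :: "real^'n \<Rightarrow> 'a"
    using continuous_on_compose2[OF that continuous_on_mirror] by auto
  show ?thesis
    using assms unfolding has_C2_partials_def
    by (intro conjI allI has_second_partials_mirror[of UNIV] compose continuous_on_scaleR continuous_on_const) auto
qed

lemma has_C2_partials_compose:
  fixes Q :: "real^'n \<Rightarrow> real" and f :: "real \<Rightarrow> 'a::real_normed_vector"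
  assumes Q: "has_C2_partials Q G H" "\<And>x. Q x \<ge> 0"
    and f: "\<And>q. q \<ge> 0 \<Longrightarrow> (f has_vector_derivative f' q) (at q)"
    and f': "\<And>q. q \<ge> 0 \<Longrightarrow> (f' has_vector_derivative f'' q) (at q)"
    and f'': "continuous_on {0..} f''"
  shows "has_C2_partials (\<lambda>x. f (Q x)) (\<lambda>i x. G i x *\<^sub>R f' (Q x))
    (\<lambda>i x. (G i x)\<^sup>2 *\<^sub>R f'' (Q x) + H i x *\<^sub>R f' (Q x))"
proof -
  have "continuous_on {0..} f" "continuous_on {0..} f'"
    using f f' by (auto intro!: continuous_at_imp_continuous_on has_vector_derivative_continuous)
  then have "continuous_on UNIV (\<lambda>x. f (Q x))" "continuous_on UNIV (\<lambda>x. f' (Q x))" "continuous_on UNIV (\<lambda>x. f'' (Q x))"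
    using f'' Q by (auto intro!: continuous_on_compose2[OF _ has_C2_partials_continuous(1)[OF Q(1)]])
  then show ?thesis
    using Q has_second_partials_compose[of UNIV Q G H f f' f'', OF _ f[OF Q(2)] f'[OF Q(2)]]
    unfolding has_C2_partials_def by (auto intro!: continuous_intros)
qed

abbreviation sqdist :: "'a::real_inner \<Rightarrow> 'a \<Rightarrow> real" where
  "sqdist y x \<equiv> (x - y) \<bullet> (x - y)"

lemma has_C2_partials_radial:
  fixes f :: "real \<Rightarrow> 'a::real_normed_vector" and y :: "real^'n"
  assumes "\<And>q. q \<ge> 0 \<Longrightarrow> (f has_vector_derivative f' q) (at q)"
    and "\<And>q. q \<ge> 0 \<Longrightarrow> (f' has_vector_derivative f'' q) (at q)" "continuous_on {0..} f''"
  shows "has_C2_partials (\<lambda>x. f (sqdist y x)) (\<lambda>i x. (2 * (x$i - y$i)) *\<^sub>R f' (sqdist y x))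
    (\<lambda>i x. (2 * (x$i - y$i))\<^sup>2 *\<^sub>R f'' (sqdist y x) + 2 *\<^sub>R f' (sqdist y x))"
proof (rule has_C2_partials_compose)
  show "has_C2_partials (sqdist y) (\<lambda>i x. 2 * (x$i - y$i)) (\<lambda>i x. 2)"
    unfolding has_C2_partials_def
    by (intro conjI allI has_second_partials_dist_sq continuous_intros)
qed (use assms in auto)

lemma radial_laplacian:
  fixes x y :: "real^'n" and a b :: complex
  shows "(\<Sum>i\<in>UNIV. (2 * (x$i - y$i))\<^sup>2 *\<^sub>R a + 2 *\<^sub>R b) = of_real (4 * sqdist y x) * a + of_nat (2 * CARD('n)) * b"
proof -
  have "(\<Sum>i\<in>UNIV. (2 * (x$i - y$i))\<^sup>2 *\<^sub>R a + 2 *\<^sub>R b) = (\<Sum>i\<in>UNIV. (2 * (x$i - y$i))\<^sup>2) *\<^sub>R a + of_nat (2 * CARD('n)) * b"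
    by (simp only: sum.distrib scaleR_sum_left) (simp add: scaleR_conv_of_real)
  also have "(\<Sum>i\<in>UNIV. (2 * (x$i - y$i))\<^sup>2) = 4 * sqdist y x"
    by (simp add: inner_vec_def power2_eq_square sum_distrib_left algebra_simps)
  finally show ?thesis by (simp add: scaleR_conv_of_real)
qed

lemma radial_gradient_product:
  fixes x y z :: "real^'n" and a b :: complex
  shows "(\<Sum>i\<in>UNIV. ((2 * (x$i - y$i)) *\<^sub>R a) * ((2 * (x$i - z$i)) *\<^sub>R b)) = of_real (4 * ((x - y) \<bullet> (x - z))) * (a * b)"
proof -
  have "(\<Sum>i\<in>UNIV. ((2 * (x$i - y$i)) *\<^sub>R a) * ((2 * (x$i - z$i)) *\<^sub>R b))
      = (\<Sum>i\<in>UNIV. 4 * ((x$i - y$i) * (x$i - z$i))) *\<^sub>R (a * b)"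
    by (simp add: scaleR_sum_left algebra_simps)
  also have "(\<Sum>i\<in>UNIV. 4 * ((x$i - y$i) * (x$i - z$i))) = 4 * ((x - y) \<bullet> (x - z))"
    by (simp add: inner_vec_def sum_distrib_left)
  finally show ?thesis by (simp add: scaleR_conv_of_real)
qed

definition has_C2_derivatives :: "(real \<Rightarrow> real) \<Rightarrow> (real \<Rightarrow> real) \<Rightarrow> (real \<Rightarrow> real) \<Rightarrow> bool" where
  "has_C2_derivatives X X' X'' \<longleftrightarrow> (\<forall>q. (X has_real_derivative X' q) (at q)) \<and>
     (\<forall>q. (X' has_real_derivative X'' q) (at q)) \<and> continuous_on UNIV X''"

lemma has_C2_derivatives_continuous:
  assumes "has_C2_derivatives X X' X''"
  shows "continuous_on A X" "continuous_on A X'" "continuous_on A X''"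
proof -
  show "continuous_on A X" "continuous_on A X'"
    using assms unfolding has_C2_derivatives_def by (auto intro!: continuous_at_imp_continuous_on DERIV_isCont)
  show "continuous_on A X''"
    using assms unfolding has_C2_derivatives_def by (auto intro: continuous_on_subset)
qed

lemma has_C2_derivatives_diff:
  "has_C2_derivatives X X' X'' \<Longrightarrow> has_C2_derivatives Y Y' Y'' \<Longrightarrow>
   has_C2_derivatives (\<lambda>q. X q - Y q) (\<lambda>q. X' q - Y' q) (\<lambda>q. X'' q - Y'' q)"
  unfolding has_C2_derivatives_def by (auto intro!: DERIV_diff continuous_on_diff)

lemma has_C2_derivatives_of_real:
  assumes "has_C2_derivatives X X' X''"
  shows "((\<lambda>q. of_real (X q)) has_vector_derivative of_real (X' q)) (at q)"
    "((\<lambda>q. of_real (X' q)) has_vector_derivative of_real (X'' q)) (at q)"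
  using assms unfolding has_C2_derivatives_def
  by (auto intro!: has_vector_derivative_of_real simp: has_real_derivative_iff_has_vector_derivative)

lemma has_C2_partials_radial_real:
  fixes y :: "real^'n"
  assumes "has_C2_derivatives X X' X''"
  shows "has_C2_partials (\<lambda>x. complex_of_real (X (sqdist y x))) (\<lambda>i x. (2 * (x$i - y$i)) *\<^sub>R of_real (X' (sqdist y x)))
    (\<lambda>i x. (2 * (x$i - y$i))\<^sup>2 *\<^sub>R of_real (X'' (sqdist y x)) + 2 *\<^sub>R of_real (X' (sqdist y x)))"
  by (rule has_C2_partials_radial[OF has_C2_derivatives_of_real[OF assms]])
     (intro continuous_intros has_C2_derivatives_continuous[OF assms])

section \<open>Cut-off functions\<close>

lemma has_real_derivative_max_power:
  assumes "n \<ge> 1"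
  shows "((\<lambda>s. (max 0 s) ^ Suc n) has_real_derivative (real (Suc n) * (max 0 s) ^ n)) (at s)"
proof -
  consider "s > 0" | "s < 0" | "s = 0" by linarith
  then show ?thesis
  proof cases
    case 1
    have "((\<lambda>s. s ^ Suc n) has_real_derivative (real (Suc n) * (max 0 s) ^ n)) (at s)"
      using 1 DERIV_pow[of "Suc n" s] by simp
    then show ?thesis
      by (rule has_field_derivative_transform_within_open[where S="{0<..}"]) (use 1 in auto)
  next
    case 2
    have "((\<lambda>s::real. 0) has_real_derivative (real (Suc n) * (max 0 s) ^ n)) (at s)"
      using 2 assms by (auto intro!: derivative_eq_intros)
    then show ?thesis
      by (rule has_field_derivative_transform_within_open[where S="{..<0}"]) (use 2 in auto)
  next
    case 3
    have "(\<lambda>h::real. (max 0 h) ^ Suc n / h) \<midarrow>0\<rightarrow> 0"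
    proof (rule Lim_null_comparison)
      show "\<forall>\<^sub>F h in at 0. norm ((max 0 h) ^ Suc n / h) \<le> \<bar>h\<bar> ^ n"
        by (rule always_eventually) (auto simp: max_def)
      show "((\<lambda>h::real. \<bar>h\<bar> ^ n) \<longlongrightarrow> 0) (at 0)"
        using assms by (intro tendsto_eq_intros) auto
    qed
    then show ?thesis using 3 assms unfolding DERIV_def by (simp add: power_0_left)
  qed
qed

definition bump :: "real \<Rightarrow> real" where
  "bump s = (max 0 (1 - (max 0 s) ^ 3)) ^ 3"

definition bump' :: "real \<Rightarrow> real" where
  "bump' s = - 9 * (max 0 (1 - (max 0 s) ^ 3))\<^sup>2 * (max 0 s)\<^sup>2"

definition bump'' :: "real \<Rightarrow> real" where
  "bump'' s = 54 * max 0 (1 - (max 0 s) ^ 3) * (max 0 s) ^ 4 - 18 * (max 0 (1 - (max 0 s) ^ 3))\<^sup>2 * max 0 s"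

lemma has_C2_derivatives_bump: "has_C2_derivatives bump bump' bump''"
proof -
  have cube: "((\<lambda>s::real. (max 0 s) ^ 3) has_real_derivative 3 * (max 0 s)\<^sup>2) (at s)"
    and square: "((\<lambda>s::real. (max 0 s)\<^sup>2) has_real_derivative 2 * max 0 s) (at s)" for s
    using has_real_derivative_max_power[of 2 s] has_real_derivative_max_power[of 1 s] by (simp_all add: eval_nat_numeral)
  have inner: "((\<lambda>s::real. 1 - (max 0 s) ^ 3) has_real_derivative - (3 * (max 0 s)\<^sup>2)) (at s)" for s
    using DERIV_diff[OF DERIV_const cube, of 1 s] by simp
  have "(bump has_real_derivative bump' s) (at s)" for s
    using DERIV_chain2[OF cube inner, of s] by (simp add: bump_def[abs_def] bump'_def mult.assoc)
  moreover have "(bump' has_real_derivative bump'' s) (at s)" for s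
  proof -
    have "((\<lambda>s. - 9 * ((max 0 (1 - (max 0 s) ^ 3))\<^sup>2 * (max 0 s)\<^sup>2)) has_real_derivative
      - 9 * (2 * max 0 (1 - (max 0 s) ^ 3) * - (3 * (max 0 s)\<^sup>2) * (max 0 s)\<^sup>2 + 2 * max 0 s * (max 0 (1 - (max 0 s) ^ 3))\<^sup>2)) (at s)"
      by (intro DERIV_cmult DERIV_mult DERIV_chain2[OF square inner] square)
    moreover have "- 9 * (2 * a * - (3 * b\<^sup>2) * b\<^sup>2 + 2 * b * a\<^sup>2) = 54 * a * b ^ 4 - 18 * a\<^sup>2 * b" for a b :: real
      by (simp add: algebra_simps eval_nat_numeral)
    ultimately show ?thesis by (simp add: bump'_def[abs_def] bump''_def mult.commute mult.left_commute)
  qed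
  moreover have "continuous_on UNIV bump''" unfolding bump''_def[abs_def] by (intro continuous_intros)
  ultimately show ?thesis by (simp add: has_C2_derivatives_def)
qed

lemma bump_eq_1: "s \<le> 0 \<Longrightarrow> bump s = 1 \<and> bump' s = 0 \<and> bump'' s = 0"
  by (simp add: bump_def bump'_def bump''_def)

lemma bump_eq_0: "s \<ge> 1 \<Longrightarrow> bump s = 0 \<and> bump' s = 0 \<and> bump'' s = 0"
  by (simp add: bump_def bump'_def bump''_def)

lemma bump_bounds: "0 \<le> bump s" "bump s \<le> 1" "\<bar>bump' s\<bar> \<le> 54" "\<bar>bump'' s\<bar> \<le> 54"
proof -
  define a where "a = max 0 (1 - (max 0 s) ^ 3)"
  define b where "b = max 0 s"
  have a: "0 \<le> a" "a \<le> 1" and b: "0 \<le> b" by (auto simp: a_def b_def)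
  show "0 \<le> bump s" "bump s \<le> 1" using a by (auto simp: bump_def a_def intro!: power_le_one)
  have power_bounds: "0 \<le> a ^ Suc m * b ^ n \<and> a ^ Suc m * b ^ n \<le> 1" for m n
  proof (cases "b \<le> 1")
    case True
    then show ?thesis using a b by (intro conjI mult_nonneg_nonneg mult_le_one power_le_one zero_le_power)
  next
    case False
    then have "a = 0" by (simp add: a_def b_def)
    then show ?thesis by simp
  qed
  have "bump' s = - (9 * (a ^ Suc 1 * b ^ 2))" by (simp add: bump'_def a_def b_def power2_eq_square)
  then show "\<bar>bump' s\<bar> \<le> 54" using power_bounds[of 1 2] by linarith
  have "bump'' s = 54 * (a ^ Suc 0 * b ^ 4) - 18 * (a ^ Suc 1 * b ^ 1)"
    by (simp add: bump''_def a_def b_def power2_eq_square)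
  then show "\<bar>bump'' s\<bar> \<le> 54" using power_bounds[of 0 4] power_bounds[of 1 1] by linarith
qed

definition plateau :: "real \<Rightarrow> real \<Rightarrow> real \<Rightarrow> real" where
  "plateau a b q = bump ((q - a) / (b - a))"

definition plateau' :: "real \<Rightarrow> real \<Rightarrow> real \<Rightarrow> real" where
  "plateau' a b q = bump' ((q - a) / (b - a)) / (b - a)"

definition plateau'' :: "real \<Rightarrow> real \<Rightarrow> real \<Rightarrow> real" where
  "plateau'' a b q = bump'' ((q - a) / (b - a)) / (b - a)\<^sup>2"

lemma has_C2_derivatives_plateau:
  assumes "a < b"
  shows "has_C2_derivatives (plateau a b) (plateau' a b) (plateau'' a b)"
proof -
  have affine: "((\<lambda>q. (q - a) / (b - a)) has_real_derivative 1 / (b - a)) (at q)" for q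
    using assms by (auto intro!: derivative_eq_intros)
  have bump: "(bump has_real_derivative bump' s) (at s)" "(bump' has_real_derivative bump'' s) (at s)" for s
    using has_C2_derivatives_bump by (auto simp: has_C2_derivatives_def)
  have "(plateau a b has_real_derivative plateau' a b q) (at q)" for q
    using DERIV_chain2[OF bump(1) affine, of q] by (simp add: plateau_def[abs_def] plateau'_def)
  moreover have "(plateau' a b has_real_derivative plateau'' a b q) (at q)" for q
    using DERIV_cdivide[OF DERIV_chain2[OF bump(2) affine, of q], of "b - a"]
    by (simp add: plateau'_def[abs_def] plateau''_def power2_eq_square)
  moreover have "continuous_on UNIV (\<lambda>q. bump'' ((q - a) / (b - a)))"
    using assms by (intro continuous_on_compose2[OF has_C2_derivatives_continuous(3)[OF has_C2_derivatives_bump]] continuous_intros) auto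
  then have "continuous_on UNIV (plateau'' a b)"
    using assms unfolding plateau''_def[abs_def] by (intro continuous_intros) auto
  ultimately show ?thesis by (simp add: has_C2_derivatives_def)
qed

lemma plateau_eq_1:
  "a < b \<Longrightarrow> q \<le> a \<Longrightarrow> plateau a b q = 1 \<and> plateau' a b q = 0 \<and> plateau'' a b q = 0"
  using bump_eq_1[of "(q - a) / (b - a)"] by (simp add: plateau_def plateau'_def plateau''_def divide_le_0_iff)

lemma plateau_eq_0:
  "a < b \<Longrightarrow> b \<le> q \<Longrightarrow> plateau a b q = 0 \<and> plateau' a b q = 0 \<and> plateau'' a b q = 0"
  using bump_eq_0[of "(q - a) / (b - a)"] by (simp add: plateau_def plateau'_def plateau''_def)

lemma plateau_bounds:
  assumes "a < b"
  shows "0 \<le> plateau a b q" "plateau a b q \<le> 1"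
    "\<bar>plateau' a b q\<bar> \<le> 54 / (b - a)" "\<bar>plateau'' a b q\<bar> \<le> 54 / (b - a)\<^sup>2"
  using bump_bounds[of "(q - a) / (b - a)"] assms
  by (auto simp: plateau_def plateau'_def plateau''_def divide_right_mono)

section \<open>Approximate identities\<close>

lemma integral_lborel_diagonal:
  fixes f :: "'a::euclidean_space \<Rightarrow> 'b::{banach, second_countable_topology}"
  assumes "f \<in> borel_measurable borel" "\<And>b. b \<in> Basis \<Longrightarrow> c b \<noteq> 0"
  shows "(LINT x|lborel. f x) = (\<Prod>b\<in>Basis. \<bar>c b\<bar>) *\<^sub>R (LINT z|lborel. f (y + (\<Sum>b\<in>Basis. (c b * (z \<bullet> b)) *\<^sub>R b)))"
proof -
  let ?T = "\<lambda>z. y + (\<Sum>b\<in>Basis. (c b * (z \<bullet> b)) *\<^sub>R b)"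
  have "(LINT x|lborel. f x) = (LINT x|density (distr lborel borel ?T) (\<lambda>_. \<Prod>b\<in>Basis. \<bar>c b\<bar>). f x)"
    using lborel_affine_euclidean[of c y] assms(2) by simp
  also have "\<dots> = (LINT x|distr lborel borel ?T. (\<Prod>b\<in>Basis. \<bar>c b\<bar>) *\<^sub>R f x)"
    using assms(1) by (intro integral_density) (auto intro!: AE_I2 prod_nonneg)
  also have "\<dots> = (LINT z|lborel. (\<Prod>b\<in>Basis. \<bar>c b\<bar>) *\<^sub>R f (?T z))"
    using assms(1) by (intro integral_distr) auto
  finally show ?thesis by simp
qed

lemma integral_lborel_affine:
  fixes f :: "'a::euclidean_space \<Rightarrow> 'b::{banach, second_countable_topology}"
  assumes "f \<in> borel_measurable borel" "c > 0"
  shows "(LINT x|lborel. f x) = c ^ DIM('a) *\<^sub>R (LINT z|lborel. f (y + c *\<^sub>R z))"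
proof -
  have "(\<Sum>b\<in>Basis. (c * (z \<bullet> b)) *\<^sub>R b) = c *\<^sub>R z" for z :: 'a
    by (simp add: euclidean_representation flip: scaleR_scaleR scaleR_sum_right)
  then show ?thesis using integral_lborel_diagonal[OF assms(1), of "\<lambda>_. c" y] assms(2) by simp
qed

lemma approximate_identity:
  fixes g :: "nat \<Rightarrow> 'a::euclidean_space \<Rightarrow> complex" and p :: "'a \<Rightarrow> real"
  assumes \<delta>: "\<And>n. 0 < \<delta> n" and p: "integrable lborel p"
    and g: "\<And>n. g n \<in> borel_measurable borel" "\<And>n x. norm (g n x) \<le> M"
    and lim: "\<And>z. (\<lambda>n. g n (y + \<delta> n *\<^sub>R z)) \<longlonglongrightarrow> L"
  shows "(\<lambda>n. LINT x|lborel. g n x * of_real (p ((x - y) /\<^sub>R \<delta> n) / \<delta> n ^ DIM('a))) \<longlonglongrightarrow> L * of_real (LINT z|lborel. p z)"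
proof -
  have [measurable]: "p \<in> borel_measurable borel" "g n \<in> borel_measurable borel" for n using p g(1) by auto
  have "M \<ge> 0" using g(2) norm_ge_zero order_trans by blast
  have rescale: "(LINT x|lborel. g n x * of_real (p ((x - y) /\<^sub>R \<delta> n) / \<delta> n ^ DIM('a)))
      = (LINT z|lborel. g n (y + \<delta> n *\<^sub>R z) * of_real (p z))" for n
  proof -
    have "(LINT x|lborel. g n x * of_real (p ((x - y) /\<^sub>R \<delta> n) / \<delta> n ^ DIM('a)))
        = \<delta> n ^ DIM('a) *\<^sub>R (LINT z|lborel. g n (y + \<delta> n *\<^sub>R z) * of_real (p (((y + \<delta> n *\<^sub>R z) - y) /\<^sub>R \<delta> n) / \<delta> n ^ DIM('a)))"
      by (rule integral_lborel_affine[OF _ \<delta>]) measurable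
    also have "\<dots> = (LINT z|lborel. \<delta> n ^ DIM('a) *\<^sub>R (g n (y + \<delta> n *\<^sub>R z) * of_real (p z / \<delta> n ^ DIM('a))))"
      using \<delta>[of n] by simp
    also have "\<dots> = (LINT z|lborel. g n (y + \<delta> n *\<^sub>R z) * of_real (p z))"
      using \<delta>[of n] by (intro Bochner_Integration.integral_cong) (simp_all add: scaleR_conv_of_real)
    finally show ?thesis .
  qed
  have "(\<lambda>n. LINT z|lborel. g n (y + \<delta> n *\<^sub>R z) * of_real (p z)) \<longlonglongrightarrow> (LINT z|lborel. L * of_real (p z))"
  proof (rule integral_dominated_convergence[where w="\<lambda>z. M * \<bar>p z\<bar>"])
    show "integrable lborel (\<lambda>z. M * \<bar>p z\<bar>)" using p by simp
    show "AE z in lborel. (\<lambda>n. g n (y + \<delta> n *\<^sub>R z) * of_real (p z)) \<longlonglongrightarrow> L * of_real (p z)"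
      by (intro AE_I2 tendsto_intros lim)
    show "AE z in lborel. norm (g n (y + \<delta> n *\<^sub>R z) * of_real (p z)) \<le> M * \<bar>p z\<bar>" for n
      using g(2) by (auto simp: norm_mult intro!: mult_right_mono)
  qed measurable
  then show ?thesis unfolding rescale by simp
qed

lemma dyadic_scale:
  fixes r :: real
  obtains n where "r \<le> 2 ^ n" "n = 0 \<or> 2 ^ (n - 1) < r"
proof -
  define n where "n = (LEAST n. r \<le> 2 ^ n)"
  obtain l where "r \<le> 2 ^ l" using real_arch_pow[of 2 r] by (auto intro: less_imp_le)
  then have "r \<le> 2 ^ n" unfolding n_def by (rule LeastI[where P="\<lambda>n. r \<le> 2 ^ n"])
  moreover have "n = 0" if "\<not> 2 ^ (n - 1) < r"
    using not_less_Least[of "n - 1" "\<lambda>n. r \<le> 2 ^ n"] that by (cases "n = 0") (simp_all add: n_def[symmetric])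
  ultimately show ?thesis by (rule that[OF _ disjCI])
qed

lemma polynomial_decay_le_dyadic:
  fixes f :: "'a::real_normed_vector \<Rightarrow> real"
  assumes bound: "\<bar>f x\<bar> \<le> C" and decay: "\<bar>f x\<bar> * norm x ^ m \<le> C"
  obtains n where "norm x \<le> 2 ^ n" "\<bar>f x\<bar> \<le> C * (2 / 2 ^ n) ^ m"
proof -
  obtain n where n: "norm x \<le> 2 ^ n" "n = 0 \<or> 2 ^ (n - 1) < norm x" by (rule dyadic_scale)
  have "\<bar>f x\<bar> \<le> C * (2 / 2 ^ n) ^ m"
  proof (cases "n = 0")
    case True
    have "C * 1 \<le> C * 2 ^ m" using bound by (intro mult_left_mono) auto
    then show ?thesis using True bound by simp
  next
    case False
    then have "\<bar>f x\<bar> * (2 ^ (n - 1)) ^ m \<le> \<bar>f x\<bar> * norm x ^ m" using n(2) by (intro mult_left_mono power_mono) auto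
    then have "\<bar>f x\<bar> * (2 ^ (n - 1)) ^ m \<le> C" using decay by linarith
    moreover have "(2::real) / 2 ^ n = 1 / 2 ^ (n - 1)" using False by (cases n) auto
    ultimately show ?thesis by (simp add: power_divide pos_le_divide_eq)
  qed
  with n(1) show ?thesis by (rule that)
qed

lemma integrable_suminf_cball_indicator:
  fixes c r :: "nat \<Rightarrow> real"
  assumes nonneg: "\<And>n. 0 \<le> c n" "\<And>n. 0 \<le> r n" and "summable c" and volumes: "summable (\<lambda>n. r n ^ DIM('a) * c n)"
  shows "summable (\<lambda>n. indicator (cball 0 (r n)) (x::'a::euclidean_space) *\<^sub>R c n)"
    and "integrable lborel (\<lambda>x::'a. \<Sum>n. indicator (cball 0 (r n)) x *\<^sub>R c n)"
proof -
  define s where "s n x = indicator (cball 0 (r n)) x *\<^sub>R c n" for n and x :: 'a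
  have norm_s: "norm (s n x) = s n x" "s n x \<le> c n" for n x using nonneg by (auto simp: s_def indicator_def)
  have s_summable: "summable (\<lambda>n. s n x)" for x
    by (rule summable_comparison_test[OF _ \<open>summable c\<close>]) (use norm_s in auto)
  then show "summable (\<lambda>n. indicator (cball 0 (r n)) x *\<^sub>R c n)" by (simp only: s_def)
  have "integrable lborel (\<lambda>x. \<Sum>n. s n x)"
  proof (rule integrable_suminf)
    show "integrable lborel (s n)" for n unfolding s_def by (intro borel_integrable_compact) auto
    show "AE x in lborel. summable (\<lambda>n. norm (s n x))" by (simp only: norm_s s_summable AE_I2)
    have "(LINT x|lborel. norm (s n x)) = unit_ball_vol (real DIM('a)) * (r n ^ DIM('a) * c n)" for n
      unfolding norm_s by (simp add: s_def content_cball nonneg)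
    then show "summable (\<lambda>n. LINT x|lborel. norm (s n x))" by (simp only: summable_mult volumes)
  qed
  then show "integrable lborel (\<lambda>x::'a. \<Sum>n. indicator (cball 0 (r n)) x *\<^sub>R c n)" by (simp only: s_def)
qed

lemma integrable_polynomial_decay:
  fixes f :: "'a::euclidean_space \<Rightarrow> real"
  assumes [measurable]: "f \<in> borel_measurable borel"
    and bound: "\<And>x. \<bar>f x\<bar> \<le> C" and decay: "\<And>x. \<bar>f x\<bar> * norm x ^ m \<le> C" and m: "DIM('a) < m"
  shows "integrable lborel f"
proof -
  define c where "c n = C * (2 / 2 ^ n) ^ m" for n :: nat
  define s where "s n x = indicator (cball 0 (2 ^ n)) x *\<^sub>R c n" for n and x :: 'a
  have "C \<ge> 0" using bound[of 0] by linarith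
  then have c_nonneg: "c n \<ge> 0" for n by (simp add: c_def)
  then have s_nonneg: "s n x \<ge> 0" for n x by (simp add: s_def)
  have power_swap: "(2 ^ n) ^ l = ((2::real) ^ l) ^ n" for n l by (metis mult.commute power_mult)
  have c_geometric: "c n = (C * 2 ^ m) * (1 / 2 ^ m) ^ n" for n
    by (simp add: c_def power_divide power_swap[of n m])
  have "summable c" unfolding c_geometric using m by (intro summable_mult summable_geometric) simp
  moreover have "summable (\<lambda>n. (2 ^ n) ^ DIM('a) * c n)"
  proof -
    have "(2 ^ n) ^ DIM('a) * c n = (C * 2 ^ m) * (2 ^ DIM('a) / 2 ^ m) ^ n" for n
      by (simp add: c_geometric power_divide power_swap[of n "DIM('a)"])
    moreover have "(2::real) ^ DIM('a) < 2 ^ m" using m by simp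
    ultimately show ?thesis by (simp only:) (intro summable_mult summable_geometric, simp)
  qed
  ultimately have s: "summable (\<lambda>n. s n x)" "integrable lborel (\<lambda>x. \<Sum>n. s n x)" for x
    unfolding s_def using c_nonneg by (intro integrable_suminf_cball_indicator; simp)+
  from s(2) show ?thesis
  proof (rule Bochner_Integration.integrable_bound)
    have "\<bar>f x\<bar> \<le> (\<Sum>n. s n x)" for x
    proof -
      obtain n where n: "norm x \<le> 2 ^ n" "\<bar>f x\<bar> \<le> C * (2 / 2 ^ n) ^ m"
        by (rule polynomial_decay_le_dyadic[OF bound decay])
      then have "\<bar>f x\<bar> \<le> c n" by (simp add: c_def)
      also have "c n = s n x" using n(1) by (simp add: s_def)
      also have "\<dots> \<le> (\<Sum>n. s n x)"
        using sum_le_suminf[OF s(1), of "{n}" x] s_nonneg by simp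
      finally show ?thesis .
    qed
    then show "AE x in lborel. norm (f x) \<le> norm (\<Sum>n. s n x)"
      by (intro AE_I2) (auto intro: order_trans[OF _ abs_ge_self])
  qed measurable
qed

lemma continuous_on_section:
  assumes "continuous_on (A \<times> T) (\<lambda>p. F (fst p) (snd p))" "t \<in> T"
  shows "continuous_on A (\<lambda>x. F x t)"
proof -
  have "continuous_on A (\<lambda>x. (x, t))" by (intro continuous_intros)
  from continuous_on_compose2[OF assms(1) this] assms(2) show ?thesis by auto
qed

lemma set_integral_tendsto_parameter:
  fixes F :: "'a::euclidean_space \<Rightarrow> 'b::metric_space \<Rightarrow> 'c::{banach, second_countable_topology}"
  assumes A: "compact A" and T: "compact T" and cont: "continuous_on (A \<times> T) (\<lambda>p. F (fst p) (snd p))"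
    and t: "\<And>n. t n \<in> T" "t \<longlonglongrightarrow> t0" "t0 \<in> T"
  shows "(\<lambda>n. LINT x:A|lborel. F x (t n)) \<longlonglongrightarrow> (LINT x:A|lborel. F x t0)"
proof -
  have "bounded ((\<lambda>p. F (fst p) (snd p)) ` (A \<times> T))"
    by (rule compact_imp_bounded[OF compact_continuous_image[OF cont compact_Times[OF A T]]])
  then obtain M where "M > 0" and M: "\<And>x t. x \<in> A \<Longrightarrow> t \<in> T \<Longrightarrow> norm (F x t) \<le> M"
    unfolding bounded_pos by fastforce
  show ?thesis unfolding set_lebesgue_integral_def
  proof (rule bounded_convergence_compact_support[OF _ _ A])
    show "(\<lambda>x. indicator A x *\<^sub>R F x (t n)) \<in> borel_measurable borel" for n
      using bounded_supported_indicator[OF continuous_on_section[OF cont t(1)] A]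
      by (rule bounded_supported_measurable)
    show "norm (indicator A x *\<^sub>R F x (t n)) \<le> M" for n x
      using M t(1) \<open>M > 0\<close> by (auto simp: indicator_def)
    show "(\<lambda>n. indicator A x *\<^sub>R F x (t n)) \<longlonglongrightarrow> indicator A x *\<^sub>R F x t0" for x
    proof (cases "x \<in> A")
      case True
      have "continuous_on T (\<lambda>t. (x, t))" by (intro continuous_intros)
      from continuous_on_compose2[OF cont this] True have "continuous_on T (F x)" by auto
      then show ?thesis using continuous_on_tendsto_compose[OF _ t(2,3)] t(1) by (auto intro!: tendsto_intros)
    qed simp
  qed simp
qed

section \<open>The representation formula\<close>

text \<open>\<open>wave \<kappa>\<close> is the radial solution \<open>e\<^sup>i\<^sup>\<kappa>\<^sup>s/s\<close>; \<open>wave'\<close> and \<open>wave''\<close> are its derivatives with respect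
  to \<open>s\<^sup>2\<close>, in which the Laplacian of a radial function is \<open>4 s\<^sup>2 f'' + 6 f'\<close>.\<close>

definition wave :: "real \<Rightarrow> complex \<Rightarrow> complex" where
  "wave \<kappa> s = exp (\<i> * of_real \<kappa> * s) / s"

definition wave' :: "real \<Rightarrow> complex \<Rightarrow> complex" where
  "wave' \<kappa> s = exp (\<i> * of_real \<kappa> * s) * (\<i> * of_real \<kappa> / (2 * s^2) - 1 / (2 * s^3))"

definition wave'' :: "real \<Rightarrow> complex \<Rightarrow> complex" where
  "wave'' \<kappa> s = exp (\<i> * of_real \<kappa> * s) *
     (- ((of_real \<kappa>)^2) / (4 * s^3) - 3 * \<i> * of_real \<kappa> / (4 * s^4) + 3 / (4 * s^5))"

definition wave_defect :: "real \<Rightarrow> complex \<Rightarrow> complex" where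
  "wave_defect \<kappa> s = exp (\<i> * of_real \<kappa> * s) * (- 3 + 3 * \<i> * of_real \<kappa> * s + (of_real \<kappa> * s)^2)"

lemma wave_deriv: "s \<noteq> 0 \<Longrightarrow> (wave \<kappa> has_field_derivative 2 * s * wave' \<kappa> s) (at s)"
  unfolding wave_def[abs_def] wave'_def
  by (auto intro!: derivative_eq_intros simp: field_simps power2_eq_square power3_eq_cube)

lemma wave'_deriv: "s \<noteq> 0 \<Longrightarrow> (wave' \<kappa> has_field_derivative 2 * s * wave'' \<kappa> s) (at s)"
  unfolding wave'_def[abs_def] wave''_def
  by (rule derivative_eq_intros refl | simp)+ (simp add: field_simps eval_nat_numeral)

lemma wave_shifted_helmholtz:
  assumes "s \<noteq> 0" "q = s\<^sup>2 - d\<^sup>2"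
  shows "4 * q * wave'' \<kappa> s + 6 * wave' \<kappa> s + (of_real \<kappa>)^2 * wave \<kappa> s = d^2 / s^5 * wave_defect \<kappa> s"
  using assms(1) unfolding assms(2) wave_def wave'_def wave''_def wave_defect_def
  by (simp add: field_simps eval_nat_numeral)

lemma continuous_on_wave:
  "continuous_on (-{0}) (wave \<kappa>)" "continuous_on (-{0}) (wave' \<kappa>)" "continuous_on (-{0}) (wave'' \<kappa>)"
  "continuous_on UNIV (wave_defect \<kappa>)"
  unfolding wave_def[abs_def] wave'_def[abs_def] wave''_def[abs_def] wave_defect_def[abs_def]
  by (auto intro!: continuous_intros)

definition smooth_dist :: "real \<Rightarrow> real \<Rightarrow> real" where
  "smooth_dist d q = sqrt (q + d\<^sup>2)"

lemma smooth_dist_pos: "0 < d \<and> 0 \<le> q \<or> 0 < q \<Longrightarrow> smooth_dist d q > 0"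
  by (auto simp: smooth_dist_def add_nonneg_pos add_pos_nonneg)

lemma smooth_dist_zero: "smooth_dist 0 (sqdist y x) = norm (x - y)"
  by (simp add: smooth_dist_def norm_eq_sqrt_inner)

lemma smooth_dist_deriv:
  assumes "d > 0" "q \<ge> 0"
  shows "((\<lambda>q. complex_of_real (smooth_dist d q)) has_vector_derivative of_real (1 / (2 * smooth_dist d q))) (at q)"
proof -
  have "q + d\<^sup>2 > 0" using assms by (simp add: add_nonneg_pos)
  then have "(smooth_dist d has_real_derivative 1 / (2 * smooth_dist d q)) (at q)"
    unfolding smooth_dist_def[abs_def] by (auto intro!: derivative_eq_intros simp: field_simps)
  then show ?thesis
    by (intro has_vector_derivative_of_real) (simp add: has_real_derivative_iff_has_vector_derivative)
qed

lemma has_C2_partials_wave: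
  fixes y :: "real^'n"
  assumes "d > 0"
  shows "has_C2_partials (\<lambda>x. wave \<kappa> (of_real (smooth_dist d (sqdist y x))))
    (\<lambda>i x. (2 * (x$i - y$i)) *\<^sub>R wave' \<kappa> (of_real (smooth_dist d (sqdist y x))))
    (\<lambda>i x. (2 * (x$i - y$i))\<^sup>2 *\<^sub>R wave'' \<kappa> (of_real (smooth_dist d (sqdist y x)))
       + 2 *\<^sub>R wave' \<kappa> (of_real (smooth_dist d (sqdist y x))))"
proof (rule has_C2_partials_radial[of "\<lambda>q. wave \<kappa> (of_real (smooth_dist d q))"
      "\<lambda>q. wave' \<kappa> (of_real (smooth_dist d q))" "\<lambda>q. wave'' \<kappa> (of_real (smooth_dist d q))"])
  fix q :: real assume "q \<ge> 0"
  then have nonzero: "complex_of_real (smooth_dist d q) \<noteq> 0" using smooth_dist_pos[of d q] assms by simp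
  show "((\<lambda>q. wave \<kappa> (of_real (smooth_dist d q))) has_vector_derivative wave' \<kappa> (of_real (smooth_dist d q))) (at q)"
    using field_vector_diff_chain_at[OF smooth_dist_deriv[OF assms \<open>q \<ge> 0\<close>] wave_deriv[OF nonzero]] nonzero
    by (simp add: o_def field_simps)
  show "((\<lambda>q. wave' \<kappa> (of_real (smooth_dist d q))) has_vector_derivative wave'' \<kappa> (of_real (smooth_dist d q))) (at q)"
    using field_vector_diff_chain_at[OF smooth_dist_deriv[OF assms \<open>q \<ge> 0\<close>] wave'_deriv[OF nonzero]] nonzero
    by (simp add: o_def field_simps)
next
  have "continuous_on {0..} (\<lambda>q. complex_of_real (smooth_dist d q))" unfolding smooth_dist_def by (intro continuous_intros)
  moreover have "complex_of_real (smooth_dist d q) \<noteq> 0" if "q \<ge> 0" for q using smooth_dist_pos[of d q] assms that by simp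
  ultimately show "continuous_on {0..} (\<lambda>q. wave'' \<kappa> (of_real (smooth_dist d q)))"
    by (intro continuous_on_compose2[OF continuous_on_wave(3)]) auto
qed

text \<open>Up to a constant, \<open>mollifier d\<close> is the Laplacian of the regularised Newton kernel
  \<open>1 / sqrt (|x|\<^sup>2 + d\<^sup>2)\<close>.\<close>

definition mollifier :: "real \<Rightarrow> real^3 \<Rightarrow> real" where
  "mollifier d x = d\<^sup>2 / (smooth_dist d (x \<bullet> x))^5"

lemma mollifier_nonneg: "mollifier d x \<ge> 0"
  by (simp add: mollifier_def smooth_dist_def)

lemma continuous_on_mollifier: "d > 0 \<Longrightarrow> continuous_on A (mollifier d)"
  unfolding mollifier_def[abs_def] smooth_dist_def
  by (intro continuous_intros) (auto simp: add_nonneg_pos less_imp_neq[symmetric] add_nonneg_eq_0_iff)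

lemma mollifier_rescale:
  assumes "d > 0"
  shows "mollifier d x = mollifier 1 (x /\<^sub>R d) / d ^ DIM(real^3)"
proof -
  have "x \<bullet> x + d\<^sup>2 = d\<^sup>2 * ((x /\<^sub>R d) \<bullet> (x /\<^sub>R d) + 1)"
    using assms by (simp add: field_simps power2_eq_square)
  then have "smooth_dist d (x \<bullet> x) = d * smooth_dist 1 ((x /\<^sub>R d) \<bullet> (x /\<^sub>R d))"
    using assms by (simp add: smooth_dist_def real_sqrt_mult)
  then show ?thesis using assms by (simp add: mollifier_def power_mult_distrib field_simps eval_nat_numeral)
qed

lemma integrable_mollifier: "integrable lborel (mollifier 1)"
proof (rule integrable_polynomial_decay[where C=1 and m=5])
  show "mollifier 1 \<in> borel_measurable borel"
    by (rule borel_measurable_continuous_onI[OF continuous_on_mollifier]) simp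
  fix x :: "real^3"
  have smooth_dist_ge: "1 \<le> smooth_dist 1 (x \<bullet> x)" "norm x \<le> smooth_dist 1 (x \<bullet> x)"
    by (auto simp: smooth_dist_def norm_eq_sqrt_inner intro: real_sqrt_le_mono)
  then have "1 \<le> smooth_dist 1 (x \<bullet> x) ^ 5" "norm x ^ 5 \<le> smooth_dist 1 (x \<bullet> x) ^ 5"
    by (auto intro: power_mono one_le_power)
  then show "\<bar>mollifier 1 x\<bar> \<le> 1" "\<bar>mollifier 1 x\<bar> * norm x ^ 5 \<le> 1"
    using smooth_dist_ge(1) mollifier_nonneg[of 1 x] by (simp_all add: mollifier_def divide_le_eq_1)
qed simp

definition mollifier_mass :: real where
  "mollifier_mass = (LINT x|lborel. mollifier 1 x)"

lemma mollifier_mass_pos: "mollifier_mass > 0"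
proof -
  have nonzero: "mollifier 1 x \<noteq> 0" for x
    using smooth_dist_pos[of 1 "x \<bullet> x"] by (simp add: mollifier_def)
  have "\<not> (AE x in lborel. mollifier 1 x = 0)"
  proof
    assume "AE x in lborel. mollifier 1 x = 0"
    then have "AE x in (lborel :: (real^3) measure). False" by eventually_elim (use nonzero in auto)
    then have "emeasure (lborel :: (real^3) measure) UNIV = 0"
      unfolding eventually_False ae_filter_eq_bot_iff space_lborel space_borel .
    then show False by simp
  qed
  then have "mollifier_mass \<noteq> 0" unfolding mollifier_mass_def
    by (subst integral_nonneg_eq_0_iff_AE[OF integrable_mollifier]) (auto simp: mollifier_nonneg)
  moreover have "mollifier_mass \<ge> 0"
    unfolding mollifier_mass_def by (rule Bochner_Integration.integral_nonneg) (rule mollifier_nonneg)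
  ultimately show ?thesis by simp
qed

lemma integral_mollifier_tendsto:
  fixes F :: "real^3 \<Rightarrow> real \<Rightarrow> complex"
  assumes K: "compact K" and "open S" "K \<subseteq> S" "y \<in> S"
    and cont: "continuous_on (S \<times> {0..1}) (\<lambda>p. F (fst p) (snd p))" and zero: "\<And>x d. x \<in> S - K \<Longrightarrow> F x d = 0"
    and \<delta>: "\<And>n. 0 < \<delta> n" "\<And>n. \<delta> n \<le> 1" "\<delta> \<longlonglongrightarrow> 0"
  shows "(\<lambda>n. LINT x:K|lborel. F x (\<delta> n) * of_real (mollifier (\<delta> n) (x - y))) \<longlonglongrightarrow> F y 0 * of_real mollifier_mass"
proof -
  have contK: "continuous_on (K \<times> {0..1}) (\<lambda>p. F (fst p) (snd p))"
    by (rule continuous_on_subset[OF cont]) (use \<open>K \<subseteq> S\<close> in auto)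
  have \<delta>01: "\<delta> n \<in> {0..1}" for n using \<delta>(1,2)[of n] by simp
  have "bounded ((\<lambda>p. F (fst p) (snd p)) ` (K \<times> {0..1}))"
    by (rule compact_imp_bounded[OF compact_continuous_image[OF contK]]) (intro compact_Times K compact_Icc)
  then obtain M where "M > 0" and M: "\<And>x d. x \<in> K \<Longrightarrow> d \<in> {0..1} \<Longrightarrow> norm (F x d) \<le> M"
    unfolding bounded_pos by fastforce
  define g where "g n x = indicator K x *\<^sub>R F x (\<delta> n)" for n x
  have g_eq: "g n x = F x (\<delta> n)" if "x \<in> S" for n x using zero[of x] that by (auto simp: g_def indicator_def)
  have "(\<lambda>n. LINT x|lborel. g n x * of_real (mollifier 1 ((x - y) /\<^sub>R \<delta> n) / \<delta> n ^ DIM(real^3)))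
      \<longlonglongrightarrow> F y 0 * of_real (LINT z|lborel. mollifier 1 z)"
  proof (rule approximate_identity[OF \<delta>(1) integrable_mollifier])
    show "g n \<in> borel_measurable borel" for n
      unfolding g_def using bounded_supported_indicator[OF continuous_on_section[OF contK \<delta>01] K]
      by (rule bounded_supported_measurable)
    show "norm (g n x) \<le> M" for n x using M \<delta>01[of n] \<open>M > 0\<close> by (auto simp: g_def indicator_def)
    fix z :: "real^3"
    have approach: "(\<lambda>n. y + \<delta> n *\<^sub>R z) \<longlonglongrightarrow> y"
      using tendsto_add[OF tendsto_const tendsto_scaleR[OF \<delta>(3) tendsto_const], of y z] by simp
    then have in_S: "\<forall>\<^sub>F n in sequentially. y + \<delta> n *\<^sub>R z \<in> S" by (rule topological_tendstoD) fact+
    have pair: "(\<lambda>n. (y + \<delta> n *\<^sub>R z, \<delta> n)) \<longlonglongrightarrow> (y, 0)" by (intro tendsto_Pair approach \<delta>(3))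
    have "\<forall>\<^sub>F n in sequentially. (y + \<delta> n *\<^sub>R z, \<delta> n) \<in> S \<times> {0..1}" using in_S by eventually_elim (use \<delta>01 in auto)
    from continuous_on_tendsto_compose[OF cont pair _ this] \<open>y \<in> S\<close>
    have "(\<lambda>n. F (y + \<delta> n *\<^sub>R z) (\<delta> n)) \<longlonglongrightarrow> F y 0" by simp
    then show "(\<lambda>n. g n (y + \<delta> n *\<^sub>R z)) \<longlonglongrightarrow> F y 0"
      by (rule Lim_transform_eventually) (use in_S in \<open>eventually_elim, simp add: g_eq\<close>)
  qed
  then show ?thesis
    unfolding mollifier_rescale[OF \<delta>(1), symmetric] mollifier_mass_def[symmetric] by (simp add: g_def set_lebesgue_integral_def)
qed

definition cutoff_kernel :: "real \<Rightarrow> (real \<Rightarrow> real) \<Rightarrow> (real \<Rightarrow> real) \<Rightarrow> real \<Rightarrow> complex \<Rightarrow> complex \<Rightarrow> complex" where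
  "cutoff_kernel \<kappa> X' X'' q m s = of_real (8 * X' q) * m * wave' \<kappa> s + of_real (6 * X' q + 4 * q * X'' q) * wave \<kappa> s"

lemma continuous_on_cutoff_kernel:
  assumes X: "has_C2_derivatives X X' X''"
    and "continuous_on A q" "continuous_on A m" "continuous_on A s" "\<And>p. p \<in> A \<Longrightarrow> s p \<noteq> 0"
  shows "continuous_on A (\<lambda>p. cutoff_kernel \<kappa> X' X'' (q p) (m p) (s p))"
proof -
  have "continuous_on A (\<lambda>p. X' (q p))" "continuous_on A (\<lambda>p. X'' (q p))"
    using assms(2) by (auto intro: continuous_on_compose2[OF has_C2_derivatives_continuous(2)[OF X, of UNIV]]
        continuous_on_compose2[OF has_C2_derivatives_continuous(3)[OF X, of UNIV]])
  moreover have "continuous_on A (\<lambda>p. wave \<kappa> (s p))" "continuous_on A (\<lambda>p. wave' \<kappa> (s p))"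
    using assms(5) by (auto intro!: continuous_on_compose2[OF continuous_on_wave(1) assms(4)]
        continuous_on_compose2[OF continuous_on_wave(2) assms(4)])
  ultimately show ?thesis unfolding cutoff_kernel_def by (intro continuous_intros assms)
qed

lemma holomorphic_on_cutoff_kernel:
  assumes "m holomorphic_on A" "s holomorphic_on A" "\<And>z. z \<in> A \<Longrightarrow> s z \<noteq> 0"
  shows "(\<lambda>z. cutoff_kernel \<kappa> X' X'' q (m z) (s z)) holomorphic_on A"
  unfolding cutoff_kernel_def wave_def wave'_def using assms by (intro holomorphic_intros) auto

definition representation_kernel ::
  "real \<Rightarrow> (real \<Rightarrow> real) \<Rightarrow> (real \<Rightarrow> real) \<Rightarrow> real^3 \<Rightarrow> real^3 \<Rightarrow> real^3 \<Rightarrow> complex \<Rightarrow> complex" where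
  "representation_kernel \<kappa> X' X'' y0 y x s = cutoff_kernel \<kappa> X' X'' (sqdist y0 x) (of_real ((x - y0) \<bullet> (x - y))) s"

lemma representation_kernel_diff:
  "representation_kernel \<kappa> (\<lambda>q. X' q - Y' q) (\<lambda>q. X'' q - Y'' q) y0 y x s
    = representation_kernel \<kappa> X' X'' y0 y x s - representation_kernel \<kappa> Y' Y'' y0 y x s"
  by (simp add: representation_kernel_def cutoff_kernel_def algebra_simps)

lemma representation_kernel_eq_0:
  "X' (sqdist y0 x) = 0 \<Longrightarrow> X'' (sqdist y0 x) = 0 \<Longrightarrow> representation_kernel \<kappa> X' X'' y0 y x s = 0"
  by (simp add: representation_kernel_def cutoff_kernel_def)

lemma continuous_on_representation_kernel:
  assumes "has_C2_derivatives X X' X''" "continuous_on A f" "continuous_on A s" "\<And>p. p \<in> A \<Longrightarrow> s p \<noteq> 0"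
  shows "continuous_on A (\<lambda>p. representation_kernel \<kappa> X' X'' y0 y (f p) (s p))"
  unfolding representation_kernel_def by (intro continuous_on_cutoff_kernel[OF assms(1)] continuous_intros assms)

lemma cutoff_times_wave:
  assumes X: "has_C2_derivatives X X' X''" and "d > 0"
  obtains G H where
    "has_C2_partials (\<lambda>x. of_real (X (sqdist y0 x)) * wave \<kappa> (of_real (smooth_dist d (sqdist y x)))) G H"
    "\<And>x. (\<Sum>i\<in>UNIV. H i x) + complex_of_real (\<kappa>\<^sup>2) * (of_real (X (sqdist y0 x)) * wave \<kappa> (of_real (smooth_dist d (sqdist y x))))
      = of_real (X (sqdist y0 x)) * wave_defect \<kappa> (of_real (smooth_dist d (sqdist y x))) * of_real (mollifier d (x - y))
        + representation_kernel \<kappa> X' X'' y0 y x (of_real (smooth_dist d (sqdist y x)))"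
proof (rule that[OF has_C2_partials_mult[OF has_C2_partials_radial_real[OF X] has_C2_partials_wave[OF \<open>d > 0\<close>]]])
  fix x :: "real^3"
  define q where "q = sqdist y0 x"
  define r where "r = sqdist y x"
  define s where "s = complex_of_real (smooth_dist d r)"
  have "r \<ge> 0" by (simp add: r_def)
  then have "s \<noteq> 0" using smooth_dist_pos[of d r] \<open>d > 0\<close> by (simp add: s_def)
  have "s\<^sup>2 = of_real (r + d\<^sup>2)" unfolding s_def of_real_power[symmetric] using \<open>r \<ge> 0\<close> by (simp add: smooth_dist_def)
  then have r_eq: "of_real r = s\<^sup>2 - (of_real d)\<^sup>2" by simp
  have mollifier_eq: "complex_of_real (mollifier d (x - y)) = (of_real d)^2 / s^5"
    by (simp add: mollifier_def s_def r_def)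
  have "(\<Sum>i\<in>UNIV. of_real (X q) * ((2 * (x $ i - y $ i))\<^sup>2 *\<^sub>R wave'' \<kappa> s + 2 *\<^sub>R wave' \<kappa> s)
       + 2 * (((2 * (x $ i - y0 $ i)) *\<^sub>R of_real (X' q)) * ((2 * (x $ i - y $ i)) *\<^sub>R wave' \<kappa> s))
       + ((2 * (x $ i - y0 $ i))\<^sup>2 *\<^sub>R of_real (X'' q) + 2 *\<^sub>R of_real (X' q)) * wave \<kappa> s)
     = of_real (X q) * (of_real (4 * r) * wave'' \<kappa> s + of_nat (2 * CARD(3)) * wave' \<kappa> s)
       + 2 * (of_real (4 * ((x - y0) \<bullet> (x - y))) * (of_real (X' q) * wave' \<kappa> s))
       + (of_real (4 * q) * of_real (X'' q) + of_nat (2 * CARD(3)) * of_real (X' q)) * wave \<kappa> s" (is "?laplacian = _")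
    unfolding sum.distrib sum_distrib_left[symmetric] sum_distrib_right[symmetric]
    unfolding radial_gradient_product sum.distrib[symmetric] radial_laplacian q_def r_def ..
  also have "\<dots> + complex_of_real (\<kappa>\<^sup>2) * (of_real (X q) * wave \<kappa> s)
     = of_real (X q) * (4 * of_real r * wave'' \<kappa> s + 6 * wave' \<kappa> s + (of_real \<kappa>)\<^sup>2 * wave \<kappa> s)
       + representation_kernel \<kappa> X' X'' y0 y x s"
    by (simp add: representation_kernel_def cutoff_kernel_def q_def algebra_simps)
  also have "\<dots> = of_real (X q) * wave_defect \<kappa> s * of_real (mollifier d (x - y)) + representation_kernel \<kappa> X' X'' y0 y x s"
    unfolding wave_shifted_helmholtz[OF \<open>s \<noteq> 0\<close> r_eq] mollifier_eq by simp
  finally have "?laplacian + complex_of_real (\<kappa>\<^sup>2) * (of_real (X q) * wave \<kappa> s)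
     = of_real (X q) * wave_defect \<kappa> s * of_real (mollifier d (x - y)) + representation_kernel \<kappa> X' X'' y0 y x s" .
  then show "(\<Sum>i\<in>UNIV. of_real (X (sqdist y0 x)) * ((2 * (x $ i - y $ i))\<^sup>2 *\<^sub>R wave'' \<kappa> (of_real (smooth_dist d (sqdist y x))) + 2 *\<^sub>R wave' \<kappa> (of_real (smooth_dist d (sqdist y x))))
       + 2 * (((2 * (x $ i - y0 $ i)) *\<^sub>R of_real (X' (sqdist y0 x))) * ((2 * (x $ i - y $ i)) *\<^sub>R wave' \<kappa> (of_real (smooth_dist d (sqdist y x)))))
       + ((2 * (x $ i - y0 $ i))\<^sup>2 *\<^sub>R of_real (X'' (sqdist y0 x)) + 2 *\<^sub>R of_real (X' (sqdist y0 x))) * wave \<kappa> (of_real (smooth_dist d (sqdist y x))))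
    + complex_of_real (\<kappa>\<^sup>2) * (of_real (X (sqdist y0 x)) * wave \<kappa> (of_real (smooth_dist d (sqdist y x))))
      = of_real (X (sqdist y0 x)) * wave_defect \<kappa> (of_real (smooth_dist d (sqdist y x))) * of_real (mollifier d (x - y))
        + representation_kernel \<kappa> X' X'' y0 y x (of_real (smooth_dist d (sqdist y x)))"
    unfolding s_def q_def r_def .
qed

lemma continuous_on_smooth_dist: "continuous_on A (\<lambda>p. complex_of_real (smooth_dist (snd p) (sqdist y (fst p))))"
  unfolding smooth_dist_def by (intro continuous_intros)

lemma regularised_wave_integral:
  assumes u: "continuous_on K u" "compact K" and X: "has_C2_derivatives X X' X''" and "d > 0"
  obtains G H where
    "has_C2_partials (\<lambda>x. of_real (X (sqdist y0 x)) * wave \<kappa> (of_real (smooth_dist d (sqdist y x)))) G H"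
    "(LINT x:K|lborel. u x * ((\<Sum>i\<in>UNIV. H i x) + of_real (\<kappa>\<^sup>2) *
        (of_real (X (sqdist y0 x)) * wave \<kappa> (of_real (smooth_dist d (sqdist y x))))))
      = (LINT x:K|lborel. u x * (of_real (X (sqdist y0 x)) * wave_defect \<kappa> (of_real (smooth_dist d (sqdist y x))))
          * of_real (mollifier d (x - y)))
        + (LINT x:K|lborel. u x * representation_kernel \<kappa> X' X'' y0 y x (of_real (smooth_dist d (sqdist y x))))"
proof -
  define s where "s x = complex_of_real (smooth_dist d (sqdist y x))" for x
  obtain G H where \<phi>: "has_C2_partials (\<lambda>x. of_real (X (sqdist y0 x)) * wave \<kappa> (s x)) G H"
    and laplacian: "\<And>x. (\<Sum>i\<in>UNIV. H i x) + of_real (\<kappa>\<^sup>2) * (of_real (X (sqdist y0 x)) * wave \<kappa> (s x))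
       = of_real (X (sqdist y0 x)) * wave_defect \<kappa> (s x) * of_real (mollifier d (x - y))
         + representation_kernel \<kappa> X' X'' y0 y x (s x)"
    by (rule cutoff_times_wave[OF X \<open>d > 0\<close>, where \<kappa>=\<kappa> and y=y and ?y0.0=y0]) (rule that[unfolded s_def])
  have s: "continuous_on K s" "s x \<noteq> 0" for x
    unfolding s_def using smooth_dist_pos[of d "sqdist y x"] \<open>d > 0\<close> by (auto simp: smooth_dist_def intro!: continuous_intros)
  have "continuous_on K (\<lambda>x. X (sqdist y0 x))" "continuous_on K (\<lambda>x. wave_defect \<kappa> (s x))"
    "continuous_on K (\<lambda>x. mollifier d (x - y))"
    by (auto intro!: continuous_on_compose2[OF has_C2_derivatives_continuous(1)[OF X, of UNIV]]
        continuous_on_compose2[OF continuous_on_wave(4) s(1)]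
        continuous_on_compose2[OF continuous_on_mollifier[OF \<open>d > 0\<close>, of UNIV]] continuous_intros)
  then have "set_integrable lborel K (\<lambda>x. u x * (of_real (X (sqdist y0 x)) * wave_defect \<kappa> (s x)) * of_real (mollifier d (x - y)))"
    unfolding set_integrable_def by (intro borel_integrable_compact u continuous_intros)
  moreover have "set_integrable lborel K (\<lambda>x. u x * representation_kernel \<kappa> X' X'' y0 y x (s x))"
    unfolding set_integrable_def
    by (intro borel_integrable_compact continuous_on_mult u continuous_on_representation_kernel[OF X] continuous_on_id s)
  ultimately have "(LINT x:K|lborel. u x * ((\<Sum>i\<in>UNIV. H i x) + of_real (\<kappa>\<^sup>2) * (of_real (X (sqdist y0 x)) * wave \<kappa> (s x))))
    = (LINT x:K|lborel. u x * (of_real (X (sqdist y0 x)) * wave_defect \<kappa> (s x)) * of_real (mollifier d (x - y)))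
      + (LINT x:K|lborel. u x * representation_kernel \<kappa> X' X'' y0 y x (s x))"
    unfolding laplacian by (simp add: distrib_left mult.assoc set_integral_add(2))
  with \<phi> show ?thesis unfolding s_def by (rule that)
qed

lemma representation_kernel_integral_tendsto:
  assumes u: "continuous_on K u" "compact K" and X: "has_C2_derivatives X X' X''" and "\<eta> > 0"
    and flat: "\<And>x. x \<in> ball y \<eta> \<Longrightarrow> X' (sqdist y0 x) = 0 \<and> X'' (sqdist y0 x) = 0"
    and \<delta>: "\<And>n. 0 < \<delta> n" "\<And>n. \<delta> n \<le> 1" "\<delta> \<longlonglongrightarrow> 0"
  shows "(\<lambda>n. LINT x:K|lborel. u x * representation_kernel \<kappa> X' X'' y0 y x (of_real (smooth_dist (\<delta> n) (sqdist y x))))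
    \<longlonglongrightarrow> (LINT x:K|lborel. u x * representation_kernel \<kappa> X' X'' y0 y x (of_real (norm (x - y))))"
proof -
  define A where "A = K - ball y \<eta>"
  define E where "E x d = u x * representation_kernel \<kappa> X' X'' y0 y x (of_real (smooth_dist d (sqdist y x)))" for x d
  have limit: "(\<lambda>n. LINT x:A|lborel. E x (\<delta> n)) \<longlonglongrightarrow> (LINT x:A|lborel. E x 0)"
  proof (rule set_integral_tendsto_parameter[where T="{0..1}"])
    have "complex_of_real (smooth_dist d (sqdist y x)) \<noteq> 0" if "x \<in> A" for x d
    proof -
      have "x \<noteq> y" using that \<open>\<eta> > 0\<close> by (auto simp: A_def)
      then show ?thesis using smooth_dist_pos[of d "sqdist y x"] by simp
    qed
    moreover have "continuous_on (A \<times> {0..1}) (\<lambda>p. u (fst p))"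
      by (rule continuous_on_compose2[OF u(1)]) (auto simp: A_def intro!: continuous_intros)
    ultimately show "continuous_on (A \<times> {0..1}) (\<lambda>p. E (fst p) (snd p))" unfolding E_def
      by (intro continuous_on_mult continuous_on_representation_kernel[OF X] continuous_on_smooth_dist continuous_on_fst continuous_on_id) auto
    show "compact A" unfolding A_def by (intro compact_diff u) auto
  qed (use \<delta> in \<open>auto intro: less_imp_le\<close>)
  have "(LINT x:A|lborel. E x d) = (LINT x:K|lborel. E x d)" for d
    unfolding set_lebesgue_integral_def
    by (rule Bochner_Integration.integral_cong)
       (use representation_kernel_eq_0 flat in \<open>auto simp: E_def A_def indicator_def\<close>)
  with limit have "(\<lambda>n. LINT x:K|lborel. E x (\<delta> n)) \<longlonglongrightarrow> (LINT x:K|lborel. E x 0)" by simp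
  then show ?thesis by (simp only: E_def smooth_dist_zero)
qed

lemma mollified_wave_defect_integral_tendsto:
  assumes S: "open S" "y \<in> S" and u: "continuous_on S u" and X: "has_C2_derivatives X X' X''"
    and K: "compact K" "K \<subseteq> S" and zero: "\<And>x. x \<notin> K \<Longrightarrow> X (sqdist y0 x) = 0"
    and \<delta>: "\<And>n. 0 < \<delta> n" "\<And>n. \<delta> n \<le> 1" "\<delta> \<longlonglongrightarrow> 0"
  shows "(\<lambda>n. LINT x:K|lborel. u x * (of_real (X (sqdist y0 x)) * wave_defect \<kappa> (of_real (smooth_dist (\<delta> n) (sqdist y x))))
      * of_real (mollifier (\<delta> n) (x - y))) \<longlonglongrightarrow> u y * (of_real (X (sqdist y0 y)) * wave_defect \<kappa> 0) * of_real mollifier_mass"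
proof -
  define F where "F x d = u x * (of_real (X (sqdist y0 x)) * wave_defect \<kappa> (of_real (smooth_dist d (sqdist y x))))" for x d
  have "(\<lambda>n. LINT x:K|lborel. F x (\<delta> n) * of_real (mollifier (\<delta> n) (x - y))) \<longlonglongrightarrow> F y 0 * of_real mollifier_mass"
  proof (rule integral_mollifier_tendsto[OF K(1) S(1) K(2) S(2) _ _ \<delta>])
    have "continuous_on (S \<times> {0..1}) (\<lambda>p. X (sqdist y0 (fst p)))"
      by (rule continuous_on_compose2[OF has_C2_derivatives_continuous(1)[OF X, of UNIV]]) (auto intro!: continuous_intros)
    moreover have "continuous_on (S \<times> {0..1}) (\<lambda>p. u (fst p))"
      by (rule continuous_on_compose2[OF u]) (auto intro!: continuous_intros)
    moreover have "continuous_on (S \<times> {0..1}) (\<lambda>p. wave_defect \<kappa> (of_real (smooth_dist (snd p) (sqdist y (fst p)))))"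
      by (rule continuous_on_compose2[OF continuous_on_wave(4) continuous_on_smooth_dist]) simp
    ultimately show "continuous_on (S \<times> {0..1}) (\<lambda>p. F (fst p) (snd p))" unfolding F_def by (intro continuous_intros)
    show "F x d = 0" if "x \<in> S - K" for x d using zero that by (simp add: F_def)
  qed
  then show ?thesis by (simp add: F_def smooth_dist_def)
qed

lemma regularised_wave_integral_tendsto:
  assumes "open S" and u: "continuous_on S u" and X: "has_C2_derivatives X X' X''"
    and K: "compact K" "K \<subseteq> S" and zero: "\<And>x. x \<notin> K \<Longrightarrow> X (sqdist y0 x) = 0" and "y \<in> S" "\<eta> > 0"
    and flat: "\<And>x. x \<in> ball y \<eta> \<Longrightarrow> X' (sqdist y0 x) = 0 \<and> X'' (sqdist y0 x) = 0"
    and \<delta>: "\<And>n. 0 < \<delta> n" "\<And>n. \<delta> n \<le> 1" "\<delta> \<longlonglongrightarrow> 0"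
  obtains G H where
    "\<And>n. has_C2_partials (\<lambda>x. of_real (X (sqdist y0 x)) * wave \<kappa> (of_real (smooth_dist (\<delta> n) (sqdist y x)))) (G n) (H n)"
    "(\<lambda>n. LINT x:K|lborel. u x * ((\<Sum>i\<in>UNIV. H n i x) + of_real (\<kappa>\<^sup>2) *
        (of_real (X (sqdist y0 x)) * wave \<kappa> (of_real (smooth_dist (\<delta> n) (sqdist y x))))))
      \<longlonglongrightarrow> (LINT x:K|lborel. u x * representation_kernel \<kappa> X' X'' y0 y x (of_real (norm (x - y))))
        - 3 * of_real mollifier_mass * (of_real (X (sqdist y0 y)) * u y)"
proof -
  define F where "F x d = u x * (of_real (X (sqdist y0 x)) * wave_defect \<kappa> (of_real (smooth_dist d (sqdist y x))))" for x d
  define E where "E x d = u x * representation_kernel \<kappa> X' X'' y0 y x (of_real (smooth_dist d (sqdist y x)))" for x d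
  have delta_limit: "(\<lambda>n. LINT x:K|lborel. F x (\<delta> n) * of_real (mollifier (\<delta> n) (x - y)))
      \<longlonglongrightarrow> u y * (of_real (X (sqdist y0 y)) * wave_defect \<kappa> 0) * of_real mollifier_mass"
    unfolding F_def by (rule mollified_wave_defect_integral_tendsto[OF \<open>open S\<close> \<open>y \<in> S\<close> u X K zero \<delta>])
  have kernel_limit: "(\<lambda>n. LINT x:K|lborel. E x (\<delta> n)) \<longlonglongrightarrow> (LINT x:K|lborel. E x 0)"
    unfolding E_def smooth_dist_zero
    by (rule representation_kernel_integral_tendsto[OF continuous_on_subset[OF u K(2)] K(1) X \<open>\<eta> > 0\<close> flat \<delta>])
  define \<phi> where "\<phi> n x = of_real (X (sqdist y0 x)) * wave \<kappa> (of_real (smooth_dist (\<delta> n) (sqdist y x)))" for n x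
  define regularised where "regularised n G H \<longleftrightarrow> has_C2_partials (\<phi> n) G H \<and>
    (LINT x:K|lborel. u x * ((\<Sum>i\<in>UNIV. H i x) + of_real (\<kappa>\<^sup>2) * \<phi> n x))
     = (LINT x:K|lborel. F x (\<delta> n) * of_real (mollifier (\<delta> n) (x - y))) + (LINT x:K|lborel. E x (\<delta> n))" for n G H
  have "\<exists>G H. regularised n G H" for n
    unfolding regularised_def \<phi>_def F_def E_def
    by (rule regularised_wave_integral[OF continuous_on_subset[OF u K(2)] K(1) X \<delta>(1)]) blast
  then obtain G H where "\<And>n. regularised n (G n) (H n)" by metis
  then have \<phi>: "has_C2_partials (\<phi> n) (G n) (H n)"
    "(LINT x:K|lborel. u x * ((\<Sum>i\<in>UNIV. H n i x) + of_real (\<kappa>\<^sup>2) * \<phi> n x))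
     = (LINT x:K|lborel. F x (\<delta> n) * of_real (mollifier (\<delta> n) (x - y))) + (LINT x:K|lborel. E x (\<delta> n))" for n
    by (simp_all add: regularised_def)
  have "u y * (of_real (X (sqdist y0 y)) * wave_defect \<kappa> 0) * of_real mollifier_mass + (LINT x:K|lborel. E x 0)
    = (LINT x:K|lborel. E x 0) - 3 * of_real mollifier_mass * (of_real (X (sqdist y0 y)) * u y)"
    by (simp add: wave_defect_def algebra_simps)
  then show ?thesis
    using that[of G H, folded \<phi>_def, OF \<phi>(1)] tendsto_add[OF delta_limit kernel_limit]
    unfolding \<phi>(2) by (simp add: E_def smooth_dist_zero)
qed

text \<open>Its value is \<open>1 / (4 \<pi>)\<close>, which is never needed.\<close>

definition representation_constant :: complex where
  "representation_constant = of_real (1 / (3 * mollifier_mass))"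

theorem representation_formula:
  assumes "\<kappa>\<^sup>2 = k\<^sup>2" "open S" and u: "weak_helmholtz k S u" and X: "has_C2_derivatives X X' X''"
    and K: "compact K" "K \<subseteq> S" and zero: "\<And>x. x \<notin> K \<Longrightarrow> X (sqdist y0 x) = 0" and "y \<in> S" "\<eta> > 0"
    and flat: "\<And>x. x \<in> ball y \<eta> \<Longrightarrow> X' (sqdist y0 x) = 0 \<and> X'' (sqdist y0 x) = 0"
  shows "of_real (X (sqdist y0 y)) * u y = representation_constant *
    (LINT x:K|lborel. u x * representation_kernel \<kappa> X' X'' y0 y x (of_real (norm (x - y))))"
proof -
  define \<delta> where "\<delta> n = inverse (real (Suc n))" for n
  have \<delta>: "0 < \<delta> n" "\<delta> n \<le> 1" for n by (auto simp: \<delta>_def field_simps)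
  have "\<delta> \<longlonglongrightarrow> 0" unfolding \<delta>_def by (rule LIMSEQ_inverse_real_of_nat)
  have "continuous_on S u" using u by (simp add: weak_helmholtz_def)
  let ?\<phi> = "\<lambda>n x. of_real (X (sqdist y0 x)) * wave \<kappa> (of_real (smooth_dist (\<delta> n) (sqdist y x)))"
  obtain G H where \<phi>: "\<And>n. has_C2_partials (?\<phi> n) (G n) (H n)"
    and limit: "(\<lambda>n. LINT x:K|lborel. u x * ((\<Sum>i\<in>UNIV. H n i x) + of_real (\<kappa>\<^sup>2) * ?\<phi> n x))
      \<longlonglongrightarrow> (LINT x:K|lborel. u x * representation_kernel \<kappa> X' X'' y0 y x (of_real (norm (x - y))))
        - 3 * of_real mollifier_mass * (of_real (X (sqdist y0 y)) * u y)"
    by (rule regularised_wave_integral_tendsto[OF \<open>open S\<close> \<open>continuous_on S u\<close> X K zero \<open>y \<in> S\<close> \<open>\<eta> > 0\<close> flat \<delta> \<open>\<delta> \<longlonglongrightarrow> 0\<close>,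
        where \<kappa>=\<kappa>]) (assumption | rule that)+
  have "(LINT x:K|lborel. u x * ((\<Sum>i\<in>UNIV. H n i x) + of_real (\<kappa>\<^sup>2) * ?\<phi> n x)) = 0" for n
    unfolding assms(1) by (rule u[unfolded weak_helmholtz_def, THEN conjunct2, rule_format, OF K \<phi>]) (simp add: zero)
  then have "(LINT x:K|lborel. u x * representation_kernel \<kappa> X' X'' y0 y x (of_real (norm (x - y))))
        - 3 * of_real mollifier_mass * (of_real (X (sqdist y0 y)) * u y) = 0"
    using limit by (simp add: LIMSEQ_const_iff)
  then show ?thesis using mollifier_mass_pos by (simp add: representation_constant_def field_simps)
qed

section \<open>Analyticity on lines\<close>

lemma holomorphic_difference_bound:
  assumes hol: "f holomorphic_on ball z (2 * \<rho>)" and bound: "\<And>w. w \<in> ball z (2 * \<rho>) \<Longrightarrow> norm (f w) \<le> M"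
    and "\<rho> > 0" "w \<in> ball z \<rho>"
  shows "norm (f w - f z) \<le> M / \<rho> * norm (w - z)"
proof (rule field_differentiable_bound[where S="ball z \<rho>" and f'="deriv f"])
  fix v assume "v \<in> ball z \<rho>"
  have cball_subset: "cball v \<rho> \<subseteq> ball z (2 * \<rho>)"
  proof
    fix w assume "w \<in> cball v \<rho>"
    then show "w \<in> ball z (2 * \<rho>)" using dist_triangle[of z w v] \<open>v \<in> ball z \<rho>\<close> by simp
  qed
  have "v \<in> ball z (2 * \<rho>)" using \<open>v \<in> ball z \<rho>\<close> \<open>\<rho> > 0\<close> by simp
  then show "(f has_field_derivative deriv f v) (at v within ball z \<rho>)"
    by (rule has_field_derivative_at_within[OF holomorphic_derivI[OF hol open_ball]])
  have "norm ((deriv ^^ 1) f v) \<le> fact 1 * M / \<rho> ^ 1"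
  proof (rule Cauchy_inequality)
    show "f holomorphic_on ball v \<rho>" by (rule holomorphic_on_subset[OF hol order_trans[OF ball_subset_cball cball_subset]])
    show "continuous_on (cball v \<rho>) f"
      by (rule holomorphic_on_imp_continuous_on[OF holomorphic_on_subset[OF hol cball_subset]])
    show "norm (f w) \<le> M" if "norm (v - w) = \<rho>" for w
      by (rule bound, rule subsetD[OF cball_subset]) (use that in \<open>simp add: dist_norm\<close>)
  qed (rule \<open>\<rho> > 0\<close>)
  then show "norm (deriv f v) \<le> M / \<rho>" by simp
qed (use assms in auto)

lemma set_integral_difference_quotient_tendsto:
  fixes N :: "'a::euclidean_space \<Rightarrow> complex \<Rightarrow> complex"
  assumes A: "compact A" and cont: "\<And>v. v \<in> ball z (2 * \<rho>) \<Longrightarrow> continuous_on A (\<lambda>x. N x v)"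
    and hol: "\<And>x. x \<in> A \<Longrightarrow> N x holomorphic_on ball z (2 * \<rho>)"
    and M: "\<And>x v. x \<in> A \<Longrightarrow> v \<in> ball z (2 * \<rho>) \<Longrightarrow> norm (N x v) \<le> M"
    and "\<rho> > 0" and w: "\<And>n. w n \<in> ball z \<rho>" "\<And>n. w n \<noteq> z" "w \<longlonglongrightarrow> z"
  shows "(\<lambda>n. ((LINT x:A|lborel. N x (w n)) - (LINT x:A|lborel. N x z)) / (w n - z)) \<longlonglongrightarrow> (LINT x:A|lborel. deriv (N x) z)"
proof -
  define q where "q n x = indicator A x *\<^sub>R ((N x (w n) - N x z) / (w n - z))" for n x
  have in_ball: "w n \<in> ball z (2 * \<rho>)" "z \<in> ball z (2 * \<rho>)" for n using w(1)[of n] \<open>\<rho> > 0\<close> by simp_all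
  have integrable: "set_integrable lborel A (\<lambda>x. N x v)" if "v \<in> ball z (2 * \<rho>)" for v
    unfolding set_integrable_def by (rule borel_integrable_compact[OF A cont[OF that]])
  have quotient: "((LINT x:A|lborel. N x (w n)) - (LINT x:A|lborel. N x z)) / (w n - z) = (LINT x|lborel. q n x)" for n
    unfolding q_def set_lebesgue_integral_def[symmetric] set_integral_divide_zero
    by (simp only: set_integral_diff(2)[OF integrable[OF in_ball(1)] integrable[OF in_ball(2)]])
  have "(\<lambda>n. LINT x|lborel. q n x) \<longlonglongrightarrow> (LINT x|lborel. indicator A x *\<^sub>R deriv (N x) z)"
  proof (rule bounded_convergence_compact_support[where K=A and M="\<bar>M\<bar> / \<rho>"])
    show "q n \<in> borel_measurable borel" for n
      unfolding q_def[abs_def]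
      by (intro bounded_supported_measurable bounded_supported_indicator[OF _ A] continuous_intros cont in_ball) (use w(2) in auto)
    show "norm (q n x) \<le> \<bar>M\<bar> / \<rho>" for n x
    proof (cases "x \<in> A")
      case True
      have "norm (N x (w n) - N x z) \<le> \<bar>M\<bar> / \<rho> * norm (w n - z)"
        by (rule holomorphic_difference_bound[OF hol[OF True] _ \<open>\<rho> > 0\<close> w(1)]) (use M[OF True] in force)
      then show ?thesis using True w(2)[of n] by (simp add: q_def norm_divide pos_divide_le_eq)
    qed (use \<open>\<rho> > 0\<close> in \<open>simp add: q_def\<close>)
    show "(\<lambda>n. q n x) \<longlonglongrightarrow> indicator A x *\<^sub>R deriv (N x) z" for x
    proof (cases "x \<in> A")
      case True
      have "(N x has_field_derivative deriv (N x) z) (at z)"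
        by (rule holomorphic_derivI[OF hol[OF True] open_ball in_ball(2)])
      then show ?thesis
        using True w(2,3) unfolding has_field_derivative_iff tendsto_at_iff_sequentially by (auto simp: q_def o_def)
    qed (simp add: q_def)
  qed (use A in \<open>auto simp: q_def\<close>)
  then show ?thesis unfolding quotient by (simp add: set_lebesgue_integral_def)
qed

lemma holomorphic_on_set_integral:
  fixes N :: "'a::euclidean_space \<Rightarrow> complex \<Rightarrow> complex"
  assumes A: "compact A" and cont: "continuous_on (A \<times> cball z0 r) (\<lambda>p. N (fst p) (snd p))"
    and hol: "\<And>x. x \<in> A \<Longrightarrow> N x holomorphic_on ball z0 r"
  shows "(\<lambda>z. LINT x:A|lborel. N x z) holomorphic_on ball z0 r"
proof -
  have "bounded ((\<lambda>p. N (fst p) (snd p)) ` (A \<times> cball z0 r))"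
    by (rule compact_imp_bounded[OF compact_continuous_image[OF cont]]) (intro compact_Times A compact_cball)
  then obtain M where M: "\<And>x z. x \<in> A \<Longrightarrow> z \<in> cball z0 r \<Longrightarrow> norm (N x z) \<le> M"
    unfolding bounded_pos by fastforce
  have "((\<lambda>z. LINT x:A|lborel. N x z) has_field_derivative (LINT x:A|lborel. deriv (N x) z)) (at z)" if z: "z \<in> ball z0 r" for z
  proof -
    define \<rho> where "\<rho> = (r - dist z0 z) / 2"
    have "\<rho> > 0" using z by (simp add: \<rho>_def)
    have ball_subset: "ball z (2 * \<rho>) \<subseteq> ball z0 r"
    proof
      fix w assume "w \<in> ball z (2 * \<rho>)"
      then show "w \<in> ball z0 r" using dist_triangle[of z0 w z] by (simp add: \<rho>_def)
    qed
    then have ball_in_cball: "v \<in> ball z (2 * \<rho>) \<Longrightarrow> v \<in> cball z0 r" for v using ball_subset_cball by blast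
    have "((\<lambda>z. LINT x:A|lborel. N x z) has_field_derivative (LINT x:A|lborel. deriv (N x) z)) (at z within ball z \<rho>)"
      unfolding has_field_derivative_iff tendsto_at_iff_sequentially o_def
      by (intro allI impI set_integral_difference_quotient_tendsto[where \<rho>=\<rho> and M=M, OF A continuous_on_section[OF cont ball_in_cball]
            holomorphic_on_subset[OF hol ball_subset] M[OF _ ball_in_cball] \<open>\<rho> > 0\<close>]) auto
    then show ?thesis using \<open>\<rho> > 0\<close> by (simp add: at_within_open[OF _ open_ball])
  qed
  then show ?thesis unfolding holomorphic_on_def field_differentiable_def
    by (blast intro: has_field_derivative_at_within)
qed

lemma holomorphic_eq_0_real_interval:
  assumes hol: "f holomorphic_on S" and S: "open S" "connected S" and "a < b"
    and segment_subset: "complex_of_real ` {a<..<b} \<subseteq> S" and zero: "\<And>t. a < t \<Longrightarrow> t < b \<Longrightarrow> f (of_real t) = 0" and "z \<in> S"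
  shows "f z = 0"
proof (rule analytic_continuation[OF hol S segment_subset])
  define m where "m = (a + b) / 2"
  have m: "a < m" "m < b" using \<open>a < b\<close> by (auto simp: m_def)
  then have "m islimpt {m<..<b}" by (intro islimpt_greaterThanLessThan1)
  then have "complex_of_real m islimpt of_real ` {m<..<b}"
    by (rule islimpt_isCont_image) (auto simp: eventually_at intro!: exI[of _ 1])
  then show "complex_of_real m islimpt of_real ` {a<..<b}"
    by (rule islimpt_subset) (use m in auto)
  show "complex_of_real m \<in> S" using segment_subset m by auto
qed (use zero \<open>z \<in> S\<close> in auto)

text \<open>For real \<open>z\<close> the square root below is a distance from a point of a line: \<open>|v - z e|\<close> if
  \<open>a = |v|\<^sup>2\<close>, \<open>p = v \<bullet> e\<close>, \<open>b = 1\<close>, and \<open>|e - z v|\<close> if \<open>a = 1\<close> and \<open>b = |v|\<^sup>2\<close>.\<close>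

definition line_dist :: "real \<Rightarrow> real \<Rightarrow> real \<Rightarrow> complex \<Rightarrow> complex" where
  "line_dist a p b z = csqrt (of_real a - 2 * z * of_real p + z\<^sup>2 * of_real b)"

lemma line_dist_Re_pos:
  assumes "a > 0" "p\<^sup>2 \<le> a * b" "(norm z)\<^sup>2 * b \<le> a / 16"
  shows "0 < Re (of_real a - 2 * z * of_real p + z\<^sup>2 * of_real b)"
proof -
  have "b \<ge> 0" using order_trans[OF zero_le_power2 assms(2)] \<open>a > 0\<close> by (simp add: zero_le_mult_iff)
  have "(norm z * \<bar>p\<bar>)\<^sup>2 \<le> (norm z)\<^sup>2 * (a * b)" unfolding power_mult_distrib using assms(2) by (simp add: mult_left_mono)
  also have "\<dots> = a * ((norm z)\<^sup>2 * b)" by simp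
  also have "\<dots> \<le> a * (a / 16)" using assms(1,3) by (intro mult_left_mono) auto
  also have "\<dots> = (a / 4)\<^sup>2" by (simp add: power2_eq_square)
  finally have "norm z * \<bar>p\<bar> \<le> a / 4" by (rule power2_le_imp_le) (use assms(1) in simp)
  then have "norm (2 * z * of_real p) \<le> a / 2" by (simp add: norm_mult)
  moreover have "norm (z\<^sup>2 * of_real b) \<le> a / 16" using assms(3) \<open>b \<ge> 0\<close> by (simp add: norm_mult norm_power)
  ultimately show ?thesis
    using complex_Re_le_cmod[of "2 * z * of_real p"] abs_Re_le_cmod[of "z\<^sup>2 * of_real b"] \<open>a > 0\<close> by simp
qed

lemma line_dist_nonzero:
  assumes "a > 0" "p\<^sup>2 \<le> a * b" "(norm z)\<^sup>2 * b \<le> a / 16"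
  shows "line_dist a p b z \<noteq> 0" "of_real a - 2 * z * of_real p + z\<^sup>2 * of_real b \<notin> \<real>\<^sub>\<le>\<^sub>0"
proof -
  let ?w = "of_real a - 2 * z * of_real p + z\<^sup>2 * of_real b"
  have "0 < Re ?w" by (rule line_dist_Re_pos[OF assms])
  then show "?w \<notin> \<real>\<^sub>\<le>\<^sub>0" unfolding complex_nonpos_Reals_iff by linarith
  from \<open>0 < Re ?w\<close> have "?w \<noteq> 0" by (metis less_irrefl zero_complex.sel(1))
  then show "line_dist a p b z \<noteq> 0" by (simp add: line_dist_def)
qed

lemma holomorphic_on_line_dist:
  assumes "a > 0" "p\<^sup>2 \<le> a * b" "\<And>z. z \<in> B \<Longrightarrow> (norm z)\<^sup>2 * b \<le> a / 16"
  shows "line_dist a p b holomorphic_on B"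
  unfolding line_dist_def[abs_def] using line_dist_nonzero(2)[OF assms] by (intro holomorphic_intros) auto

lemma continuous_on_line_dist:
  assumes "continuous_on D a" "continuous_on D p" "continuous_on D b" "continuous_on D z"
    and "\<And>x. x \<in> D \<Longrightarrow> 0 < a x" "\<And>x. x \<in> D \<Longrightarrow> (p x)\<^sup>2 \<le> a x * b x" "\<And>x. x \<in> D \<Longrightarrow> (norm (z x))\<^sup>2 * b x \<le> a x / 16"
  shows "continuous_on D (\<lambda>x. line_dist (a x) (p x) (b x) (z x))"
  unfolding line_dist_def using line_dist_nonzero(2)[OF assms(5-7)]
  by (intro continuous_on_compose2[OF continuous_on_csqrt] continuous_intros assms) auto

definition annulus :: "'a::metric_space \<Rightarrow> real \<Rightarrow> real \<Rightarrow> 'a set" where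
  "annulus y0 r R = cball y0 R - ball y0 r"

lemma compact_annulus: "compact (annulus (y0 :: 'a::heine_borel) r R)"
  unfolding annulus_def by (intro compact_diff) auto

lemma mem_annulus: "x \<in> annulus y0 r R \<longleftrightarrow> r \<le> norm (x - y0) \<and> norm (x - y0) \<le> R"
  by (auto simp: annulus_def dist_norm norm_minus_commute)

lemma plateau_sqdist_inside:
  assumes "0 \<le> r" "r < R" "norm (x - y0) \<le> r"
  shows "plateau (r\<^sup>2) (R\<^sup>2) (sqdist y0 x) = 1 \<and> plateau' (r\<^sup>2) (R\<^sup>2) (sqdist y0 x) = 0 \<and> plateau'' (r\<^sup>2) (R\<^sup>2) (sqdist y0 x) = 0"
  using plateau_eq_1[of "r\<^sup>2" "R\<^sup>2" "sqdist y0 x"] power_strict_mono[OF assms(2,1), of 2] power_mono[OF assms(3), of 2]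
  by (simp add: power2_norm_eq_inner)

lemma plateau_sqdist_outside:
  assumes "0 \<le> r" "r < R" "R \<le> norm (x - y0)"
  shows "plateau (r\<^sup>2) (R\<^sup>2) (sqdist y0 x) = 0 \<and> plateau' (r\<^sup>2) (R\<^sup>2) (sqdist y0 x) = 0 \<and> plateau'' (r\<^sup>2) (R\<^sup>2) (sqdist y0 x) = 0"
  using plateau_eq_0[of "r\<^sup>2" "R\<^sup>2" "sqdist y0 x"] power_strict_mono[OF assms(2,1), of 2] power_mono[OF assms(3), of 2] assms(1,2)
  by (simp add: power2_norm_eq_inner)

lemma has_C2_derivatives_plateau_square:
  "0 \<le> r \<Longrightarrow> r < R \<Longrightarrow> has_C2_derivatives (plateau (r\<^sup>2) (R\<^sup>2)) (plateau' (r\<^sup>2) (R\<^sup>2)) (plateau'' (r\<^sup>2) (R\<^sup>2))"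
  by (rule has_C2_derivatives_plateau) (simp add: power_strict_mono)

definition annulus_kernel :: "real \<Rightarrow> real \<Rightarrow> real \<Rightarrow> real^3 \<Rightarrow> real^3 \<Rightarrow> real^3 \<Rightarrow> complex" where
  "annulus_kernel \<kappa> r R y0 y x
     = representation_kernel \<kappa> (plateau' (r\<^sup>2) (R\<^sup>2)) (plateau'' (r\<^sup>2) (R\<^sup>2)) y0 y x (of_real (norm (x - y)))"

lemma annulus_kernel_eq_0:
  assumes "0 \<le> r" "r < R" "norm (x - y0) \<le> r \<or> R \<le> norm (x - y0)"
  shows "annulus_kernel \<kappa> r R y0 y x = 0"
  using plateau_sqdist_inside[OF assms(1,2), of x y0] plateau_sqdist_outside[OF assms(1,2), of x y0] assms(3)
  unfolding annulus_kernel_def by (auto intro!: representation_kernel_eq_0)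

lemma continuous_on_annulus_kernel:
  assumes "0 \<le> r" "r < R" "y \<notin> A"
  shows "continuous_on A (annulus_kernel \<kappa> r R y0 y)"
  unfolding annulus_kernel_def[abs_def]
  by (intro continuous_on_representation_kernel[OF has_C2_derivatives_plateau_square[OF assms(1,2)]] continuous_intros)
     (use assms(3) in auto)

lemma set_integral_annulus_kernel:
  assumes "0 \<le> r" "r < R" "annulus y0 r R \<subseteq> K"
  shows "(LINT x:K|lborel. u x * annulus_kernel \<kappa> r R y0 y x) = (LINT x:annulus y0 r R|lborel. u x * annulus_kernel \<kappa> r R y0 y x)"
  unfolding set_lebesgue_integral_def
proof (rule Bochner_Integration.integral_cong)
  show "indicator K x *\<^sub>R (u x * annulus_kernel \<kappa> r R y0 y x) = indicator (annulus y0 r R) x *\<^sub>R (u x * annulus_kernel \<kappa> r R y0 y x)" for x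
    using annulus_kernel_eq_0[OF assms(1,2), of x y0 \<kappa> y] assms(3)
    by (cases "x \<in> annulus y0 r R") (auto simp: mem_annulus)
qed simp

lemma weak_helmholtz_local_representation:
  assumes "open S" "weak_helmholtz k S u" "cball y0 \<rho> \<subseteq> S" "\<rho> > 0" "norm (y - y0) < \<rho>/4"
  shows "u y = representation_constant * (LINT x:annulus y0 (\<rho>/2) \<rho>|lborel. u x * annulus_kernel k (\<rho>/2) \<rho> y0 y x)"
proof -
  have \<rho>: "0 \<le> \<rho>/2" "\<rho>/2 < \<rho>" using \<open>\<rho> > 0\<close> by auto
  have representation: "of_real (plateau ((\<rho>/2)\<^sup>2) (\<rho>\<^sup>2) (sqdist y0 y)) * u y
      = representation_constant * (LINT x:cball y0 \<rho>|lborel. u x * annulus_kernel k (\<rho>/2) \<rho> y0 y x)"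
    unfolding annulus_kernel_def
  proof (rule representation_formula[OF refl assms(1,2) has_C2_derivatives_plateau_square[OF \<rho>] compact_cball assms(3), where \<eta>="\<rho>/4"])
    show "plateau ((\<rho>/2)\<^sup>2) (\<rho>\<^sup>2) (sqdist y0 x) = 0" if "x \<notin> cball y0 \<rho>" for x
      using plateau_sqdist_outside[OF \<rho>, of x y0] that by (simp add: dist_norm norm_minus_commute)
    show "y \<in> S" using assms(4,5) by (intro subsetD[OF assms(3)]) (simp add: dist_norm norm_minus_commute)
    fix x assume "x \<in> ball y (\<rho>/4)"
    then have "norm (x - y0) \<le> \<rho>/2"
      using norm_triangle_ineq[of "x - y" "y - y0"] assms(5) by (simp add: dist_norm norm_minus_commute)
    then show "plateau' ((\<rho>/2)\<^sup>2) (\<rho>\<^sup>2) (sqdist y0 x) = 0 \<and> plateau'' ((\<rho>/2)\<^sup>2) (\<rho>\<^sup>2) (sqdist y0 x) = 0"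
      using plateau_sqdist_inside[OF \<rho>] by blast
  qed (use \<open>\<rho> > 0\<close> in auto)
  have "plateau ((\<rho>/2)\<^sup>2) (\<rho>\<^sup>2) (sqdist y0 y) = 1"
    using plateau_sqdist_inside[OF \<rho>, of y y0] assms(4,5) by simp
  moreover have "annulus y0 (\<rho>/2) \<rho> \<subseteq> cball y0 \<rho>" by (auto simp: annulus_def)
  note set_integral_annulus_kernel[OF \<rho> this]
  ultimately show ?thesis using representation by (simp only: of_real_1 mult_1)
qed

lemma annulus_kernel_on_line:
  assumes e: "norm e = 1"
  shows "annulus_kernel \<kappa> r R y0 (y0 + t *\<^sub>R e) x = cutoff_kernel \<kappa> (plateau' (r\<^sup>2) (R\<^sup>2)) (plateau'' (r\<^sup>2) (R\<^sup>2)) (sqdist y0 x)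
    (of_real (sqdist y0 x) - of_real t * of_real ((x - y0) \<bullet> e)) (line_dist (sqdist y0 x) ((x - y0) \<bullet> e) 1 (of_real t))"
proof -
  let ?y = "y0 + t *\<^sub>R e" and ?q = "sqdist y0 x" and ?p = "(x - y0) \<bullet> e"
  have "e \<bullet> e = 1" using e by (simp add: norm_eq_1)
  have "(x - y0) \<bullet> (x - ?y) = ?q - t * ?p" by (simp add: inner_diff_right algebra_simps)
  moreover have "sqdist ?y x = ?q - 2 * t * ?p + t\<^sup>2"
    using \<open>e \<bullet> e = 1\<close>
    by (simp add: inner_diff_right inner_diff_left inner_add_left inner_add_right inner_commute power2_eq_square algebra_simps)
  then have "line_dist ?q ?p 1 (of_real t) = csqrt (of_real (sqdist ?y x))" by (simp add: line_dist_def)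
  then have "line_dist ?q ?p 1 (of_real t) = of_real (norm (x - ?y))"
    by (simp add: csqrt_of_real_nonneg norm_eq_sqrt_inner)
  ultimately show ?thesis by (simp add: annulus_kernel_def representation_kernel_def)
qed

definition line_integrand :: "real \<Rightarrow> real \<Rightarrow> (real^3 \<Rightarrow> complex) \<Rightarrow> real^3 \<Rightarrow> real^3 \<Rightarrow> real^3 \<Rightarrow> complex \<Rightarrow> complex" where
  "line_integrand \<kappa> \<rho> u y0 e x z =
    u x * cutoff_kernel \<kappa> (plateau' ((\<rho>/2)\<^sup>2) (\<rho>\<^sup>2)) (plateau'' ((\<rho>/2)\<^sup>2) (\<rho>\<^sup>2)) (sqdist y0 x)
      (of_real (sqdist y0 x) - z * of_real ((x - y0) \<bullet> e)) (line_dist (sqdist y0 x) ((x - y0) \<bullet> e) 1 z)"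

lemma holomorphic_on_line_integral:
  assumes u: "continuous_on (cball y0 \<rho>) u" and "\<rho> > 0" and e: "norm e = 1"
  shows "(\<lambda>z. LINT x:annulus y0 (\<rho>/2) \<rho>|lborel. line_integrand \<kappa> \<rho> u y0 e x z) holomorphic_on ball 0 (\<rho>/8)"
proof (rule holomorphic_on_set_integral)
  let ?A = "annulus y0 (\<rho>/2) \<rho>"
  define q where "q x = sqdist y0 x" for x
  define p where "p x = (x - y0) \<bullet> e" for x
  have "e \<bullet> e = 1" using e by (simp add: norm_eq_1)
  have q_ge: "(\<rho>/2)\<^sup>2 \<le> q x" if "x \<in> ?A" for x
    using power_mono[of "\<rho>/2" "norm (x - y0)" 2] that \<open>\<rho> > 0\<close> by (simp add: mem_annulus q_def power2_norm_eq_inner)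
  have q_pos: "0 < q x" if "x \<in> ?A" for x by (rule less_le_trans[OF _ q_ge[OF that]]) (use \<open>\<rho> > 0\<close> in simp)
  have q_small: "(norm z)\<^sup>2 * 1 \<le> q x / 16" if "x \<in> ?A" "norm z \<le> \<rho>/8" for x and z :: complex
    using power_mono[OF that(2), of 2] q_ge[OF that(1)] by (simp add: power_divide)
  have p_le: "(p x)\<^sup>2 \<le> q x * 1" for x
    using Cauchy_Schwarz_ineq[of "x - y0" e] \<open>e \<bullet> e = 1\<close> by (simp add: p_def q_def)
  have plateau: "has_C2_derivatives (plateau ((\<rho>/2)\<^sup>2) (\<rho>\<^sup>2)) (plateau' ((\<rho>/2)\<^sup>2) (\<rho>\<^sup>2)) (plateau'' ((\<rho>/2)\<^sup>2) (\<rho>\<^sup>2))"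
    by (rule has_C2_derivatives_plateau_square) (use \<open>\<rho> > 0\<close> in auto)
  note unfold_integrand = line_integrand_def q_def[symmetric] p_def[symmetric]
  show "compact ?A" by (rule compact_annulus)
  show "line_integrand \<kappa> \<rho> u y0 e x holomorphic_on ball 0 (\<rho>/8)" if "x \<in> ?A" for x
    unfolding unfold_integrand
    by (intro holomorphic_on_mult holomorphic_on_const holomorphic_on_cutoff_kernel holomorphic_on_line_dist
      line_dist_nonzero holomorphic_intros q_pos p_le q_small that) auto
  have "continuous_on (?A \<times> cball 0 (\<rho>/8)) (\<lambda>r. u (fst r))"
    by (rule continuous_on_compose2[OF u]) (auto simp: annulus_def intro!: continuous_intros)
  moreover have "continuous_on (?A \<times> cball 0 (\<rho>/8)) (\<lambda>r. q (fst r))" "continuous_on (?A \<times> cball 0 (\<rho>/8)) (\<lambda>r. p (fst r))"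
    unfolding q_def p_def by (intro continuous_intros)+
  ultimately show "continuous_on (?A \<times> cball 0 (\<rho>/8)) (\<lambda>r. line_integrand \<kappa> \<rho> u y0 e (fst r) (snd r))"
    unfolding unfold_integrand
    by (intro continuous_on_mult continuous_on_cutoff_kernel[OF plateau] continuous_on_line_dist line_dist_nonzero
        continuous_intros q_pos p_le q_small) auto
qed

lemma weak_helmholtz_line_holomorphic:
  fixes y0 e :: "real^3"
  assumes "open S" and u: "weak_helmholtz k S u" and cball: "cball y0 \<rho> \<subseteq> S" and "\<rho> > 0" and e: "norm e = 1"
  obtains h where "h holomorphic_on ball 0 (\<rho>/8)" "\<And>t. \<bar>t\<bar> < \<rho>/8 \<Longrightarrow> h (of_real t) = u (y0 + t *\<^sub>R e)"
proof -
  define h where "h z = representation_constant * (LINT x:annulus y0 (\<rho>/2) \<rho>|lborel. line_integrand k \<rho> u y0 e x z)" for z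
  have "continuous_on (cball y0 \<rho>) u" using u cball by (auto simp: weak_helmholtz_def intro: continuous_on_subset)
  then have "h holomorphic_on ball 0 (\<rho>/8)"
    unfolding h_def by (intro holomorphic_intros holomorphic_on_line_integral \<open>\<rho> > 0\<close> e)
  moreover have "h (of_real t) = u (y0 + t *\<^sub>R e)" if t: "\<bar>t\<bar> < \<rho>/8" for t
  proof -
    have "annulus_kernel k (\<rho>/2) \<rho> y0 (y0 + t *\<^sub>R e) x * u x = line_integrand k \<rho> u y0 e x (of_real t)" for x
      unfolding annulus_kernel_on_line[OF e] by (simp add: line_integrand_def)
    then show ?thesis
      using weak_helmholtz_local_representation[OF \<open>open S\<close> u cball \<open>\<rho> > 0\<close>, of "y0 + t *\<^sub>R e"] t e
      by (simp add: h_def mult.commute)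
  qed
  ultimately show ?thesis by (rule that)
qed

lemma weak_helmholtz_zero_propagates:
  fixes x e :: "real^3"
  assumes "open S" "weak_helmholtz k S u" "norm e = 1" and S: "x + t *\<^sub>R e \<in> S"
  obtains r where "r > 0" "\<And>a \<epsilon> s. \<epsilon> > 0 \<Longrightarrow> \<bar>a - t\<bar> < r \<Longrightarrow> (\<And>s. \<bar>s - a\<bar> < \<epsilon> \<Longrightarrow> u (x + s *\<^sub>R e) = 0)
    \<Longrightarrow> \<bar>s - t\<bar> < r \<Longrightarrow> u (x + s *\<^sub>R e) = 0"
proof -
  obtain \<rho> where "\<rho> > 0" "cball (x + t *\<^sub>R e) \<rho> \<subseteq> S" using S \<open>open S\<close> by (auto simp: open_contains_cball)
  then obtain h where hol: "h holomorphic_on ball 0 (\<rho>/8)"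
    and h: "\<And>s. \<bar>s\<bar> < \<rho>/8 \<Longrightarrow> h (of_real s) = u ((x + t *\<^sub>R e) + s *\<^sub>R e)"
    using weak_helmholtz_line_holomorphic[OF assms(1,2) _ _ assms(3)] by metis
  define r where "r = \<rho>/8"
  have h_line: "h (of_real (s - t)) = u (x + s *\<^sub>R e)" if "\<bar>s - t\<bar> < r" for s
    using h[of "s - t"] that by (simp add: r_def algebra_simps)
  show ?thesis
  proof (rule that)
    show "r > 0" using \<open>\<rho> > 0\<close> by (simp add: r_def)
    fix a \<epsilon> s assume "\<epsilon> > 0" and a: "\<bar>a - t\<bar> < r" and zero: "\<And>s. \<bar>s - a\<bar> < \<epsilon> \<Longrightarrow> u (x + s *\<^sub>R e) = 0"
      and s: "\<bar>s - t\<bar> < r"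
    have "h (of_real (s - t)) = 0"
    proof (rule holomorphic_eq_0_real_interval[where f=h and S="ball 0 r" and a="max (a - t - \<epsilon>) (- r)" and b="min (a - t + \<epsilon>) r"])
      show "h holomorphic_on ball 0 r" using hol by (simp add: r_def)
      show "h (of_real v) = 0" if "max (a - t - \<epsilon>) (- r) < v" "v < min (a - t + \<epsilon>) r" for v
      proof -
        have v: "\<bar>(v + t) - t\<bar> < r" "\<bar>(v + t) - a\<bar> < \<epsilon>" using that by auto
        show ?thesis using h_line[OF v(1)] zero[OF v(2)] by simp
      qed
    qed (use \<open>\<epsilon> > 0\<close> a s in \<open>auto simp flip: of_real_diff\<close>)
    then show "u (x + s *\<^sub>R e) = 0" using h_line[OF s] by simp
  qed
qed

theorem weak_helmholtz_line_unique_continuation: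
  fixes x e :: "real^3"
  assumes "open S" "weak_helmholtz k S u" "norm e = 1" "connected I" and S: "\<And>t. t \<in> I \<Longrightarrow> x + t *\<^sub>R e \<in> S"
    and "t0 \<in> I" "\<epsilon> > 0" and zero: "\<And>t. \<bar>t - t0\<bar> < \<epsilon> \<Longrightarrow> u (x + t *\<^sub>R e) = 0" and "t1 \<in> I"
  shows "u (x + t1 *\<^sub>R e) = 0"
proof -
  define zero_near where "zero_near t \<longleftrightarrow> (\<exists>\<epsilon>>0. \<forall>s. \<bar>s - t\<bar> < \<epsilon> \<longrightarrow> u (x + s *\<^sub>R e) = 0)" for t
  have "zero_near t1"
  proof (rule connected_induction_simple[OF \<open>connected I\<close> \<open>t0 \<in> I\<close> \<open>t1 \<in> I\<close>])
    show "zero_near t0" using \<open>\<epsilon> > 0\<close> zero unfolding zero_near_def by blast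
    fix t assume "t \<in> I"
    from weak_helmholtz_zero_propagates[OF assms(1-3) S[OF this]] obtain r where "r > 0"
      and propagate: "\<And>a \<epsilon> s. \<epsilon> > 0 \<Longrightarrow> \<bar>a - t\<bar> < r \<Longrightarrow> (\<And>s. \<bar>s - a\<bar> < \<epsilon> \<Longrightarrow> u (x + s *\<^sub>R e) = 0)
        \<Longrightarrow> \<bar>s - t\<bar> < r \<Longrightarrow> u (x + s *\<^sub>R e) = 0" by blast
    have "zero_near b" if a: "\<bar>a - t\<bar> < r" "zero_near a" and b: "\<bar>b - t\<bar> < r" for a b
    proof -
      obtain \<epsilon> where "\<epsilon> > 0" "\<And>s. \<bar>s - a\<bar> < \<epsilon> \<Longrightarrow> u (x + s *\<^sub>R e) = 0" using a(2) by (auto simp: zero_near_def)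
      then have "u (x + s *\<^sub>R e) = 0" if "\<bar>s - t\<bar> < r" for s using propagate[OF _ a(1) _ that] by blast
      then show ?thesis unfolding zero_near_def using b by (intro exI[of _ "r - \<bar>b - t\<bar>"]) auto
    qed
    then show "\<exists>T. openin (top_of_set I) T \<and> t \<in> T \<and> (\<forall>a\<in>T. \<forall>b\<in>T. zero_near a \<longrightarrow> zero_near b)"
      using \<open>r > 0\<close> \<open>t \<in> I\<close> by (intro exI[of _ "I \<inter> ball t r"]) (auto simp: openin_open dist_real_def abs_minus_commute)
  qed
  then show ?thesis unfolding zero_near_def by (metis abs_zero cancel_comm_monoid_add_class.diff_cancel)
qed

section \<open>Rellich's lemma\<close>

lemma holomorphic_flat_eq_0:
  assumes g: "g holomorphic_on ball 0 r" and "r > 0" and z: "z \<longlonglongrightarrow> 0" "\<And>n. z n \<noteq> 0"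
    and flat: "\<And>m. (\<lambda>n. g (z n) / z n ^ m) \<longlonglongrightarrow> 0" and "w \<in> ball 0 r"
  shows "g w = 0"
proof (rule ccontr)
  assume "g w \<noteq> 0"
  define m where "m = nat (zorder g 0)"
  define p where "p = zor_poly g 0"
  have "\<exists>\<rho>>0. cball (0::complex) \<rho> \<subseteq> ball 0 r \<and> p holomorphic_on cball 0 \<rho> \<and>
      (\<forall>w\<in>cball 0 \<rho>. g w = p w * (w - 0) ^ m \<and> p w \<noteq> 0)"
    unfolding m_def p_def
    by (rule conjunct2[OF zorder_exist_zero[OF g open_ball convex_connected[OF convex_ball]]])
       (use \<open>r > 0\<close> \<open>g w \<noteq> 0\<close> \<open>w \<in> ball 0 r\<close> in auto)
  then obtain \<rho> where "\<rho> > 0" and p: "p holomorphic_on cball 0 \<rho>"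
    and factor: "\<And>w. w \<in> cball 0 \<rho> \<Longrightarrow> g w = p w * w ^ m \<and> p w \<noteq> 0" by auto
  have "isCont p 0"
    using holomorphic_on_imp_continuous_on[OF holomorphic_on_subset[OF p ball_subset_cball]] \<open>\<rho> > 0\<close>
    by (simp add: continuous_on_eq_continuous_at)
  then have "(\<lambda>n. p (z n)) \<longlonglongrightarrow> p 0" using z(1) by (rule isCont_tendsto_compose)
  moreover have "\<forall>\<^sub>F n in sequentially. z n \<in> ball 0 \<rho>"
    using z(1) open_ball by (rule topological_tendstoD) (use \<open>\<rho> > 0\<close> in simp)
  then have "\<forall>\<^sub>F n in sequentially. p (z n) = g (z n) / z n ^ m"
    by eventually_elim (use factor z(2) in auto)
  ultimately have "(\<lambda>n. g (z n) / z n ^ m) \<longlonglongrightarrow> p 0" by (rule Lim_transform_eventually)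
  then have "p 0 = 0" using flat LIMSEQ_unique by blast
  then show False using factor[of 0] \<open>\<rho> > 0\<close> by simp
qed

lemma exp_quotient_extends:
  assumes "r > 0" and f: "f holomorphic_on ball 0 r" and g: "g holomorphic_on ball 0 r"
    and quotient: "\<And>t. 0 < t \<Longrightarrow> t < r \<Longrightarrow> g (of_real t) = exp (c / of_real t) * f (of_real t)"
    and z: "norm z < r" "0 < Re z"
  shows "g z = exp (c / z) * f z"
proof -
  define U where "U = ball (0::complex) r \<inter> {z. Re z > 0}"
  have U: "open U" "connected U" unfolding U_def
    by (auto intro!: open_Int open_halfspace_Re_gt convex_connected convex_Int convex_halfspace_Re_gt)
  have "(\<lambda>z. g z - exp (c / z) * f z) holomorphic_on U"
    using f g by (intro holomorphic_intros) (auto simp: U_def elim: holomorphic_on_subset)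
  then have "g z - exp (c / z) * f z = 0"
    by (rule holomorphic_eq_0_real_interval[OF _ U \<open>r > 0\<close>]) (use quotient z in \<open>auto simp: U_def\<close>)
  then show ?thesis by simp
qed

lemma exp_decay_on_diagonal:
  assumes "k > 0" "y > 0" and z: "z = Complex (k / y) (- (k / y))" and "norm b \<le> M"
  shows "norm (exp (2 * \<i> * of_real k / z) * b / z ^ m) \<le> M / k ^ m * (y ^ m / exp y)"
proof -
  have "z \<noteq> 0" using assms(1,2) by (simp add: z complex_eq_iff)
  have "2 * \<i> * of_real k = Complex (- y) y * z" using assms(2) by (simp add: z complex_eq_iff)
  then have "2 * \<i> * of_real k / z = Complex (- y) y" by (simp add: divide_eq_eq \<open>z \<noteq> 0\<close>)
  then have "norm (exp (2 * \<i> * of_real k / z) * b) \<le> exp (- y) * M"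
    using assms(4) by (simp add: norm_mult norm_exp_eq_Re)
  moreover have "k / y \<le> norm z" using abs_Re_le_cmod[of z] assms(1,2) by (simp add: z)
  then have "(k / y) ^ m \<le> norm z ^ m" using assms(1,2) by (intro power_mono) auto
  ultimately have "norm (exp (2 * \<i> * of_real k / z) * b) / norm z ^ m \<le> (exp (- y) * M) / (k / y) ^ m"
    using assms(1,2) by (intro frac_le) (auto intro: order_trans[OF norm_ge_zero])
  then show ?thesis by (simp add: norm_divide norm_power exp_minus power_divide field_simps)
qed

text \<open>An essential singularity cannot be compensated: below the real axis the exponential is
  smaller than every power of \<open>z\<close>.\<close>

lemma holomorphic_exp_quotient_eq_0:
  assumes "r > 0" "k > (0::real)" and f: "f holomorphic_on ball 0 r" and g: "g holomorphic_on ball 0 r"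
    and quotient: "\<And>t. 0 < t \<Longrightarrow> t < r \<Longrightarrow> g (of_real t) = exp (2 * \<i> * of_real k / of_real t) * f (of_real t)"
    and t: "0 < t" "t < r"
  shows "f (of_real t) = 0"
proof -
  have "bounded (f ` cball 0 (r/2))" using f \<open>r > 0\<close>
    by (intro compact_imp_bounded compact_continuous_image holomorphic_on_imp_continuous_on) (auto elim: holomorphic_on_subset)
  then obtain M where M: "\<And>z. z \<in> cball 0 (r/2) \<Longrightarrow> norm (f z) \<le> M" unfolding bounded_iff by blast
  define y where "y n = 4 * k / r + real n" for n
  have y_pos: "y n > 0" for n using assms(1,2) by (simp add: y_def add_pos_nonneg)
  have y_top: "filterlim y at_top sequentially"
    unfolding y_def by (intro filterlim_tendsto_add_at_top[OF tendsto_const] filterlim_real_sequentially)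
  define z where "z n = Complex (k / y n) (- (k / y n))" for n
  have z_norm: "norm (z n) \<le> 2 * (k / y n)" for n
    using cmod_le[of "z n"] y_pos[of n] \<open>k > 0\<close> by (simp add: z_def)
  have decay: "norm (g (z n) / z n ^ m) \<le> M / k ^ m * (y n ^ m / exp (y n))" for n m
  proof -
    have "2 * (k / y n) \<le> r / 2" using y_pos[of n] assms(1,2) by (simp add: y_def field_simps)
    then have "norm (z n) \<le> r / 2" using z_norm[of n] by linarith
    moreover have "0 < Re (z n)" using y_pos[of n] \<open>k > 0\<close> by (simp add: z_def)
    ultimately have "g (z n) = exp (2 * \<i> * of_real k / z n) * f (z n)" "norm (f (z n)) \<le> M"
      using \<open>r > 0\<close> by (auto intro!: exp_quotient_extends[OF \<open>r > 0\<close> f g quotient] M)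
    then show ?thesis using exp_decay_on_diagonal[OF \<open>k > 0\<close> y_pos z_def] by simp
  qed
  have "g (of_real t) = 0"
  proof (rule holomorphic_flat_eq_0[OF g \<open>r > 0\<close>])
    have "(\<lambda>n. 2 * (k / y n)) \<longlonglongrightarrow> 2 * 0"
      by (intro tendsto_mult tendsto_const tendsto_divide_0[OF tendsto_const] filterlim_at_top_imp_at_infinity y_top)
    then show "z \<longlonglongrightarrow> 0"
      by (intro Lim_null_comparison[OF always_eventually[OF allI[OF z_norm]]]) (simp only: mult_zero_right)
    show "z n \<noteq> 0" for n using y_pos[of n] \<open>k > 0\<close> by (simp add: z_def complex_eq_iff)
    fix m
    have "(\<lambda>n. M / k ^ m * (y n ^ m / exp (y n))) \<longlonglongrightarrow> M / k ^ m * 0"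
      by (intro tendsto_intros filterlim_compose[OF tendsto_power_div_exp_0 y_top])
    then show "(\<lambda>n. g (z n) / z n ^ m) \<longlonglongrightarrow> 0"
      by (intro Lim_null_comparison[OF always_eventually[OF allI[OF decay]]]) simp
  qed (use t in auto)
  then show ?thesis using quotient[OF t] by auto
qed

lemma norm_wave_le:
  assumes "s > 0"
  shows "norm (wave \<kappa> (of_real s)) \<le> 1 / s" "norm (wave' \<kappa> (of_real s)) \<le> \<bar>\<kappa>\<bar> / (2 * s\<^sup>2) + 1 / (2 * s^3)"
proof -
  have unimodular: "norm (exp (\<i> * of_real \<kappa> * complex_of_real s)) = 1"
    by (metis mult.assoc norm_exp_i_times of_real_mult)
  show "norm (wave \<kappa> (of_real s)) \<le> 1 / s"
    unfolding wave_def norm_divide unimodular using assms by simp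
  have "norm (wave' \<kappa> (of_real s)) \<le> norm (\<i> * of_real \<kappa> / (2 * complex_of_real s ^ 2)) + norm (1 / (2 * complex_of_real s ^ 3))"
    unfolding wave'_def norm_mult[of "exp _"] unimodular using norm_triangle_ineq4 by simp
  also have "\<dots> = \<bar>\<kappa>\<bar> / (2 * s\<^sup>2) + 1 / (2 * s^3)"
    using assms by (simp add: norm_divide norm_mult norm_power)
  finally show "norm (wave' \<kappa> (of_real s)) \<le> \<bar>\<kappa>\<bar> / (2 * s\<^sup>2) + 1 / (2 * s^3)" .
qed

lemma norm_cutoff_kernel_le:
  assumes "0 \<le> q" "norm (8 * X' q * m) \<le> a" "6 * \<bar>X' q\<bar> + 4 * q * \<bar>X'' q\<bar> \<le> b" "s > 0"
  shows "norm (cutoff_kernel \<kappa> X' X'' q (of_real m) (of_real s)) \<le> a * (\<bar>\<kappa>\<bar> / (2 * s\<^sup>2) + 1 / (2 * s^3)) + b * (1 / s)"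
proof -
  have "norm (cutoff_kernel \<kappa> X' X'' q (of_real m) (of_real s))
      \<le> norm (complex_of_real (8 * X' q * m)) * norm (wave' \<kappa> (of_real s))
        + norm (complex_of_real (6 * X' q + 4 * q * X'' q)) * norm (wave \<kappa> (of_real s))"
    unfolding cutoff_kernel_def
    by (rule order_trans[OF norm_triangle_ineq]) (simp only: norm_mult of_real_mult order_refl)
  also have "\<dots> \<le> a * (\<bar>\<kappa>\<bar> / (2 * s\<^sup>2) + 1 / (2 * s^3)) + b * (1 / s)"
  proof (intro add_mono mult_mono norm_wave_le \<open>s > 0\<close>)
    show "norm (complex_of_real (8 * X' q * m)) \<le> a" using assms(2) by (simp only: norm_of_real) simp
    then show "0 \<le> a" by (rule order_trans[OF norm_ge_zero])
    have "\<bar>6 * X' q + 4 * q * X'' q\<bar> \<le> 6 * \<bar>X' q\<bar> + 4 * q * \<bar>X'' q\<bar>"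
      using \<open>0 \<le> q\<close> by (intro order_trans[OF abs_triangle_ineq]) (simp add: abs_mult)
    then show "norm (complex_of_real (6 * X' q + 4 * q * X'' q)) \<le> b" using assms(3) unfolding norm_of_real by linarith
    then show "0 \<le> b" by (rule order_trans[OF norm_ge_zero])
  qed auto
  finally show ?thesis .
qed

lemma norm_annulus_kernel_far_le:
  assumes \<rho>: "\<rho> \<ge> 1" "2 * norm y \<le> \<rho>" and x: "\<rho> \<le> norm x" "norm x \<le> 2 * \<rho>"
  shows "norm (annulus_kernel \<kappa> \<rho> (2 * \<rho>) 0 y x) \<le> 54 * (28 * \<bar>\<kappa>\<bar> + 64) / \<rho>\<^sup>2"
proof -
  define q where "q = x \<bullet> x"
  define s where "s = norm (x - y)"
  have "\<rho> > 0" using \<rho> by simp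
  have s: "\<rho>/2 \<le> s" "s \<le> 5/2 * \<rho>"
    using norm_triangle_ineq[of "x - y" y] norm_triangle_ineq4[of x y] x \<rho> by (auto simp: s_def)
  have q: "0 \<le> q" "q \<le> 4 * \<rho>\<^sup>2"
    using power_mono[OF x(2), of 2] by (auto simp: q_def power2_norm_eq_inner power_mult_distrib)
  have gap: "(2 * \<rho>)\<^sup>2 - \<rho>\<^sup>2 = 3 * \<rho>\<^sup>2" by (simp add: power_mult_distrib)
  have "\<rho>\<^sup>2 < (2 * \<rho>)\<^sup>2" using \<open>\<rho> > 0\<close> by (simp add: power_mult_distrib)
  from plateau_bounds(3,4)[OF this, of q]
  have X': "\<bar>plateau' (\<rho>\<^sup>2) ((2 * \<rho>)\<^sup>2) q\<bar> \<le> 18 / \<rho>\<^sup>2" and X'': "\<bar>plateau'' (\<rho>\<^sup>2) ((2 * \<rho>)\<^sup>2) q\<bar> \<le> 6 / \<rho>^4"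
    unfolding gap using \<open>\<rho> > 0\<close> by (auto simp: power_mult_distrib field_simps eval_nat_numeral)
  have "\<bar>x \<bullet> (x - y)\<bar> \<le> norm x * s" unfolding s_def by (rule Cauchy_Schwarz_ineq2)
  also have "\<dots> \<le> (2 * \<rho>) * (5/2 * \<rho>)" using x s \<open>\<rho> > 0\<close> by (intro mult_mono) auto
  finally have inner: "\<bar>x \<bullet> (x - y)\<bar> \<le> 5 * \<rho>\<^sup>2" by (simp add: power2_eq_square)
  have "norm (annulus_kernel \<kappa> \<rho> (2 * \<rho>) 0 y x) \<le> 54 * 14 * (\<bar>\<kappa>\<bar> / (2 * s\<^sup>2) + 1 / (2 * s^3)) + (54 * 4 / \<rho>\<^sup>2) * (1 / s)"
    unfolding annulus_kernel_def representation_kernel_def diff_zero q_def[symmetric] s_def[symmetric]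
  proof (rule norm_cutoff_kernel_le)
    have "norm (8 * plateau' (\<rho>\<^sup>2) ((2 * \<rho>)\<^sup>2) q * (x \<bullet> (x - y))) \<le> 8 * (18 / \<rho>\<^sup>2) * (5 * \<rho>\<^sup>2)"
      unfolding real_norm_def abs_mult using X' inner by (intro mult_mono) auto
    also have "\<dots> \<le> 54 * 14" using \<open>\<rho> > 0\<close> by simp
    finally show "norm (8 * plateau' (\<rho>\<^sup>2) ((2 * \<rho>)\<^sup>2) q * (x \<bullet> (x - y))) \<le> 54 * 14" .
    have "6 * \<bar>plateau' (\<rho>\<^sup>2) ((2 * \<rho>)\<^sup>2) q\<bar> + 4 * q * \<bar>plateau'' (\<rho>\<^sup>2) ((2 * \<rho>)\<^sup>2) q\<bar> \<le> 6 * (18 / \<rho>\<^sup>2) + 4 * (4 * \<rho>\<^sup>2) * (6 / \<rho>^4)"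
      using X' X'' q by (intro add_mono mult_mono) auto
    also have "\<dots> \<le> 54 * 4 / \<rho>\<^sup>2" using \<open>\<rho> > 0\<close> by (simp add: field_simps eval_nat_numeral)
    finally show "6 * \<bar>plateau' (\<rho>\<^sup>2) ((2 * \<rho>)\<^sup>2) q\<bar> + 4 * q * \<bar>plateau'' (\<rho>\<^sup>2) ((2 * \<rho>)\<^sup>2) q\<bar> \<le> 54 * 4 / \<rho>\<^sup>2" .
  qed (use q s \<open>\<rho> > 0\<close> in auto)
  also have "\<dots> \<le> 54 * 14 * (\<bar>\<kappa>\<bar> / (2 * (\<rho>/2)\<^sup>2) + 1 / (2 * (\<rho>/2)^3)) + (54 * 4 / \<rho>\<^sup>2) * (1 / (\<rho>/2))"
    using s \<open>\<rho> > 0\<close> by (intro add_mono mult_left_mono divide_left_mono power_mono mult_pos_pos) auto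
  also have "\<dots> = 54 * (28 * \<bar>\<kappa>\<bar> + 64 / \<rho>) / \<rho>\<^sup>2" using \<open>\<rho> > 0\<close> by (simp add: field_simps eval_nat_numeral)
  also have "\<dots> \<le> 54 * (28 * \<bar>\<kappa>\<bar> + 64) / \<rho>\<^sup>2"
    using \<rho>(1) by (intro divide_right_mono mult_left_mono add_left_mono) (auto simp: divide_le_eq)
  finally show ?thesis .
qed

lemma set_integrable_annulus_kernel:
  assumes "0 \<le> r" "r < R" "annulus y0 r R \<subseteq> K" "y \<notin> annulus y0 r R" "continuous_on K u"
  shows "set_integrable lborel K (\<lambda>x. u x * annulus_kernel \<kappa> r R y0 y x)"
proof -
  have "set_integrable lborel (annulus y0 r R) (\<lambda>x. u x * annulus_kernel \<kappa> r R y0 y x)"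
    unfolding set_integrable_def
    by (intro borel_integrable_compact compact_annulus continuous_on_mult continuous_on_subset[OF assms(5,3)]
        continuous_on_annulus_kernel assms)
  moreover have "indicator K x *\<^sub>R (u x * annulus_kernel \<kappa> r R y0 y x)
      = indicator (annulus y0 r R) x *\<^sub>R (u x * annulus_kernel \<kappa> r R y0 y x)" for x
    using annulus_kernel_eq_0[OF assms(1,2), of x y0 \<kappa> y] assms(3)
    by (cases "x \<in> annulus y0 r R") (auto simp: mem_annulus)
  ultimately show ?thesis by (simp only: set_integrable_def)
qed

lemma weak_helmholtz_annulus_representation:
  assumes \<kappa>: "\<kappa>\<^sup>2 = k\<^sup>2" and "open S" and u: "weak_helmholtz k S u" and S: "annulus y0 r1 R2 \<subseteq> S"
    and radii: "0 \<le> r1" "r1 < R1" "R1 < norm (y - y0)" "norm (y - y0) < r2" "r2 < R2"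
  shows "u y = representation_constant * ((LINT x:annulus y0 r2 R2|lborel. u x * annulus_kernel \<kappa> r2 R2 y0 y x)
    - (LINT x:annulus y0 r1 R1|lborel. u x * annulus_kernel \<kappa> r1 R1 y0 y x))"
proof -
  have inner: "0 \<le> r1" "r1 < R1" and outer: "0 \<le> r2" "r2 < R2" using radii norm_ge_zero[of "y - y0"] by linarith+
  define K where "K = annulus y0 r1 R2"
  define \<eta> where "\<eta> = min (norm (y - y0) - R1) (r2 - norm (y - y0))"
  have near: "R1 \<le> norm (x - y0) \<and> norm (x - y0) \<le> r2" if "x \<in> ball y \<eta>" for x
    using that norm_triangle_ineq3[of "x - y0" "y - y0"] by (auto simp: \<eta>_def dist_norm norm_minus_commute)
  have annuli_subset: "annulus y0 r1 R1 \<subseteq> K" "annulus y0 r2 R2 \<subseteq> K" using radii by (auto simp: K_def mem_annulus subset_iff)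
  have cont: "continuous_on K u"
    using u S unfolding weak_helmholtz_def K_def by (blast intro: continuous_on_subset)
  let ?X = "\<lambda>q. plateau (r2\<^sup>2) (R2\<^sup>2) q - plateau (r1\<^sup>2) (R1\<^sup>2) q"
  have "of_real (?X (sqdist y0 y)) * u y = representation_constant *
      (LINT x:K|lborel. u x * (annulus_kernel \<kappa> r2 R2 y0 y x - annulus_kernel \<kappa> r1 R1 y0 y x))"
    unfolding annulus_kernel_def representation_kernel_diff[symmetric]
  proof (rule representation_formula[OF \<kappa> \<open>open S\<close> u has_C2_derivatives_diff[OF has_C2_derivatives_plateau_square[OF outer]
          has_C2_derivatives_plateau_square[OF inner]], where \<eta>=\<eta>])
    show "?X (sqdist y0 x) = 0" if "x \<notin> K" for x
      using that plateau_sqdist_inside[OF inner, of x y0] plateau_sqdist_outside[OF inner, of x y0]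
        plateau_sqdist_inside[OF outer, of x y0] plateau_sqdist_outside[OF outer, of x y0] radii
      by (auto simp: K_def mem_annulus)
    show "plateau' (r2\<^sup>2) (R2\<^sup>2) (sqdist y0 x) - plateau' (r1\<^sup>2) (R1\<^sup>2) (sqdist y0 x) = 0 \<and>
        plateau'' (r2\<^sup>2) (R2\<^sup>2) (sqdist y0 x) - plateau'' (r1\<^sup>2) (R1\<^sup>2) (sqdist y0 x) = 0" if "x \<in> ball y \<eta>" for x
      using near[OF that] plateau_sqdist_outside[OF inner, of x y0] plateau_sqdist_inside[OF outer, of x y0] by simp
    show "y \<in> S" using S radii by (auto simp: mem_annulus subset_iff)
  qed (use S radii in \<open>auto simp: K_def compact_annulus \<eta>_def\<close>)
  moreover have "?X (sqdist y0 y) = 1"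
    using plateau_sqdist_outside[OF inner, of y y0] plateau_sqdist_inside[OF outer, of y y0] radii by simp
  moreover have "(LINT x:K|lborel. u x * (annulus_kernel \<kappa> r2 R2 y0 y x - annulus_kernel \<kappa> r1 R1 y0 y x))
    = (LINT x:K|lborel. u x * annulus_kernel \<kappa> r2 R2 y0 y x) - (LINT x:K|lborel. u x * annulus_kernel \<kappa> r1 R1 y0 y x)"
    unfolding right_diff_distrib
    by (intro set_integral_diff set_integrable_annulus_kernel inner outer annuli_subset cont) (use radii in \<open>auto simp: mem_annulus\<close>)
  ultimately show ?thesis
    unfolding set_integral_annulus_kernel[OF inner annuli_subset(1)] set_integral_annulus_kernel[OF outer annuli_subset(2)] by simp
qed

lemma norm_far_annulus_integral_le:
  assumes V: "continuous_on {x. R < norm x} V" and decay: "\<And>x. R < norm x \<Longrightarrow> norm (V x) \<le> C / (norm x)\<^sup>2"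
    and \<rho>: "\<rho> \<ge> 1" "2 * norm y \<le> \<rho>" "R < \<rho>"
  shows "norm (LINT x:annulus 0 \<rho> (2*\<rho>)|lborel. V x * annulus_kernel \<kappa> \<rho> (2*\<rho>) 0 y x)
    \<le> 8 * unit_ball_vol 3 * \<bar>C\<bar> * (54 * (28 * \<bar>\<kappa>\<bar> + 64)) / \<rho>" (is "norm ?far \<le> ?D / \<rho>")
proof -
  have "\<rho> > 0" "\<rho> > norm y" using \<rho> norm_ge_zero[of y] by linarith+
  define B where "B = \<bar>C\<bar> / \<rho>\<^sup>2 * (54 * (28 * \<bar>\<kappa>\<bar> + 64) / \<rho>\<^sup>2)"
  have "B \<ge> 0" by (simp add: B_def)
  have "continuous_on (annulus 0 \<rho> (2*\<rho>)) V"
    using V \<open>\<rho> > R\<close> by (auto simp: mem_annulus intro: continuous_on_subset)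
  then have integrable: "integrable lborel (\<lambda>x. indicator (annulus 0 \<rho> (2*\<rho>)) x *\<^sub>R (V x * annulus_kernel \<kappa> \<rho> (2*\<rho>) 0 y x))"
    using \<open>\<rho> > norm y\<close> \<open>\<rho> > 0\<close>
    by (intro borel_integrable_compact compact_annulus continuous_on_mult continuous_on_annulus_kernel) (auto simp: mem_annulus)
  have "norm ?far \<le> (LINT x|lborel. indicator (cball (0::real^3) (2 * \<rho>)) x *\<^sub>R B)"
    unfolding set_lebesgue_integral_def
  proof (rule Bochner_Integration.integral_norm_bound_integral[OF integrable])
    show "integrable lborel (\<lambda>x. indicator (cball (0::real^3) (2 * \<rho>)) x *\<^sub>R B)"
      by (intro borel_integrable_compact) auto
    fix x :: "real^3"
    show "norm (indicator (annulus 0 \<rho> (2*\<rho>)) x *\<^sub>R (V x * annulus_kernel \<kappa> \<rho> (2*\<rho>) 0 y x)) \<le> indicator (cball 0 (2 * \<rho>)) x *\<^sub>R B"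
    proof (cases "x \<in> annulus 0 \<rho> (2*\<rho>)")
      case True
      then have x: "\<rho> \<le> norm x" "norm x \<le> 2 * \<rho>" by (auto simp: mem_annulus)
      have "norm (V x) \<le> C / (norm x)\<^sup>2" by (rule decay) (use x \<open>\<rho> > R\<close> in auto)
      also have "\<dots> \<le> \<bar>C\<bar> / \<rho>\<^sup>2" using x \<open>\<rho> > 0\<close> by (intro frac_le power_mono) auto
      finally have "norm (V x * annulus_kernel \<kappa> \<rho> (2*\<rho>) 0 y x) \<le> B"
        unfolding norm_mult B_def by (intro mult_mono norm_annulus_kernel_far_le \<rho> x) auto
      then show ?thesis using x True by simp
    qed (use \<open>B \<ge> 0\<close> in simp)
  qed
  also have "\<dots> = ?D / \<rho>"
    using \<open>\<rho> > 0\<close> by (simp add: content_cball power_mult_distrib B_def) (simp add: field_simps eval_nat_numeral)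
  finally show ?thesis .
qed

lemma exterior_representation:
  assumes "R > 0" and V: "weak_helmholtz k {x. R < norm x} V"
    and decay: "\<And>x. R < norm x \<Longrightarrow> norm (V x) \<le> C / (norm x)\<^sup>2"
    and \<kappa>: "\<kappa>\<^sup>2 = k\<^sup>2" and y: "norm y > 3 * R"
  shows "V y = - representation_constant *
    (LINT x:annulus 0 (2*R) (3*R)|lborel. V x * annulus_kernel \<kappa> (2*R) (3*R) 0 y x)"
proof -
  have "open {x::real^3. R < norm x}" by (intro open_Collect_less continuous_intros)
  define near where "near = (LINT x:annulus 0 (2*R) (3*R)|lborel. V x * annulus_kernel \<kappa> (2*R) (3*R) 0 y x)"
  define far where "far \<rho> = (LINT x:annulus 0 \<rho> (2*\<rho>)|lborel. V x * annulus_kernel \<kappa> \<rho> (2*\<rho>) 0 y x)" for \<rho>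
  define D where "D = 8 * unit_ball_vol 3 * \<bar>C\<bar> * (54 * (28 * \<bar>\<kappa>\<bar> + 64))"
  have representation: "V y = representation_constant * (far \<rho> - near)" if "norm y < \<rho>" for \<rho>
    unfolding far_def near_def
    by (rule weak_helmholtz_annulus_representation[OF \<kappa> \<open>open {x. R < norm x}\<close> V])
       (use \<open>R > 0\<close> y that in \<open>auto simp: mem_annulus\<close>)
  have far_bound: "norm (far \<rho>) \<le> D / \<rho>" if \<rho>: "\<rho> \<ge> 1" "2 * norm y \<le> \<rho>" for \<rho>
    unfolding far_def D_def using V decay \<rho> y \<open>R > 0\<close>
    by (intro norm_far_annulus_integral_le[where R=R]) (auto simp: weak_helmholtz_def)
  have "((\<lambda>\<rho>. D / \<rho>) \<longlongrightarrow> 0) at_top" by (rule tendsto_divide_0[OF tendsto_const filterlim_at_top_imp_at_infinity[OF filterlim_ident]])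
  moreover have "\<forall>\<^sub>F \<rho> in at_top. norm (far \<rho>) \<le> D / \<rho>"
    using eventually_ge_at_top[of "max 1 (2 * norm y)"] by eventually_elim (use far_bound in auto)
  ultimately have "(far \<longlongrightarrow> 0) at_top" by (rule Lim_null_comparison[rotated])
  then have "((\<lambda>\<rho>. representation_constant * (far \<rho> - near)) \<longlongrightarrow> representation_constant * (0 - near)) at_top"
    by (intro tendsto_intros)
  moreover have "\<forall>\<^sub>F \<rho> in at_top. representation_constant * (far \<rho> - near) = V y"
    using eventually_gt_at_top[of "norm y"] by eventually_elim (use representation in auto)
  ultimately have "((\<lambda>\<rho>::real. V y) \<longlongrightarrow> representation_constant * (0 - near)) at_top" by (rule Lim_transform_eventually)
  then show ?thesis by (simp add: near_def tendsto_const_iff)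
qed

text \<open>With \<open>z = 1/t\<close> and \<open>\<sigma> = |x - t e| / t\<close>, this is \<open>t e\<^sup>-\<^sup>i\<^sup>\<kappa>\<^sup>t\<close> times the kernel of the representation at \<open>t e\<close>;
  it is regular at \<open>z = 0\<close> because \<open>t (\<sigma> - 1) = (z q - 2 p) / (\<sigma> + 1)\<close>.\<close>

definition pattern_kernel ::
  "real \<Rightarrow> (real \<Rightarrow> real) \<Rightarrow> (real \<Rightarrow> real) \<Rightarrow> real \<Rightarrow> real \<Rightarrow> complex \<Rightarrow> complex \<Rightarrow> complex" where
  "pattern_kernel \<kappa> X' X'' q p \<sigma> z = exp (\<i> * of_real \<kappa> * ((z * of_real q - 2 * of_real p) / (\<sigma> + 1))) *
     (of_real (8 * X' q) * ((z * of_real q - of_real p) * (\<i> * of_real \<kappa> / (2 * \<sigma>\<^sup>2) - z / (2 * \<sigma>^3)))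
      + of_real (6 * X' q + 4 * q * X'' q) * (1 / \<sigma>))"

lemma holomorphic_on_pattern_kernel:
  assumes "\<sigma> holomorphic_on B" "\<And>z. z \<in> B \<Longrightarrow> \<sigma> z \<noteq> 0" "\<And>z. z \<in> B \<Longrightarrow> \<sigma> z + 1 \<noteq> 0"
  shows "(\<lambda>z. pattern_kernel \<kappa> X' X'' q p (\<sigma> z) z) holomorphic_on B"
  unfolding pattern_kernel_def using assms by (intro holomorphic_intros) auto

lemma continuous_on_pattern_kernel:
  assumes X: "has_C2_derivatives X X' X''" and "continuous_on B q" "continuous_on B p" "continuous_on B \<sigma>" "continuous_on B w"
    and "\<And>z. z \<in> B \<Longrightarrow> \<sigma> z \<noteq> 0" "\<And>z. z \<in> B \<Longrightarrow> \<sigma> z + 1 \<noteq> 0"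
  shows "continuous_on B (\<lambda>z. pattern_kernel \<kappa> X' X'' (q z) (p z) (\<sigma> z) (w z))"
proof -
  have "continuous_on B (\<lambda>z. X' (q z))" "continuous_on B (\<lambda>z. X'' (q z))"
    using assms(2) by (auto intro: continuous_on_compose2[OF has_C2_derivatives_continuous(2)[OF X, of UNIV]]
        continuous_on_compose2[OF has_C2_derivatives_continuous(3)[OF X, of UNIV]])
  then show ?thesis unfolding pattern_kernel_def using assms by (intro continuous_intros) auto
qed

lemma pattern_kernel_eq:
  assumes "t > 0" "s > 0" "s\<^sup>2 = q - 2 * t * p + t\<^sup>2"
  shows "pattern_kernel \<kappa> X' X'' q p (of_real (s / t)) (of_real (1 / t))
    = of_real t * exp (- (\<i> * of_real \<kappa> * of_real t)) * cutoff_kernel \<kappa> X' X'' q (of_real (q - t * p)) (of_real s)"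
proof -
  define A where "A = \<i> * of_real \<kappa> / (2 * (complex_of_real s)^2) - 1 / (2 * (of_real s)^3)"
  have nonzero: "complex_of_real s \<noteq> 0" "complex_of_real t \<noteq> 0" using assms(1,2) by auto
  have "1/t * q - 2 * p = (s - t) * (s / t + 1)" using assms(1,3) by (simp add: field_simps power2_eq_square)
  moreover have "s / t + 1 \<noteq> 0" using assms(1,2) by (simp add: add_nonneg_eq_0_iff)
  ultimately have "(1/t * q - 2 * p) / (s / t + 1) = s - t" by (metis nonzero_mult_div_cancel_right)
  from arg_cong[OF this, of complex_of_real]
  have path: "(of_real (1/t) * of_real q - 2 * of_real p) / (of_real (s / t) + 1) = complex_of_real (s - t)"
    by (simp only: of_real_1 of_real_numeral of_real_add of_real_diff of_real_divide of_real_mult)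
  have phase: "exp (\<i> * of_real \<kappa> * ((of_real (1/t) * of_real q - 2 * of_real p) / (of_real (s / t) + 1)))
      = exp (- (\<i> * of_real \<kappa> * of_real t)) * exp (\<i> * of_real \<kappa> * of_real s)"
    unfolding path exp_add[symmetric] of_real_diff by (simp add: algebra_simps)
  have "of_real (1/t) * of_real q - of_real p = complex_of_real (q - t * p) / of_real t"
    using nonzero by (simp add: field_simps)
  moreover have "\<i> * of_real \<kappa> / (2 * (of_real (s / t))\<^sup>2) - of_real (1/t) / (2 * (complex_of_real (s / t))^3) = (of_real t)\<^sup>2 * A"
    using nonzero by (simp add: A_def field_simps power2_eq_square power3_eq_cube)
  ultimately have "pattern_kernel \<kappa> X' X'' q p (of_real (s / t)) (of_real (1 / t))
    = exp (- (\<i> * of_real \<kappa> * of_real t)) * exp (\<i> * of_real \<kappa> * of_real s) *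
      (of_real (8 * X' q) * (of_real (q - t * p) / of_real t * ((of_real t)\<^sup>2 * A)) + of_real (6 * X' q + 4 * q * X'' q) * (1 / of_real (s / t)))"
    unfolding pattern_kernel_def phase by (simp only:)
  also have "\<dots> = of_real t * exp (- (\<i> * of_real \<kappa> * of_real t)) *
      (of_real (8 * X' q) * of_real (q - t * p) * (exp (\<i> * of_real \<kappa> * of_real s) * A)
       + of_real (6 * X' q + 4 * q * X'' q) * (exp (\<i> * of_real \<kappa> * of_real s) / of_real s))"
  proof -
    have "E * W * (a * (w / \<tau> * (\<tau>\<^sup>2 * A)) + b * (1 / (\<sigma> / \<tau>))) = \<tau> * E * (a * w * (W * A) + b * (W / \<sigma>))"
      if "\<sigma> \<noteq> 0" "\<tau> \<noteq> 0" for \<tau> \<sigma> w a b E W :: complex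
      using that by (simp add: field_simps power2_eq_square)
    from this[OF nonzero] show ?thesis by (simp only: of_real_divide)
  qed
  finally show ?thesis by (simp only: cutoff_kernel_def wave_def wave'_def A_def)
qed

lemma line_dist_add_1_nonzero: "line_dist a p b z + 1 \<noteq> 0"
proof
  assume "line_dist a p b z + 1 = 0"
  then have "Re (line_dist a p b z) = - 1" by (simp add: complex_eq_iff)
  moreover have "0 \<le> Re (line_dist a p b z)"
    unfolding line_dist_def using csqrt_principal[of "of_real a - 2 * z * of_real p + z\<^sup>2 * of_real b"] by linarith
  ultimately show False by linarith
qed

lemma annulus_kernel_eq_pattern_kernel:
  assumes e: "norm e = 1" and "t > 0" "x \<noteq> t *\<^sub>R e"
  shows "of_real t * exp (- (\<i> * of_real \<kappa> * of_real t)) * annulus_kernel \<kappa> r R 0 (t *\<^sub>R e) x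
    = pattern_kernel \<kappa> (plateau' (r\<^sup>2) (R\<^sup>2)) (plateau'' (r\<^sup>2) (R\<^sup>2)) (x \<bullet> x) (x \<bullet> e)
        (line_dist 1 (x \<bullet> e) (x \<bullet> x) (of_real (1 / t))) (of_real (1 / t))"
proof -
  define s where "s = norm (x - t *\<^sub>R e)"
  have "e \<bullet> e = 1" using e by (simp add: norm_eq_1)
  have "s > 0" using assms(3) by (simp add: s_def)
  have s_sq: "s\<^sup>2 = x \<bullet> x - 2 * t * (x \<bullet> e) + t\<^sup>2"
    unfolding s_def power2_norm_eq_inner using \<open>e \<bullet> e = 1\<close>
    by (simp add: inner_diff_right inner_diff_left inner_commute power2_eq_square algebra_simps)
  have "line_dist 1 (x \<bullet> e) (x \<bullet> x) (of_real (1 / t)) = csqrt (of_real ((s / t)\<^sup>2))"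
    unfolding line_dist_def power_divide s_sq using \<open>t > 0\<close> by (simp add: field_simps power2_eq_square)
  then have "line_dist 1 (x \<bullet> e) (x \<bullet> x) (of_real (1 / t)) = of_real (s / t)"
    using \<open>s > 0\<close> \<open>t > 0\<close> by (simp add: csqrt_of_real_nonneg)
  moreover have "x \<bullet> (x - t *\<^sub>R e) = x \<bullet> x - t * (x \<bullet> e)" by (simp add: inner_diff_right)
  ultimately show ?thesis
    unfolding annulus_kernel_def representation_kernel_def s_def[symmetric] diff_zero
    by (simp only: pattern_kernel_eq[OF \<open>t > 0\<close> \<open>s > 0\<close> s_sq])
qed

definition pattern_integrand :: "real \<Rightarrow> real \<Rightarrow> (real^3 \<Rightarrow> complex) \<Rightarrow> real^3 \<Rightarrow> real^3 \<Rightarrow> complex \<Rightarrow> complex" where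
  "pattern_integrand \<kappa> R V e x z =
    V x * pattern_kernel \<kappa> (plateau' ((2*R)\<^sup>2) ((3*R)\<^sup>2)) (plateau'' ((2*R)\<^sup>2) ((3*R)\<^sup>2))
      (x \<bullet> x) (x \<bullet> e) (line_dist 1 (x \<bullet> e) (x \<bullet> x) z) z"

lemma holomorphic_on_pattern_integral:
  assumes "R > 0" and V: "continuous_on {x. R < norm x} V" and e: "norm e = 1"
  shows "(\<lambda>z. LINT x:annulus 0 (2*R) (3*R)|lborel. pattern_integrand \<kappa> R V e x z) holomorphic_on ball 0 (1 / (12 * R))"
proof (rule holomorphic_on_set_integral)
  let ?A = "annulus (0::real^3) (2*R) (3*R)" and ?D = "cball 0 (1 / (12 * R)) :: complex set"
  have "e \<bullet> e = 1" using e by (simp add: norm_eq_1)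
  have p_le: "(x \<bullet> e)\<^sup>2 \<le> 1 * (x \<bullet> x)" for x
    using Cauchy_Schwarz_ineq[of x e] \<open>e \<bullet> e = 1\<close> by simp
  have q_small: "(norm z)\<^sup>2 * (x \<bullet> x) \<le> 1 / 16" if "x \<in> ?A" "norm z \<le> 1 / (12 * R)" for x and z :: complex
  proof -
    have "(norm z * norm x)\<^sup>2 \<le> (1 / (12 * R) * (3 * R))\<^sup>2"
      using that by (intro power_mono mult_mono) (auto simp: mem_annulus)
    then show ?thesis using \<open>R > 0\<close> by (simp add: power_mult_distrib power2_norm_eq_inner power_divide)
  qed
  have plateau: "has_C2_derivatives (plateau ((2*R)\<^sup>2) ((3*R)\<^sup>2)) (plateau' ((2*R)\<^sup>2) ((3*R)\<^sup>2)) (plateau'' ((2*R)\<^sup>2) ((3*R)\<^sup>2))"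
    by (rule has_C2_derivatives_plateau_square) (use \<open>R > 0\<close> in auto)
  show "compact ?A" by (rule compact_annulus)
  show "pattern_integrand \<kappa> R V e x holomorphic_on ball 0 (1 / (12 * R))" if "x \<in> ?A" for x
    unfolding pattern_integrand_def
    by (intro holomorphic_on_mult holomorphic_on_const holomorphic_on_pattern_kernel holomorphic_on_line_dist
      line_dist_nonzero line_dist_add_1_nonzero p_le q_small that) auto
  have "continuous_on (?A \<times> ?D) (\<lambda>r. V (fst r))"
    by (rule continuous_on_compose2[OF V]) (use \<open>R > 0\<close> in \<open>auto simp: mem_annulus intro!: continuous_intros\<close>)
  moreover have "continuous_on (?A \<times> ?D) (\<lambda>r. fst r \<bullet> fst r)" "continuous_on (?A \<times> ?D) (\<lambda>r. fst r \<bullet> e)"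
    by (intro continuous_intros)+
  ultimately show "continuous_on (?A \<times> ?D) (\<lambda>r. pattern_integrand \<kappa> R V e (fst r) (snd r))"
    unfolding pattern_integrand_def
    by (intro continuous_on_mult continuous_on_pattern_kernel[OF plateau] continuous_on_line_dist line_dist_nonzero
        line_dist_add_1_nonzero continuous_intros p_le q_small) auto
qed

lemma radiation_pattern_holomorphic:
  fixes e :: "real^3"
  assumes "R > 0" and V: "weak_helmholtz k {x. R < norm x} V"
    and decay: "\<And>x. R < norm x \<Longrightarrow> norm (V x) \<le> C / (norm x)\<^sup>2" and \<kappa>: "\<kappa>\<^sup>2 = k\<^sup>2" and e: "norm e = 1"
  obtains h where "h holomorphic_on ball 0 (1 / (12 * R))"
    "\<And>t. t > 12 * R \<Longrightarrow> of_real t * exp (- (\<i> * of_real \<kappa> * of_real t)) * V (t *\<^sub>R e) = h (of_real (1 / t))"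
proof -
  let ?A = "annulus (0::real^3) (2*R) (3*R)"
  define h where "h z = - representation_constant * (LINT x:?A|lborel. pattern_integrand \<kappa> R V e x z)" for z
  have "h holomorphic_on ball 0 (1 / (12 * R))"
    unfolding h_def using V by (intro holomorphic_intros holomorphic_on_pattern_integral \<open>R > 0\<close> e) (simp add: weak_helmholtz_def)
  moreover have "of_real t * exp (- (\<i> * of_real \<kappa> * of_real t)) * V (t *\<^sub>R e) = h (of_real (1 / t))" if t: "t > 12 * R" for t
  proof -
    have "t > 0" using t \<open>R > 0\<close> by linarith
    then have far: "norm (t *\<^sub>R e) > 3 * R" using t e \<open>R > 0\<close> by simp
    let ?a = "of_real t * exp (- (\<i> * of_real \<kappa> * of_real t))"
    let ?k = "annulus_kernel \<kappa> (2*R) (3*R) 0 (t *\<^sub>R e)"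
    have "?a * (V x * ?k x) = pattern_integrand \<kappa> R V e x (of_real (1 / t))" if "x \<in> ?A" for x
    proof -
      have "x \<noteq> t *\<^sub>R e" using that far by (auto simp: mem_annulus)
      from annulus_kernel_eq_pattern_kernel[OF e \<open>t > 0\<close> this, of \<kappa> "2*R" "3*R"] show ?thesis
        by (simp only: pattern_integrand_def mult.left_commute[of ?a])
    qed
    then have "(LINT x:?A|lborel. pattern_integrand \<kappa> R V e x (of_real (1 / t))) = (LINT x:?A|lborel. ?a * (V x * ?k x))"
      by (intro set_lebesgue_integral_cong) (auto simp: compact_imp_closed[OF compact_annulus])
    also have "\<dots> = ?a * (LINT x:?A|lborel. V x * ?k x)" by (rule set_integral_mult_right)
    finally have "h (of_real (1 / t)) = - representation_constant * (?a * (LINT x:?A|lborel. V x * ?k x))"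
      by (simp only: h_def)
    also have "\<dots> = ?a * V (t *\<^sub>R e)"
      by (simp only: exterior_representation[OF \<open>R > 0\<close> V decay \<kappa> far] mult.left_commute)
    finally show ?thesis by (rule sym)
  qed
  ultimately show ?thesis by (rule that)
qed

theorem rellich:
  fixes x :: "real^3"
  assumes "R > 0" "k > 0" and V: "weak_helmholtz k {x. R < norm x} V"
    and decay: "\<And>x. R < norm x \<Longrightarrow> norm (V x) \<le> C / (norm x)\<^sup>2" and x: "norm x > 12 * R"
  shows "V x = 0"
proof -
  define e where "e = x /\<^sub>R norm x"
  define t where "t = norm x"
  have t: "t > 0" "t > 12 * R" using x \<open>R > 0\<close> by (auto simp: t_def)
  have "norm e = 1" using t by (simp add: e_def t_def)
  obtain f where f: "f holomorphic_on ball 0 (1 / (12 * R))"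
    "\<And>t. t > 12 * R \<Longrightarrow> of_real t * exp (- (\<i> * of_real k * of_real t)) * V (t *\<^sub>R e) = f (of_real (1 / t))"
    by (rule radiation_pattern_holomorphic[OF \<open>R > 0\<close> V decay, of k e]) (use that \<open>norm e = 1\<close> in auto)
  obtain g where g: "g holomorphic_on ball 0 (1 / (12 * R))"
    "\<And>t. t > 12 * R \<Longrightarrow> of_real t * exp (- (\<i> * of_real (- k) * of_real t)) * V (t *\<^sub>R e) = g (of_real (1 / t))"
    by (rule radiation_pattern_holomorphic[OF \<open>R > 0\<close> V decay, of "- k" e]) (use that \<open>norm e = 1\<close> in auto)
  have "f (of_real (1 / t)) = 0"
  proof (rule holomorphic_exp_quotient_eq_0[OF _ \<open>k > 0\<close> f(1) g(1)])
    fix s :: real assume s: "0 < s" "s < 1 / (12 * R)"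
    define \<tau> where "\<tau> = 1 / s"
    have \<tau>: "\<tau> > 12 * R" "s = 1 / \<tau>" using s \<open>R > 0\<close> by (auto simp: \<tau>_def field_simps)
    have "exp (2 * \<i> * of_real k / of_real s) = exp (\<i> * of_real k * of_real \<tau>) * exp (\<i> * of_real k * of_real \<tau>)"
      by (simp add: \<tau>_def field_simps flip: exp_add)
    moreover have "exp (- (\<i> * of_real k * of_real \<tau>)) * exp (\<i> * of_real k * of_real \<tau>) = (1::complex)"
      by (simp flip: exp_add)
    ultimately show "g (of_real s) = exp (2 * \<i> * of_real k / of_real s) * f (of_real s)"
      unfolding \<tau>(2) f(2)[OF \<tau>(1), symmetric] g(2)[OF \<tau>(1), symmetric]
      by (simp add: algebra_simps flip: \<tau>(2))
  qed (use t \<open>R > 0\<close> in \<open>auto simp: field_simps\<close>)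
  then have "V (t *\<^sub>R e) = 0" using f(2)[OF t(2)] t(1) by simp
  then show ?thesis using t by (simp add: e_def t_def)
qed

section \<open>Odd reflection\<close>

definition scale_axis :: "'n \<Rightarrow> real \<Rightarrow> real^'n \<Rightarrow> real^'n" where
  "scale_axis j c x = x + ((c - 1) * x$j) *\<^sub>R axis j 1"

lemma scale_axis_component: "scale_axis j c x $ i = (if i = j then c * x$j else x$i)"
  by (simp add: scale_axis_def axis_def algebra_simps)

lemma norm_le_scale_axis: "norm x \<le> norm (scale_axis j c x) + \<bar>1 - c\<bar> * \<bar>x$j\<bar>"
proof -
  have "x = scale_axis j c x + ((1 - c) * x$j) *\<^sub>R axis j 1" by (simp add: scale_axis_def algebra_simps)
  then show ?thesis
    using norm_triangle_ineq[of "scale_axis j c x" "((1 - c) * x$j) *\<^sub>R axis j 1"] by (simp add: norm_axis_1 abs_mult)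
qed

lemma mirror_0_eq_scale_axis: "mirror j 0 = scale_axis j (- 1)"
  by (rule ext) (simp add: vec_eq_iff mirror_component scale_axis_component)

lemma mirror_0_eq_self_iff: "mirror j 0 x = x \<longleftrightarrow> x$j = 0"
  by (auto simp: vec_eq_iff mirror_component)

lemma norm_mirror_0: "norm (mirror j 0 x) = norm x"
proof -
  have "(\<Sum>i\<in>UNIV. (mirror j 0 x $ i)\<^sup>2) = (\<Sum>i\<in>UNIV. (x $ i)\<^sup>2)"
    by (rule sum.cong) (auto simp: mirror_component)
  then show ?thesis by (simp add: norm_vec_def L2_set_def)
qed

lemma integral_scale_axis:
  fixes f :: "real^'n \<Rightarrow> 'b::{banach, second_countable_topology}"
  assumes "f \<in> borel_measurable borel" "c \<noteq> 0"
  shows "(LINT x|lborel. f x) = \<bar>c\<bar> *\<^sub>R (LINT x|lborel. f (scale_axis j c x))"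
proof -
  let ?c = "\<lambda>b::real^'n. if b = axis j 1 then c else 1"
  have j: "axis j 1 \<in> (Basis :: (real^'n) set)" by (simp add: axis_in_Basis_iff)
  have scale: "0 + (\<Sum>b\<in>Basis. (?c b * (x \<bullet> b)) *\<^sub>R b) = scale_axis j c x" for x :: "real^'n"
  proof -
    have "(\<Sum>b\<in>Basis. (?c b * (x \<bullet> b)) *\<^sub>R b) = (\<Sum>b\<in>Basis. (x \<bullet> b) *\<^sub>R b + (if b = axis j 1 then ((c - 1) * (x \<bullet> b)) *\<^sub>R b else 0))"
      by (rule sum.cong) (auto simp: algebra_simps simp flip: scaleR_left_distrib)
    also have "\<dots> = scale_axis j c x"
      using j by (simp add: sum.distrib euclidean_representation scale_axis_def inner_axis)
    finally show ?thesis by simp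
  qed
  have "(\<Prod>b\<in>Basis. \<bar>?c b\<bar>) = (\<Prod>b\<in>(Basis :: (real^'n) set). if b = axis j 1 then \<bar>c\<bar> else 1)" by (rule prod.cong) auto
  also have "\<dots> = \<bar>c\<bar>" using j by simp
  finally show ?thesis using integral_lborel_diagonal[OF assms(1), of ?c 0] assms(2) unfolding scale by simp
qed

lemma has_C2_partials_slab_cutoff:
  assumes X: "has_C2_derivatives X X' X''"
  shows "has_C2_partials (\<lambda>x::real^'n. complex_of_real (1 - X ((x$j)\<^sup>2)))
    (\<lambda>i x. (if i = j then 2 * x$j else 0) *\<^sub>R complex_of_real (- X' ((x$j)\<^sup>2)))
    (\<lambda>i x. (if i = j then 2 * x$j else 0)\<^sup>2 *\<^sub>R complex_of_real (- X'' ((x$j)\<^sup>2))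
       + (if i = j then 2 else 0) *\<^sub>R complex_of_real (- X' ((x$j)\<^sup>2)))"
proof (rule has_C2_partials_compose[where f="\<lambda>q. complex_of_real (1 - X q)" and f'="\<lambda>q. complex_of_real (- X' q)"])
  have component: "has_C2_partials (\<lambda>x::real^'n. x$j) (\<lambda>i x. if i = j then 1 else 0) (\<lambda>i x. 0)"
    unfolding has_C2_partials_def by (intro conjI allI has_second_partials_component continuous_intros)
  show "has_C2_partials (\<lambda>x::real^'n. (x$j)\<^sup>2) (\<lambda>i x. if i = j then 2 * x$j else 0) (\<lambda>i x. if i = j then 2 else 0)"
  proof -
    have "(\<lambda>i x. x$j * (if i = j then 1 else 0) + (if i = j then 1 else 0) * x$j) = (\<lambda>i (x::real^'n). if i = j then 2 * x$j else 0)"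
      "(\<lambda>i x. x$j * 0 + 2 * ((if i = j then 1 else 0) * (if i = j then 1 else 0)) + 0 * x$j) = (\<lambda>i (x::real^'n). if i = j then 2 else 0)"
      by (auto simp: fun_eq_iff)
    from has_C2_partials_mult[OF component component, unfolded this] show ?thesis by (simp only: power2_eq_square)
  qed
  have "has_C2_derivatives (\<lambda>q. 1 - X q) (\<lambda>q. 0 - X' q) (\<lambda>q. 0 - X'' q)"
    by (intro has_C2_derivatives_diff X) (simp add: has_C2_derivatives_def)
  from has_C2_derivatives_of_real[OF this]
  show "((\<lambda>q. complex_of_real (1 - X q)) has_vector_derivative complex_of_real (- X' q)) (at q)"
    "((\<lambda>q. complex_of_real (- X' q)) has_vector_derivative complex_of_real (- X'' q)) (at q)" for q
    by simp_all
  show "continuous_on {0..} (\<lambda>q. complex_of_real (- X'' q))"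
    by (intro continuous_intros has_C2_derivatives_continuous[OF X])
qed auto

text \<open>The terms of \<open>\<Delta>((1 - X(x\<^sub>j\<^sup>2)) \<phi>)\<close> in which the cut-off is differentiated.\<close>

definition slab_defect :: "(real \<Rightarrow> real) \<Rightarrow> (real \<Rightarrow> real) \<Rightarrow> 'n \<Rightarrow>
    (real^'n \<Rightarrow> complex) \<Rightarrow> ('n \<Rightarrow> real^'n \<Rightarrow> complex) \<Rightarrow> real^'n \<Rightarrow> complex" where
  "slab_defect X' X'' j \<phi> G x = - (of_real (4 * x$j * X' ((x$j)\<^sup>2)) * G j x
     + of_real (4 * (x$j)\<^sup>2 * X'' ((x$j)\<^sup>2) + 2 * X' ((x$j)\<^sup>2)) * \<phi> x)"

lemma slab_cutoff_laplacian:
  "(\<Sum>i\<in>UNIV. complex_of_real (1 - X ((x$j)\<^sup>2)) * H i x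
     + 2 * ((if i = j then 2 * x$j else 0) *\<^sub>R complex_of_real (- X' ((x$j)\<^sup>2)) * G i x)
     + ((if i = j then 2 * x$j else 0)\<^sup>2 *\<^sub>R complex_of_real (- X'' ((x$j)\<^sup>2))
       + (if i = j then 2 else 0) *\<^sub>R complex_of_real (- X' ((x$j)\<^sup>2))) * \<phi> x)
   = of_real (1 - X ((x$j)\<^sup>2)) * (\<Sum>i\<in>UNIV. H i x) + slab_defect X' X'' j \<phi> G (x::real^'n)"
proof -
  have "(\<Sum>i\<in>UNIV. 2 * ((if i = j then 2 * x$j else 0) *\<^sub>R complex_of_real (- X' ((x$j)\<^sup>2)) * G i x)
     + ((if i = j then 2 * x$j else 0)\<^sup>2 *\<^sub>R complex_of_real (- X'' ((x$j)\<^sup>2))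
       + (if i = j then 2 else 0) *\<^sub>R complex_of_real (- X' ((x$j)\<^sup>2))) * \<phi> x)
    = (\<Sum>i\<in>UNIV. if i = j then slab_defect X' X'' j \<phi> G x else 0)"
    by (rule sum.cong) (auto simp: slab_defect_def scaleR_conv_of_real algebra_simps power2_eq_square)
  then show ?thesis by (simp only: sum.distrib sum_distrib_left add.assoc sum.delta finite UNIV_I if_True)
qed

lemma continuous_on_slab_defect:
  assumes X: "has_C2_derivatives X X' X''" and \<phi>: "has_C2_partials \<phi> G H"
  shows "continuous_on A (slab_defect X' X'' j \<phi> G)"
proof -
  have "continuous_on A (\<lambda>x::real^'a. X' ((x$j)\<^sup>2))" "continuous_on A (\<lambda>x::real^'a. X'' ((x$j)\<^sup>2))"
    by (auto intro!: continuous_intros continuous_on_compose2[OF has_C2_derivatives_continuous(2)[OF X, of UNIV]]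
        continuous_on_compose2[OF has_C2_derivatives_continuous(3)[OF X, of UNIV]])
  then show ?thesis unfolding slab_defect_def[abs_def]
    by (intro continuous_intros has_C2_partials_continuous[OF \<phi>])
qed

lemma weak_helmholtz_slab_identity:
  fixes V :: "real^'n \<Rightarrow> complex"
  assumes weak: "weak_helmholtz k {x\<in>S. x$j \<noteq> 0} V" and V: "continuous_on S V"
    and X: "has_C2_derivatives X X' X''" "\<epsilon> > 0" "\<And>q. q \<le> \<epsilon> \<Longrightarrow> X q = 1 \<and> X' q = 0 \<and> X'' q = 0"
    and \<phi>: "has_C2_partials \<phi> G H" "compact K" "K \<subseteq> S" "\<And>x. x \<notin> K \<Longrightarrow> \<phi> x = 0"
  shows "(LINT x:K|lborel. V x * (of_real (1 - X ((x$j)\<^sup>2)) * ((\<Sum>i\<in>UNIV. H i x) + of_real (k\<^sup>2) * \<phi> x)))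
    = - (LINT x:K|lborel. V x * slab_defect X' X'' j \<phi> G x)"
proof -
  define L where "L x = (\<Sum>i\<in>UNIV. H i x) + of_real (k\<^sup>2) * \<phi> x" for x
  define E where "E = K \<inter> {x. \<epsilon> \<le> (x$j)\<^sup>2}"
  have "compact E" unfolding E_def by (intro compact_Int_closed \<phi>(2) closed_Collect_le continuous_intros)
  moreover have "E \<subseteq> {x\<in>S. x$j \<noteq> 0}" using \<phi>(3) \<open>\<epsilon> > 0\<close> by (auto simp: E_def)
  moreover have "complex_of_real (1 - X ((x$j)\<^sup>2)) * \<phi> x = 0" if "x \<notin> E" for x
    using X(3)[of "(x$j)\<^sup>2"] \<phi>(4)[of x] that by (cases "x \<in> K") (auto simp: E_def)
  ultimately have "(LINT x:E|lborel. V x * (of_real (1 - X ((x$j)\<^sup>2)) * (\<Sum>i\<in>UNIV. H i x)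
      + slab_defect X' X'' j \<phi> G x + of_real (k\<^sup>2) * (of_real (1 - X ((x$j)\<^sup>2)) * \<phi> x))) = 0"
    using weak[unfolded weak_helmholtz_def, THEN conjunct2, rule_format, OF _ _
        has_C2_partials_mult[OF has_C2_partials_slab_cutoff[OF X(1)] \<phi>(1)], of E j]
    unfolding slab_cutoff_laplacian by blast
  also have "(LINT x:E|lborel. V x * (of_real (1 - X ((x$j)\<^sup>2)) * (\<Sum>i\<in>UNIV. H i x)
      + slab_defect X' X'' j \<phi> G x + of_real (k\<^sup>2) * (of_real (1 - X ((x$j)\<^sup>2)) * \<phi> x)))
    = (LINT x:K|lborel. V x * (of_real (1 - X ((x$j)\<^sup>2)) * L x) + V x * slab_defect X' X'' j \<phi> G x)"
    unfolding set_lebesgue_integral_def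
  proof (rule Bochner_Integration.integral_cong[OF refl])
    fix x
    have "1 - X ((x$j)\<^sup>2) = 0 \<and> slab_defect X' X'' j \<phi> G x = 0" if "\<not> \<epsilon> \<le> (x$j)\<^sup>2"
      using X(3)[of "(x$j)\<^sup>2"] that by (simp add: slab_defect_def)
    then show "indicator E x *\<^sub>R (V x * (of_real (1 - X ((x$j)\<^sup>2)) * (\<Sum>i\<in>UNIV. H i x)
        + slab_defect X' X'' j \<phi> G x + of_real (k\<^sup>2) * (of_real (1 - X ((x$j)\<^sup>2)) * \<phi> x)))
      = indicator K x *\<^sub>R (V x * (of_real (1 - X ((x$j)\<^sup>2)) * L x) + V x * slab_defect X' X'' j \<phi> G x)"
      by (cases "\<epsilon> \<le> (x$j)\<^sup>2") (auto simp: E_def L_def indicator_def algebra_simps)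
  qed
  also have "\<dots> = (LINT x:K|lborel. V x * (of_real (1 - X ((x$j)\<^sup>2)) * L x)) + (LINT x:K|lborel. V x * slab_defect X' X'' j \<phi> G x)"
  proof (rule set_integral_add)
    have V_cont: "continuous_on K V" using V \<phi>(3) by (rule continuous_on_subset)
    have X_cont: "continuous_on K (\<lambda>x. X ((x$j)\<^sup>2))"
      by (intro continuous_on_compose2[OF has_C2_derivatives_continuous(1)[OF X(1), of UNIV]] continuous_intros) auto
    show "set_integrable lborel K (\<lambda>x. V x * (of_real (1 - X ((x$j)\<^sup>2)) * L x))"
      "set_integrable lborel K (\<lambda>x. V x * slab_defect X' X'' j \<phi> G x)"
      unfolding set_integrable_def L_def
      by (intro borel_integrable_compact \<phi>(2) V_cont X_cont continuous_intros continuous_on_slab_defect[OF X(1) \<phi>(1)]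
          has_C2_partials_continuous[OF \<phi>(1)])+
  qed
  finally show ?thesis unfolding L_def by (simp add: eq_neg_iff_add_eq_0)
qed

lemma norm_slab_defect_le:
  assumes "\<epsilon> > 0" "norm (\<phi> x) \<le> M * \<bar>x$j\<bar>" "norm (G j x) \<le> M"
  shows "norm (slab_defect (plateau' (\<epsilon>\<^sup>2) (4 * \<epsilon>\<^sup>2)) (plateau'' (\<epsilon>\<^sup>2) (4 * \<epsilon>\<^sup>2)) j \<phi> G x) \<le> 408 * M / \<epsilon>"
    "2 * \<epsilon> \<le> \<bar>x$j\<bar> \<Longrightarrow> slab_defect (plateau' (\<epsilon>\<^sup>2) (4 * \<epsilon>\<^sup>2)) (plateau'' (\<epsilon>\<^sup>2) (4 * \<epsilon>\<^sup>2)) j \<phi> G x = 0"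
proof -
  define a where "a = \<bar>x$j\<bar>"
  define Y where "Y = plateau' (\<epsilon>\<^sup>2) (4 * \<epsilon>\<^sup>2) ((x$j)\<^sup>2)"
  define Y2 where "Y2 = plateau'' (\<epsilon>\<^sup>2) (4 * \<epsilon>\<^sup>2) ((x$j)\<^sup>2)"
  let ?D = "slab_defect (plateau' (\<epsilon>\<^sup>2) (4 * \<epsilon>\<^sup>2)) (plateau'' (\<epsilon>\<^sup>2) (4 * \<epsilon>\<^sup>2)) j \<phi> G x"
  have "\<epsilon>\<^sup>2 < 4 * \<epsilon>\<^sup>2" "a \<ge> 0" using \<open>\<epsilon> > 0\<close> by (auto simp: a_def)
  have D: "?D = - (of_real (4 * x$j * Y) * G j x + of_real (4 * (x$j)\<^sup>2 * Y2 + 2 * Y) * \<phi> x)"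
    by (simp add: slab_defect_def Y_def Y2_def)
  have far: "?D = 0" if "2 * \<epsilon> \<le> a"
  proof -
    have "4 * \<epsilon>\<^sup>2 \<le> (x$j)\<^sup>2" using power_mono[OF that, of 2] \<open>\<epsilon> > 0\<close> by (simp add: a_def power_mult_distrib)
    from plateau_eq_0[OF \<open>\<epsilon>\<^sup>2 < 4 * \<epsilon>\<^sup>2\<close> this] show ?thesis by (simp add: D Y_def Y2_def)
  qed
  then show "2 * \<epsilon> \<le> \<bar>x$j\<bar> \<Longrightarrow> ?D = 0" by (simp add: a_def)
  have "M \<ge> 0" using assms(3) norm_ge_zero order_trans by blast
  have Y: "\<bar>Y\<bar> \<le> 18 / \<epsilon>\<^sup>2" "\<bar>Y2\<bar> \<le> 6 / \<epsilon> ^ 4"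
    using plateau_bounds(3,4)[OF \<open>\<epsilon>\<^sup>2 < 4 * \<epsilon>\<^sup>2\<close>, of "(x$j)\<^sup>2"] unfolding Y_def Y2_def
    by (simp_all add: power_mult_distrib flip: power_mult)
  show "norm ?D \<le> 408 * M / \<epsilon>"
  proof (cases "2 * \<epsilon> \<le> a")
    case False
    have "norm ?D \<le> norm (of_real (4 * x$j * Y) * G j x) + norm (of_real (4 * (x$j)\<^sup>2 * Y2 + 2 * Y) * \<phi> x)"
      unfolding D norm_minus_cancel by (rule norm_triangle_ineq)
    also have "\<dots> = 4 * a * \<bar>Y\<bar> * norm (G j x) + \<bar>4 * (x$j)\<^sup>2 * Y2 + 2 * Y\<bar> * norm (\<phi> x)"
      by (simp only: norm_mult norm_of_real abs_mult a_def abs_numeral)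
    also have "\<dots> \<le> 4 * (2 * \<epsilon>) * (18 / \<epsilon>\<^sup>2) * M + (4 * (2 * \<epsilon>)\<^sup>2 * (6 / \<epsilon> ^ 4) + 2 * (18 / \<epsilon>\<^sup>2)) * (M * (2 * \<epsilon>))"
    proof (intro add_mono mult_mono)
      have "\<bar>4 * (x$j)\<^sup>2 * Y2 + 2 * Y\<bar> \<le> 4 * a\<^sup>2 * \<bar>Y2\<bar> + 2 * \<bar>Y\<bar>"
        using abs_triangle_ineq[of "4 * (x$j)\<^sup>2 * Y2" "2 * Y"] by (simp add: abs_mult a_def)
      also have "\<dots> \<le> 4 * (2 * \<epsilon>)\<^sup>2 * (6 / \<epsilon> ^ 4) + 2 * (18 / \<epsilon>\<^sup>2)"
        using False Y \<open>a \<ge> 0\<close> by (intro add_mono mult_mono power_mono) auto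
      finally show "\<bar>4 * (x$j)\<^sup>2 * Y2 + 2 * Y\<bar> \<le> 4 * (2 * \<epsilon>)\<^sup>2 * (6 / \<epsilon> ^ 4) + 2 * (18 / \<epsilon>\<^sup>2)" .
      have "M * a \<le> M * (2 * \<epsilon>)" using False \<open>M \<ge> 0\<close> by (intro mult_left_mono) auto
      then show "norm (\<phi> x) \<le> M * (2 * \<epsilon>)" using assms(2) by (simp add: a_def)
    qed (use False Y assms(3) \<open>\<epsilon> > 0\<close> \<open>a \<ge> 0\<close> in auto)
    also have "\<dots> = 408 * M / \<epsilon>" using \<open>\<epsilon> > 0\<close> by (simp add: field_simps eval_nat_numeral)
    finally show ?thesis .
  qed (use far \<open>M \<ge> 0\<close> \<open>\<epsilon> > 0\<close> in auto)
qed

lemma vanishing_on_plane_bound: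
  fixes \<phi> :: "real^'n \<Rightarrow> complex"
  assumes "has_second_partials UNIV \<phi> G H" "\<And>x. norm (G j x) \<le> M" "\<And>x. x$j = 0 \<Longrightarrow> \<phi> x = 0"
  shows "norm (\<phi> x) \<le> M * \<bar>x$j\<bar>"
proof -
  have "norm (\<phi> (x + 0 *\<^sub>R axis j 1) - \<phi> (x + (- x$j) *\<^sub>R axis j 1)) \<le> M * norm (0 - (- x$j))"
  proof (rule differentiable_bound[where S=UNIV and f'="\<lambda>s t. t *\<^sub>R G j (x + s *\<^sub>R axis j 1)" and f="\<lambda>t. \<phi> (x + t *\<^sub>R axis j 1)"])
    show "((\<lambda>t. \<phi> (x + t *\<^sub>R axis j 1)) has_derivative (\<lambda>t. t *\<^sub>R G j (x + s *\<^sub>R axis j 1))) (at s within UNIV)" for s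
      using has_second_partials_first[OF assms(1) UNIV_I, where x=x and t=s and i=j] by (simp add: has_vector_derivative_def)
    show "onorm (\<lambda>t. t *\<^sub>R G j (x + s *\<^sub>R axis j 1)) \<le> M" for s
      using assms(2) by (simp add: onorm_scaleR_left onorm_id)
  qed auto
  moreover have "\<phi> (x + (- x$j) *\<^sub>R axis j 1) = 0" by (rule assms(3)) (simp add: axis_def)
  ultimately show ?thesis by simp
qed

lemma indicator_extension_tendsto_0:
  fixes V :: "'a::metric_space \<Rightarrow> 'b::real_normed_vector"
  assumes "open S" "continuous_on S V" "compact K" "K \<subseteq> S" "y \<longlonglongrightarrow> z" "z \<in> S \<Longrightarrow> V z = 0"
  shows "(\<lambda>n. indicator K (y n) *\<^sub>R V (y n)) \<longlonglongrightarrow> 0"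
proof (cases "z \<in> S")
  case True
  then have "isCont V z" using assms(1,2) continuous_on_eq_continuous_at by blast
  then have "(\<lambda>n. V (y n)) \<longlonglongrightarrow> 0" using isCont_tendsto_compose[OF _ assms(5)] assms(6)[OF True] by metis
  then show ?thesis
    by (rule Lim_null_comparison[where g="\<lambda>n. norm (V (y n))", OF always_eventually tendsto_norm_zero, rotated])
       (simp add: indicator_def)
next
  case False
  then have "\<forall>\<^sub>F n in sequentially. y n \<in> - K"
    using assms(3,4,5) by (intro topological_tendstoD) (auto dest: compact_imp_closed)
  then show ?thesis by (rule tendsto_eventually[OF eventually_mono]) auto
qed

lemma borel_measurable_scale_axis [measurable]: "scale_axis j c \<in> borel_measurable borel"
  unfolding scale_axis_def[abs_def] by (intro borel_measurable_continuous_onI continuous_intros)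

lemma rescaled_slab_integral_tendsto_0:
  fixes W :: "real^'n \<Rightarrow> complex" and g :: "nat \<Rightarrow> real^'n \<Rightarrow> complex"
  assumes W: "bounded_supported W" and W_lim: "\<And>x. (\<lambda>n. W (scale_axis j (\<epsilon> n) x)) \<longlonglongrightarrow> 0"
    and \<epsilon>: "\<And>n. 0 < \<epsilon> n" "\<And>n. \<epsilon> n \<le> 1"
    and [measurable]: "\<And>n. g n \<in> borel_measurable borel"
    and g: "\<And>n x. norm (g n x) \<le> C" "\<And>n x. 2 \<le> \<bar>x$j\<bar> \<Longrightarrow> g n x = 0"
  shows "(\<lambda>n. LINT x|lborel. W (scale_axis j (\<epsilon> n) x) * g n x) \<longlonglongrightarrow> 0"
proof -
  have [measurable]: "W \<in> borel_measurable borel" by (rule bounded_supported_measurable[OF W])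
  obtain M where M: "M \<ge> 0" "\<And>x. norm (W x) \<le> M" by (rule bounded_supported_bound[OF W]) (rule that)
  obtain \<rho> where \<rho>: "\<And>x. x \<notin> cball 0 \<rho> \<Longrightarrow> W x = 0" by (rule bounded_supported_support[OF W]) (rule that)
  have support: "W (scale_axis j (\<epsilon> n) x) * g n x = 0" if "x \<notin> cball 0 (\<rho> + 2)" for n x
  proof (cases "2 \<le> \<bar>x$j\<bar>")
    case False
    note norm_le_scale_axis[of x j "\<epsilon> n"]
    also have "\<bar>1 - \<epsilon> n\<bar> * \<bar>x$j\<bar> \<le> 1 * 2" using False \<epsilon>[of n] by (intro mult_mono) auto
    finally have "scale_axis j (\<epsilon> n) x \<notin> cball 0 \<rho>" using that by simp
    then show ?thesis using \<rho> by simp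
  qed (simp add: g(2))
  have "(\<lambda>n. LINT x|lborel. W (scale_axis j (\<epsilon> n) x) * g n x) \<longlonglongrightarrow> (LINT x::real^'n|lborel. 0)"
  proof (rule bounded_convergence_compact_support[where K="cball 0 (\<rho> + 2)" and M="M * C"])
    show "norm (W (scale_axis j (\<epsilon> n) x) * g n x) \<le> M * C" for n x
      unfolding norm_mult using M g(1) by (intro mult_mono) auto
    have "norm (W (scale_axis j (\<epsilon> n) x) * g n x) \<le> norm (W (scale_axis j (\<epsilon> n) x)) * C" for n x
      unfolding norm_mult using g(1) by (intro mult_left_mono) auto
    moreover have "(\<lambda>n. norm (W (scale_axis j (\<epsilon> n) x)) * C) \<longlonglongrightarrow> 0" for x
      by (intro tendsto_mult_left_zero tendsto_norm_zero W_lim)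
    ultimately show "(\<lambda>n. W (scale_axis j (\<epsilon> n) x) * g n x) \<longlonglongrightarrow> 0" for x
      by (rule Lim_null_comparison[OF always_eventually[OF allI]])
  qed (use support in auto)
  then show ?thesis by simp
qed

text \<open>The slab \<open>\<bar>x\<^sub>j\<bar> \<le> 2\<epsilon>\<close> is stretched to unit thickness: the Jacobian \<open>\<epsilon>\<close> absorbs the bound \<open>C/\<epsilon>\<close> on
  the integrand, and \<open>V\<close> tends to its values on the plane, which are zero.\<close>

lemma thin_slab_integral_tendsto_0:
  fixes V :: "real^'n \<Rightarrow> complex"
  assumes "open S" and V: "continuous_on S V" "\<And>x. x \<in> S \<Longrightarrow> x$j = 0 \<Longrightarrow> V x = 0" and K: "compact K" "K \<subseteq> S"
    and \<epsilon>: "\<epsilon> \<longlonglongrightarrow> 0" "\<And>n. 0 < \<epsilon> n" "\<And>n. \<epsilon> n \<le> 1"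
    and d: "\<And>n. continuous_on K (d n)" "\<And>n x. norm (d n x) \<le> C / \<epsilon> n" "\<And>n x. 2 * \<epsilon> n \<le> \<bar>x$j\<bar> \<Longrightarrow> d n x = 0"
  shows "(\<lambda>n. LINT x:K|lborel. V x * d n x) \<longlonglongrightarrow> 0"
proof -
  define W where "W x = indicator K x *\<^sub>R V x" for x
  define D where "D n x = indicator K x *\<^sub>R d n x" for n x
  define g where "g n x = \<epsilon> n *\<^sub>R D n (scale_axis j (\<epsilon> n) x)" for n x
  have W: "bounded_supported W"
    unfolding W_def by (intro bounded_supported_indicator K(1) continuous_on_subset[OF V(1) K(2)])
  have D: "bounded_supported (D n)" for n
    unfolding D_def by (intro bounded_supported_indicator K(1) d(1))
  have [measurable]: "W \<in> borel_measurable borel" "D n \<in> borel_measurable borel" for n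
    by (rule bounded_supported_measurable W D)+
  have "C / \<epsilon> 0 \<ge> 0" using d(2)[of 0 0] norm_ge_zero order_trans by blast
  then have "C \<ge> 0" using \<epsilon>(2)[of 0] by (simp add: zero_le_divide_iff)
  have "(\<lambda>n. LINT x|lborel. W (scale_axis j (\<epsilon> n) x) * g n x) \<longlonglongrightarrow> 0"
  proof (rule rescaled_slab_integral_tendsto_0[OF W _ \<epsilon>(2,3)])
    show "(\<lambda>n. W (scale_axis j (\<epsilon> n) x)) \<longlonglongrightarrow> 0" for x
      unfolding W_def by (rule indicator_extension_tendsto_0[OF \<open>open S\<close> V(1) K])
        (use \<epsilon>(1) V(2)[of "scale_axis j 0 x"] in \<open>auto simp: scale_axis_def intro!: tendsto_eq_intros\<close>)
    show "g n \<in> borel_measurable borel" for n unfolding g_def[abs_def] by measurable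
    show "norm (g n x) \<le> C" for n x
      using d(2)[of n "scale_axis j (\<epsilon> n) x"] \<epsilon>(2)[of n] \<open>C \<ge> 0\<close> by (simp add: g_def D_def indicator_def field_simps)
    show "g n x = 0" if "2 \<le> \<bar>x$j\<bar>" for n x
      using that d(3)[of n "scale_axis j (\<epsilon> n) x"] \<epsilon>(2)[of n] by (simp add: g_def D_def scale_axis_component abs_mult)
  qed
  moreover have "(LINT x|lborel. W (scale_axis j (\<epsilon> n) x) * g n x) = (LINT x|lborel. W x * D n x)" for n
    using integral_scale_axis[of "\<lambda>x. W x * D n x" "\<epsilon> n" j] \<epsilon>(2)[of n] by (simp add: g_def)
  moreover have "(LINT x:K|lborel. V x * d n x) = (LINT x|lborel. W x * D n x)" for n
    unfolding set_lebesgue_integral_def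
    by (rule Bochner_Integration.integral_cong) (auto simp: W_def D_def indicator_def)
  ultimately show ?thesis by simp
qed

lemma slab_cutoff_integral_tendsto:
  fixes g :: "real^'n \<Rightarrow> complex"
  assumes K: "compact K" and g: "continuous_on K g" "\<And>x. x \<in> K \<Longrightarrow> x$j = 0 \<Longrightarrow> g x = 0"
    and \<epsilon>: "\<epsilon> \<longlonglongrightarrow> 0" "\<And>n. 0 < \<epsilon> n"
  shows "(\<lambda>n. LINT x:K|lborel. of_real (1 - plateau ((\<epsilon> n)\<^sup>2) (4 * (\<epsilon> n)\<^sup>2) ((x$j)\<^sup>2)) * g x) \<longlonglongrightarrow> (LINT x:K|lborel. g x)"
proof -
  define \<theta> where "\<theta> n x = complex_of_real (1 - plateau ((\<epsilon> n)\<^sup>2) (4 * (\<epsilon> n)\<^sup>2) ((x$j)\<^sup>2))" for n and x :: "real^'n"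
  have \<epsilon>_less: "(\<epsilon> n)\<^sup>2 < 4 * (\<epsilon> n)\<^sup>2" for n using \<epsilon>(2)[of n] by simp
  have "continuous_on K (\<theta> n)" for n unfolding \<theta>_def
    by (intro continuous_intros continuous_on_compose2[OF has_C2_derivatives_continuous(1)[OF has_C2_derivatives_plateau[OF \<epsilon>_less], of UNIV]]) auto
  then have measurable: "(\<lambda>x. indicator K x *\<^sub>R (\<theta> n x * g x)) \<in> borel_measurable borel" for n
    by (intro bounded_supported_measurable bounded_supported_indicator K continuous_on_mult g(1))
  obtain B where B: "\<And>x. norm (indicator K x *\<^sub>R g x) \<le> B"
    by (rule bounded_supported_bound[OF bounded_supported_indicator[OF g(1) K]]) (rule that)
  have bound: "norm (indicator K x *\<^sub>R (\<theta> n x * g x)) \<le> B" for n x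
  proof -
    have "norm (\<theta> n x) \<le> 1" using plateau_bounds(1,2)[OF \<epsilon>_less] by (simp add: \<theta>_def del: of_real_diff)
    then have "norm (\<theta> n x) * norm (indicator K x *\<^sub>R g x) \<le> 1 * B" using B by (intro mult_mono) auto
    then show ?thesis by (simp add: norm_mult mult_ac)
  qed
  have limit: "(\<lambda>n. indicator K x *\<^sub>R (\<theta> n x * g x)) \<longlonglongrightarrow> indicator K x *\<^sub>R g x" for x
  proof (cases "x \<in> K \<and> x$j \<noteq> 0")
    case True
    have "(\<lambda>n. 4 * (\<epsilon> n)\<^sup>2) \<longlonglongrightarrow> 4 * 0\<^sup>2" by (intro tendsto_intros \<epsilon>(1))
    then have "\<forall>\<^sub>F n in sequentially. 4 * (\<epsilon> n)\<^sup>2 < (x$j)\<^sup>2" by (rule order_tendstoD) (use True in simp)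
    then have "\<forall>\<^sub>F n in sequentially. \<theta> n x = 1"
      by eventually_elim (use plateau_eq_0[OF \<epsilon>_less] in \<open>auto simp: \<theta>_def\<close>)
    then show ?thesis by (intro tendsto_eventually) (auto elim: eventually_mono)
  qed (use g(2) in \<open>auto simp: indicator_def\<close>)
  show ?thesis unfolding set_lebesgue_integral_def \<theta>_def[symmetric]
    by (rule bounded_convergence_compact_support[OF measurable bound K _ limit]) simp
qed

lemma weak_helmholtz_test_vanishing_on_plane:
  fixes V :: "real^'n \<Rightarrow> complex"
  assumes weak: "weak_helmholtz k {x\<in>S. x$j \<noteq> 0} V" and "open S"
    and V: "continuous_on S V" "\<And>x. x \<in> S \<Longrightarrow> x$j = 0 \<Longrightarrow> V x = 0"
    and \<phi>: "has_C2_partials \<phi> G H" "compact K" "K \<subseteq> S" "\<And>x. x \<notin> K \<Longrightarrow> \<phi> x = 0" "\<And>x. x$j = 0 \<Longrightarrow> \<phi> x = 0"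
  shows "(LINT x:K|lborel. V x * ((\<Sum>i\<in>UNIV. H i x) + of_real (k\<^sup>2) * \<phi> x)) = 0"
proof -
  define L where "L x = (\<Sum>i\<in>UNIV. H i x) + of_real (k\<^sup>2) * \<phi> x" for x
  define \<epsilon> where "\<epsilon> n = inverse (real (Suc n))" for n
  have \<epsilon>_lim: "\<epsilon> \<longlonglongrightarrow> 0" unfolding \<epsilon>_def by (rule LIMSEQ_inverse_real_of_nat)
  have \<epsilon>: "0 < \<epsilon> n" "\<epsilon> n \<le> 1" "(\<epsilon> n)\<^sup>2 < 4 * (\<epsilon> n)\<^sup>2" for n by (auto simp: \<epsilon>_def divide_simps)
  define \<theta> where "\<theta> n x = complex_of_real (1 - plateau ((\<epsilon> n)\<^sup>2) (4 * (\<epsilon> n)\<^sup>2) ((x$j)\<^sup>2))" for n and x :: "real^'n"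
  define d where "d n = slab_defect (plateau' ((\<epsilon> n)\<^sup>2) (4 * (\<epsilon> n)\<^sup>2)) (plateau'' ((\<epsilon> n)\<^sup>2) (4 * (\<epsilon> n)\<^sup>2)) j \<phi> G" for n
  note plateau = has_C2_derivatives_plateau[OF \<epsilon>(3)]
  have identity: "(LINT x:K|lborel. V x * (\<theta> n x * L x)) = - (LINT x:K|lborel. V x * d n x)" for n
    unfolding \<theta>_def d_def L_def
    by (rule weak_helmholtz_slab_identity[where \<epsilon>="(\<epsilon> n)\<^sup>2", OF weak V(1) plateau _ _ \<phi>(1-3)])
       (use \<epsilon>(1)[of n] plateau_eq_1[OF \<epsilon>(3)] \<phi>(4) in auto)
  obtain M where M: "\<And>x. norm (G j x) \<le> M"
    by (rule bounded_supported_bound[OF has_C2_partials_bounded_supported(2)[OF \<phi>(1,2)]]) (use that \<phi>(4) in auto)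
  have "norm (\<phi> x) \<le> M * \<bar>x$j\<bar>" for x
    using \<phi>(1,5) M by (intro vanishing_on_plane_bound[where G=G and H=H]) (auto simp: has_C2_partials_def)
  note norm_slab_defect_le[where \<phi>=\<phi> and G=G and M=M, OF \<epsilon>(1) this M]
  then have d: "norm (d n x) \<le> 408 * M / \<epsilon> n" "2 * \<epsilon> n \<le> \<bar>x$j\<bar> \<Longrightarrow> d n x = 0" for n x
    unfolding d_def by auto
  have "(\<lambda>n. LINT x:K|lborel. V x * d n x) \<longlonglongrightarrow> 0"
    by (rule thin_slab_integral_tendsto_0[OF \<open>open S\<close> V \<phi>(2,3) \<epsilon>_lim \<epsilon>(1,2) _ d])
       (auto simp: d_def intro: continuous_on_slab_defect[OF plateau \<phi>(1)])
  moreover have "(\<lambda>n. LINT x:K|lborel. \<theta> n x * (V x * L x)) \<longlonglongrightarrow> (LINT x:K|lborel. V x * L x)"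
    unfolding \<theta>_def
  proof (rule slab_cutoff_integral_tendsto[OF \<phi>(2) _ _ \<epsilon>_lim \<epsilon>(1)])
    show "continuous_on K (\<lambda>x. V x * L x)"
      unfolding L_def using continuous_on_subset[OF V(1) \<phi>(3)]
      by (intro continuous_intros has_C2_partials_continuous[OF \<phi>(1)])
  qed (use V(2) \<phi>(3) in auto)
  ultimately have "(LINT x:K|lborel. V x * L x) = - 0"
    unfolding mult.left_commute[of "\<theta> _ _"] identity by (intro LIMSEQ_unique[OF _ tendsto_minus])
  then show ?thesis by (simp add: L_def)
qed

lemma set_integral_mirror_0:
  fixes f :: "real^'n \<Rightarrow> complex"
  assumes "compact E" "continuous_on E f" "\<And>x. mirror j 0 x \<in> E \<longleftrightarrow> x \<in> E"
  shows "(LINT x:E|lborel. f (mirror j 0 x)) = (LINT x:E|lborel. f x)"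
proof -
  have "(\<lambda>x. indicator E x *\<^sub>R f x) \<in> borel_measurable borel"
    by (intro bounded_supported_measurable bounded_supported_indicator assms)
  from integral_scale_axis[OF this, of "- 1" j] show ?thesis
    unfolding set_lebesgue_integral_def by (simp add: indicator_def assms(3) flip: mirror_0_eq_scale_axis)
qed

lemma odd_eq_0_on_plane:
  fixes V :: "real^'n \<Rightarrow> complex"
  assumes "V (mirror j 0 x) = - V x" "x$j = 0"
  shows "V x = 0"
proof -
  have "mirror j 0 x = x" using assms(2) by (simp add: mirror_0_eq_self_iff)
  then have "V x + V x = 0" using assms(1) by (simp add: eq_neg_iff_add_eq_0)
  then show ?thesis by (simp flip: mult_2)
qed

lemma set_integral_odd_mult_diff_mirror:
  fixes V L :: "real^'n \<Rightarrow> complex"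
  assumes E: "compact E" "\<And>x. mirror j 0 x \<in> E \<longleftrightarrow> x \<in> E"
    and V: "continuous_on E V" "\<And>x. x \<in> E \<Longrightarrow> V (mirror j 0 x) = - V x" and L: "continuous_on E L"
  shows "(LINT x:E|lborel. V x * (L x - L (mirror j 0 x))) = 2 * (LINT x:E|lborel. V x * L x)"
proof -
  have L_mirror: "continuous_on E (\<lambda>x. L (mirror j 0 x))"
    by (rule continuous_on_compose2[OF L continuous_on_mirror]) (use E(2) in auto)
  have "set_integrable lborel E (\<lambda>x. V x * L x)" "set_integrable lborel E (\<lambda>x. V x * L (mirror j 0 x))"
    unfolding set_integrable_def
    by (intro borel_integrable_compact E(1) continuous_on_mult V(1) L L_mirror)+
  then have "(LINT x:E|lborel. V x * (L x - L (mirror j 0 x)))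
      = (LINT x:E|lborel. V x * L x) - (LINT x:E|lborel. V x * L (mirror j 0 x))"
    by (simp only: right_diff_distrib set_integral_diff(2))
  also have "(LINT x:E|lborel. V x * L (mirror j 0 x)) = (LINT x:E|lborel. V (mirror j 0 x) * L x)"
    using set_integral_mirror_0[OF E(1) continuous_on_mult[OF V(1) L_mirror] E(2)] by (simp add: mirror_mirror)
  also have "\<dots> = - (LINT x:E|lborel. V x * L x)"
    unfolding set_lebesgue_integral_def integral_minus[symmetric]
    by (rule Bochner_Integration.integral_cong) (use V(2) in \<open>auto simp: indicator_def\<close>)
  finally show ?thesis by simp
qed

theorem weak_helmholtz_odd_reflection:
  fixes V :: "real^'n \<Rightarrow> complex"
  assumes weak: "weak_helmholtz k {x\<in>S. x$j \<noteq> 0} V" and V: "open S" "continuous_on S V"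
    and symmetric: "\<And>x. x \<in> S \<Longrightarrow> mirror j 0 x \<in> S" "\<And>x. x \<in> S \<Longrightarrow> V (mirror j 0 x) = - V x"
  shows "weak_helmholtz k S V"
  unfolding weak_helmholtz_def
proof (intro conjI allI impI V(2))
  let ?m = "mirror j 0 :: real^'n \<Rightarrow> real^'n"
  fix K and \<phi> :: "real^'n \<Rightarrow> complex" and G H
  assume K: "compact K" "K \<subseteq> S" and \<phi>: "has_C2_partials \<phi> G H" and "\<forall>x. x \<notin> K \<longrightarrow> \<phi> x = 0"
  then have zero: "\<phi> x = 0" if "x \<notin> K" for x using that by blast
  define L where "L x = (\<Sum>i\<in>UNIV. H i x) + complex_of_real (k\<^sup>2) * \<phi> x" for x
  define E where "E = K \<union> ?m ` K"
  have E: "compact E" "E \<subseteq> S" "K \<subseteq> E"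
    using K symmetric(1) by (auto simp: E_def intro!: compact_Un compact_continuous_image continuous_on_mirror)
  have "?m x \<in> E" if "x \<in> E" for x using that by (auto simp: E_def mirror_mirror)
  then have mirror_E: "?m x \<in> E \<longleftrightarrow> x \<in> E" for x by (metis mirror_mirror)
  have L_zero: "L x = 0" if "x \<notin> K" for x
    using has_second_partials_zero_outside(2)[of \<phi> G H K x] \<phi> zero that compact_imp_closed[OF K(1)]
    by (simp add: L_def has_C2_partials_def)
  have continuous_on_L: "continuous_on E L"
    unfolding L_def by (intro continuous_intros has_C2_partials_continuous[OF \<phi>])
  have "V x = 0" if "x \<in> S" "x$j = 0" for x by (rule odd_eq_0_on_plane[OF symmetric(2)[OF that(1)] that(2)])
  then have "(LINT x:E|lborel. V x * ((\<Sum>i\<in>UNIV. H i x - H i (?m x)) + of_real (k\<^sup>2) * (\<phi> x - \<phi> (?m x)))) = 0"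
  proof (rule weak_helmholtz_test_vanishing_on_plane[OF weak V _ has_C2_partials_diff[OF \<phi> has_C2_partials_mirror[OF \<phi>]] E(1,2)])
    show "\<phi> x - \<phi> (?m x) = 0" if "x \<notin> E" for x
    proof -
      have "x \<notin> K" "?m x \<notin> K" using that mirror_E[of x] E(3) by blast+
      then show ?thesis by (simp add: zero)
    qed
    show "\<phi> x - \<phi> (?m x) = 0" if "x$j = 0" for x using that by (simp add: mirror_0_eq_self_iff[symmetric])
  qed
  then have "(LINT x:E|lborel. V x * (L x - L (?m x))) = 0"
    by (simp add: L_def sum_subtractf algebra_simps)
  moreover have "(LINT x:E|lborel. V x * (L x - L (?m x))) = 2 * (LINT x:E|lborel. V x * L x)"
    by (rule set_integral_odd_mult_diff_mirror[OF E(1) mirror_E continuous_on_subset[OF V(2) E(2)] _ continuous_on_L])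
       (use E(2) symmetric(2) in blast)
  ultimately have "(LINT x:E|lborel. V x * L x) = 0" by simp
  also have "(LINT x:E|lborel. V x * L x) = (LINT x:K|lborel. V x * L x)"
    unfolding set_lebesgue_integral_def
    by (rule Bochner_Integration.integral_cong) (use L_zero E(3) in \<open>auto simp: indicator_def\<close>)
  finally show "(LINT x:K|lborel. V x * ((\<Sum>i\<in>UNIV. H i x) + complex_of_real (k\<^sup>2) * \<phi> x)) = 0"
    by (simp add: L_def)
qed

definition odd_extension :: "'n \<Rightarrow> (real^'n \<Rightarrow> complex) \<Rightarrow> real^'n \<Rightarrow> complex" where
  "odd_extension j w x = (if x$j \<le> 0 then - w (mirror j 0 x) else w x)"

lemma odd_extension_mirror:
  assumes "x$j = 0 \<Longrightarrow> w x = 0"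
  shows "odd_extension j w (mirror j 0 x) = - odd_extension j w x"
proof (cases "x$j = 0")
  case True
  then have "mirror j 0 x = x" by (simp add: mirror_0_eq_self_iff)
  then show ?thesis using assms[OF True] True by (simp add: odd_extension_def)
qed (auto simp: odd_extension_def mirror_component mirror_mirror)

theorem weak_helmholtz_odd_extension:
  fixes w :: "real^'n \<Rightarrow> complex"
  assumes "open S" and symmetric: "\<And>x. x \<in> S \<Longrightarrow> mirror j 0 x \<in> S"
    and w: "classical_helmholtz k {x\<in>S. 0 < x$j} w" "continuous_on {x\<in>S. 0 \<le> x$j} w"
    and zero: "\<And>x. x \<in> S \<Longrightarrow> x$j = 0 \<Longrightarrow> w x = 0"
  shows "weak_helmholtz k S (odd_extension j w)"
proof (rule weak_helmholtz_odd_reflection[OF _ \<open>open S\<close> _ symmetric])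
  let ?P = "{x\<in>S. 0 < x$j}" and ?M = "{x\<in>S. x$j < 0}"
  show "continuous_on S (odd_extension j w)" unfolding odd_extension_def[abs_def]
  proof (rule continuous_on_cases_le)
    show "continuous_on {x\<in>S. x$j \<le> 0} (\<lambda>x. - w (mirror j 0 x))"
      by (intro continuous_intros continuous_on_compose2[OF w(2) continuous_on_mirror]) (auto simp: symmetric mirror_component)
    show "- w (mirror j 0 x) = w x" if "x \<in> S" "x$j = 0" for x
      using that zero[OF that] by (simp add: mirror_0_eq_self_iff[THEN iffD2])
  qed (use w(2) in \<open>auto intro!: continuous_intros\<close>)
  show "odd_extension j w (mirror j 0 x) = - odd_extension j w x" if "x \<in> S" for x
    using zero[OF that] by (rule odd_extension_mirror)
  have "open (S \<inter> {x. 0 < x$j})" "open (S \<inter> {x. x$j < 0})"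
    by (intro open_Int open_Collect_less continuous_intros \<open>open S\<close>)+
  then have "open ?P" "open ?M" by (simp_all add: Int_def)
  have "classical_helmholtz k ?P (odd_extension j w)"
    by (rule classical_helmholtz_cong[OF \<open>open ?P\<close> w(1)]) (auto simp: odd_extension_def)
  moreover have "classical_helmholtz k ?M (odd_extension j w)"
  proof (rule classical_helmholtz_cong[OF \<open>open ?M\<close>])
    show "classical_helmholtz k ?M (\<lambda>x. (-1) * w (mirror j 0 x))"
      by (intro classical_helmholtz_cmult classical_helmholtz_mirror[OF w(1)]) (auto simp: symmetric mirror_component)
  qed (auto simp: odd_extension_def)
  ultimately have "weak_helmholtz k (?P \<union> ?M) (odd_extension j w)"
    by (intro classical_helmholtz_imp_weak classical_helmholtz_Un open_Un \<open>open ?P\<close> \<open>open ?M\<close>)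
  moreover have "?P \<union> ?M = {x\<in>S. x$j \<noteq> 0}" by auto
  ultimately show "weak_helmholtz k {x\<in>S. x$j \<noteq> 0} (odd_extension j w)" by simp
qed

theorem half_space_rellich:
  fixes w :: "real^3 \<Rightarrow> complex"
  assumes "R > 0" "k > 0" and w: "classical_helmholtz k {x. R < norm x \<and> 0 < x$j} w" "continuous_on {x. R < norm x \<and> 0 \<le> x$j} w"
    and zero: "\<And>x. R < norm x \<Longrightarrow> x$j = 0 \<Longrightarrow> w x = 0"
    and decay: "\<And>x. R < norm x \<Longrightarrow> 0 < x$j \<Longrightarrow> norm (w x) \<le> C / (norm x)\<^sup>2"
    and x: "12 * R < norm x" "0 < x$j"
  shows "w x = 0"
proof -
  have "weak_helmholtz k {x. R < norm x} (odd_extension j w)"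
    by (rule weak_helmholtz_odd_extension) (use w zero in \<open>auto simp: norm_mirror_0 intro!: open_Collect_less continuous_intros\<close>)
  then have "odd_extension j w x = 0"
  proof (rule rellich[OF \<open>R > 0\<close> \<open>k > 0\<close> _ _ x(1), where C="\<bar>C\<bar>"])
    fix z :: "real^3" assume z: "R < norm z"
    have upper: "norm (w y) \<le> \<bar>C\<bar> / (norm y)\<^sup>2" if "R < norm y" "0 < y$j" for y
      by (rule order_trans[OF decay[OF that] divide_right_mono]) auto
    consider "0 < z$j" | "z$j < 0" | "z$j = 0" by linarith
    then show "norm (odd_extension j w z) \<le> \<bar>C\<bar> / (norm z)\<^sup>2"
    proof cases
      case 1
      then show ?thesis using upper[OF z] by (simp add: odd_extension_def)
    next
      case 2
      then show ?thesis using upper[of "mirror j 0 z"] z by (simp add: odd_extension_def norm_mirror_0 mirror_component)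
    next
      case 3
      then have "mirror j 0 z = z" by (simp add: mirror_0_eq_self_iff)
      then show ?thesis using 3 zero[OF z] by (simp add: odd_extension_def)
    qed
  qed
  then show ?thesis using x(2) by (simp add: odd_extension_def)
qed

section \<open>Subsolutions\<close>

definition weak_subsolution :: "real \<Rightarrow> (real^'n \<Rightarrow> real) \<Rightarrow> bool" where
  "weak_subsolution \<kappa> v \<longleftrightarrow> continuous_on UNIV v \<and>
     (\<forall>K \<phi> G H. compact K \<longrightarrow> has_C2_partials \<phi> G H \<longrightarrow> (\<forall>x. 0 \<le> \<phi> x) \<longrightarrow> (\<forall>x. x \<notin> K \<longrightarrow> \<phi> x = 0) \<longrightarrow>
        0 \<le> (LINT x:K|lborel. v x * ((\<Sum>i\<in>UNIV. H i x) + \<kappa>\<^sup>2 * \<phi> x)))"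

definition dirichlet_extension :: "real \<Rightarrow> (real^'n) set \<Rightarrow> (real^'n \<Rightarrow> complex) \<Rightarrow> bool" where
  "dirichlet_extension k D W \<longleftrightarrow> continuous_on UNIV W \<and> classical_helmholtz k D W \<and> (\<forall>x. x \<notin> D \<longrightarrow> W x = 0)"

lemma dirichlet_extension_bounded_supported:
  assumes "bounded D" "dirichlet_extension k D W"
  shows "bounded_supported W"
proof (rule bounded_supported_continuous[where K="closure D"])
  show "W x = 0" if "x \<notin> closure D" for x using that assms(2) closure_subset by (auto simp: dirichlet_extension_def)
qed (use assms in \<open>auto simp: dirichlet_extension_def\<close>)

lemma dirichlet_extension_cmult: "dirichlet_extension k D W \<Longrightarrow> dirichlet_extension k D (\<lambda>x. c * W x)"
  by (auto simp: dirichlet_extension_def intro!: classical_helmholtz_cmult continuous_intros)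

lemma dirichlet_extension_diff:
  "dirichlet_extension k D V \<Longrightarrow> dirichlet_extension k D W \<Longrightarrow> dirichlet_extension k D (\<lambda>x. V x - W x)"
  by (auto simp: dirichlet_extension_def intro!: classical_helmholtz_diff continuous_intros)

lemma dirichlet_extension_sum:
  "(\<And>i. i \<in> I \<Longrightarrow> dirichlet_extension k D (W i)) \<Longrightarrow> dirichlet_extension k D (\<lambda>x. \<Sum>i\<in>I. a i * W i x)"
  by (auto simp: dirichlet_extension_def intro!: classical_helmholtz_sum continuous_intros)

lemma norm_sq_ge_tangent:
  fixes a b :: complex
  shows "(norm a)\<^sup>2 + 2 * Re (cnj a * (b - a)) \<le> (norm b)\<^sup>2"
proof -
  have "(norm b)\<^sup>2 - ((norm a)\<^sup>2 + 2 * Re (cnj a * (b - a))) = (Re b - Re a)\<^sup>2 + (Im b - Im a)\<^sup>2"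
    unfolding cmod_power2 by (simp add: power2_eq_square algebra_simps)
  then show ?thesis using sum_power2_ge_zero[of "Re b - Re a" "Im b - Im a"] by linarith
qed

text \<open>The discrete Kato inequality. Truncating at height \<open>e\<close> keeps the argument away from the boundary of
  the domain, where \<open>W\<close> solves no equation.\<close>

lemma difference_laplacian_truncated_norm_sq:
  fixes W :: "real^'n \<Rightarrow> complex"
  shows "indicator {x. e \<le> (norm (W x))\<^sup>2} x * (2 * Re (cnj (W x) * difference_laplacian h W x))
    \<le> difference_laplacian h (\<lambda>y. max 0 ((norm (W y))\<^sup>2 - e)) x"
proof -
  define F where "F z = max 0 ((norm z)\<^sup>2 - e)" for z :: complex
  define l where "l z = 2 * Re (cnj (W x) * z)" for z
  have linear_l: "linear l" by (rule linearI) (simp_all add: l_def algebra_simps)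
  have laplacian: "difference_laplacian h (\<lambda>y. F (W y)) x
      = (\<Sum>i\<in>UNIV. F (W (x + h *\<^sub>R axis i 1)) + F (W (x - h *\<^sub>R axis i 1)) - 2 * F (W x)) / h\<^sup>2"
    by (simp add: difference_laplacian_def divide_inverse mult.commute)
  show ?thesis
  proof (cases "e \<le> (norm (W x))\<^sup>2")
    case True
    then have tangent: "l (b - W x) \<le> F b - F (W x)" for b
      using norm_sq_ge_tangent[of "W x" b] by (simp add: F_def l_def max_def)
    have "l (difference_laplacian h W x)
        = (\<Sum>i\<in>UNIV. l (W (x + h *\<^sub>R axis i 1) - W x) + l (W (x - h *\<^sub>R axis i 1) - W x)) / h\<^sup>2"
      by (simp add: difference_laplacian_def linear_cmul[OF linear_l] linear_sum[OF linear_l] linear_diff[OF linear_l] linear_add[OF linear_l]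
          divide_inverse algebra_simps)
    also have "\<dots> \<le> (\<Sum>i\<in>UNIV. (F (W (x + h *\<^sub>R axis i 1)) - F (W x)) + (F (W (x - h *\<^sub>R axis i 1)) - F (W x))) / h\<^sup>2"
      by (intro divide_right_mono sum_mono add_mono tangent) simp
    also have "\<dots> = difference_laplacian h (\<lambda>y. F (W y)) x"
      unfolding laplacian by (simp add: algebra_simps)
    finally show ?thesis using True by (simp add: F_def l_def)
  next
    case False
    then have "F (W x) = 0" by (simp add: F_def)
    moreover have "F z \<ge> 0" for z by (simp add: F_def)
    ultimately have "0 \<le> difference_laplacian h (\<lambda>y. F (W y)) x"
      unfolding laplacian by (intro divide_nonneg_nonneg sum_nonneg) auto
    then show ?thesis using False by (simp add: F_def)
  qed
qed

lemma bounded_supported_truncated_norm_sq: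
  assumes W: "continuous_on UNIV W" "bounded D" "\<And>x. x \<notin> D \<Longrightarrow> W x = 0" and "e > 0"
  shows "bounded_supported (\<lambda>x. max 0 ((norm (W x))\<^sup>2 - e))"
proof (rule bounded_supported_continuous[where K="closure D"])
  show "max 0 ((norm (W x))\<^sup>2 - e) = 0" if "x \<notin> closure D" for x
  proof -
    have "W x = 0" using that W(3) closure_subset by blast
    then show ?thesis using \<open>e > 0\<close> by simp
  qed
qed (use W(1,2) in \<open>auto intro!: continuous_intros\<close>)

lemma truncated_norm_sq_difference_inequality:
  fixes W :: "real^'n \<Rightarrow> complex" and \<phi> :: "real^'n \<Rightarrow> real"
  defines "A \<equiv> \<lambda>e. {x. e \<le> (norm (W x))\<^sup>2}"
  assumes supported: "bounded_supported W" "bounded_supported (\<lambda>x. indicator (A e) x *\<^sub>R (cnj (W x) * of_real (\<phi> x)))"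
    "bounded_supported (\<lambda>x. max 0 ((norm (W x))\<^sup>2 - e))" "bounded_supported \<phi>"
    and \<phi>_nonneg: "\<And>x. 0 \<le> \<phi> x"
  shows "2 * Re (LINT x|lborel. difference_laplacian h W x * (indicator (A e) x *\<^sub>R (cnj (W x) * of_real (\<phi> x))))
    \<le> (LINT x|lborel. max 0 ((norm (W x))\<^sup>2 - e) * difference_laplacian h \<phi> x)"
proof -
  define w where "w x = max 0 ((norm (W x))\<^sup>2 - e)" for x
  define g where "g x = indicator (A e) x *\<^sub>R (cnj (W x) * of_real (\<phi> x))" for x
  have w: "bounded_supported w" and g: "bounded_supported g"
    unfolding w_def g_def by (rule supported)+
  have integrable: "integrable lborel (\<lambda>x. difference_laplacian h W x * g x)"
    "integrable lborel (\<lambda>x. difference_laplacian h w x * \<phi> x)"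
    by (intro bounded_supported_integrable bounded_supported_mult bounded_supported_difference_laplacian
        supported g w)+
  have "2 * Re (LINT x|lborel. difference_laplacian h W x * g x) = (LINT x|lborel. 2 * Re (difference_laplacian h W x * g x))"
    by (simp only: integral_mult_right_zero integral_Re[OF integrable(1)])
  also have "\<dots> \<le> (LINT x|lborel. difference_laplacian h w x * \<phi> x)"
  proof (intro integral_mono integrable_mult_right integrable_Re integrable)
    fix x
    have "2 * Re (difference_laplacian h W x * g x)
        = indicator (A e) x * (2 * Re (cnj (W x) * difference_laplacian h W x)) * \<phi> x"
      by (simp add: g_def algebra_simps)
    also have "\<dots> \<le> difference_laplacian h w x * \<phi> x"
      unfolding A_def w_def[abs_def] by (intro mult_right_mono difference_laplacian_truncated_norm_sq \<phi>_nonneg)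
    finally show "2 * Re (difference_laplacian h W x * g x) \<le> difference_laplacian h w x * \<phi> x" .
  qed
  also have "\<dots> = (LINT x|lborel. w x * difference_laplacian h \<phi> x)"
    by (rule integral_difference_laplacian_by_parts[OF w supported(4), symmetric])
  finally show ?thesis by (simp only: w_def g_def)
qed

lemma compact_superlevel_norm_sq:
  fixes W :: "real^'n \<Rightarrow> complex"
  assumes W: "continuous_on UNIV W" "bounded D" "\<And>x. x \<notin> D \<Longrightarrow> W x = 0" and "e > 0"
  shows "{x. e \<le> (norm (W x))\<^sup>2} \<subseteq> D" and "compact {x. e \<le> (norm (W x))\<^sup>2}"
proof -
  show subset: "{x. e \<le> (norm (W x))\<^sup>2} \<subseteq> D" using W(3) \<open>e > 0\<close> by force
  have "closed {x. e \<le> (norm (W x))\<^sup>2}" by (intro closed_Collect_le continuous_intros W(1))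
  then show "compact {x. e \<le> (norm (W x))\<^sup>2}"
    using bounded_subset[OF W(2) subset] unfolding compact_eq_bounded_closed by blast
qed

lemma truncated_norm_sq_weak_inequality:
  fixes W :: "real^'n \<Rightarrow> complex"
  assumes W: "dirichlet_extension k D W" and D: "open D" "bounded D" and "e > 0"
    and \<phi>: "has_C2_partials \<phi> G H" "compact K" "\<And>x. x \<notin> K \<Longrightarrow> \<phi> x = 0" "\<And>x. 0 \<le> \<phi> x"
  shows "- (2 * k\<^sup>2 * (LINT x:{x. e \<le> (norm (W x))\<^sup>2}|lborel. (norm (W x))\<^sup>2 * \<phi> x))
    \<le> (LINT x|lborel. max 0 ((norm (W x))\<^sup>2 - e) * (\<Sum>i\<in>UNIV. H i x))"
proof -
  define A where "A = {x. e \<le> (norm (W x))\<^sup>2}"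
  define w where "w x = max 0 ((norm (W x))\<^sup>2 - e)" for x
  define g where "g x = indicator A x *\<^sub>R (cnj (W x) * of_real (\<phi> x))" for x
  have cont: "continuous_on UNIV W" and helmholtz: "classical_helmholtz k D W" and zero: "\<And>x. x \<notin> D \<Longrightarrow> W x = 0"
    using W by (auto simp: dirichlet_extension_def)
  have "A \<subseteq> D" "compact A"
    unfolding A_def using compact_superlevel_norm_sq[OF cont D(2) zero \<open>e > 0\<close>] by blast+
  have supported: "bounded_supported W" by (rule dirichlet_extension_bounded_supported[OF D(2) W])
  have \<phi>_supported: "bounded_supported \<phi>"
    by (rule has_C2_partials_bounded_supported(1)[OF \<phi>(1,2)]) (rule \<phi>(3))
  have w: "bounded_supported w"
    unfolding w_def by (rule bounded_supported_truncated_norm_sq[OF cont D(2) zero \<open>e > 0\<close>])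
  have "continuous_on A (\<lambda>x. cnj (W x) * of_real (\<phi> x))"
    by (intro continuous_intros continuous_on_subset[OF cont] has_C2_partials_continuous[OF \<phi>(1)]) auto
  then have g: "bounded_supported g" "\<And>x. x \<notin> A \<Longrightarrow> g x = 0"
    unfolding g_def by (auto intro: bounded_supported_indicator[OF _ \<open>compact A\<close>])
  obtain d C where "d > 0"
    and C: "\<And>x h. x \<in> A \<Longrightarrow> 0 < h \<Longrightarrow> h \<le> d \<Longrightarrow> norm (difference_laplacian h W x) \<le> C"
    using helmholtz_difference_laplacian_bound[OF helmholtz D(1) \<open>compact A\<close> \<open>A \<subseteq> D\<close>] by metis
  define h where "h n = d / real (Suc n)" for n
  have h: "h \<longlonglongrightarrow> 0" unfolding h_def divide_inverse
    by (rule tendsto_eq_rhs[OF tendsto_mult[OF tendsto_const LIMSEQ_inverse_real_of_nat]]) simp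
  have h_pos: "h n > 0" "h n \<le> d" for n using \<open>d > 0\<close> by (auto simp: h_def field_simps)
  have integrand: "- (complex_of_real (k\<^sup>2) * W x) * g x = complex_of_real (- (k\<^sup>2) * (indicator A x *\<^sub>R ((norm (W x))\<^sup>2 * \<phi> x)))" for x
    using complex_norm_square[of "W x"] by (simp add: g_def indicator_def mult.assoc[symmetric])
  have "2 * Re (LINT x|lborel. difference_laplacian (h n) W x * g x) \<le> (LINT x|lborel. w x * difference_laplacian (h n) \<phi> x)" for n
    unfolding g_def w_def A_def
    by (rule truncated_norm_sq_difference_inequality[OF supported g(1)[unfolded g_def A_def] w[unfolded w_def] \<phi>_supported \<phi>(4)])
  moreover have "(\<lambda>n. LINT x|lborel. difference_laplacian (h n) W x * g x) \<longlonglongrightarrow> (LINT x|lborel. - (complex_of_real (k\<^sup>2) * W x) * g x)"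
    by (rule integral_difference_laplacian_helmholtz_tendsto[where C=C, OF helmholtz D(1) \<open>compact A\<close> \<open>A \<subseteq> D\<close> g h h_pos(1)
          bounded_supported_measurable[OF supported]]) (use C h_pos in auto)
  moreover have "(\<lambda>n. LINT x|lborel. w x * difference_laplacian (h n) \<phi> x) \<longlonglongrightarrow> (LINT x|lborel. w x * (\<Sum>i\<in>UNIV. H i x))"
    by (rule integral_difference_laplacian_test_tendsto[OF \<phi>(1-3) w h h_pos(1)])
  ultimately have "2 * Re (LINT x|lborel. - (complex_of_real (k\<^sup>2) * W x) * g x) \<le> (LINT x|lborel. w x * (\<Sum>i\<in>UNIV. H i x))"
    by (intro LIMSEQ_le[OF tendsto_mult[OF tendsto_const tendsto_Re]]) auto
  also have "(LINT x|lborel. - (complex_of_real (k\<^sup>2) * W x) * g x) = of_real (- (k\<^sup>2) * (LINT x:A|lborel. (norm (W x))\<^sup>2 * \<phi> x))"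
    unfolding integrand by (simp only: integral_complex_of_real integral_mult_right_zero set_lebesgue_integral_def)
  finally show ?thesis by (simp add: A_def w_def)
qed

lemma integral_truncated_norm_sq_tendsto:
  fixes W :: "'a::euclidean_space \<Rightarrow> complex"
  assumes "continuous_on UNIV W" "bounded_supported W" "continuous_on UNIV g" "compact K" "\<And>x. x \<notin> K \<Longrightarrow> g x = 0"
    and e: "\<And>n. e n > 0" "e \<longlonglongrightarrow> 0"
  shows "(\<lambda>n. LINT x|lborel. max 0 ((norm (W x))\<^sup>2 - e n) * g x) \<longlonglongrightarrow> (LINT x|lborel. (norm (W x))\<^sup>2 * g x)"
proof -
  obtain M where M: "M \<ge> 0" "\<And>x. norm (W x) \<le> M" by (rule bounded_supported_bound[OF assms(2)]) (rule that)
  obtain B where B: "\<And>x. norm (g x) \<le> B"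
    by (rule bounded_supported_bound[OF bounded_supported_continuous[OF assms(3,4)]]) (use assms(5) that in auto)
  show ?thesis
  proof (rule bounded_convergence_compact_support[where M="M\<^sup>2 * B", OF _ _ assms(4)])
    show "(\<lambda>x. max 0 ((norm (W x))\<^sup>2 - e n) * g x) \<in> borel_measurable borel" for n
      by (intro borel_measurable_continuous_onI continuous_intros assms)
    show "norm (max 0 ((norm (W x))\<^sup>2 - e n) * g x) \<le> M\<^sup>2 * B" for n x
    proof -
      have "(norm (W x))\<^sup>2 \<le> M\<^sup>2" using M(2) by (intro power_mono) auto
      then have "max 0 ((norm (W x))\<^sup>2 - e n) \<le> M\<^sup>2" using e(1)[of n] by (simp add: max_def)
      then show ?thesis unfolding norm_mult using B by (intro mult_mono) auto
    qed
    have "(\<lambda>n. max 0 ((norm (W x))\<^sup>2 - e n) * g x) \<longlonglongrightarrow> max 0 ((norm (W x))\<^sup>2 - 0) * g x" for x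
      by (intro tendsto_intros e(2))
    then show "(\<lambda>n. max 0 ((norm (W x))\<^sup>2 - e n) * g x) \<longlonglongrightarrow> (norm (W x))\<^sup>2 * g x" for x
      by simp
  qed (simp add: assms(5))
qed

theorem norm_sq_weak_subsolution:
  fixes W :: "real^'n \<Rightarrow> complex"
  assumes W: "dirichlet_extension k D W" and D: "open D" "bounded D"
  shows "weak_subsolution (sqrt 2 * k) (\<lambda>x. (norm (W x))\<^sup>2)"
  unfolding weak_subsolution_def
proof (intro conjI allI impI)
  have cont: "continuous_on UNIV W" using W by (simp add: dirichlet_extension_def)
  then show "continuous_on UNIV (\<lambda>x. (norm (W x))\<^sup>2)" by (intro continuous_intros)
  fix K and \<phi> :: "real^'n \<Rightarrow> real" and G H
  assume \<phi>: "has_C2_partials \<phi> G H" "compact K" "\<forall>x. x \<notin> K \<longrightarrow> \<phi> x = 0" "\<forall>x. 0 \<le> \<phi> x"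
  then have zero: "\<phi> x = 0" if "x \<notin> K" for x using that by blast
  have H_zero: "(\<Sum>i\<in>UNIV. H i x) = 0" if "x \<notin> K" for x
    using has_second_partials_zero_outside(2)[of \<phi> G H K x] \<phi>(1) compact_imp_closed[OF \<phi>(2)] zero that
    by (simp add: has_C2_partials_def)
  define e where "e n = inverse (real (Suc n))" for n
  have e: "e n > 0" "e \<longlonglongrightarrow> 0" for n unfolding e_def using LIMSEQ_inverse_real_of_nat by simp_all
  have integrable: "set_integrable lborel K (\<lambda>x. (norm (W x))\<^sup>2 * \<phi> x)" "set_integrable lborel K (\<lambda>x. (norm (W x))\<^sup>2 * (\<Sum>i\<in>UNIV. H i x))"
    unfolding set_integrable_def
    by (intro borel_integrable_compact \<phi>(2) continuous_intros continuous_on_subset[OF cont] subset_UNIV has_C2_partials_continuous[OF \<phi>(1)])+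
  have lower: "- (2 * k\<^sup>2 * (LINT x:K|lborel. (norm (W x))\<^sup>2 * \<phi> x)) \<le> (LINT x|lborel. max 0 ((norm (W x))\<^sup>2 - e n) * (\<Sum>i\<in>UNIV. H i x))" for n
  proof -
    have "(LINT x:{x. e n \<le> (norm (W x))\<^sup>2}|lborel. (norm (W x))\<^sup>2 * \<phi> x) \<le> (LINT x:K|lborel. (norm (W x))\<^sup>2 * \<phi> x)"
      unfolding set_lebesgue_integral_def
      by (rule integral_mono'[OF integrable(1)[unfolded set_integrable_def]]) (use \<phi>(4) zero in \<open>auto simp: indicator_def\<close>)
    then have "2 * k\<^sup>2 * (LINT x:{x. e n \<le> (norm (W x))\<^sup>2}|lborel. (norm (W x))\<^sup>2 * \<phi> x) \<le> 2 * k\<^sup>2 * (LINT x:K|lborel. (norm (W x))\<^sup>2 * \<phi> x)"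
      by (intro mult_left_mono) auto
    then show ?thesis
      using truncated_norm_sq_weak_inequality[OF W D e(1) \<phi>(1,2) zero, of n] \<phi>(4) by auto
  qed
  have "(\<lambda>n. LINT x|lborel. max 0 ((norm (W x))\<^sup>2 - e n) * (\<Sum>i\<in>UNIV. H i x)) \<longlonglongrightarrow> (LINT x|lborel. (norm (W x))\<^sup>2 * (\<Sum>i\<in>UNIV. H i x))"
    by (intro integral_truncated_norm_sq_tendsto[OF cont dirichlet_extension_bounded_supported[OF D(2) W] _ \<phi>(2) H_zero e]
        continuous_intros has_C2_partials_continuous[OF \<phi>(1)])
  then have "- (2 * k\<^sup>2 * (LINT x:K|lborel. (norm (W x))\<^sup>2 * \<phi> x)) \<le> (LINT x|lborel. (norm (W x))\<^sup>2 * (\<Sum>i\<in>UNIV. H i x))"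
    using lower by (intro LIMSEQ_le_const) auto
  also have "\<dots> = (LINT x:K|lborel. (norm (W x))\<^sup>2 * (\<Sum>i\<in>UNIV. H i x))"
    unfolding set_lebesgue_integral_def by (rule Bochner_Integration.integral_cong) (auto simp: indicator_def H_zero)
  finally have "0 \<le> (LINT x:K|lborel. (norm (W x))\<^sup>2 * (\<Sum>i\<in>UNIV. H i x)) + 2 * k\<^sup>2 * (LINT x:K|lborel. (norm (W x))\<^sup>2 * \<phi> x)"
    by linarith
  also have "\<dots> = (LINT x:K|lborel. (norm (W x))\<^sup>2 * (\<Sum>i\<in>UNIV. H i x) + 2 * k\<^sup>2 * ((norm (W x))\<^sup>2 * \<phi> x))"
    unfolding set_integral_mult_right[symmetric]
    by (rule set_integral_add(2)[OF integrable(2) set_integrable_mult_right[OF integrable(1)], symmetric])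
  also have "\<dots> = (LINT x:K|lborel. (norm (W x))\<^sup>2 * ((\<Sum>i\<in>UNIV. H i x) + (sqrt 2 * k)\<^sup>2 * \<phi> x))"
    by (simp add: power_mult_distrib algebra_simps)
  finally show "0 \<le> (LINT x:K|lborel. (norm (W x))\<^sup>2 * ((\<Sum>i\<in>UNIV. H i x) + (sqrt 2 * k)\<^sup>2 * \<phi> x))" .
qed

lemma bounded_supported_cnj: "bounded_supported f \<Longrightarrow> bounded_supported (\<lambda>x. cnj (f x))"
  by (rule bounded_supported_linear[OF bounded_linear_cnj])

lemma integrable_norm_sq:
  fixes f :: "'a::euclidean_space \<Rightarrow> complex"
  assumes "bounded_supported f"
  shows "integrable lborel (\<lambda>x. (norm (f x))\<^sup>2)"
proof -
  have "integrable lborel (\<lambda>x. Re (f x * cnj (f x)))"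
    by (intro integrable_Re bounded_supported_integrable bounded_supported_mult bounded_supported_cnj assms)
  then show ?thesis by (simp add: complex_mult_cnj cmod_power2)
qed

lemma set_integral_Re:
  fixes f :: "'a \<Rightarrow> complex"
  assumes "set_integrable M A f"
  shows "(LINT x:A|M. Re (f x)) = Re (LINT x:A|M. f x)"
  using integral_Re[OF assms[unfolded set_integrable_def]] by (simp add: set_lebesgue_integral_def)

lemma has_C2_partials_linear:
  assumes "bounded_linear L" "has_C2_partials f G H"
  shows "has_C2_partials (\<lambda>x. L (f x)) (\<lambda>i x. L (G i x)) (\<lambda>i x. L (H i x))"
  using assms has_second_partials_linear[OF assms(1), of UNIV f G H]
  by (auto simp: has_C2_partials_def intro: bounded_linear.continuous_on)

lemma Re_cutoff_times_wave_nonneg: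
  assumes "0 \<le> a" "0 < s" "a \<noteq> 0 \<Longrightarrow> \<bar>\<kappa> * s\<bar> \<le> 1"
  shows "0 \<le> Re (of_real a * wave \<kappa> (of_real s))"
proof (cases "a = 0")
  case False
  have "exp (\<i> * of_real \<kappa> * complex_of_real s) = cis (\<kappa> * s)" by (simp add: cis_conv_exp mult.assoc)
  then have "Re (of_real a * wave \<kappa> (of_real s)) = a * (cos (\<kappa> * s) / s)" by (simp add: wave_def Re_divide_of_real)
  moreover have "0 \<le> cos (\<kappa> * s)" using assms(3)[OF False] pi_gt3 by (intro cos_ge_zero) auto
  ultimately show ?thesis using assms(1,2) by simp
qed simp

lemma weak_subsolution_wave_test:
  fixes v :: "real^3 \<Rightarrow> real"
  assumes v: "weak_subsolution \<kappa> v" and K: "compact K" and \<phi>: "has_C2_partials \<phi> G H" "\<And>x. x \<notin> K \<Longrightarrow> \<phi> x = 0" "\<And>x. 0 \<le> Re (\<phi> x)"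
  shows "0 \<le> Re (LINT x:K|lborel. of_real (v x) * ((\<Sum>i\<in>UNIV. H i x) + of_real (\<kappa>\<^sup>2) * \<phi> x))"
proof -
  have "continuous_on K v" using v by (auto simp: weak_subsolution_def intro: continuous_on_subset)
  then have "set_integrable lborel K (\<lambda>x. of_real (v x) * ((\<Sum>i\<in>UNIV. H i x) + of_real (\<kappa>\<^sup>2) * \<phi> x))"
    unfolding set_integrable_def
    by (intro borel_integrable_compact K continuous_intros has_C2_partials_continuous[OF \<phi>(1)])
  moreover have "0 \<le> (LINT x:K|lborel. v x * ((\<Sum>i\<in>UNIV. Re (H i x)) + \<kappa>\<^sup>2 * Re (\<phi> x)))"
    using v[unfolded weak_subsolution_def] K has_C2_partials_linear[OF bounded_linear_Re \<phi>(1)] \<phi>(2,3) by auto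
  ultimately show ?thesis by (simp flip: set_integral_Re)
qed

lemma smooth_dist_sqdist_le:
  assumes "0 < d" "d \<le> r" "norm (x - y) \<le> r"
  shows "smooth_dist d (sqdist y x) \<le> 2 * r"
proof -
  have "(norm (x - y))\<^sup>2 \<le> r\<^sup>2" "d\<^sup>2 \<le> r\<^sup>2" using assms by (auto intro!: power_mono)
  then have "(norm (x - y))\<^sup>2 + d\<^sup>2 \<le> 4 * r\<^sup>2" using zero_le_power2[of r] by linarith
  then have "sqdist y x + d\<^sup>2 \<le> (2 * r)\<^sup>2" by (simp add: power2_norm_eq_inner power_mult_distrib)
  then show ?thesis unfolding smooth_dist_def using assms by (intro real_le_lsqrt) auto
qed

lemma Re_cutoff_wave_nonneg:
  assumes "0 < r" and small: "2 * r * \<bar>\<kappa>\<bar> \<le> 1" and d: "0 < d" "d \<le> r"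
  shows "0 \<le> Re (of_real (plateau ((r/2)\<^sup>2) (r\<^sup>2) (sqdist y x)) * wave \<kappa> (of_real (smooth_dist d (sqdist y x))))"
proof (rule Re_cutoff_times_wave_nonneg)
  have half: "0 \<le> r/2" "r/2 < r" using \<open>0 < r\<close> by auto
  show "0 \<le> plateau ((r/2)\<^sup>2) (r\<^sup>2) (sqdist y x)" using half by (intro plateau_bounds power_strict_mono) auto
  show "0 < smooth_dist d (sqdist y x)" using d(1) by (intro smooth_dist_pos) simp
  assume "plateau ((r/2)\<^sup>2) (r\<^sup>2) (sqdist y x) \<noteq> 0"
  then have "norm (x - y) \<le> r" using plateau_sqdist_outside[OF half, of x y] by force
  then have "smooth_dist d (sqdist y x) \<le> 2 * r" using d by (intro smooth_dist_sqdist_le)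
  then have "\<bar>\<kappa>\<bar> * smooth_dist d (sqdist y x) \<le> \<bar>\<kappa>\<bar> * (2 * r)" by (intro mult_left_mono) auto
  then show "\<bar>\<kappa> * smooth_dist d (sqdist y x)\<bar> \<le> 1"
    using small smooth_dist_pos[of d "sqdist y x"] d(1) by (simp add: abs_mult mult.commute)
qed

theorem weak_subsolution_mean_value:
  fixes v :: "real^3 \<Rightarrow> real"
  assumes v: "weak_subsolution \<kappa> v" and r: "0 < r" "r \<le> 1" "2 * r * \<bar>\<kappa>\<bar> \<le> 1"
  shows "3 * mollifier_mass * v y \<le> (LINT x:annulus y (r/2) r|lborel. v x * Re (annulus_kernel \<kappa> (r/2) r y y x))"
proof -
  have half: "0 \<le> r/2" "0 < r/2" "r/2 < r" using r by auto
  define X where "X = plateau ((r/2)\<^sup>2) (r\<^sup>2)"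
  define \<delta> where "\<delta> n = r * inverse (real (Suc n))" for n
  have \<delta>: "0 < \<delta> n" "\<delta> n \<le> r" for n using r(1) by (auto simp: \<delta>_def field_simps)
  then have \<delta>_le_1: "\<delta> n \<le> 1" for n using r(2) order_trans by blast
  have \<delta>_lim: "\<delta> \<longlonglongrightarrow> 0"
    unfolding \<delta>_def by (rule tendsto_eq_rhs[OF tendsto_mult[OF tendsto_const LIMSEQ_inverse_real_of_nat]]) simp
  have v_cont: "continuous_on A (\<lambda>x. complex_of_real (v x))" for A
    using v by (intro continuous_intros) (auto simp: weak_subsolution_def intro: continuous_on_subset)
  have outside: "X (sqdist y x) = 0" if "x \<notin> cball y r" for x
    using plateau_sqdist_outside[OF half(1,3), of x y] that by (simp add: X_def dist_norm norm_minus_commute)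
  have inside: "plateau' ((r/2)\<^sup>2) (r\<^sup>2) (sqdist y x) = 0 \<and> plateau'' ((r/2)\<^sup>2) (r\<^sup>2) (sqdist y x) = 0" if "x \<in> ball y (r/2)" for x
    using plateau_sqdist_inside[OF half(1,3), of x y] that by (simp add: dist_norm norm_minus_commute)
  let ?\<phi> = "\<lambda>n x. of_real (X (sqdist y x)) * wave \<kappa> (of_real (smooth_dist (\<delta> n) (sqdist y x)))"
  obtain G H where \<phi>: "\<And>n. has_C2_partials (?\<phi> n) (G n) (H n)"
    and limit: "(\<lambda>n. LINT x:cball y r|lborel. of_real (v x) * ((\<Sum>i\<in>UNIV. H n i x) + of_real (\<kappa>\<^sup>2) * ?\<phi> n x))
      \<longlonglongrightarrow> (LINT x:cball y r|lborel. of_real (v x) * annulus_kernel \<kappa> (r/2) r y y x)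
        - 3 * of_real mollifier_mass * (of_real (X (sqdist y y)) * of_real (v y))"
    unfolding X_def annulus_kernel_def
    by (rule regularised_wave_integral_tendsto[OF open_UNIV v_cont has_C2_derivatives_plateau_square[OF half(1,3)]
          compact_cball subset_UNIV outside[unfolded X_def] UNIV_I half(2) inside \<delta>(1) \<delta>_le_1 \<delta>_lim, where \<kappa>=\<kappa>])
       (assumption | rule that[unfolded X_def annulus_kernel_def])+
  have "0 \<le> Re (?\<phi> n x)" for n x unfolding X_def by (rule Re_cutoff_wave_nonneg[OF r(1,3) \<delta>])
  then have "0 \<le> Re (LINT x:cball y r|lborel. of_real (v x) * ((\<Sum>i\<in>UNIV. H n i x) + of_real (\<kappa>\<^sup>2) * ?\<phi> n x))" for n
    by (intro weak_subsolution_wave_test[OF v compact_cball \<phi>]) (auto simp: outside)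
  then have "0 \<le> Re ((LINT x:cball y r|lborel. of_real (v x) * annulus_kernel \<kappa> (r/2) r y y x)
        - 3 * of_real mollifier_mass * (of_real (X (sqdist y y)) * of_real (v y)))"
    by (intro LIMSEQ_le_const[OF tendsto_Re[OF limit]]) auto
  moreover have "X (sqdist y y) = 1" using plateau_sqdist_inside[OF half(1,3), of y y] r by (simp add: X_def)
  moreover have "set_integrable lborel (annulus y (r/2) r) (\<lambda>x. of_real (v x) * annulus_kernel \<kappa> (r/2) r y y x)"
    by (rule set_integrable_annulus_kernel[OF half(1,3) subset_refl _ v_cont]) (use r in \<open>simp add: mem_annulus\<close>)
  moreover have "annulus y (r/2) r \<subseteq> cball y r" by (auto simp: annulus_def)
  note set_integral_annulus_kernel[OF half(1,3) this]
  ultimately show ?thesis by (simp flip: set_integral_Re)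
qed

lemma annulus_kernel_centred_bound:
  assumes "0 < r" "r < R"
  obtains B where "B \<ge> 0" "\<And>x y. norm (annulus_kernel \<kappa> r R y y x) \<le> B"
proof -
  have "bounded (annulus_kernel \<kappa> r R 0 0 ` annulus 0 r R)"
    using assms by (intro compact_imp_bounded compact_continuous_image compact_annulus continuous_on_annulus_kernel)
      (auto simp: mem_annulus)
  then obtain B where B: "B > 0" "\<And>x. x \<in> annulus 0 r R \<Longrightarrow> norm (annulus_kernel \<kappa> r R 0 0 x) \<le> B"
    unfolding bounded_pos by blast
  have "norm (annulus_kernel \<kappa> r R y y x) \<le> B" for x y
  proof -
    have "annulus_kernel \<kappa> r R y y x = annulus_kernel \<kappa> r R 0 0 (x - y)"
      by (simp add: annulus_kernel_def representation_kernel_def)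
    moreover have "norm (annulus_kernel \<kappa> r R 0 0 (x - y)) \<le> B"
      using B(1) B(2)[of "x - y"] annulus_kernel_eq_0[of r R "x - y" 0 \<kappa> 0] assms
      by (cases "x - y \<in> annulus 0 r R") (auto simp: mem_annulus)
    ultimately show ?thesis by simp
  qed
  then show ?thesis using that[of B] B(1) by simp
qed

theorem dirichlet_extension_sup_bound:
  assumes "k > 0"
  obtains C where "C \<ge> 0"
    "\<And>D W y::real^3. open D \<Longrightarrow> bounded D \<Longrightarrow> dirichlet_extension k D W \<Longrightarrow> (norm (W y))\<^sup>2 \<le> C * (LINT x|lborel. (norm (W x))\<^sup>2)"
proof -
  define \<kappa> where "\<kappa> = sqrt 2 * k"
  define r where "r = min 1 (1 / (2 * \<kappa>))"
  have "\<kappa> > 0" using assms by (simp add: \<kappa>_def)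
  then have r: "0 < r" "r \<le> 1" "2 * r * \<bar>\<kappa>\<bar> \<le> 1" by (auto simp: r_def min_def field_simps)
  obtain B where B: "B \<ge> 0" "\<And>x y. norm (annulus_kernel \<kappa> (r/2) r y y x) \<le> B"
    by (rule annulus_kernel_centred_bound[of "r/2" r \<kappa>]) (use r that in auto)
  have "(norm (W y))\<^sup>2 \<le> B / (3 * mollifier_mass) * (LINT x|lborel. (norm (W x))\<^sup>2)"
    if D: "open D" "bounded D" and W: "dirichlet_extension k D W" for D W and y :: "real^3"
  proof -
    have supported: "bounded_supported W" by (rule dirichlet_extension_bounded_supported[OF D(2) W])
    have "3 * mollifier_mass * (norm (W y))\<^sup>2 \<le> (LINT x:annulus y (r/2) r|lborel. (norm (W x))\<^sup>2 * Re (annulus_kernel \<kappa> (r/2) r y y x))"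
      unfolding \<kappa>_def by (rule weak_subsolution_mean_value[OF norm_sq_weak_subsolution[OF W D] r[unfolded \<kappa>_def]])
    also have "\<dots> \<le> (LINT x|lborel. B * (norm (W x))\<^sup>2)"
      unfolding set_lebesgue_integral_def
    proof (rule integral_mono')
      show "integrable lborel (\<lambda>x. B * (norm (W x))\<^sup>2)"
        by (intro integrable_mult_right integrable_norm_sq supported)
      fix x
      have "Re (annulus_kernel \<kappa> (r/2) r y y x) \<le> B" using B(2) complex_Re_le_cmod order_trans by blast
      from mult_left_mono[OF this, of "(norm (W x))\<^sup>2"]
      show "indicator (annulus y (r/2) r) x *\<^sub>R ((norm (W x))\<^sup>2 * Re (annulus_kernel \<kappa> (r/2) r y y x)) \<le> B * (norm (W x))\<^sup>2"
        using B(1) by (auto simp: indicator_def mult.commute)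
    qed (use B(1) in simp)
    finally show ?thesis using mollifier_mass_pos by (simp add: field_simps)
  qed
  then show ?thesis using that[of "B / (3 * mollifier_mass)"] B(1) mollifier_mass_pos by simp
qed

section \<open>Finite dimension of the space of Dirichlet solutions\<close>

definition L2_inner :: "('a::euclidean_space \<Rightarrow> complex) \<Rightarrow> ('a \<Rightarrow> complex) \<Rightarrow> complex" where
  "L2_inner f g = (LINT x|lborel. f x * cnj (g x))"

lemma integrable_L2_inner:
  "bounded_supported f \<Longrightarrow> bounded_supported g \<Longrightarrow> integrable lborel (\<lambda>x. f x * cnj (g x))"
  by (intro bounded_supported_integrable bounded_supported_mult bounded_supported_cnj)

lemma L2_inner_cnj: "cnj (L2_inner f g) = L2_inner g f"
  unfolding L2_inner_def by (subst Bochner_Integration.integral_cnj[symmetric]) (simp add: mult.commute)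

lemma L2_inner_self:
  "bounded_supported f \<Longrightarrow> L2_inner f f = of_real (LINT x|lborel. (norm (f x))\<^sup>2)"
  unfolding L2_inner_def integral_complex_of_real[symmetric] complex_norm_square[symmetric] ..

lemma L2_inner_diff_left:
  assumes "bounded_supported f" "bounded_supported g" "bounded_supported h"
  shows "L2_inner (\<lambda>x. f x - g x) h = L2_inner f h - L2_inner g h"
  using assms by (simp add: L2_inner_def left_diff_distrib integrable_L2_inner)

lemma L2_inner_cmult_left: "L2_inner (\<lambda>x. c * f x) g = c * L2_inner f g"
  by (simp add: L2_inner_def mult.assoc)

lemma L2_inner_sum_left:
  assumes "\<And>i. i \<in> I \<Longrightarrow> bounded_supported (f i)" "bounded_supported g"
  shows "L2_inner (\<lambda>x. \<Sum>i\<in>I. a i * f i x) g = (\<Sum>i\<in>I. a i * L2_inner (f i) g)"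
  using assms by (simp add: L2_inner_def sum_distrib_right mult.assoc integrable_L2_inner)

lemma L2_norm_pos:
  fixes f :: "'a::euclidean_space \<Rightarrow> complex"
  assumes "bounded_supported f" "continuous_on UNIV f" "f x0 \<noteq> 0"
  shows "(LINT x|lborel. (norm (f x))\<^sup>2) > 0"
proof -
  have "integrable lborel (\<lambda>x. (norm (f x))\<^sup>2)" by (rule integrable_norm_sq[OF assms(1)])
  moreover have "\<not> (AE x in lborel. (norm (f x))\<^sup>2 = 0)"
  proof
    assume "AE x in lborel. (norm (f x))\<^sup>2 = 0"
    then have "AE x in lborel. f x = 0" by eventually_elim simp
    moreover have "open {x. f x \<noteq> 0}" using assms(2) by (intro open_Collect_neq continuous_on_const)
    ultimately have "{x. f x \<noteq> 0} \<in> null_sets lborel" using AE_iff_null[of lborel "\<lambda>x. f x = 0"] by simp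
    then have "negligible {x. f x \<noteq> 0}" unfolding negligible_iff_null_sets by (rule null_sets_completionI)
    then show False using open_not_negligible[OF \<open>open {x. f x \<noteq> 0}\<close>] assms(3) by blast
  qed
  ultimately show ?thesis
    by (simp add: integral_nonneg_eq_0_iff_AE less_le integral_nonneg_AE)
qed

definition L2_orthonormal :: "('a::euclidean_space \<Rightarrow> complex) set \<Rightarrow> bool" where
  "L2_orthonormal B \<longleftrightarrow> (\<forall>f\<in>B. \<forall>g\<in>B. L2_inner f g = (if f = g then 1 else 0))"

lemma L2_inner_orthonormal_sum:
  assumes "finite B" "L2_orthonormal B" "\<And>f. f \<in> B \<Longrightarrow> bounded_supported f" "g \<in> B"
  shows "L2_inner (\<lambda>x. \<Sum>f\<in>B. a f * f x) g = a g"
proof -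
  have "L2_inner (\<lambda>x. \<Sum>f\<in>B. a f * f x) g = (\<Sum>f\<in>B. a f * L2_inner f g)"
    by (rule L2_inner_sum_left) (use assms in auto)
  also have "\<dots> = (\<Sum>f\<in>B. if f = g then a f else 0)"
    by (rule sum.cong) (use assms in \<open>auto simp: L2_orthonormal_def\<close>)
  finally show ?thesis using assms(1,4) by simp
qed

text \<open>At each point \<open>y\<close> the function \<open>\<Sum>\<^sub>f cnj (f y) f\<close> has both the value and the squared norm
  \<open>S = \<Sum>\<^sub>f \<bar>f y\<bar>\<^sup>2\<close>, so the sup bound \<open>S\<^sup>2 \<le> C S\<close> gives \<open>S \<le> C\<close>.\<close>

lemma orthonormal_pointwise_bound:
  assumes B: "finite B" "L2_orthonormal B" "\<And>f. f \<in> B \<Longrightarrow> dirichlet_extension k D f" and "bounded D" "C \<ge> 0"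
    and C: "\<And>W. dirichlet_extension k D W \<Longrightarrow> (norm (W y))\<^sup>2 \<le> C * (LINT x|lborel. (norm (W x))\<^sup>2)"
  shows "(\<Sum>f\<in>B. (norm (f y))\<^sup>2) \<le> C"
proof -
  define S where "S = (\<Sum>f\<in>B. (norm (f y))\<^sup>2)"
  define W where "W x = (\<Sum>f\<in>B. cnj (f y) * f x)" for x
  have supported: "bounded_supported f" if "f \<in> B" for f
    by (rule dirichlet_extension_bounded_supported[OF \<open>bounded D\<close> B(3)[OF that]])
  have W: "dirichlet_extension k D W" unfolding W_def by (rule dirichlet_extension_sum) (rule B(3))
  then have W_supported: "bounded_supported W" by (rule dirichlet_extension_bounded_supported[OF \<open>bounded D\<close>])
  have S: "of_real S = (\<Sum>f\<in>B. cnj (f y) * f y)"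
    unfolding S_def of_real_sum complex_norm_square by (simp add: mult.commute)
  have "L2_inner f W = f y" if "f \<in> B" for f
  proof -
    have "L2_inner W f = cnj (f y)" unfolding W_def using B(1,2) supported that by (rule L2_inner_orthonormal_sum)
    then show ?thesis using L2_inner_cnj[of W f] by simp
  qed
  moreover have "L2_inner W W = (\<Sum>f\<in>B. cnj (f y) * L2_inner f W)"
    using L2_inner_sum_left[of B "\<lambda>f. f" W "\<lambda>f. cnj (f y)"] supported W_supported by (simp add: W_def[abs_def])
  ultimately have "L2_inner W W = of_real S" by (simp add: S)
  then have "(LINT x|lborel. (norm (W x))\<^sup>2) = S" unfolding L2_inner_self[OF W_supported] by (simp only: of_real_eq_iff)
  moreover have "W y = of_real S" by (simp add: W_def S)
  ultimately have "S * S \<le> C * S" using C[OF W] by (simp add: power2_eq_square)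
  moreover have "S \<ge> 0" by (simp add: S_def sum_nonneg)
  ultimately have "S \<le> C" using \<open>C \<ge> 0\<close> by (cases "S = 0") (auto simp: mult_le_cancel_right)
  then show ?thesis by (simp add: S_def)
qed

lemma orthonormal_card_bound:
  assumes B: "finite B" "L2_orthonormal B" "\<And>f. f \<in> B \<Longrightarrow> dirichlet_extension k D f" and "bounded D" "C \<ge> 0"
    and C: "\<And>W y. dirichlet_extension k D W \<Longrightarrow> (norm (W y))\<^sup>2 \<le> C * (LINT x|lborel. (norm (W x))\<^sup>2)"
  shows "real (card B) \<le> C * measure lborel (closure D)"
proof -
  have supported: "bounded_supported f" if "f \<in> B" for f
    by (rule dirichlet_extension_bounded_supported[OF \<open>bounded D\<close> B(3)[OF that]])
  have "compact (closure D)" using \<open>bounded D\<close> by simp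
  have zero: "f x = 0" if "f \<in> B" "x \<notin> closure D" for f x
    using B(3)[OF that(1)] that(2) closure_subset by (auto simp: dirichlet_extension_def)
  have unit: "(LINT x|lborel. (norm (f x))\<^sup>2) = 1" if "f \<in> B" for f
  proof -
    have "complex_of_real (LINT x|lborel. (norm (f x))\<^sup>2) = 1"
      using B(2) that L2_inner_self[OF supported[OF that]] by (simp add: L2_orthonormal_def)
    then show ?thesis by (simp only: of_real_eq_1_iff)
  qed
  have "real (card B) = (\<Sum>f\<in>B. (LINT x|lborel. (norm (f x))\<^sup>2))" using unit by simp
  also have "\<dots> = (LINT x|lborel. (\<Sum>f\<in>B. (norm (f x))\<^sup>2))"
    by (rule Bochner_Integration.integral_sum[symmetric]) (rule integrable_norm_sq[OF supported])
  also have "\<dots> \<le> (LINT x:closure D|lborel. C)"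
    unfolding set_lebesgue_integral_def
  proof (rule integral_mono)
    show "integrable lborel (\<lambda>x. \<Sum>f\<in>B. (norm (f x))\<^sup>2)"
      by (rule Bochner_Integration.integrable_sum) (rule integrable_norm_sq[OF supported])
    show "integrable lborel (\<lambda>x. indicator (closure D) x *\<^sub>R C)"
      by (rule borel_integrable_compact[OF \<open>compact (closure D)\<close>]) simp
    show "(\<Sum>f\<in>B. (norm (f x))\<^sup>2) \<le> indicator (closure D) x *\<^sub>R C" for x
      using orthonormal_pointwise_bound[OF B \<open>bounded D\<close> \<open>C \<ge> 0\<close> C, of x] zero[of _ x]
      by (cases "x \<in> closure D") (auto intro!: sum_nonpos)
  qed
  also have "\<dots> = C * measure lborel (closure D)" by (simp add: set_lebesgue_integral_def)
  finally show ?thesis .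
qed

lemma maximal_orthonormal_expansion:
  assumes B: "finite B" "L2_orthonormal B" "\<And>f. f \<in> B \<Longrightarrow> dirichlet_extension k D f" and "bounded D"
    and maximal: "\<And>g. dirichlet_extension k D g \<Longrightarrow> g \<notin> B \<Longrightarrow> \<not> L2_orthonormal (insert g B)"
    and W: "dirichlet_extension k D W"
  shows "W x = (\<Sum>f\<in>B. L2_inner W f * f x)"
proof (rule ccontr)
  define V where "V x = W x - (\<Sum>f\<in>B. L2_inner W f * f x)" for x
  assume "W x \<noteq> (\<Sum>f\<in>B. L2_inner W f * f x)"
  then have "V x \<noteq> 0" by (simp add: V_def)
  note supported = dirichlet_extension_bounded_supported[OF \<open>bounded D\<close>]
  have projection: "dirichlet_extension k D (\<lambda>x. \<Sum>f\<in>B. L2_inner W f * f x)"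
    by (rule dirichlet_extension_sum) (rule B(3))
  then have V: "dirichlet_extension k D V" unfolding V_def[abs_def] by (rule dirichlet_extension_diff[OF W])
  have orthogonal: "L2_inner V g = 0" if "g \<in> B" for g
  proof -
    have "L2_inner V g = L2_inner W g - L2_inner (\<lambda>x. \<Sum>f\<in>B. L2_inner W f * f x) g"
      unfolding V_def by (intro L2_inner_diff_left supported[OF W] supported[OF projection] supported[OF B(3)] that)
    then show ?thesis using L2_inner_orthonormal_sum[OF B(1,2) supported[OF B(3)] that] by simp
  qed
  define m where "m = (LINT x|lborel. (norm (V x))\<^sup>2)"
  have "m > 0" unfolding m_def
    by (rule L2_norm_pos[OF supported[OF V] _ \<open>V x \<noteq> 0\<close>]) (use V in \<open>simp add: dirichlet_extension_def\<close>)
  define g where "g x = of_real (1 / sqrt m) * V x" for x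
  have g: "dirichlet_extension k D g" unfolding g_def[abs_def] by (rule dirichlet_extension_cmult[OF V])
  have left: "L2_inner g h = of_real (1 / sqrt m) * L2_inner V h" for h
    unfolding g_def by (rule L2_inner_cmult_left)
  have right: "L2_inner h g = of_real (1 / sqrt m) * L2_inner h V" for h
    using left[of h] L2_inner_cnj[of g h] L2_inner_cnj[of V h] by (metis complex_cnj_complex_of_real complex_cnj_mult)
  have "L2_inner g g = of_real (1 / sqrt m * (1 / sqrt m) * m)"
    unfolding left right L2_inner_self[OF supported[OF V]] m_def[symmetric] by (simp only: of_real_mult mult.assoc)
  also have "1 / sqrt m * (1 / sqrt m) * m = 1" using \<open>m > 0\<close> by (simp add: field_simps)
  finally have "L2_inner g g = 1" by simp
  moreover have g_orthogonal: "L2_inner g h = 0" "L2_inner h g = 0" if "h \<in> B" for h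
    using orthogonal[OF that] L2_inner_cnj[of V h] by (auto simp: left right)
  ultimately have "g \<notin> B" by auto
  moreover have "L2_orthonormal (insert g B)"
    using B(2) \<open>L2_inner g g = 1\<close> g_orthogonal \<open>g \<notin> B\<close> by (auto simp: L2_orthonormal_def)
  ultimately show False using maximal[OF g] by blast
qed

theorem dirichlet_extension_finite_basis:
  fixes D :: "(real^3) set"
  assumes "k > 0" "open D" "bounded D"
  obtains B where "finite B" "\<And>W x. dirichlet_extension k D W \<Longrightarrow> W x = (\<Sum>f\<in>B. L2_inner W f * f x)"
proof -
  obtain C where C: "C \<ge> 0" "\<And>W y. dirichlet_extension k D W \<Longrightarrow> (norm (W y))\<^sup>2 \<le> C * (LINT x|lborel. (norm (W x))\<^sup>2)"
    by (rule dirichlet_extension_sup_bound[OF \<open>k > 0\<close>]) (use assms(2,3) in blast)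
  define system where "system B \<longleftrightarrow> finite B \<and> L2_orthonormal B \<and> (\<forall>f\<in>B. dirichlet_extension k D f)" for B
  have "card B < nat \<lceil>C * measure lborel (closure D)\<rceil> + 1" if "system B" for B
  proof -
    have "real (card B) \<le> C * measure lborel (closure D)"
      using orthonormal_card_bound[of B k D C] C assms(3) that unfolding system_def by blast
    then show ?thesis by linarith
  qed
  moreover have "system {}" by (simp add: system_def L2_orthonormal_def)
  ultimately obtain B where B: "system B" and maximal: "\<And>B'. system B' \<Longrightarrow> card B' \<le> card B"
    using ex_has_greatest_nat[of system "{}" card] by blast
  have "\<not> L2_orthonormal (insert g B)" if "dirichlet_extension k D g" "g \<notin> B" for g
    using maximal[of "insert g B"] that B by (auto simp: system_def)
  then show ?thesis
    using that[of B] maximal_orthonormal_expansion[of B k D] B assms(3) unfolding system_def by blast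
qed

lemma infinitely_many_vectors_dependent:
  fixes a :: "nat \<Rightarrow> 'b \<Rightarrow> 'c::field"
  assumes "finite B"
  shows "\<exists>N c. (\<exists>i<N. c i \<noteq> 0) \<and> (\<forall>b\<in>B. (\<Sum>i<N. c i * a i b) = 0)"
  using assms
proof (induction B arbitrary: a rule: finite_induct)
  case empty
  show ?case by (intro exI[of _ "Suc 0"] exI[of _ "\<lambda>_. 1"]) auto
next
  case (insert g B)
  show ?case
  proof (cases "\<forall>i. a i g = 0")
    case True
    from insert.IH[of a] obtain N c where "\<exists>i<N. c i \<noteq> 0" "\<forall>b\<in>B. (\<Sum>i<N. c i * a i b) = 0" by blast
    then show ?thesis using True by (intro exI[of _ N] exI[of _ c]) auto
  next
    case False
    then obtain p where p: "a p g \<noteq> 0" by blast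
    define r where "r n = a (Suc p + n) g / a p g" for n
    from insert.IH[of "\<lambda>n b. a (Suc p + n) b - r n * a p b"] obtain N c
      where c: "\<exists>i<N. c i \<noteq> 0" "\<forall>b\<in>B. (\<Sum>n<N. c n * (a (Suc p + n) b - r n * a p b)) = 0" by blast
    define d where "d i = (if i < p then 0 else if i = p then - (\<Sum>n<N. c n * r n) else c (i - Suc p))" for i
    have split: "(\<Sum>i<Suc p + N. d i * a i b) = (\<Sum>n<N. c n * (a (Suc p + n) b - r n * a p b))" for b
    proof -
      have "(\<Sum>i<Suc p + M. d i * a i b) = (\<Sum>i<Suc p. d i * a i b) + (\<Sum>n<M. c n * a (Suc p + n) b)" for M
        by (induction M) (simp_all add: d_def add.assoc)
      moreover have "(\<Sum>i<Suc p. d i * a i b) = - (\<Sum>n<N. c n * r n) * a p b" by (simp add: d_def)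
      ultimately show ?thesis by (simp add: right_diff_distrib sum_subtractf sum_distrib_right mult.assoc)
    qed
    have "\<exists>i<Suc p + N. d i \<noteq> 0"
    proof -
      obtain n where "n < N" "c n \<noteq> 0" using c(1) by blast
      then show ?thesis by (intro exI[of _ "Suc p + n"]) (simp add: d_def)
    qed
    moreover have "(\<Sum>i<Suc p + N. d i * a i b) = 0" if "b \<in> insert g B" for b
      unfolding split using c(2) that p by (auto simp: r_def)
    ultimately show ?thesis by blast
  qed
qed

theorem dirichlet_extensions_dependent:
  fixes U :: "nat \<Rightarrow> real^3 \<Rightarrow> complex"
  assumes "k > 0" "open D" "bounded D" and U: "\<And>i. dirichlet_extension k D (U i)"
  obtains N c j where "j < N" "c j \<noteq> 0" "\<And>x. (\<Sum>i<N. c i * U i x) = 0"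
proof -
  obtain B where "finite B" and expansion: "\<And>W x. dirichlet_extension k D W \<Longrightarrow> W x = (\<Sum>f\<in>B. L2_inner W f * f x)"
    by (rule dirichlet_extension_finite_basis[OF assms(1-3)]) (rule that)
  from infinitely_many_vectors_dependent[OF \<open>finite B\<close>, of "\<lambda>i. L2_inner (U i)"]
  obtain N c j where c: "j < N" "c j \<noteq> 0" "\<And>f. f \<in> B \<Longrightarrow> (\<Sum>i<N. c i * L2_inner (U i) f) = 0" by blast
  have "(\<Sum>i<N. c i * U i x) = 0" for x
  proof -
    have "(\<Sum>i<N. c i * U i x) = (\<Sum>f\<in>B. (\<Sum>i<N. c i * L2_inner (U i) f) * f x)"
      unfolding expansion[OF U, of _ x] sum_distrib_left sum_distrib_right mult.assoc by (rule sum.swap)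
    then show ?thesis by (simp add: c(3))
  qed
  with c(1,2) show ?thesis by (rule that)
qed

section \<open>Linear independence of sines at infinity\<close>

lemma sin_tendsto_0_imp:
  fixes c :: complex
  assumes "l > 0" "((\<lambda>t. c * of_real (sin (l * t))) \<longlongrightarrow> 0) at_top"
  shows "c = 0"
proof -
  define \<tau> where "\<tau> n = (pi / 2 + real n * (2 * pi)) * (1 / l)" for n :: nat
  have "filterlim \<tau> at_top sequentially"
    unfolding \<tau>_def using assms(1)
    by (intro filterlim_at_top_mult_tendsto_pos[OF tendsto_const] filterlim_tendsto_add_at_top[OF tendsto_const]
         filterlim_real_sequentially) auto
  from filterlim_compose[OF assms(2) this] have "(\<lambda>n. c * of_real (sin (l * \<tau> n))) \<longlonglongrightarrow> 0" .
  moreover have "sin (l * \<tau> n) = 1" for n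
  proof -
    have "l * \<tau> n = pi / 2 + real n * (2 * pi)" using assms(1) by (simp add: \<tau>_def)
    then show ?thesis using cos_2npi[of n] by (simp add: sin_add mult.commute mult.left_commute)
  qed
  ultimately show ?thesis by (simp add: LIMSEQ_const_iff)
qed

lemma small_multiples_less_pi:
  fixes l :: "'i \<Rightarrow> real"
  assumes "finite I" "\<And>i. i \<in> I \<Longrightarrow> l i > 0"
  obtains h where "h > 0" "\<And>i. i \<in> I \<Longrightarrow> l i * h < pi"
proof -
  define s where "s = (\<Sum>i\<in>I. l i)"
  have "s \<ge> 0" unfolding s_def using assms(2) by (intro sum_nonneg less_imp_le)
  have "l i * (pi / (1 + s)) < pi" if "i \<in> I" for i
  proof -
    have "l i \<le> s" unfolding s_def using that assms by (intro member_le_sum) (auto intro: less_imp_le)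
    then have "l i * pi < (1 + s) * pi" by (intro mult_strict_right_mono) auto
    then show ?thesis using \<open>s \<ge> 0\<close> by (simp add: field_simps)
  qed
  then show ?thesis using \<open>s \<ge> 0\<close> by (intro that[of "pi / (1 + s)"]) auto
qed

lemma sin_sum_eliminate:
  fixes c :: "'i \<Rightarrow> complex" and l :: "'i \<Rightarrow> real" and I
  defines "g \<equiv> \<lambda>t. \<Sum>i\<in>I. c i * of_real (sin (l i * t))"
  shows "g (t + h) + g (t - h) - of_real (2 * cos (\<mu> * h)) * g t
    = (\<Sum>i\<in>I. c i * of_real (2 * (cos (l i * h) - cos (\<mu> * h))) * of_real (sin (l i * t)))"
proof -
  have "sin (l i * (t + h)) + sin (l i * (t - h)) = 2 * cos (l i * h) * sin (l i * t)" for i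
    by (simp add: distrib_left right_diff_distrib sin_add sin_diff)
  then have shift: "sin (l i * (t + h)) + sin (l i * (t - h)) - 2 * cos (\<mu> * h) * sin (l i * t)
      = 2 * (cos (l i * h) - cos (\<mu> * h)) * sin (l i * t)" for i
    by (simp add: algebra_simps)
  have collect: "c i * of_real a + c i * of_real b - of_real m * (c i * of_real d) = c i * of_real (a + b - m * d)" for i a b m d
    by (simp add: algebra_simps)
  have "c i * of_real (sin (l i * (t + h))) + c i * of_real (sin (l i * (t - h)))
      - of_real (2 * cos (\<mu> * h)) * (c i * of_real (sin (l i * t)))
    = c i * of_real (2 * (cos (l i * h) - cos (\<mu> * h))) * of_real (sin (l i * t))" for i
    unfolding collect shift by (simp only: of_real_mult mult.assoc)
  then show ?thesis unfolding g_def sum_distrib_left sum.distrib[symmetric] sum_subtractf[symmetric] by simp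
qed

theorem sin_independent_at_infinity:
  fixes l :: "'i \<Rightarrow> real" and c :: "'i \<Rightarrow> complex"
  assumes "finite I" "\<And>i. i \<in> I \<Longrightarrow> l i > 0" "inj_on l I"
    and "((\<lambda>t. \<Sum>i\<in>I. c i * of_real (sin (l i * t))) \<longlongrightarrow> 0) at_top" "i \<in> I"
  shows "c i = 0"
  using assms
proof (induction I arbitrary: c i rule: finite_induct)
  case (insert j I)
  define g where "g t = (\<Sum>i\<in>insert j I. c i * of_real (sin (l i * t)))" for t
  have g: "(g \<longlongrightarrow> 0) at_top" using insert.prems(3) by (simp only: g_def[abs_def])
  obtain h where "h > 0" and h: "\<And>i. i \<in> insert j I \<Longrightarrow> l i * h < pi"
    by (rule small_multiples_less_pi[of "insert j I" l]) (use insert.hyps(1) insert.prems(1) that in auto)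
  have "filterlim (\<lambda>t. t + h) at_top at_top" "filterlim (\<lambda>t. t - h) at_top at_top"
    by real_asymp+
  then have "((\<lambda>t. g (t + h) + g (t - h) - of_real (2 * cos (l j * h)) * g t) \<longlongrightarrow> 0 + 0 - of_real (2 * cos (l j * h)) * 0) at_top"
    by (intro tendsto_intros g filterlim_compose[OF g])
  then have "((\<lambda>t. \<Sum>i\<in>I. c i * of_real (2 * (cos (l i * h) - cos (l j * h))) * of_real (sin (l i * t))) \<longlongrightarrow> 0) at_top"
    unfolding g_def sin_sum_eliminate using insert.hyps by simp
  moreover have "cos (l i * h) \<noteq> cos (l j * h)" if "i \<in> I" for i
  proof -
    have "l i \<noteq> l j" using insert.prems(2) insert.hyps(2) that by (auto simp: inj_on_def)
    then show ?thesis
      using cos_inj_pi[of "l i * h" "l j * h"] h[of i] h[of j] insert.prems(1)[of i] insert.prems(1)[of j] \<open>h > 0\<close> that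
      by (auto intro: less_imp_le)
  qed
  ultimately have zero: "c i = 0" if "i \<in> I" for i
    using insert.IH[of "\<lambda>i. c i * of_real (2 * (cos (l i * h) - cos (l j * h)))" i] insert.prems(1,2) that
    by (auto simp: inj_on_def)
  then have "g = (\<lambda>t. c j * of_real (sin (l j * t)))" using insert.hyps by (simp add: g_def fun_eq_iff)
  then have "c j = 0" using g insert.prems(1)[of j] by (intro sin_tendsto_0_imp[of "l j"]) simp_all
  then show ?case using zero insert.prems(4) by auto
qed simp

section \<open>Total fields over perturbed surfaces\<close>

abbreviation (input) scattered :: "real \<Rightarrow> real^3 \<Rightarrow> (real^3 \<Rightarrow> complex) \<Rightarrow> real^3 \<Rightarrow> complex" where
  "scattered k d u \<equiv> \<lambda>x. u x - u_in k d x - u_re_D k d x"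

lemma tild_component: "tild x $ 1 = x$1" "tild x $ 2 = x$2"
  by (simp_all add: tild_def)

lemma add_vertical_component: "(x + t *\<^sub>R axis 3 1 :: real^3) $ 1 = x$1" "(x + t *\<^sub>R axis 3 1 :: real^3) $ 2 = x$2"
  "(x + t *\<^sub>R axis 3 1 :: real^3) $ 3 = x$3 + t"
  by (simp_all add: axis_def)

lemma tild_add_vertical: "tild (x + t *\<^sub>R axis 3 1) = tild x"
  unfolding vec_eq_iff forall_2 tild_component add_vertical_component by simp

lemma continuous_on_tild: "continuous_on A tild"
proof (rule linear_continuous_on)
  have "linear tild" by (rule linearI) (simp_all add: vec_eq_iff forall_2 tild_component)
  then show "bounded_linear tild" by (simp add: linear_conv_bounded_linear)
qed

lemma norm_le_cylinder:
  assumes "norm (tild x) \<le> R" "\<bar>x$3\<bar> \<le> R"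
  shows "norm x \<le> 2 * R"
proof (rule power2_le_imp_le)
  have "(norm x)\<^sup>2 = (norm (tild x))\<^sup>2 + \<bar>x$3\<bar>\<^sup>2"
    unfolding power2_norm_eq_inner inner_vec_def sum_3 sum_2 tild_component by (simp add: power2_eq_square)
  also have "\<dots> \<le> R\<^sup>2 + R\<^sup>2" using assms by (intro add_mono power_mono) auto
  also have "\<dots> \<le> (2 * R)\<^sup>2" by (simp add: power_mult_distrib)
  finally show "(norm x)\<^sup>2 \<le> (2 * R)\<^sup>2" .
  show "0 \<le> 2 * R" using order_trans[OF norm_ge_zero assms(1)] by simp
qed

lemma locally_perturbed_continuous:
  assumes "locally_perturbed f"
  shows "continuous_on A (\<lambda>x. f (tild x))"
proof -
  obtain L where "L-lipschitz_on UNIV f" using assms by (auto simp: locally_perturbed_def)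
  then have "continuous_on UNIV f" by (rule lipschitz_on_continuous_on)
  then show ?thesis using continuous_on_compose2[OF _ continuous_on_tild] by blast
qed

lemma locally_perturbed_common_radius:
  assumes "locally_perturbed f" "locally_perturbed g"
  obtains R where "R > 0" "\<And>y. R < norm y \<Longrightarrow> f y = 0 \<and> g y = 0" "\<And>y. \<bar>f y\<bar> < R \<and> \<bar>g y\<bar> < R"
proof -
  obtain R1 where R1: "\<And>y. norm y > R1 \<Longrightarrow> f y = 0" "\<And>y. \<bar>f y\<bar> < R1" using assms(1) by (auto simp: locally_perturbed_def)
  obtain R2 where R2: "\<And>y. norm y > R2 \<Longrightarrow> g y = 0" "\<And>y. \<bar>g y\<bar> < R2" using assms(2) by (auto simp: locally_perturbed_def)
  have "0 < max R1 R2" using R1(2)[of 0] by linarith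
  moreover have "\<bar>f y\<bar> < max R1 R2 \<and> \<bar>g y\<bar> < max R1 R2" for y using R1(2)[of y] R2(2)[of y] by linarith
  ultimately show ?thesis using R1(1) R2(1) by (intro that[of "max R1 R2"]) auto
qed

lemma outside_perturbation:
  assumes "\<And>y. R < norm y \<Longrightarrow> f y = 0" "\<And>y. \<bar>f y\<bar> < R" "2 * R < norm x"
  shows "0 < x$3 \<Longrightarrow> x \<in> Omega f" "x$3 = 0 \<Longrightarrow> x \<in> Gamma f"
proof -
  have far: "R < norm (tild x) \<or> R < \<bar>x$3\<bar>" using norm_le_cylinder[of x R] assms(3) by linarith
  show "x \<in> Omega f" if "0 < x$3" using far that assms(1,2)[of "tild x"] by (auto simp: Omega_def)
  have "0 < R" using assms(2)[of 0] by linarith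
  then show "x \<in> Gamma f" if "x$3 = 0" using far that assms(1)[of "tild x"] by (auto simp: Gamma_def)
qed

lemma open_Omega: "locally_perturbed f \<Longrightarrow> open (Omega f)"
  unfolding Omega_def by (intro open_Collect_less locally_perturbed_continuous continuous_intros)

lemma add_vertical_in_Omega: "x \<in> Omega f \<or> x \<in> Gamma f \<Longrightarrow> t > 0 \<Longrightarrow> x + t *\<^sub>R axis 3 1 \<in> Omega f"
  by (auto simp: Omega_def Gamma_def tild_add_vertical add_vertical_component)

lemma add_vertical_tendsto: "(\<lambda>n. x + inverse (real (Suc n)) *\<^sub>R axis 3 1) \<longlonglongrightarrow> (x :: real^3)"
proof -
  have "(\<lambda>n. x + inverse (real (Suc n)) *\<^sub>R axis 3 1) \<longlonglongrightarrow> x + 0 *\<^sub>R axis 3 1"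
    by (intro tendsto_intros LIMSEQ_inverse_real_of_nat)
  then show ?thesis by simp
qed

lemma Gamma_subset_closure_Omega: "Gamma f \<subseteq> closure (Omega f)"
proof
  fix x assume "x \<in> Gamma f"
  then have "\<forall>n. x + inverse (real (Suc n)) *\<^sub>R axis 3 1 \<in> Omega f" by (simp add: add_vertical_in_Omega)
  then show "x \<in> closure (Omega f)" unfolding closure_sequential using add_vertical_tendsto[of x]
    by (intro exI[of _ "\<lambda>n. x + inverse (real (Suc n)) *\<^sub>R axis 3 1"] conjI)
qed

lemma helmholtz_on_imp_classical:
  assumes "helmholtz_on S k u"
  shows "classical_helmholtz k S u"
proof (rule classical_helmholtzI)
  have partial: "((\<lambda>t. v (x + t *\<^sub>R axis i 1)) has_vector_derivative pdiff i v x) (at 0)" if "v differentiable (at x)" for v i x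
  proof -
    have "(\<lambda>t. x + t *\<^sub>R axis i 1) differentiable (at (0::real))"
      by (intro derivative_intros differentiableI) (auto intro!: derivative_eq_intros)
    moreover have "v differentiable (at (x + 0 *\<^sub>R axis i 1))" using that by simp
    ultimately have "(v \<circ> (\<lambda>t. x + t *\<^sub>R axis i 1)) differentiable (at 0)"
      by (intro differentiable_chain_at) auto
    then show ?thesis unfolding pdiff_def vector_derivative_works by (simp add: o_def)
  qed
  show "continuous_on S u" using assms
    by (auto simp: helmholtz_on_def intro!: continuous_at_imp_continuous_on differentiable_imp_continuous_within)
  show "has_second_partials S u (\<lambda>i. pdiff i u) (\<lambda>i. pdiff i (pdiff i u))"
    using assms partial by (auto simp: has_second_partials_def helmholtz_on_def)
qed (use assms in \<open>auto simp: helmholtz_on_def\<close>)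

lemma dirichlet_total_fieldD:
  assumes "dirichlet_total_field k f d u"
  shows "continuous_on (closure (Omega f)) u" "continuous_on (Omega f) u" "classical_helmholtz k (Omega f) u"
    "\<And>x. x \<in> Gamma f \<Longrightarrow> u x = 0"
  using assms helmholtz_on_imp_classical continuous_on_subset[OF _ closure_subset]
  by (auto simp: dirichlet_total_field_def)

lemma far_field_difference_decay:
  assumes "far_field k S v F" "far_field k S' v' F'" "\<forall>xh\<in>S2plus. F xh = F' xh"
  obtains C T where "\<And>x. x \<in> S \<inter> S' \<Longrightarrow> 0 < x$3 \<Longrightarrow> T \<le> norm x \<Longrightarrow> norm (v x - v' x) \<le> C / (norm x)\<^sup>2"
proof -
  let ?E = "\<lambda>F x. exp (\<i> * complex_of_real (k * norm x)) / complex_of_real (norm x) * F (x /\<^sub>R norm x)"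
  obtain C1 T1 where decay: "\<And>x. x \<in> S \<Longrightarrow> T1 \<le> norm x \<Longrightarrow> norm (v x - ?E F x) \<le> C1 / (norm x)\<^sup>2"
    using assms(1) unfolding far_field_def by blast
  obtain C2 T2 where decay': "\<And>x. x \<in> S' \<Longrightarrow> T2 \<le> norm x \<Longrightarrow> norm (v' x - ?E F' x) \<le> C2 / (norm x)\<^sup>2"
    using assms(2) unfolding far_field_def by blast
  show ?thesis
  proof (rule that[of "max T1 T2" "C1 + C2"])
    fix x assume x: "x \<in> S \<inter> S'" "0 < x$3" "max T1 T2 \<le> norm x"
    have "x \<noteq> 0" using x(2) by auto
    then have "x /\<^sub>R norm x \<in> S2plus" using x(2) by (simp add: S2plus_def)
    then have "?E F' x = ?E F x" using assms(3) by simp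
    then have "v x - v' x = (v x - ?E F x) - (v' x - ?E F' x)" by (simp only: diff_diff_eq2 diff_add_cancel)
    then have "norm (v x - v' x) = norm ((v x - ?E F x) - (v' x - ?E F' x))" by (rule arg_cong)
    also have "\<dots> \<le> C1 / (norm x)\<^sup>2 + C2 / (norm x)\<^sup>2"
      by (rule order_trans[OF norm_triangle_ineq4 add_mono[OF decay decay']]) (use x in auto)
    finally show "norm (v x - v' x) \<le> (C1 + C2) / (norm x)\<^sup>2" by (simp add: add_divide_distrib)
  qed
qed

lemma norm_add_vertical_ge: "\<bar>t\<bar> - norm x \<le> norm (x + t *\<^sub>R axis 3 1 :: real^3)"
  using norm_triangle_ineq4[of "x + t *\<^sub>R axis 3 1" x] by (simp add: norm_axis_1)

lemma total_fields_agree_far_away: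
  assumes "k > 0" and perturbed: "locally_perturbed f1" "locally_perturbed f2"
    and u: "dirichlet_total_field k f1 d u1" "dirichlet_total_field k f2 d u2"
    and far_fields: "far_field k (Omega f1) (scattered k d u1) F1" "far_field k (Omega f2) (scattered k d u2) F2"
      "\<forall>xh\<in>S2plus. F1 xh = F2 xh"
  obtains T where "T > 0" "\<And>x. T < norm x \<Longrightarrow> 0 < x$3 \<Longrightarrow> u1 x = u2 x"
proof -
  obtain R where R: "R > 0" "\<And>y. R < norm y \<Longrightarrow> f1 y = 0 \<and> f2 y = 0" "\<And>y. \<bar>f1 y\<bar> < R \<and> \<bar>f2 y\<bar> < R"
    by (rule locally_perturbed_common_radius[OF perturbed]) (rule that)
  obtain C T where decay: "\<And>x. x \<in> Omega f1 \<inter> Omega f2 \<Longrightarrow> 0 < x$3 \<Longrightarrow> T \<le> norm x \<Longrightarrow>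
      norm (scattered k d u1 x - scattered k d u2 x) \<le> C / (norm x)\<^sup>2"
    by (rule far_field_difference_decay[OF far_fields]) (rule that)
  define \<rho> where "\<rho> = max (2 * R) T"
  have "\<rho> > 0" using R(1) by (simp add: \<rho>_def)
  have upper: "x \<in> Omega f1 \<inter> Omega f2" if "\<rho> < norm x" "0 < x$3" for x
    using outside_perturbation(1)[of R f1 x] outside_perturbation(1)[of R f2 x] R that by (auto simp: \<rho>_def)
  have plane: "x \<in> Gamma f1 \<inter> Gamma f2" if "\<rho> < norm x" "x$3 = 0" for x
    using outside_perturbation(2)[of R f1 x] outside_perturbation(2)[of R f2 x] R that by (auto simp: \<rho>_def)
  have closed_half: "{x. \<rho> < norm x \<and> 0 \<le> x$3} \<subseteq> closure (Omega f1) \<inter> closure (Omega f2)"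
    using upper plane Gamma_subset_closure_Omega closure_subset by (force simp: less_eq_real_def)
  have "u1 x - u2 x = 0" if x: "12 * \<rho> < norm x" "0 < x$3" for x
  proof (rule half_space_rellich[OF \<open>\<rho> > 0\<close> \<open>k > 0\<close> _ _ _ _ x])
    show "classical_helmholtz k {x. \<rho> < norm x \<and> 0 < x$3} (\<lambda>x. u1 x - u2 x)"
      using upper by (intro classical_helmholtz_diff) (auto intro: classical_helmholtz_subset[OF dirichlet_total_fieldD(3)[OF u(1)]]
          classical_helmholtz_subset[OF dirichlet_total_fieldD(3)[OF u(2)]])
    show "continuous_on {x. \<rho> < norm x \<and> 0 \<le> x$3} (\<lambda>x. u1 x - u2 x)"
      using closed_half by (intro continuous_on_diff) (auto intro: continuous_on_subset[OF dirichlet_total_fieldD(1)[OF u(1)]]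
          continuous_on_subset[OF dirichlet_total_fieldD(1)[OF u(2)]])
    show "u1 x - u2 x = 0" if "\<rho> < norm x" "x$3 = 0" for x
      using plane[OF that] dirichlet_total_fieldD(4)[OF u(1)] dirichlet_total_fieldD(4)[OF u(2)] by simp
    show "norm (u1 x - u2 x) \<le> C / (norm x)\<^sup>2" if "\<rho> < norm x" "0 < x$3" for x
      using decay[OF upper[OF that] that(2)] that(1) by (simp add: \<rho>_def)
  qed
  then show ?thesis using that[of "12 * \<rho>"] \<open>\<rho> > 0\<close> by simp
qed

theorem total_fields_agree:
  assumes "k > 0" and perturbed: "locally_perturbed f1" "locally_perturbed f2"
    and u: "dirichlet_total_field k f1 d u1" "dirichlet_total_field k f2 d u2"
    and far_fields: "far_field k (Omega f1) (scattered k d u1) F1" "far_field k (Omega f2) (scattered k d u2) F2"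
      "\<forall>xh\<in>S2plus. F1 xh = F2 xh" and x: "x \<in> Omega f1 \<inter> Omega f2"
  shows "u1 x = u2 x"
proof -
  obtain T where "T > 0" and far: "\<And>x. T < norm x \<Longrightarrow> 0 < x$3 \<Longrightarrow> u1 x = u2 x"
    by (rule total_fields_agree_far_away[OF \<open>k > 0\<close> perturbed u far_fields]) (rule that)
  define S where "S = Omega f1 \<inter> Omega f2"
  have "open S" unfolding S_def by (intro open_Int open_Omega perturbed)
  have "classical_helmholtz k S (\<lambda>x. u1 x - u2 x)"
    unfolding S_def by (intro classical_helmholtz_diff classical_helmholtz_subset[OF dirichlet_total_fieldD(3)[OF u(1)]]
        classical_helmholtz_subset[OF dirichlet_total_fieldD(3)[OF u(2)]]) auto
  then have weak: "weak_helmholtz k S (\<lambda>x. u1 x - u2 x)" using \<open>open S\<close> by (rule classical_helmholtz_imp_weak)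
  define t0 where "t0 = T + 2 * norm x + 1"
  have "u1 (x + 0 *\<^sub>R axis 3 1) - u2 (x + 0 *\<^sub>R axis 3 1) = 0"
  proof (rule weak_helmholtz_line_unique_continuation[OF \<open>open S\<close> weak, where I="{0..}" and ?t0.0=t0 and \<epsilon>=1])
    show "x + t *\<^sub>R axis 3 1 \<in> S" if "t \<in> {0..}" for t
      using that x by (auto simp: S_def Omega_def tild_add_vertical add_vertical_component)
    show "u1 (x + t *\<^sub>R axis 3 1) - u2 (x + t *\<^sub>R axis 3 1) = 0" if "\<bar>t - t0\<bar> < 1" for t
    proof -
      have t: "t > T + 2 * norm x" using that unfolding t0_def by linarith
      then have "T < norm (x + t *\<^sub>R axis 3 1)"
        using norm_add_vertical_ge[of t x] norm_ge_zero[of x] by linarith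
      moreover have "0 < (x + t *\<^sub>R axis 3 1) $ 3"
        unfolding add_vertical_component using t component_le_norm_cart[of x 3] norm_ge_zero[of x] \<open>T > 0\<close> by linarith
      ultimately show ?thesis using far by simp
    qed
  qed (use \<open>T > 0\<close> in \<open>auto simp: norm_axis_1 t0_def\<close>)
  then show ?thesis by simp
qed

section \<open>Fields along vertical rays\<close>

lemma filterlim_norm_add_vertical: "filterlim (\<lambda>t. norm (x + t *\<^sub>R axis 3 1 :: real^3)) at_top at_top"
proof (rule filterlim_at_top_mono)
  show "filterlim (\<lambda>t::real. \<bar>t\<bar> - norm x) at_top at_top" by real_asymp
  show "\<forall>\<^sub>F t in at_top. \<bar>t\<bar> - norm x \<le> norm (x + t *\<^sub>R axis 3 1)"
    by (intro always_eventually allI norm_add_vertical_ge)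
qed

lemma sgn_add_vertical_tendsto: "((\<lambda>t. sgn (x + t *\<^sub>R axis 3 1)) \<longlongrightarrow> (axis 3 1 :: real^3)) at_top"
proof -
  have "((\<lambda>t. inverse t *\<^sub>R x + axis 3 1) \<longlongrightarrow> 0 *\<^sub>R x + axis 3 (1::real)) at_top"
    by (intro tendsto_add tendsto_scaleR tendsto_const tendsto_inverse_0_at_top filterlim_ident)
  then have "((\<lambda>t. sgn (inverse t *\<^sub>R x + axis 3 1)) \<longlongrightarrow> sgn (0 *\<^sub>R x + axis 3 (1::real))) at_top"
    by (rule tendsto_sgn) (simp add: axis_eq_0_iff)
  also have "sgn (0 *\<^sub>R x + axis 3 (1::real)) = axis 3 1" by (simp add: sgn_div_norm norm_axis_1)
  finally show ?thesis
  proof (rule Lim_transform_eventually)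
    show "\<forall>\<^sub>F t in at_top. sgn (inverse t *\<^sub>R x + axis 3 1) = sgn (x + t *\<^sub>R axis 3 1)"
      using eventually_gt_at_top[of 0]
    proof eventually_elim
      case (elim t)
      then have "x + t *\<^sub>R axis 3 1 = t *\<^sub>R (inverse t *\<^sub>R x + axis 3 1)" by (simp add: scaleR_add_right)
      then show ?case using elim by (simp add: sgn_scaleR)
    qed
  qed
qed

text \<open>The far-field pattern is not assumed to be bounded; near the vertical direction this follows by
  comparing it with the field on a fixed large sphere.\<close>

lemma far_field_pattern_bounded_near_vertical:
  assumes f: "locally_perturbed f" and far_fields: "far_field k (Omega f) v F" and v: "continuous_on (Omega f) v"
  obtains B where "\<forall>\<^sub>F t in at_top. norm (F (sgn (x + t *\<^sub>R axis 3 1))) \<le> B"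
proof -
  obtain R where R: "R > 0" "\<And>y. \<bar>f y\<bar> < R \<and> \<bar>f y\<bar> < R" by (rule locally_perturbed_common_radius[OF f f]) (rule that)
  obtain C T where CT: "\<And>x. x \<in> Omega f \<Longrightarrow> norm x \<ge> T \<Longrightarrow>
      norm (v x - exp (\<i> * complex_of_real (k * norm x)) / complex_of_real (norm x) * F (x /\<^sub>R norm x)) \<le> C / (norm x)\<^sup>2"
    using far_fields unfolding far_field_def by blast
  define r where "r = \<bar>T\<bar> + R + 1"
  have r: "r > 0" "r > R" "r \<ge> T" using R(1) by (auto simp: r_def)
  define p :: "real^3" where "p = r *\<^sub>R axis 3 1"
  have p: "p \<in> Omega f" using R(2)[of "tild p"] r by (auto simp: Omega_def p_def axis_def)
  define h where "h t = r *\<^sub>R sgn (x + t *\<^sub>R axis 3 1)" for t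
  have h: "(h \<longlongrightarrow> p) at_top" unfolding h_def p_def
    by (intro tendsto_scaleR tendsto_const sgn_add_vertical_tendsto)
  have "isCont v p" using v p open_Omega[OF f] by (simp add: continuous_on_eq_continuous_at)
  then have "((\<lambda>t. v (h t)) \<longlongrightarrow> v p) at_top" using h by (rule isCont_tendsto_compose)
  then have "\<forall>\<^sub>F t in at_top. norm (v (h t)) < norm (v p) + 1"
    by (intro order_tendstoD(2)[OF tendsto_norm]) auto
  moreover have "\<forall>\<^sub>F t in at_top. h t \<in> Omega f" using topological_tendstoD[OF h open_Omega[OF f] p] .
  moreover have "\<forall>\<^sub>F t in at_top. norm (x + t *\<^sub>R axis 3 1) > 0"
    using filterlim_norm_add_vertical[of x] unfolding filterlim_at_top_dense by blast
  ultimately have "\<forall>\<^sub>F t in at_top. norm (F (sgn (x + t *\<^sub>R axis 3 1))) \<le> r * (norm (v p) + 1 + C / r\<^sup>2)"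
  proof eventually_elim
    case (elim t)
    define E where "E = F (sgn (x + t *\<^sub>R axis 3 1))"
    define q where "q = exp (\<i> * complex_of_real (k * r)) / complex_of_real r * E"
    have "norm (h t) = r" using r elim(3) by (simp add: h_def norm_sgn)
    then have "norm (v (h t) - q) \<le> C / r\<^sup>2"
      using CT[OF elim(2)] r by (simp add: E_def q_def h_def)
    moreover have "norm q = norm E / r"
      using r by (simp add: q_def norm_mult norm_divide norm_exp_i_times del: of_real_mult)
    ultimately have "norm E / r \<le> norm (v p) + 1 + C / r\<^sup>2"
      using elim(1) norm_triangle_ineq2[of q "v (h t)"] by (simp add: norm_minus_commute)
    then show ?case using r by (simp add: E_def pos_divide_le_eq mult.commute)
  qed
  then show ?thesis by (rule that)
qed

lemma far_field_vertical_decay: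
  assumes f: "locally_perturbed f" and far_fields: "far_field k (Omega f) v F" and v: "continuous_on (Omega f) v"
  shows "((\<lambda>t. v (x + t *\<^sub>R axis 3 1)) \<longlongrightarrow> 0) at_top"
proof -
  define y where "y t = x + t *\<^sub>R axis 3 1" for t
  obtain B where B: "\<forall>\<^sub>F t in at_top. norm (F (sgn (y t))) \<le> B"
    unfolding y_def by (rule far_field_pattern_bounded_near_vertical[OF assms, where x=x]) (rule that[unfolded y_def])
  obtain C T where CT: "\<And>x. x \<in> Omega f \<Longrightarrow> norm x \<ge> T \<Longrightarrow>
      norm (v x - exp (\<i> * complex_of_real (k * norm x)) / complex_of_real (norm x) * F (x /\<^sub>R norm x)) \<le> C / (norm x)\<^sup>2"
    using far_fields unfolding far_field_def by blast
  have y_top: "filterlim (\<lambda>t. norm (y t)) at_top at_top" unfolding y_def by (rule filterlim_norm_add_vertical)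
  have "\<forall>\<^sub>F t in at_top. norm (y t) \<ge> max T 1" using y_top unfolding filterlim_at_top by blast
  with B have bound: "\<forall>\<^sub>F t in at_top. norm (v (y t)) \<le> C * (inverse (norm (y t)))\<^sup>2 + B * inverse (norm (y t))"
    using eventually_gt_at_top[of "f (tild x) - x$3"]
  proof eventually_elim
    case (elim t)
    have "y t \<in> Omega f" using elim(3) by (auto simp: y_def Omega_def tild_add_vertical add_vertical_component)
    have y: "norm (y t) > 0" "norm (y t) \<ge> T" using elim(2) by auto
    define q where "q = exp (\<i> * complex_of_real (k * norm (y t))) / complex_of_real (norm (y t)) * F (sgn (y t))"
    have "norm (v (y t) - q) \<le> C / (norm (y t))\<^sup>2"
      using CT[OF \<open>y t \<in> Omega f\<close> y(2)] by (simp add: q_def sgn_div_norm)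
    moreover have "norm q = norm (F (sgn (y t))) / norm (y t)"
      using y by (simp add: q_def norm_mult norm_divide norm_exp_i_times del: of_real_mult)
    moreover have "norm (F (sgn (y t))) / norm (y t) \<le> B / norm (y t)" using elim(1) y by (intro divide_right_mono) auto
    ultimately have "norm (v (y t)) \<le> C / (norm (y t))\<^sup>2 + B / norm (y t)"
      using norm_triangle_ineq2[of "v (y t)" q] by linarith
    then show ?case by (simp add: divide_inverse power_inverse)
  qed
  have "((\<lambda>t. C * (inverse (norm (y t)))\<^sup>2 + B * inverse (norm (y t))) \<longlongrightarrow> C * 0\<^sup>2 + B * 0) at_top"
    by (intro tendsto_intros tendsto_inverse_0_at_top[OF y_top])
  then have "((\<lambda>t. C * (inverse (norm (y t)))\<^sup>2 + B * inverse (norm (y t))) \<longlongrightarrow> 0) at_top" by simp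
  then show ?thesis using Lim_null_comparison[OF bound] by (simp add: y_def)
qed

lemma incident_plus_reflected:
  "u_in k d x + u_re_D k d x =
     cis (k * (d$1 * x$1 + d$2 * x$2)) * (- 2 * \<i>) * of_real (sin (k * (- d$3) * x$3))"
proof -
  define A where "A = k * (d$1 * x$1 + d$2 * x$2)"
  define \<theta> where "\<theta> = k * (- d$3) * x$3"
  have "u_in k d x = cis (A - \<theta>)"
    unfolding u_in_def cis_conv_exp A_def \<theta>_def inner_vec_def sum_3 by (simp add: algebra_simps)
  moreover have "u_re_D k d x = - cis (A + \<theta>)"
    unfolding u_re_D_def cis_conv_exp A_def \<theta>_def by (simp add: algebra_simps)
  moreover have "cis (A - \<theta>) - cis (A + \<theta>) = cis A * (- 2 * \<i>) * of_real (sin \<theta>)"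
    by (simp add: complex_eq_iff cos_add cos_diff sin_add sin_diff)
  ultimately show ?thesis by (simp add: A_def \<theta>_def)
qed

lemma total_field_standing_wave:
  assumes f: "locally_perturbed f" and u: "dirichlet_total_field k f d u" and far_fields: "far_field k (Omega f) (scattered k d u) F"
  obtains A where "A \<noteq> 0" "((\<lambda>t. u (x + t *\<^sub>R axis 3 1) - A * of_real (sin (k * (- d$3) * (x$3 + t)))) \<longlongrightarrow> 0) at_top"
proof -
  define A where "A = cis (k * (d$1 * x$1 + d$2 * x$2)) * (- 2 * \<i>)"
  have "continuous_on (Omega f) (scattered k d u)"
    unfolding u_in_def u_re_D_def by (intro continuous_intros dirichlet_total_fieldD(2)[OF u])
  then have "((\<lambda>t. scattered k d u (x + t *\<^sub>R axis 3 1)) \<longlongrightarrow> 0) at_top"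
    by (rule far_field_vertical_decay[OF f far_fields])
  moreover have "scattered k d u (x + t *\<^sub>R axis 3 1) = u (x + t *\<^sub>R axis 3 1) - A * of_real (sin (k * (- d$3) * (x$3 + t)))" for t
    using incident_plus_reflected[of k d "x + t *\<^sub>R axis 3 1"]
    unfolding add_vertical_component A_def by (simp only: diff_diff_eq)
  ultimately show ?thesis by (intro that[of A]) (simp_all add: A_def)
qed

theorem standing_waves_independent:
  assumes f: "locally_perturbed f" and u: "\<And>i. i \<in> I \<Longrightarrow> classical_helmholtz k (Omega f) (u i)" and "finite I"
    and wave: "\<And>i. i \<in> I \<Longrightarrow> ((\<lambda>t. u i (x + t *\<^sub>R axis 3 1) - A i * of_real (sin (l i * (x$3 + t)))) \<longlongrightarrow> 0) at_top"
    and A: "\<And>i. i \<in> I \<Longrightarrow> A i \<noteq> 0" and l: "\<And>i. i \<in> I \<Longrightarrow> l i > 0" "inj_on l I"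
    and x: "x \<in> Omega f" and "e > 0" and zero: "\<And>z. z \<in> ball x e \<Longrightarrow> (\<Sum>i\<in>I. c i * u i z) = 0" and "j \<in> I"
  shows "c j = 0"
proof -
  have "classical_helmholtz k (Omega f) (\<lambda>z. \<Sum>i\<in>I. c i * u i z)" by (intro classical_helmholtz_sum u)
  then have weak: "weak_helmholtz k (Omega f) (\<lambda>z. \<Sum>i\<in>I. c i * u i z)"
    by (rule classical_helmholtz_imp_weak[OF _ open_Omega[OF f]])
  have ray: "(\<Sum>i\<in>I. c i * u i (x + t *\<^sub>R axis 3 1)) = 0" if "t \<ge> 0" for t
  proof (rule weak_helmholtz_line_unique_continuation[OF open_Omega[OF f] weak, where I="{0..}" and ?t0.0=0 and \<epsilon>=e])
    show "x + s *\<^sub>R axis 3 1 \<in> Omega f" if "s \<in> {0..}" for s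
      using that x by (auto simp: Omega_def tild_add_vertical add_vertical_component)
    show "(\<Sum>i\<in>I. c i * u i (x + s *\<^sub>R axis 3 1)) = 0" if "\<bar>s - 0\<bar> < e" for s
      by (rule zero) (use that in \<open>simp add: dist_norm norm_axis_1\<close>)
  qed (use \<open>e > 0\<close> that in \<open>auto simp: norm_axis_1\<close>)
  have "((\<lambda>t. \<Sum>i\<in>I. - c i * (u i (x + t *\<^sub>R axis 3 1) - A i * of_real (sin (l i * (x$3 + t))))) \<longlongrightarrow> (\<Sum>i\<in>I. - c i * 0)) at_top"
    by (intro tendsto_sum tendsto_mult tendsto_const wave)
  moreover have "\<forall>\<^sub>F t in at_top. (\<Sum>i\<in>I. - c i * (u i (x + t *\<^sub>R axis 3 1) - A i * of_real (sin (l i * (x$3 + t)))))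
      = (\<Sum>i\<in>I. c i * A i * of_real (sin (l i * (x$3 + t))))"
    using eventually_ge_at_top[of 0]
    by eventually_elim (simp add: ray right_diff_distrib sum_subtractf sum_negf mult.assoc)
  ultimately have limit: "((\<lambda>t. \<Sum>i\<in>I. c i * A i * of_real (sin (l i * (x$3 + t)))) \<longlongrightarrow> 0) at_top"
    by (simp add: Lim_transform_eventually)
  have "filterlim (\<lambda>s::real. - (x$3) + s) at_top at_top"
    by (rule filterlim_tendsto_add_at_top[OF tendsto_const filterlim_ident])
  from filterlim_compose[OF limit this]
  have "((\<lambda>s. \<Sum>i\<in>I. c i * A i * of_real (sin (l i * s))) \<longlongrightarrow> 0) at_top" by simp
  then have "c j * A j = 0"
    by (rule sin_independent_at_infinity[where c="\<lambda>i. c i * A i", OF \<open>finite I\<close> _ l(2) _ \<open>j \<in> I\<close>, rotated])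
       (rule l(1))
  then show ?thesis using A[OF \<open>j \<in> I\<close>] by simp
qed

section \<open>Uniqueness\<close>

definition region_between :: "(real^2 \<Rightarrow> real) \<Rightarrow> (real^2 \<Rightarrow> real) \<Rightarrow> (real^3) set" where
  "region_between f g = {x. f (tild x) < x$3 \<and> x$3 < g (tild x)}"

lemma region_between_subset_Omega: "region_between f g \<subseteq> Omega f"
  by (auto simp: region_between_def Omega_def)

lemma open_region_between: "locally_perturbed f \<Longrightarrow> locally_perturbed g \<Longrightarrow> open (region_between f g)"
  unfolding region_between_def by (intro open_Collect_conj open_Collect_less locally_perturbed_continuous continuous_intros)

lemma bounded_region_between:
  assumes "locally_perturbed f" "locally_perturbed g"
  shows "bounded (region_between f g)"
proof -
  obtain R where R: "R > 0" "\<And>y. R < norm y \<Longrightarrow> f y = 0 \<and> g y = 0" "\<And>y. \<bar>f y\<bar> < R \<and> \<bar>g y\<bar> < R"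
    by (rule locally_perturbed_common_radius[OF assms]) (rule that)
  show ?thesis
  proof (rule boundedI, rule norm_le_cylinder)
    fix x assume "x \<in> region_between f g"
    then show "norm (tild x) \<le> R" "\<bar>x$3\<bar> \<le> R"
      using R(2)[of "tild x"] R(3)[of "tild x"] by (fastforce simp: region_between_def)+
  qed
qed

lemma boundary_region_between:
  assumes "locally_perturbed f" "locally_perturbed g" "x \<in> closure (region_between f g) - region_between f g"
  shows "x \<in> Gamma f \<or> x \<in> Omega f \<inter> Gamma g"
proof -
  have "closure (region_between f g) \<subseteq> {x. f (tild x) \<le> x$3 \<and> x$3 \<le> g (tild x)}"
    by (rule closure_minimal)
       (auto simp: region_between_def intro!: closed_Collect_conj closed_Collect_le locally_perturbed_continuous assms continuous_intros)
  then show ?thesis using assms(3) by (force simp: region_between_def Gamma_def Omega_def)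
qed

lemma continuous_on_add_vertical_tendsto:
  assumes "continuous_on A u" "x \<in> A" "\<And>t. t > 0 \<Longrightarrow> x + t *\<^sub>R axis 3 1 \<in> A"
  shows "(\<lambda>n. u (x + inverse (real (Suc n)) *\<^sub>R axis 3 1)) \<longlonglongrightarrow> u (x :: real^3)"
  by (rule continuous_on_tendsto_compose[OF assms(1) add_vertical_tendsto assms(2)]) (use assms(3) in auto)

lemma continuous_on_zero_extension:
  fixes u :: "'a::topological_space \<Rightarrow> 'b::{topological_space, zero}"
  assumes "open D" "continuous_on (closure D) u" "\<And>x. x \<in> closure D - D \<Longrightarrow> u x = 0"
  shows "continuous_on UNIV (\<lambda>x. if x \<in> D then u x else 0)"
proof -
  have "continuous_on (closure D \<union> - D) (\<lambda>x. if x \<in> D then u x else 0)"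
    by (rule continuous_on_If) (use assms in auto)
  moreover have "closure D \<union> - D = UNIV" using closure_subset[of D] by auto
  ultimately show ?thesis by simp
qed

text \<open>On the part of the boundary that lies on the second surface the two total fields agree by continuity from
  above, so the first one inherits the boundary condition of the second.\<close>

lemma total_field_dirichlet_extension:
  assumes "k > 0" and perturbed: "locally_perturbed f1" "locally_perturbed f2"
    and u: "dirichlet_total_field k f1 d u1" "dirichlet_total_field k f2 d u2"
    and far_fields: "far_field k (Omega f1) (scattered k d u1) F1" "far_field k (Omega f2) (scattered k d u2) F2"
      "\<forall>xh\<in>S2plus. F1 xh = F2 xh"
  shows "dirichlet_extension k (region_between f1 f2) (\<lambda>x. if x \<in> region_between f1 f2 then u1 x else 0)"
proof -
  define D where "D = region_between f1 f2"
  have "open D" unfolding D_def by (rule open_region_between[OF perturbed])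
  have "D \<subseteq> Omega f1" unfolding D_def by (rule region_between_subset_Omega)
  have boundary: "u1 x = 0" if x: "x \<in> closure D - D" for x
  proof (cases "x \<in> Gamma f1")
    case True
    then show ?thesis by (rule dirichlet_total_fieldD(4)[OF u(1)])
  next
    case False
    then have x: "x \<in> Omega f1" "x \<in> Gamma f2" using boundary_region_between[OF perturbed x[unfolded D_def]] by auto
    have "(\<lambda>n. u1 (x + inverse (real (Suc n)) *\<^sub>R axis 3 1)) \<longlonglongrightarrow> u1 x"
      by (rule continuous_on_add_vertical_tendsto[OF dirichlet_total_fieldD(2)[OF u(1)] x(1)]) (simp add: add_vertical_in_Omega x)
    moreover have "(\<lambda>n. u2 (x + inverse (real (Suc n)) *\<^sub>R axis 3 1)) \<longlonglongrightarrow> u2 x"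
      by (rule continuous_on_add_vertical_tendsto[OF dirichlet_total_fieldD(1)[OF u(2)]])
         (use x(2) Gamma_subset_closure_Omega closure_subset add_vertical_in_Omega in blast)+
    moreover have "u1 (x + inverse (real (Suc n)) *\<^sub>R axis 3 1) = u2 (x + inverse (real (Suc n)) *\<^sub>R axis 3 1)" for n
      by (rule total_fields_agree[OF \<open>k > 0\<close> perturbed u far_fields]) (use x in \<open>simp add: add_vertical_in_Omega\<close>)
    ultimately have "u1 x = u2 x" using LIMSEQ_unique by simp
    then show ?thesis using dirichlet_total_fieldD(4)[OF u(2) x(2)] by simp
  qed
  have "continuous_on (closure D) u1"
    using dirichlet_total_fieldD(1)[OF u(1)] closure_mono[OF \<open>D \<subseteq> Omega f1\<close>] by (rule continuous_on_subset)
  then have "continuous_on UNIV (\<lambda>x. if x \<in> D then u1 x else 0)"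
    by (rule continuous_on_zero_extension[OF \<open>open D\<close> _ boundary])
  moreover have "classical_helmholtz k D (\<lambda>x. if x \<in> D then u1 x else 0)"
    by (rule classical_helmholtz_cong[OF \<open>open D\<close> classical_helmholtz_subset[OF dirichlet_total_fieldD(3)[OF u(1)] \<open>D \<subseteq> Omega f1\<close>]]) simp
  ultimately show ?thesis by (simp add: dirichlet_extension_def D_def)
qed

definition equal_far_fields :: "real \<Rightarrow> (real^2 \<Rightarrow> real) \<Rightarrow> (real^2 \<Rightarrow> real) \<Rightarrow> bool" where
  "equal_far_fields k f1 f2 \<longleftrightarrow> (\<forall>d\<in>S2minus. \<exists>u1 u2 F1 F2.
     dirichlet_total_field k f1 d u1 \<and> dirichlet_total_field k f2 d u2 \<and>
     far_field k (Omega f1) (scattered k d u1) F1 \<and> far_field k (Omega f2) (scattered k d u2) F2 \<and>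
     (\<forall>xh\<in>S2plus. F1 xh = F2 xh))"

lemma equal_far_fields_sym:
  assumes "equal_far_fields k f1 f2"
  shows "equal_far_fields k f2 f1"
  unfolding equal_far_fields_def
proof
  fix d :: "real^3" assume "d \<in> S2minus"
  with assms obtain u1 u2 F1 F2 where
    "dirichlet_total_field k f1 d u1" "dirichlet_total_field k f2 d u2"
    "far_field k (Omega f1) (scattered k d u1) F1" "far_field k (Omega f2) (scattered k d u2) F2" "\<forall>xh\<in>S2plus. F1 xh = F2 xh"
    unfolding equal_far_fields_def by blast
  then show "\<exists>u1 u2 F1 F2. dirichlet_total_field k f2 d u1 \<and> dirichlet_total_field k f1 d u2 \<and>
     far_field k (Omega f2) (scattered k d u1) F1 \<and> far_field k (Omega f1) (scattered k d u2) F2 \<and>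
     (\<forall>xh\<in>S2plus. F1 xh = F2 xh)"
    by (intro exI[of _ u2] exI[of _ u1] exI[of _ F2] exI[of _ F1]) simp
qed

definition descending_direction :: "real \<Rightarrow> real^3" where
  "descending_direction g = vector [sqrt (1 - g\<^sup>2), 0, - g]"

lemma descending_direction_in_S2minus:
  assumes "0 < g" "g \<le> 1"
  shows "descending_direction g \<in> S2minus"
proof -
  have "g\<^sup>2 \<le> 1" using assms by (simp add: power_le_one)
  then have "norm (descending_direction g) = 1" by (simp add: norm_vec_def L2_set_def sum_3 descending_direction_def)
  then show ?thesis using assms(1) by (simp add: S2minus_def descending_direction_def)
qed

lemma equal_far_fields_test_field:
  assumes "k > 0" and perturbed: "locally_perturbed f1" "locally_perturbed f2" and "equal_far_fields k f1 f2" and g: "0 < g" "g \<le> 1"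
  obtains u A where "dirichlet_extension k (region_between f1 f2) (\<lambda>x. if x \<in> region_between f1 f2 then u x else 0)"
    "classical_helmholtz k (Omega f1) u" "A \<noteq> 0"
    "((\<lambda>t. u (x + t *\<^sub>R axis 3 1) - A * of_real (sin (k * g * (x$3 + t)))) \<longlongrightarrow> 0) at_top"
proof -
  define d where "d = descending_direction g"
  have d: "d \<in> S2minus" "- d$3 = g"
    unfolding d_def using descending_direction_in_S2minus[OF g] by (auto simp: descending_direction_def)
  obtain u1 u2 F1 F2 where u: "dirichlet_total_field k f1 d u1" "dirichlet_total_field k f2 d u2"
    and far_fields: "far_field k (Omega f1) (scattered k d u1) F1" "far_field k (Omega f2) (scattered k d u2) F2"
      "\<forall>xh\<in>S2plus. F1 xh = F2 xh"
    using assms(4) d(1) unfolding equal_far_fields_def by blast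
  obtain A where "A \<noteq> 0" "((\<lambda>t. u1 (x + t *\<^sub>R axis 3 1) - A * of_real (sin (k * g * (x$3 + t)))) \<longlongrightarrow> 0) at_top"
    by (rule total_field_standing_wave[OF perturbed(1) u(1) far_fields(1), where x=x]) (use d(2) that in auto)
  with total_field_dirichlet_extension[OF \<open>k > 0\<close> perturbed u far_fields] dirichlet_total_fieldD(3)[OF u(1)] show ?thesis by (rule that)
qed

theorem equal_far_fields_le:
  assumes "k > 0" and perturbed: "locally_perturbed f1" "locally_perturbed f2" and equal: "equal_far_fields k f1 f2"
  shows "f2 y \<le> f1 y"
proof (rule ccontr)
  define D where "D = region_between f1 f2"
  define x :: "real^3" where "x = vector [y$1, y$2, (f1 y + f2 y) / 2]"
  assume "\<not> f2 y \<le> f1 y"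
  moreover have "tild x = y" by (simp add: x_def tild_def vec_eq_iff forall_2)
  ultimately have "x \<in> D" by (simp add: D_def region_between_def x_def)
  define g where "g i = 1 / (real i + 2)" for i
  have g: "0 < g i" "g i \<le> 1" for i by (auto simp: g_def)
  define test where "test i u A \<longleftrightarrow> dirichlet_extension k D (\<lambda>x. if x \<in> D then u x else 0) \<and> classical_helmholtz k (Omega f1) u \<and>
      A \<noteq> 0 \<and> ((\<lambda>t. u (x + t *\<^sub>R axis 3 1) - A * of_real (sin (k * g i * (x$3 + t)))) \<longlongrightarrow> 0) at_top" for i u A
  have "\<exists>u A. test i u A" for i
    unfolding test_def D_def by (rule equal_far_fields_test_field[OF \<open>k > 0\<close> perturbed equal g(1)[of i] g(2)[of i], where x=x]) blast
  then obtain u A where u: "\<And>i. test i (u i) (A i)" by metis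
  obtain N c j where "j < N" "c j \<noteq> 0" and dependent: "\<And>x. (\<Sum>i<N. c i * (if x \<in> D then u i x else 0)) = 0"
    by (rule dirichlet_extensions_dependent[OF \<open>k > 0\<close>, of D "\<lambda>i x. if x \<in> D then u i x else 0"])
       (use u perturbed that in \<open>auto simp: D_def test_def open_region_between bounded_region_between\<close>)
  have "open D" unfolding D_def by (rule open_region_between[OF perturbed])
  then obtain e where e: "e > 0" "ball x e \<subseteq> D" using \<open>x \<in> D\<close> by (rule openE)
  have "c j = 0"
  proof (rule standing_waves_independent[OF perturbed(1), where I="{..<N}" and u=u and A=A and l="\<lambda>i. k * g i" and x=x and e=e])
    show "inj_on (\<lambda>i. k * g i) {..<N}" using \<open>k > 0\<close> by (auto simp: inj_on_def g_def)
    show "x \<in> Omega f1" using \<open>x \<in> D\<close> region_between_subset_Omega unfolding D_def by blast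
    show "(\<Sum>i\<in>{..<N}. c i * u i z) = 0" if "z \<in> ball x e" for z
      using dependent[of z] e(2) that by auto
  qed (use u g \<open>k > 0\<close> \<open>j < N\<close> e(1) in \<open>auto simp: test_def\<close>)
  with \<open>c j \<noteq> 0\<close> show False by contradiction
qed

theorem mainTheorem4:
  fixes k :: real and f1 f2 :: "real^2 \<Rightarrow> real"
  assumes "k > 0"
    and "locally_perturbed f1" and "locally_perturbed f2"
    and "\<forall>d\<in>S2minus. \<exists>u1 u2 F1 F2.
           dirichlet_total_field k f1 d u1 \<and> dirichlet_total_field k f2 d u2 \<and>
           far_field k (Omega f1) (\<lambda>x. u1 x - u_in k d x - u_re_D k d x) F1 \<and>
           far_field k (Omega f2) (\<lambda>x. u2 x - u_in k d x - u_re_D k d x) F2 \<and>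
           (\<forall>xh\<in>S2plus. F1 xh = F2 xh)"
  shows "Gamma f1 = Gamma f2"
proof -
  have equal: "equal_far_fields k f1 f2" using assms(4) by (simp only: equal_far_fields_def)
  have "f1 y = f2 y" for y
  proof (rule antisym)
    show "f2 y \<le> f1 y" by (rule equal_far_fields_le[OF assms(1-3) equal])
    show "f1 y \<le> f2 y" by (rule equal_far_fields_le[OF assms(1,3,2) equal_far_fields_sym[OF equal]])
  qed
  then have "f1 = f2" by (rule ext)
  then show ?thesis by (rule arg_cong)
qed

end
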